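(* Let $n \ge 1$, let $V \in C_0^\infty(\mathbb{R}^n)$ be real-valued and independent of $h$, and let $R_0>0$ be such that $\operatorname{supp} V \subset \{x\in\mathbb{R}^n : |x| < R_0\}$. Let $E>0$, and let $\chi \in C_0^\infty(\mathbb{R}^n)$ (independent of $h$) satisfy $\chi(x)=1$ for all $x$ in a neighborhood of $\{|x| \le R_0+5\}$. For $h>0$ let $$P = -h^2\Delta + V(x), \qquad R(\lambda) = (P-\lambda)^{-1},$$ where $P$ is considered as an operator on $L^2(\mathbb{R}^n)$. Suppose there exist $h_0>0$ and a function $a\colon (0,h_0]\to(0,\infty)$ satisfying $1\le a(h)\le h^{-N}$ for all $h \in (0,h_0]$, for some $N\in\mathbb{N}$, such that $$\|\chi R(E+i0)\chi\|_{L^2(\mathbb{R}^n)\to L^2(\mathbb{R}^n)} \le a(h) \qquad \text{for all } 0<h\le h_0.$$ Then there exist constants $C>0$ and $h_1>0$ (independent of $h$ and $\lambda$) such that the meromorphic continuation of $\lambda\mapsto\chi R(\lambda)\chi$ from $\{\arg\lambda>0\}$ to $\{\arg\lambda<0\}$, across the positive real axis, obeys $$\|\chi R(\lambda)\chi\|_{L^2(\mathbb{R}^n)\to L^2(\mathbb{R}^n)} \le C\,a(h) \qquad \text{whenever } |\lambda - E|\le \frac{1}{C\,a(h)} \text{ and } 0<h\le h_1$$ (in particular, the continuation has no poles in this set of $\lambda$).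
   Context: $\Delta=\sum_{j=1}^n\partial_{x_j}^2$ is the Laplacian on $\mathbb{R}^n$, and $P=-h^2\Delta+V$ is the self-adjoint operator on $L^2(\mathbb{R}^n)$ with domain $H^2(\mathbb{R}^n)$; here $h>0$ is a semiclassical parameter. The essential spectrum of $P$ is $[0,\infty)$. The operator $\chi R(E+i0)\chi$ denotes the limit $\lim_{\varepsilon\to0^+}\chi R(E+i\varepsilon)\chi$ as bounded operators on $L^2(\mathbb{R}^n)$, where $\chi$ acts by multiplication. Meromorphic continuation: for each fixed $h$, the bounded-operator-valued function $\lambda\mapsto\chi R(\lambda)\chi$, initially defined by the $L^2$ resolvent for $\operatorname{Im}\lambda>0$ (i.e. $0<\arg\lambda<\pi$), extends meromorphically across the positive half-axis $(0,\infty)$ into the lower half-plane ($\arg\lambda<0$ near $0$). In the conclusion, for $\lambda$ near $E$, $\chi R(\lambda)\chi$ denotes this continuation: it equals the $L^2$ cutoff resolvent when $\operatorname{Im}\lambda>0$, equals $\chi R(\lambda+i0)\chi$ when $\lambda$ is real, and is the continued operator (not the $L^2$ resolvent of the lower half-plane) when $\operatorname{Im}\lambda<0$. *)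

theory Defs
  imports "HOL-Analysis.Analysis"
begin

section \<open>Smooth functions on Euclidean space\<close>

definition partial_deriv :: "'n \<Rightarrow> (real^'n \<Rightarrow> 'b::real_normed_vector) \<Rightarrow> real^'n \<Rightarrow> 'b" where
  "partial_deriv i f x = frechet_derivative f (at x) (axis i 1)"

fun C_k :: "nat \<Rightarrow> (real^'n \<Rightarrow> 'b::real_normed_vector) \<Rightarrow> bool" where
  "C_k 0 f \<longleftrightarrow> continuous_on UNIV f"
| "C_k (Suc k) f \<longleftrightarrow> (\<forall>x. f differentiable (at x)) \<and> (\<forall>i. C_k k (partial_deriv i f))"

definition supp :: "(real^'n \<Rightarrow> 'b::real_normed_vector) \<Rightarrow> (real^'n) set" where
  "supp f = closure {x. f x \<noteq> 0}"

definition C0_infinity :: "(real^'n \<Rightarrow> 'b::real_normed_vector) \<Rightarrow> bool" where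
  "C0_infinity f \<longleftrightarrow> (\<forall>k. C_k k f) \<and> compact (supp f)"

lemma C_k_continuous: "C_k k f \<Longrightarrow> continuous_on UNIV f"
  by (cases k) (auto intro!: continuous_at_imp_continuous_on differentiable_imp_continuous_within)

lemma C0_infinity_measurable:
  assumes "C0_infinity (f :: real^'n \<Rightarrow> complex)"
  shows "f \<in> borel_measurable lborel" "partial_deriv i f \<in> borel_measurable lborel"
proof -
  have "C_k 0 f" "C_k (Suc 0) f"
    using assms by (simp_all only: C0_infinity_def)
  then show "f \<in> borel_measurable lborel" "partial_deriv i f \<in> borel_measurable lborel"
    by (auto intro: borel_measurable_continuous_onI)
qed

lemma bounded_range_C0_infinity:
  assumes "C0_infinity (f :: real^'n \<Rightarrow> 'b::real_normed_vector)"
  shows "bounded (range f)"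
proof -
  have "C_k 0 f" "compact (supp f)" using assms by (auto simp only: C0_infinity_def)
  then have "compact (f ` supp f)"
    by (metis C_k.simps(1) compact_continuous_image continuous_on_subset subset_UNIV)
  then have "bounded (insert 0 (f ` supp f))" by (simp add: compact_imp_bounded)
  moreover have "range f \<subseteq> insert 0 (f ` supp f)"
    using closure_subset by (fastforce simp: supp_def)
  ultimately show ?thesis by (rule bounded_subset)
qed


section \<open>The space of square-integrable complex functions\<close>

definition square_integrable :: "(real^'n \<Rightarrow> complex) \<Rightarrow> bool" where
  "square_integrable f \<longleftrightarrow>
     f \<in> borel_measurable lborel \<and> integrable lborel (\<lambda>x. (cmod (f x))\<^sup>2)"

definition L2_rel :: "(real^'n \<Rightarrow> complex) \<Rightarrow> (real^'n \<Rightarrow> complex) \<Rightarrow> bool" where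
  "L2_rel f g \<longleftrightarrow> square_integrable f \<and> square_integrable g \<and> (AE x in lborel. f x = g x)"

lemma square_integrable_zero [simp]: "square_integrable (\<lambda>_. 0)"
  by (simp add: square_integrable_def)

lemma square_integrable_dominated:
  assumes "f \<in> borel_measurable lborel" "integrable lborel k" "\<And>x. (cmod (f x))\<^sup>2 \<le> k x"
  shows "square_integrable f"
proof -
  have "integrable lborel (\<lambda>x. (cmod (f x))\<^sup>2)"
  proof (rule Bochner_Integration.integrable_bound[OF assms(2)])
    show "(\<lambda>x. (cmod (f x))\<^sup>2) \<in> borel_measurable lborel"
      using assms(1) by measurable
    show "AE x in lborel. norm ((cmod (f x))\<^sup>2) \<le> norm (k x)"
    proof (rule AE_I2)
      fix x
      have "(cmod (f x))\<^sup>2 \<le> \<bar>k x\<bar>" by (rule order_trans[OF assms(3) abs_ge_self])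
      then show "norm ((cmod (f x))\<^sup>2) \<le> norm (k x)" by simp
    qed
  qed
  with assms(1) show ?thesis unfolding square_integrable_def by (rule conjI)
qed

lemma square_integrable_mult:
  assumes f: "square_integrable f" and g: "g \<in> borel_measurable lborel" "bounded (range g)"
  shows "square_integrable (\<lambda>x. g x * f x)"
proof -
  obtain B where B: "\<And>x. cmod (g x) \<le> B"
    using g(2) by (auto simp: bounded_iff)
  have f': "f \<in> borel_measurable lborel" "integrable lborel (\<lambda>x. (cmod (f x))\<^sup>2)"
    using f unfolding square_integrable_def by simp_all
  show ?thesis
  proof (rule square_integrable_dominated)
    show "(\<lambda>x. g x * f x) \<in> borel_measurable lborel"
      by (intro borel_measurable_times f' g)
    show "integrable lborel (\<lambda>x. B\<^sup>2 * (cmod (f x))\<^sup>2)"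
      by (intro integrable_mult_right f')
    show "(cmod (g x * f x))\<^sup>2 \<le> B\<^sup>2 * (cmod (f x))\<^sup>2" for x
      unfolding norm_mult power_mult_distrib
      by (intro mult_right_mono power_mono B norm_ge_zero zero_le_power2)
  qed
qed

lemma square_integrable_add:
  assumes f: "square_integrable f" and g: "square_integrable g"
  shows "square_integrable (\<lambda>x. f x + g x)"
proof (rule square_integrable_dominated)
  show "(\<lambda>x. f x + g x) \<in> borel_measurable lborel"
    using f g unfolding square_integrable_def by (intro borel_measurable_add) simp_all
  show "integrable lborel (\<lambda>x. 2 * (cmod (f x))\<^sup>2 + 2 * (cmod (g x))\<^sup>2)"
    using f g unfolding square_integrable_def
    by (intro Bochner_Integration.integrable_add integrable_mult_right) simp_all
  fix x
  have "(cmod (f x + g x))\<^sup>2 \<le> (cmod (f x) + cmod (g x))\<^sup>2"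
    by (intro power_mono norm_triangle_ineq norm_ge_zero)
  also have "\<dots> \<le> 2 * (cmod (f x))\<^sup>2 + 2 * (cmod (g x))\<^sup>2"
    using sum_squares_bound[of "cmod (f x)" "cmod (g x)"] by (simp add: power2_sum)
  finally show "(cmod (f x + g x))\<^sup>2 \<le> 2 * (cmod (f x))\<^sup>2 + 2 * (cmod (g x))\<^sup>2" .
qed

lemma square_integrable_scaleR: "square_integrable f \<Longrightarrow> square_integrable (\<lambda>x. r *\<^sub>R f x)"
  using square_integrable_mult[of f "\<lambda>_. of_real r"] by (simp add: scaleR_conv_of_real)

lemma square_integrable_uminus: "square_integrable f \<Longrightarrow> square_integrable (\<lambda>x. - f x)"
  using square_integrable_scaleR[of f "-1"] by simp

lemma square_integrable_diff:
  "square_integrable f \<Longrightarrow> square_integrable g \<Longrightarrow> square_integrable (\<lambda>x. f x - g x)"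
  using square_integrable_add[of f "\<lambda>x. - g x"] square_integrable_uminus[of g] by simp

lemma integrable_inner_square_integrable:
  assumes f: "square_integrable f" and g: "square_integrable g"
  shows "integrable lborel (\<lambda>x. f x \<bullet> g x)"
proof (rule Bochner_Integration.integrable_bound)
  show "integrable lborel (\<lambda>x. (cmod (f x))\<^sup>2 + (cmod (g x))\<^sup>2)"
    using f g unfolding square_integrable_def
    by (intro Bochner_Integration.integrable_add) simp_all
  show "(\<lambda>x. f x \<bullet> g x) \<in> borel_measurable lborel"
    using f g unfolding square_integrable_def by (intro borel_measurable_inner) simp_all
  have "\<bar>a \<bullet> b\<bar> \<le> (cmod a)\<^sup>2 + (cmod b)\<^sup>2" for a b :: complex
  proof -
    have "\<bar>a \<bullet> b\<bar> \<le> cmod a * cmod b" by (rule Cauchy_Schwarz_ineq2)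
    also have "\<dots> \<le> 2 * cmod a * cmod b" by (simp add: mult.assoc)
    also have "\<dots> \<le> (cmod a)\<^sup>2 + (cmod b)\<^sup>2" by (rule sum_squares_bound)
    finally show ?thesis .
  qed
  from this have "norm (f x \<bullet> g x) \<le> norm ((cmod (f x))\<^sup>2 + (cmod (g x))\<^sup>2)" for x
    unfolding real_norm_def by (rule order_trans[OF _ abs_ge_self])
  then show "AE x in lborel. norm (f x \<bullet> g x) \<le> norm ((cmod (f x))\<^sup>2 + (cmod (g x))\<^sup>2)"
    by (rule AE_I2)
qed

lemma L2_rel_map:
  assumes "L2_rel f f'" and "\<And>f. square_integrable f \<Longrightarrow> square_integrable (\<lambda>x. T x (f x))"
  shows "L2_rel (\<lambda>x. T x (f x)) (\<lambda>x. T x (f' x))"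
proof -
  have "AE x in lborel. f x = f' x" using assms(1) by (simp add: L2_rel_def)
  then have "AE x in lborel. T x (f x) = T x (f' x)" by eventually_elim simp
  moreover have "square_integrable (\<lambda>x. T x (f x))" "square_integrable (\<lambda>x. T x (f' x))"
    using assms(1) by (simp_all only: L2_rel_def assms(2))
  ultimately show ?thesis unfolding L2_rel_def by blast
qed

lemma L2_rel_map2:
  fixes f f' g g' :: "real^'n \<Rightarrow> complex"
  assumes "L2_rel f f'" and "L2_rel g g'"
    and "\<And>f g :: real^'n \<Rightarrow> complex. square_integrable f \<Longrightarrow> square_integrable g \<Longrightarrow>
      square_integrable (\<lambda>x. T (f x) (g x))"
  shows "L2_rel (\<lambda>x. T (f x) (g x)) (\<lambda>x. T (f' x) (g' x))"
proof -
  have "AE x in lborel. f x = f' x" "AE x in lborel. g x = g' x"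
    using assms(1,2) by (simp_all add: L2_rel_def)
  then have "AE x in lborel. T (f x) (g x) = T (f' x) (g' x)" by eventually_elim simp
  moreover have "square_integrable (\<lambda>x. T (f x) (g x))" "square_integrable (\<lambda>x. T (f' x) (g' x))"
    using assms(1,2) by (simp_all only: L2_rel_def assms(3))
  ultimately show ?thesis unfolding L2_rel_def by blast
qed

quotient_type 'n L2 = "real^'n::finite \<Rightarrow> complex" / partial: L2_rel
proof (rule part_equivpI)
  show "\<exists>f. L2_rel f f"
    by (rule exI[of _ "\<lambda>_. 0"]) (simp add: L2_rel_def)
  show "symp (L2_rel :: (real^'n \<Rightarrow> complex) \<Rightarrow> _)"
    by (auto simp: symp_def L2_rel_def eq_commute)
  show "transp (L2_rel :: (real^'n \<Rightarrow> complex) \<Rightarrow> _)"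
  proof (rule transpI)
    fix f g k :: "real^'n \<Rightarrow> complex"
    assume "L2_rel f g" "L2_rel g k"
    then have sq: "square_integrable f" "square_integrable k"
      and ae: "AE x in lborel. f x = g x" "AE x in lborel. g x = k x"
      by (simp_all add: L2_rel_def)
    from ae have "AE x in lborel. f x = k x" by eventually_elim simp
    with sq show "L2_rel f k" by (simp add: L2_rel_def)
  qed
qed

instantiation L2 :: (finite) real_inner
begin

lift_definition zero_L2 :: "'a L2" is "\<lambda>_. 0" by (simp add: L2_rel_def)

lift_definition plus_L2 :: "'a L2 \<Rightarrow> 'a L2 \<Rightarrow> 'a L2" is "\<lambda>f g x. f x + g x"
  by (erule (1) L2_rel_map2) (erule (1) square_integrable_add)

lift_definition minus_L2 :: "'a L2 \<Rightarrow> 'a L2 \<Rightarrow> 'a L2" is "\<lambda>f g x. f x - g x"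
  by (erule (1) L2_rel_map2) (erule (1) square_integrable_diff)

lift_definition uminus_L2 :: "'a L2 \<Rightarrow> 'a L2" is "\<lambda>f x. - f x"
  by (erule L2_rel_map) (erule square_integrable_uminus)

lift_definition scaleR_L2 :: "real \<Rightarrow> 'a L2 \<Rightarrow> 'a L2" is "\<lambda>r f x. r *\<^sub>R f x"
  by (erule L2_rel_map) (erule square_integrable_scaleR)

text \<open>The real inner product \<open>Re \<integral> f cnj(g)\<close>; it induces the usual norm
  \<open>(\<integral> |f|\<^sup>2)\<^sup>1\<^sup>/\<^sup>2\<close>.\<close>

lift_definition inner_L2 :: "'a L2 \<Rightarrow> 'a L2 \<Rightarrow> real" is
  "\<lambda>f g. integral\<^sup>L lborel (\<lambda>x. f x \<bullet> g x)"
proof -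
  fix f f' g g' :: "real^'a \<Rightarrow> complex"
  assume "L2_rel f f'" "L2_rel g g'"
  then have m: "f \<in> borel_measurable lborel" "f' \<in> borel_measurable lborel"
      "g \<in> borel_measurable lborel" "g' \<in> borel_measurable lborel"
    and ae: "AE x in lborel. f x = f' x" "AE x in lborel. g x = g' x"
    by (simp_all add: L2_rel_def square_integrable_def)
  show "integral\<^sup>L lborel (\<lambda>x. f x \<bullet> g x) = integral\<^sup>L lborel (\<lambda>x. f' x \<bullet> g' x)"
  proof (rule integral_cong_AE)
    show "(\<lambda>x. f x \<bullet> g x) \<in> borel_measurable lborel" "(\<lambda>x. f' x \<bullet> g' x) \<in> borel_measurable lborel"
      by (intro borel_measurable_inner m)+
    from ae show "AE x in lborel. f x \<bullet> g x = f' x \<bullet> g' x" by eventually_elim simp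
  qed
qed

definition norm_L2 :: "'a L2 \<Rightarrow> real" where "norm_L2 u = sqrt (u \<bullet> u)"
definition sgn_L2 :: "'a L2 \<Rightarrow> 'a L2" where "sgn_L2 u = inverse (norm u) *\<^sub>R u"
definition dist_L2 :: "'a L2 \<Rightarrow> 'a L2 \<Rightarrow> real" where "dist_L2 u v = norm (u - v)"
definition uniformity_L2 :: "('a L2 \<times> 'a L2) filter" where
  "uniformity_L2 = (INF e\<in>{0<..}. principal {(u, v). dist u v < e})"
definition open_L2 :: "'a L2 set \<Rightarrow> bool" where
  "open_L2 S \<longleftrightarrow> (\<forall>u\<in>S. \<forall>\<^sub>F (u', v) in uniformity. u' = u \<longrightarrow> v \<in> S)"

instance
proof
  fix u v w :: "'a L2" and r s :: real and S :: "'a L2 set"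
  show "u + v + w = u + (v + w)"
    by transfer (auto simp: L2_rel_def square_integrable_add add.assoc)
  show "u + v = v + u"
    by transfer (auto simp: L2_rel_def square_integrable_add add.commute)
  show "0 + u = u" by transfer (auto simp: L2_rel_def)
  show "- u + u = 0" by transfer (auto simp: L2_rel_def)
  show "u - v = u + - v"
    by transfer (auto simp: L2_rel_def square_integrable_diff)
  show "r *\<^sub>R (u + v) = r *\<^sub>R u + r *\<^sub>R v"
    by transfer (auto simp: L2_rel_def square_integrable_add square_integrable_scaleR
        scaleR_add_right)
  show "(r + s) *\<^sub>R u = r *\<^sub>R u + s *\<^sub>R u"
    by transfer (auto simp: L2_rel_def square_integrable_add square_integrable_scaleR
        scaleR_add_left)
  show "r *\<^sub>R s *\<^sub>R u = (r * s) *\<^sub>R u"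
    by transfer (auto simp: L2_rel_def square_integrable_scaleR)
  show "1 *\<^sub>R u = u" by transfer (auto simp: L2_rel_def)
  show "dist u v = norm (u - v)" by (simp add: dist_L2_def)
  show "sgn u = inverse (norm u) *\<^sub>R u" by (simp add: sgn_L2_def)
  show "(uniformity :: ('a L2 \<times> 'a L2) filter) =
      (INF e\<in>{0<..}. principal {(x, y). dist x y < e})"
    by (simp add: uniformity_L2_def)
  show "open S \<longleftrightarrow> (\<forall>x\<in>S. \<forall>\<^sub>F (x', y) in uniformity. x' = x \<longrightarrow> y \<in> S)"
    by (simp add: open_L2_def)
  show "u \<bullet> v = v \<bullet> u" by transfer (simp add: inner_commute)
  show "(u + v) \<bullet> w = u \<bullet> w + v \<bullet> w"
    by transfer (simp add: L2_rel_def inner_add_left integrable_inner_square_integrable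
        del: inner_complex_def)
  show "(r *\<^sub>R u) \<bullet> v = r * (u \<bullet> v)" by transfer simp
  show "0 \<le> u \<bullet> u" by transfer simp
  show "u \<bullet> u = 0 \<longleftrightarrow> u = 0"
  proof transfer
    fix f :: "real^'a \<Rightarrow> complex"
    assume "L2_rel f f"
    then have f: "square_integrable f" by (simp add: L2_rel_def)
    have "integral\<^sup>L lborel (\<lambda>x. f x \<bullet> f x) = 0 \<longleftrightarrow> (AE x in lborel. f x \<bullet> f x = 0)"
      by (rule integral_nonneg_eq_0_iff_AE) (simp_all add: integrable_inner_square_integrable f)
    then show "integral\<^sup>L lborel (\<lambda>x. f x \<bullet> f x) = 0 \<longleftrightarrow> L2_rel f (\<lambda>_. 0)"
      using f by (simp add: L2_rel_def)
  qed
  show "norm u = sqrt (u \<bullet> u)" by (simp add: norm_L2_def)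
qed

end

text \<open>Multiplication by a function. The definition is meant for bounded Borel multipliers;
  it is \<open>0\<close> for all others.\<close>

lift_definition L2_mult :: "(real^'n \<Rightarrow> complex) \<Rightarrow> 'n L2 \<Rightarrow> 'n::finite L2" is
  "\<lambda>g f x. if g \<in> borel_measurable lborel \<and> bounded (range g) then g x * f x else 0"
proof -
  fix g f f' :: "real^'n \<Rightarrow> complex"
  assume "L2_rel f f'"
  then show "L2_rel
      (\<lambda>x. if g \<in> borel_measurable lborel \<and> bounded (range g) then g x * f x else 0)
      (\<lambda>x. if g \<in> borel_measurable lborel \<and> bounded (range g) then g x * f' x else 0)"
  proof (rule L2_rel_map)
    fix f :: "real^'n \<Rightarrow> complex"
    assume "square_integrable f"
    then show "square_integrable
        (\<lambda>x. if g \<in> borel_measurable lborel \<and> bounded (range g) then g x * f x else 0)"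
      by (cases "g \<in> borel_measurable lborel \<and> bounded (range g)")
         (simp_all only: square_integrable_mult square_integrable_zero if_True if_False simp_thms)
  qed
qed

lemma L2_mult_inner_le:
  assumes "g \<in> borel_measurable lborel" "bounded (range g)" "\<And>x. cmod (g x) \<le> B"
  shows "L2_mult g u \<bullet> L2_mult g u \<le> B\<^sup>2 * (u \<bullet> u)"
  using assms
proof (transfer fixing: g B)
  fix f :: "real^'a \<Rightarrow> complex"
  assume "L2_rel f f" and g: "g \<in> borel_measurable lborel" "bounded (range g)"
    and B: "\<And>x. cmod (g x) \<le> B"
  then have f: "square_integrable f" by (simp add: L2_rel_def)
  have "integral\<^sup>L lborel (\<lambda>x. (g x * f x) \<bullet> (g x * f x))
      \<le> integral\<^sup>L lborel (\<lambda>x. B\<^sup>2 * (f x \<bullet> f x))"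
  proof (rule integral_mono)
    show "integrable lborel (\<lambda>x. (g x * f x) \<bullet> (g x * f x))"
      using f g by (intro integrable_inner_square_integrable square_integrable_mult) auto
    show "integrable lborel (\<lambda>x. B\<^sup>2 * (f x \<bullet> f x))"
      using f by (intro integrable_mult_right integrable_inner_square_integrable)
    show "(g x * f x) \<bullet> (g x * f x) \<le> B\<^sup>2 * (f x \<bullet> f x)" for x
      unfolding power2_norm_eq_inner[symmetric] norm_mult power_mult_distrib
      by (intro mult_right_mono power_mono B) auto
  qed
  then show "integral\<^sup>L lborel
        (\<lambda>x. (if g \<in> borel_measurable lborel \<and> bounded (range g) then g x * f x else 0)
          \<bullet> (if g \<in> borel_measurable lborel \<and> bounded (range g) then g x * f x else 0))
      \<le> B\<^sup>2 * integral\<^sup>L lborel (\<lambda>x. f x \<bullet> f x)"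
    using g by simp
qed

lemma bounded_linear_L2_mult: "bounded_linear (L2_mult g)"
proof (cases "g \<in> borel_measurable lborel \<and> bounded (range g)")
  case g: True
  then obtain B where B: "\<And>x. cmod (g x) \<le> B"
    by (auto simp: bounded_iff)
  then have B0: "0 \<le> B" using norm_ge_zero order_trans by blast
  show ?thesis
  proof (rule bounded_linear_intro)
    show "L2_mult g (u + v) = L2_mult g u + L2_mult g v" for u v
      using g by transfer
        (auto simp: L2_rel_def square_integrable_add square_integrable_mult distrib_left)
    show "L2_mult g (r *\<^sub>R u) = r *\<^sub>R L2_mult g u" for r u
      using g by transfer
        (auto simp: L2_rel_def square_integrable_scaleR square_integrable_mult)
    show "norm (L2_mult g u) \<le> norm u * B" for u
    proof -
      have "L2_mult g u \<bullet> L2_mult g u \<le> B\<^sup>2 * (u \<bullet> u)"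
        by (rule L2_mult_inner_le) (use g B in simp_all)
      then have "(norm (L2_mult g u))\<^sup>2 \<le> (norm u * B)\<^sup>2"
        by (simp add: power2_norm_eq_inner power_mult_distrib mult.commute)
      then show ?thesis by (rule power2_le_imp_le) (simp add: B0)
    qed
  qed
next
  case False
  then have "L2_mult g = (\<lambda>_. 0)"
    by (intro ext, transfer) (auto simp: L2_rel_def)
  then show ?thesis by simp
qed

definition L2_scaleC :: "complex \<Rightarrow> 'n::finite L2 \<Rightarrow> 'n L2" where
  "L2_scaleC c = L2_mult (\<lambda>_. c)"


section \<open>Operator-valued holomorphic and meromorphic functions\<close>

text \<open>Bounded operators are bounded real-linear maps; the complex structure on them is
  \<open>op_scaleC\<close>, and complex linearity is a separate predicate. For a complex-linear
  operator the norm of \<open>\<Rightarrow>\<^sub>L\<close> is the usual operator norm.\<close>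

type_synonym 'n L2_op = "'n L2 \<Rightarrow>\<^sub>L 'n L2"

definition mult_op :: "(real^'n \<Rightarrow> complex) \<Rightarrow> 'n::finite L2_op" where
  "mult_op g = Blinfun (L2_mult g)"

definition op_scaleC :: "complex \<Rightarrow> 'n::finite L2_op \<Rightarrow> 'n L2_op" where
  "op_scaleC c T = mult_op (\<lambda>_. c) o\<^sub>L T"

definition complex_linear :: "'n::finite L2_op \<Rightarrow> bool" where
  "complex_linear T \<longleftrightarrow>
     (\<forall>c u. blinfun_apply T (L2_scaleC c u) = L2_scaleC c (blinfun_apply T u))"

text \<open>Complex differentiability in operator norm at each point of \<open>A\<close> (with respect to full
  neighbourhoods, also when \<open>A\<close> is not open).\<close>

definition op_holomorphic_on :: "(complex \<Rightarrow> 'n::finite L2_op) \<Rightarrow> complex set \<Rightarrow> bool" where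
  "op_holomorphic_on F A \<longleftrightarrow>
     (\<forall>z\<in>A. \<exists>D. (F has_derivative (\<lambda>w. op_scaleC w D)) (at z))"

definition op_meromorphic_on :: "(complex \<Rightarrow> 'n::finite L2_op) \<Rightarrow> complex set \<Rightarrow> bool" where
  "op_meromorphic_on F A \<longleftrightarrow>
     (\<forall>z\<in>A. \<exists>k::nat. \<exists>r>0. \<exists>G. op_holomorphic_on G (ball z r) \<and>
        (\<forall>w\<in>ball z r - {z}. F w = op_scaleC (1 / (w - z) ^ k) (G w)))"

lemma blinfun_apply_mult_op [simp]: "blinfun_apply (mult_op g) u = L2_mult g u"
  by (simp add: mult_op_def bounded_linear_L2_mult bounded_linear_Blinfun_apply)


section \<open>The Schroedinger operator and its cutoff resolvent\<close>

text \<open>\<open>weak_partial i u v\<close>: the distributional derivative of \<open>u\<close> in direction \<open>i\<close> is \<open>v\<close>.\<close>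

lift_definition weak_partial :: "'n \<Rightarrow> 'n L2 \<Rightarrow> 'n::finite L2 \<Rightarrow> bool" is
  "\<lambda>i f g. \<forall>\<phi>. C0_infinity \<phi> \<longrightarrow>
     integral\<^sup>L lborel (\<lambda>x. f x * partial_deriv i \<phi> x) = - integral\<^sup>L lborel (\<lambda>x. g x * \<phi> x)"
proof -
  fix i and f f' g g' :: "real^'n \<Rightarrow> complex"
  assume f: "L2_rel f f'" and g: "L2_rel g g'"
  have *: "integral\<^sup>L lborel (\<lambda>x. k x * g x) = integral\<^sup>L lborel (\<lambda>x. k' x * g x)"
    if k: "L2_rel k k'" and g: "g \<in> borel_measurable lborel" for k k' g :: "real^'n \<Rightarrow> complex"
  proof (rule integral_cong_AE)
    have m: "k \<in> borel_measurable lborel" "k' \<in> borel_measurable lborel"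
      using k by (simp_all add: L2_rel_def square_integrable_def)
    show "(\<lambda>x. k x * g x) \<in> borel_measurable lborel" "(\<lambda>x. k' x * g x) \<in> borel_measurable lborel"
      by (intro borel_measurable_times m g)+
    have "AE x in lborel. k x = k' x" using k by (simp add: L2_rel_def)
    then show "AE x in lborel. k x * g x = k' x * g x" by (rule eventually_mono) simp
  qed
  have "integral\<^sup>L lborel (\<lambda>x. f x * partial_deriv i \<phi> x)
      = integral\<^sup>L lborel (\<lambda>x. f' x * partial_deriv i \<phi> x)"
    and "integral\<^sup>L lborel (\<lambda>x. g x * \<phi> x) = integral\<^sup>L lborel (\<lambda>x. g' x * \<phi> x)"
    if "C0_infinity \<phi>" for \<phi> :: "real^'n \<Rightarrow> complex"
    using *[OF f] *[OF g] C0_infinity_measurable[OF that] by blast+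
  then show "(\<forall>\<phi>. C0_infinity \<phi> \<longrightarrow>
        integral\<^sup>L lborel (\<lambda>x. f x * partial_deriv i \<phi> x) = - integral\<^sup>L lborel (\<lambda>x. g x * \<phi> x))
    \<longleftrightarrow> (\<forall>\<phi>. C0_infinity \<phi> \<longrightarrow>
        integral\<^sup>L lborel (\<lambda>x. f' x * partial_deriv i \<phi> x) = - integral\<^sup>L lborel (\<lambda>x. g' x * \<phi> x))"
    by simp
qed

definition H2 :: "'n::finite L2 set" where
  "H2 = {u. \<forall>i. \<exists>v. weak_partial i u v \<and> (\<forall>j. \<exists>w. weak_partial j v w)}"

definition weak_deriv :: "'n \<Rightarrow> 'n::finite L2 \<Rightarrow> 'n L2" where
  "weak_deriv i u = (THE v. weak_partial i u v)"

definition laplacian :: "'n::finite L2 \<Rightarrow> 'n L2" where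
  "laplacian u = (\<Sum>i\<in>UNIV. weak_deriv i (weak_deriv i u))"

definition schroedinger :: "(real^'n \<Rightarrow> real) \<Rightarrow> real \<Rightarrow> 'n::finite L2 \<Rightarrow> 'n L2" where
  "schroedinger V h u =
     - (h\<^sup>2 *\<^sub>R laplacian u) + L2_mult (\<lambda>x. complex_of_real (V x)) u"

text \<open>\<open>(P - z)\<^sup>-\<^sup>1\<close> with \<open>P\<close> on the domain \<open>H2\<close>; only meaningful for \<open>z\<close> in the resolvent set
  of \<open>P\<close>, for example \<open>Im z > 0\<close>.\<close>

definition resolvent :: "(real^'n \<Rightarrow> real) \<Rightarrow> real \<Rightarrow> complex \<Rightarrow> 'n::finite L2_op" where
  "resolvent V h z = Blinfun (the_inv_into H2 (\<lambda>u. schroedinger V h u - L2_scaleC z u))"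

definition cutoff_resolvent ::
    "(real^'n \<Rightarrow> real) \<Rightarrow> (real^'n \<Rightarrow> complex) \<Rightarrow> real \<Rightarrow> complex \<Rightarrow> 'n::finite L2_op" where
  "cutoff_resolvent V chi h z = mult_op chi o\<^sub>L resolvent V h z o\<^sub>L mult_op chi"

text \<open>\<open>F\<close> is the meromorphic continuation of the cutoff resolvent from the upper half-plane across
  \<open>(0,\<infinity>)\<close> to \<open>U\<close>. As \<open>U\<close> is connected, \<open>F\<close> is determined by \<open>U\<close> up to its values at
  isolated points.\<close>

definition cutoff_resolvent_continuation ::
    "(real^'n \<Rightarrow> real) \<Rightarrow> (real^'n \<Rightarrow> complex) \<Rightarrow> real \<Rightarrow> complex set
      \<Rightarrow> (complex \<Rightarrow> 'n::finite L2_op) \<Rightarrow> bool" where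
  "cutoff_resolvent_continuation V chi h U F \<longleftrightarrow>
     open U \<and> connected U \<and> {z. Im z > 0} \<subseteq> U \<and> complex_of_real ` {0<..} \<subseteq> U \<and>
     op_meromorphic_on F U \<and> (\<forall>z\<in>U. complex_linear (F z)) \<and>
     (\<forall>z. Im z > 0 \<longrightarrow> F z = cutoff_resolvent V chi h z)"

end

(*
  The free resolvent kernel is continued across (0, infinity) by deforming, in polar coordinates
  on the Fourier side, the radial variable into the lower half-plane near the resonant radius
  sqrt(E)/h; the cut-offs turn the complex exponentials into entire, norm-convergent series. This
  keeps ch R0(z) ch and its derivatives holomorphic and Lipschitz in z with explicit powers of h.
  Writing A = chi R(z) chi, B = chi R0(z) chi, one has (I + B V)(I - A V) = I, so a Fredholm
  argument by rank one perturbations continues A meromorphically.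
  Near E, a solution u = R(z) chi f is corrected at infinity by (R0(E) - R0(z)) g, where (1 - psi) u
  = R0(z) g; this gives an identity X A(z) = Y in which X - I and Y only involve A(E + i0), a bounded
  number of differences of cut-off free resolvents, and |z - E|. As A(E + i0) is at least of size
  1/h (test on a plane wave times a bump outside supp V), these errors are O(|z - E| a(h)), and a
  Neumann series inverts X.
*)
theory Submission
  imports Defs "HOL-Complex_Analysis.Complex_Analysis" "HOL-Probability.Probability"
begin

text \<open>The hypothesis controls the cut-off resolvent at one energy only, while
  \<open>u = R(z) chi f\<close> fills the whole space, so \<open>(z - E) u\<close> cannot serve as a
  source for \<open>R(E + i0)\<close>. The correction by free resolvents is arranged so that this
  term cancels at infinity; afterwards every source is cut off and only
  \<open>chi u = A(z) f\<close> is left. The price is differences of cut-off free resolvents, which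
  must be small uniformly in h. The contour is therefore pushed down by the fixed amount 1 in the
  Fourier variable, whose resonant radius is \<open>sqrt E / h\<close>; a depth growing with 1/h
  would make the exponentials on the support of chi grow with it. A difference with k derivatives
  then costs \<open>|z - E| * h^(-2-k)\<close>. The two commutators bring \<open>h^2\<close> each,
  and the remaining \<open>1/h\<close> and \<open>1/h^2\<close> are paid for by
  \<open>1/h <= a(h)/c\<close>. The same bound fits the disc of radius \<open>1/(C a(h))\<close>
  into the one of radius \<open>h sqrt E / 4\<close> where the deformed kernel is holomorphic. Away
  from E no uniformity is wanted, and compactness with invertibility above the axis
  suffices.\<close>

type_synonym 'n cfun = "real^'n \<Rightarrow> complex"
abbreviation (input) cor :: "real \<Rightarrow> complex" where "cor \<equiv> of_real"
abbreviation (input) LI :: "('a::euclidean_space \<Rightarrow> 'b::{banach,second_countable_topology}) \<Rightarrow> 'b" where "LI \<equiv> integral\<^sup>L lborel"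
abbreviation (input) I1 :: "'a::real_normed_vector \<Rightarrow>\<^sub>L 'a" where "I1 \<equiv> id_blinfun"
abbreviation (input) ap :: "('a::real_normed_vector \<Rightarrow>\<^sub>L 'b::real_normed_vector) \<Rightarrow> 'a \<Rightarrow> 'b" where "ap \<equiv> blinfun_apply"
abbreviation (input) blinfun_comp (infixl "oL" 55) where "S oL T \<equiv> S o\<^sub>L T"
abbreviation (input) seq_lim (infixr "---->" 60) where "X ----> l \<equiv> X \<longlonglongrightarrow> l"
abbreviation (input) pd :: "'n \<Rightarrow> (real^'n \<Rightarrow> 'b::real_normed_vector) \<Rightarrow> real^'n \<Rightarrow> 'b" where "pd \<equiv> partial_deriv"
abbreviation (input) sqi :: "(real^'n \<Rightarrow> complex) \<Rightarrow> bool" where "sqi \<equiv> square_integrable"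
abbreviation (input) bm :: "'a measure \<Rightarrow> ('a \<Rightarrow> 'b::topological_space) set" where "bm \<equiv> borel_measurable"

section \<open>The Hilbert space L2\<close>

lemma L2_rel_refl [simp]: "L2_rel f f \<longleftrightarrow> sqi f"
 by (simp add: L2_rel_def)

lemma L2_cases:
 obtains f where "sqi f" "u = abs_L2 f"
proof
 show "sqi (rep_L2 u)"
  using Quotient3_rep_reflp[OF Quotient3_L2, of u] by simp
 show "u = abs_L2 (rep_L2 u)"
  using Quotient3_abs_rep[OF Quotient3_L2, of u] by simp
qed

lemma abs_L2_eq_iff:
 "sqi f ==> sqi g ==>
  abs_L2 f = abs_L2 g \<longleftrightarrow> (AE x in lborel. f x = g x)"
 using Quotient3_rel[OF Quotient3_L2, of f g] by (simp add: L2_rel_def)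

lemma square_integrable_measurable [measurable_dest]:
 "sqi f ==> f \<in> bm lborel"
 by (simp add: square_integrable_def)

lemma abs_L2_zero: "abs_L2 (%_. 0) = 0"
 by (simp add: zero_L2_def)

lemma abs_L2_plus:
 "sqi f ==> sqi g ==> abs_L2 f + abs_L2 g = abs_L2 (%x. f x + g x)"
 by (simp add: plus_L2.abs_eq)

lemma abs_L2_minus:
 "sqi f ==> sqi g ==> abs_L2 f - abs_L2 g = abs_L2 (%x. f x - g x)"
 by (simp add: minus_L2.abs_eq)

lemma abs_L2_scaleR:
 "sqi f ==> r *\<^sub>R abs_L2 f = abs_L2 (%x. r *\<^sub>R f x)"
 by (simp add: scaleR_L2.abs_eq)

lemma abs_L2_inner:
 "sqi f ==> sqi g ==>
  abs_L2 f \<bullet> abs_L2 g = LI (%x. f x \<bullet> g x)"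
 by (simp add: inner_L2.abs_eq)

lemma abs_L2_norm:
 "sqi f ==> (norm (abs_L2 f))\<^sup>2 = LI (%x. (cmod (f x))\<^sup>2)"
 by (simp add: power2_norm_eq_inner abs_L2_inner del: inner_complex_def)

lemma abs_L2_mult:
 "sqi f ==> g \<in> bm lborel ==> bounded (range g) ==>
  L2_mult g (abs_L2 f) = abs_L2 (%x. g x * f x)"
 by (simp add: L2_mult.abs_eq)

lemma square_integrable_nn:
 "sqi f \<longleftrightarrow>
   f \<in> bm lborel & (\<integral>\<^sup>+x. ennreal ((cmod (f x))\<^sup>2) \<partial>lborel) < \<infinity>"
 by (auto simp: square_integrable_def integrable_iff_bounded)

lemma abs_L2_norm_nn:
 assumes "sqi f"
 shows "(\<integral>\<^sup>+x. ennreal ((cmod (f x))\<^sup>2) \<partial>lborel) = ennreal ((norm (abs_L2 f))\<^sup>2)"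
 using assms by (simp add: abs_L2_norm nn_integral_eq_integral square_integrable_def)

lemma square_integrable_norm_leI:
 assumes "f \<in> bm lborel" "(\<integral>\<^sup>+x. ennreal ((cmod (f x))\<^sup>2) \<partial>lborel) <= ennreal (C\<^sup>2)" "0 <= C"
 shows "sqi f" "norm (abs_L2 f) <= C"
proof -
 show f: "sqi f"
  using assms by (auto simp: square_integrable_nn intro: le_less_trans)
 have "ennreal ((norm (abs_L2 f))\<^sup>2) <= ennreal (C\<^sup>2)"
  using assms abs_L2_norm_nn[OF f] by simp
 then have "(norm (abs_L2 f))\<^sup>2 <= C\<^sup>2" by simp
 then show "norm (abs_L2 f) <= C" using assms(3) power2_le_imp_le by blast
qed

section \<open>Pointwise limits and completeness of L2\<close>

lemma Fatou_L2:
 assumes f: "!!n. sqi (f n)" "!!n. norm (abs_L2 (f n)) <= C"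
  and F[measurable]: "F \<in> bm lborel"
  and lim: "AE x in lborel. (%n. f n x) ----> F x"
 shows "sqi F" "norm (abs_L2 F) <= C"
proof -
 have [measurable]: "!!n. f n \<in> bm lborel" using f(1) by (simp add: square_integrable_def)
 have C: "0 <= C" using f(2)[of 0] norm_ge_zero order_trans by blast
 have "(\<integral>\<^sup>+x. ennreal ((cmod (F x))\<^sup>2) \<partial>lborel)
   = (\<integral>\<^sup>+x. liminf (%n. ennreal ((cmod (f n x))\<^sup>2)) \<partial>lborel)"
 proof (rule nn_integral_cong_AE, use lim in eventually_elim)
  fix x assume "(%n. f n x) ----> F x"
  then have "(%n. ennreal ((cmod (f n x))\<^sup>2)) ----> ennreal ((cmod (F x))\<^sup>2)"
   by (intro tendsto_intros)
  then show "ennreal ((cmod (F x))\<^sup>2) = liminf (%n. ennreal ((cmod (f n x))\<^sup>2))"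
   by (metis lim_imp_Liminf trivial_limit_sequentially)
 qed
 also have "... <= liminf (%n. \<integral>\<^sup>+x. ennreal ((cmod (f n x))\<^sup>2) \<partial>lborel)"
  by (rule nn_integral_liminf) measurable
 also have "... <= liminf (%n. ennreal (C\<^sup>2))"
 proof (rule Liminf_mono, rule always_eventually, rule allI)
  fix n
  show "(\<integral>\<^sup>+x. ennreal ((cmod (f n x))\<^sup>2) \<partial>lborel) <= ennreal (C\<^sup>2)"
   using abs_L2_norm_nn[OF f(1)] f(2)[of n] by (simp add: ennreal_leI power_mono)
 qed
 also have "... = ennreal (C\<^sup>2)" by (simp add: Liminf_const)
 finally show "sqi F" "norm (abs_L2 F) <= C"
  using square_integrable_norm_leI[OF F _ C] by blast+
qed

text \<open>Fatou's lemma is applied to \<open>f (m + N) - f n\<close> as \<open>m\<close> grows: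
  the Cauchy bound \<open>e/2\<close> passes to the pointwise limit \<open>F - f n\<close>. A norm
  limit may therefore be computed pointwise, which is how limits of kernels are identified
  later.\<close>

lemma Cauchy_L2_pointwise:
 assumes f: "!!n. sqi (f n)" and cau: "Cauchy (%n. abs_L2 (f n))"
  and F[measurable]: "F \<in> bm lborel"
  and lim: "AE x in lborel. (%n. f n x) ----> F x"
 shows "sqi F" "(%n. abs_L2 (f n)) ----> abs_L2 F"
proof -
 obtain C where C: "!!n. norm (abs_L2 (f n)) <= C"
  using Cauchy_Bseq[OF cau] by (auto simp: Bseq_def)
 show sF: "sqi F" by (rule Fatou_L2[OF f C F lim])
 show "(%n. abs_L2 (f n)) ----> abs_L2 F"
 proof (rule metric_LIMSEQ_I)
  fix e :: real assume e: "0 < e"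
  then obtain N where N: "!!m n. m \<ge> N ==> n \<ge> N ==> dist (abs_L2 (f m)) (abs_L2 (f n)) < e/2"
   using metric_CauchyD[OF cau, of "e/2"] by auto
  have "dist (abs_L2 (f n)) (abs_L2 F) < e" if n: "n \<ge> N" for n
  proof -
   have "norm (abs_L2 (%x. F x - f n x)) <= e/2"
   proof (rule Fatou_L2(2)[where f="%m x. f (m + N) x - f n x"])
    show "sqi (%x. f (m + N) x - f n x)" for m
     by (intro square_integrable_diff f)
    show "norm (abs_L2 (%x. f (m + N) x - f n x)) <= e/2" for m
     using N[of "m+N" n] n by (simp add: abs_L2_minus[OF f f, symmetric] dist_norm)
    show "(%x. F x - f n x) \<in> bm lborel" using f[of n] by measurable
    show "AE x in lborel. (%m. f (m + N) x - f n x) ----> F x - f n x"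
     using lim by eventually_elim (intro tendsto_intros LIMSEQ_ignore_initial_segment)
   qed
   then show ?thesis using e by (simp add: dist_norm norm_minus_commute abs_L2_minus[OF sF f])
  qed
  then show "\<exists>no. \<forall>n\<ge>no. dist (abs_L2 (f n)) (abs_L2 F) < e" by blast
 qed
qed

lemma norm_abs_L2_cmod:
 assumes "sqi f"
 shows "sqi (%x. cor (cmod (f x)))"
  "norm (abs_L2 (%x. cor (cmod (f x)))) = norm (abs_L2 f)"
proof -
 show s: "sqi (%x. cor (cmod (f x)))"
  using assms by (auto simp: square_integrable_def)
 have "(norm (abs_L2 (%x. cor (cmod (f x)))))\<^sup>2 = (norm (abs_L2 f))\<^sup>2"
  by (simp add: abs_L2_norm s assms)
 then show "norm (abs_L2 (%x. cor (cmod (f x)))) = norm (abs_L2 f)" by simp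
qed

lemma square_integrable_sum:
 "(!!i. i \<in> I ==> sqi (f i)) ==> sqi (%x. \<Sum>i\<in>I. f i x)"
 by (induction I rule: infinite_finite_induct) (auto intro: square_integrable_add)

lemma abs_L2_sum:
 "(!!i. i \<in> I ==> sqi (f i)) ==> abs_L2 (%x. \<Sum>i\<in>I. f i x) = (\<Sum>i\<in>I. abs_L2 (f i))"
 by (induction I rule: infinite_finite_induct)
   (auto simp: abs_L2_zero abs_L2_plus[symmetric] square_integrable_sum)

text \<open>The moduli of the increments have summable norms, so their partial sums stay below 2 in
  norm. By monotone convergence the full series is square integrable, hence finite almost
  everywhere, and there the telescoping series converges absolutely.\<close>

lemma L2_fast_Cauchy_pointwise:
 fixes f :: "nat => 'n::finite cfun"
 assumes f: "!!n. sqi (f n)"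
  and d: "!!n. norm (abs_L2 (f (Suc n)) - abs_L2 (f n)) <= (1/2)^n"
 shows "AE x in lborel. convergent (%n. f n x)"
proof -
 have [measurable]: "!!n. f n \<in> bm lborel" using f by (simp add: square_integrable_def)
 define g where "g n x = cmod (f (Suc n) x - f n x)" for n x
 have [measurable]: "g n \<in> bm lborel" for n unfolding g_def by measurable
 have g: "sqi (%x. cor (g n x))"
   "norm (abs_L2 (%x. cor (g n x))) <= (1/2)^n" for n
  using norm_abs_L2_cmod[OF square_integrable_diff[OF f f], of "Suc n" n] d[of n]
  by (auto simp: g_def abs_L2_minus[OF f f])
 have S: "norm (abs_L2 (%x. \<Sum>n<N. cor (g n x))) <= 2" for N
 proof -
  have "norm (abs_L2 (%x. \<Sum>n<N. cor (g n x))) <= (\<Sum>n<N. (1/2)^n)"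
   by (simp add: abs_L2_sum g(1)) (intro sum_norm_le g(2))
  also have "... <= 2" by (simp add: geometric_sum)
  finally show ?thesis .
 qed
 have "(\<integral>\<^sup>+x. (\<Sum>n. ennreal (g n x))\<^sup>2 \<partial>lborel) <= ennreal (2\<^sup>2)"
 proof -
  have sup: "(\<Sum>n. ennreal (g n x))\<^sup>2 = (SUP N. (\<Sum>n<N. ennreal (g n x))\<^sup>2)" for x
  proof -
   have inc: "incseq (%N. (\<Sum>n<N. ennreal (g n x))\<^sup>2)"
    by (intro incseq_SucI power_mono) auto
   have "(%N. (\<Sum>n<N. ennreal (g n x))) ----> (\<Sum>n. ennreal (g n x))"
    by (simp add: summable_LIMSEQ)
   then have "(%N. (\<Sum>n<N. ennreal (g n x))\<^sup>2) ----> (\<Sum>n. ennreal (g n x))\<^sup>2"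
    unfolding power2_eq_square by (intro tendsto_mult_ennreal) (auto simp: power2_eq_square)
   then show ?thesis using LIMSEQ_SUP[OF inc] LIMSEQ_unique by blast
  qed
  have "(\<integral>\<^sup>+x. (\<Sum>n. ennreal (g n x))\<^sup>2 \<partial>lborel) = (SUP N. \<integral>\<^sup>+x. (\<Sum>n<N. ennreal (g n x))\<^sup>2 \<partial>lborel)"
   unfolding sup
  proof (rule nn_integral_monotone_convergence_SUP)
   show "incseq (%N x. (\<Sum>n<N. ennreal (g n x))\<^sup>2)"
    by (intro incseq_SucI le_funI power_mono) auto
  qed measurable
  also have "... <= ennreal (2\<^sup>2)"
  proof (rule SUP_least)
   fix N
   have g0: "g n x \<ge> 0" for n x by (simp add: g_def)
   have "(\<integral>\<^sup>+x. (\<Sum>n<N. ennreal (g n x))\<^sup>2 \<partial>lborel)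
     = (\<integral>\<^sup>+x. ennreal ((cmod (\<Sum>n<N. cor (g n x)))\<^sup>2) \<partial>lborel)"
   proof (rule nn_integral_cong)
    fix x
    have "cmod (\<Sum>n<N. cor (g n x)) = (\<Sum>n<N. g n x)"
     by (simp add: of_real_sum[symmetric] sum_nonneg g0 del: of_real_sum)
    then show "(\<Sum>n<N. ennreal (g n x))\<^sup>2 = ennreal ((cmod (\<Sum>n<N. cor (g n x)))\<^sup>2)"
     by (simp add: sum_ennreal g0 ennreal_power sum_nonneg)
   qed
   also have "... = ennreal ((norm (abs_L2 (%x. \<Sum>n<N. cor (g n x))))\<^sup>2)"
    by (intro abs_L2_norm_nn square_integrable_sum g)
   also have "... <= ennreal (2\<^sup>2)" using S[of N] by (intro ennreal_leI power_mono) auto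
   finally show "(\<integral>\<^sup>+x. (\<Sum>n<N. ennreal (g n x))\<^sup>2 \<partial>lborel) <= ennreal (2\<^sup>2)" .
  qed
  finally show ?thesis .
 qed
 then have "(\<integral>\<^sup>+x. (\<Sum>n. ennreal (g n x))\<^sup>2 \<partial>lborel) ~= \<infinity>"
  by (auto simp: top_unique)
 then have "AE x in lborel. (\<Sum>n. ennreal (g n x))\<^sup>2 ~= \<infinity>"
  by (intro nn_integral_PInf_AE) measurable
 then show ?thesis
 proof eventually_elim
  fix x assume "(\<Sum>n. ennreal (g n x))\<^sup>2 ~= \<infinity>"
  then have "(\<Sum>n. ennreal (g n x)) ~= \<infinity>" by (auto simp: power2_eq_square ennreal_mult_eq_top_iff)
  then have "summable (%n. g n x)"
   by (intro summable_suminf_not_top) (auto simp: g_def)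
  then have "summable (%n. f (Suc n) x - f n x)"
   unfolding g_def by (rule summable_norm_cancel)
  then have "convergent (%n. \<Sum>i<n. f (Suc i) x - f i x)"
   by (simp add: summable_iff_convergent)
  then have "convergent (%n. f n x - f 0 x)" using sum_lessThan_telescope[of "%n. f n x"] by simp
  then have "convergent (%n. (f n x - f 0 x) + f 0 x)" by (intro convergent_add convergent_const)
  then show "convergent (%n. f n x)" by simp
 qed
qed

instance L2 :: (finite) banach
proof
 fix X :: "nat => 'a L2"
 assume X: "Cauchy X"
 have "\<forall>n. \<exists>N. \<forall>m\<ge>N. \<forall>k\<ge>N. dist (X m) (X k) < (1/2)^n"
  using metric_CauchyD[OF X] by (meson half_gt_zero_iff zero_less_one zero_less_power)
 then obtain M where M: "!!n m k. m \<ge> M n ==> k \<ge> M n ==> dist (X m) (X k) < (1/2)^n" by metis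
 \<comment> \<open>Summing the thresholds gives an index beyond every \<open>M i\<close> with
   \<open>i \<le> n\<close>; the added \<open>n\<close> makes the sequence strictly increasing even
   where the thresholds vanish.\<close>
 define r where "r n = (\<Sum>i\<le>n. M i) + n" for n
 have r: "strict_mono r" by (rule strict_monoI_Suc) (simp add: r_def)
 have rM: "r n \<ge> M n" for n unfolding r_def by (simp add: member_le_sum trans_le_add1)
 define f where "f n = rep_L2 (X (r n))" for n
 have f: "sqi (f n)" "abs_L2 (f n) = X (r n)" for n
  using Quotient3_rep_reflp[OF Quotient3_L2] Quotient3_abs_rep[OF Quotient3_L2]
  by (auto simp: f_def)
 have [measurable]: "f n \<in> bm lborel" for n using f(1) by (simp add: square_integrable_def)
 have cau: "Cauchy (%n. abs_L2 (f n))"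
  using Cauchy_subseq_Cauchy[OF X r] by (simp add: f(2) comp_def)
 have ae: "AE x in lborel. convergent (%n. f n x)"
 proof (rule L2_fast_Cauchy_pointwise[OF f(1)])
  fix n
  have "r (Suc n) \<ge> M n" using rM[of n] strict_monoD[OF r, of n "Suc n"] by simp
  then have "dist (X (r (Suc n))) (X (r n)) < (1/2)^n" by (intro M rM)
  then show "norm (abs_L2 (f (Suc n)) - abs_L2 (f n)) <= (1/2)^n" by (simp add: f dist_norm)
 qed
 define F where "F x = lim (%n. f n x)" for x
 have "F \<in> bm lborel" unfolding F_def by measurable
 then have "(%n. abs_L2 (f n)) ----> abs_L2 F"
  by (rule Cauchy_L2_pointwise[OF f(1) cau])
    (use ae in \<open>eventually_elim, simp add: F_def convergent_LIMSEQ_iff\<close>)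
 then have "(X \<circ> r) ----> abs_L2 F" by (simp add: f(2) comp_def)
 then have "X ----> abs_L2 F" using X r Cauchy_converges_subseq by blast
 then show "convergent X" by (auto simp: convergent_def)
qed

section \<open>The complex structure and multiplication operators\<close>

text \<open>\<open>L2_mult g\<close> is set to 0 unless \<open>g\<close> is Borel and bounded; this
  is the condition under which it really is multiplication by \<open>g\<close>.\<close>

definition bdd_mult :: "(real^'n => complex) => bool" where
 "bdd_mult g \<longleftrightarrow> g \<in> bm lborel & bounded (range g)"

lemma bdd_multI: "g \<in> bm lborel ==> (!!x. cmod (g x) <= B) ==> bdd_mult g"
 by (auto simp: bdd_mult_def bounded_iff)

lemma bdd_mult_measurable [measurable_dest]: "bdd_mult g ==> g \<in> bm lborel"
 by (simp add: bdd_mult_def)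

lemma bdd_mult_borel: "bdd_mult g ==> g \<in> bm borel"
 by (simp add: bdd_mult_def)

lemma borel_measurable_cnj_comp [measurable (raw)]:
 "f \<in> bm M ==> (%x. cnj (f x)) \<in> bm M"
 by (rule measurable_compose[OF _ borel_measurable_continuous_onI]) (auto intro: continuous_intros)

lemma bdd_multE:
 assumes "bdd_mult g" obtains B where "B > 0" "!!x. cmod (g x) <= B"
proof -
 obtain B where "\<forall>x\<in>range g. norm x <= B" using assms by (auto simp: bdd_mult_def bounded_iff)
 then have "!!x. cmod (g x) <= max B 1" by (auto simp: le_max_iff_disj)
 then show thesis using that[of "max B 1"] by simp
qed

lemma bdd_mult_const [simp]: "bdd_mult (%_. c)"
 by (rule bdd_multI[of _ "cmod c"]) auto

lemma bdd_mult_mult [intro]: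
 assumes "bdd_mult g" "bdd_mult h" shows "bdd_mult (%x. g x * h x)"
proof -
 obtain B C where B: "B > 0" "C > 0" "!!x. cmod (g x) <= B" "!!x. cmod (h x) <= C"
  using assms by (metis bdd_multE)
 show ?thesis
  by (rule bdd_multI[where B="B * C", OF borel_measurable_times[OF assms[THEN bdd_mult_measurable]]])
    (use B in \<open>auto simp: norm_mult less_imp_le intro!: mult_mono\<close>)
qed

lemma bdd_mult_add [intro]:
 assumes "bdd_mult g" "bdd_mult h" shows "bdd_mult (%x. g x + h x)"
proof -
 obtain B C where B: "B > 0" "C > 0" "!!x. cmod (g x) <= B" "!!x. cmod (h x) <= C"
  using assms by (metis bdd_multE)
 have *: "cmod (g x + h x) <= B + C" for x
  using norm_triangle_ineq[of "g x" "h x"] B(3)[of x] B(4)[of x] by linarith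
 show ?thesis
  by (rule bdd_multI[where B="B + C", OF borel_measurable_add[OF assms[THEN bdd_mult_measurable]]]) fact
qed

lemma bdd_mult_diff [intro]:
 assumes "bdd_mult g" "bdd_mult h" shows "bdd_mult (%x. g x - h x)"
 using bdd_mult_add[OF assms(1) bdd_mult_mult[OF bdd_mult_const[of "-1"] assms(2)]] by simp

lemma sqi_bdd_mult:
 "sqi f ==> bdd_mult g ==> sqi (%x. g x * f x)"
 by (simp add: bdd_mult_def square_integrable_mult)

lemma L2_mult_abs:
 "sqi f ==> bdd_mult g ==> L2_mult g (abs_L2 f) = abs_L2 (%x. g x * f x)"
 by (simp add: bdd_mult_def abs_L2_mult)

lemma L2_mult_add: "L2_mult g (u + v) = L2_mult g u + L2_mult g v"
 by (rule linear_add[OF bounded_linear.linear[OF bounded_linear_L2_mult]])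

lemma L2_mult_diff: "L2_mult g (u - v) = L2_mult g u - L2_mult g v"
 by (rule linear_diff[OF bounded_linear.linear[OF bounded_linear_L2_mult]])

lemma L2_mult_zero [simp]: "L2_mult g 0 = 0"
 by (rule linear_0[OF bounded_linear.linear[OF bounded_linear_L2_mult]])

lemma L2_mult_scaleR: "L2_mult g (r *\<^sub>R u) = r *\<^sub>R L2_mult g u"
 by (rule linear_scale[OF bounded_linear.linear[OF bounded_linear_L2_mult]])

lemma L2_mult_sum: "L2_mult g (\<Sum>i\<in>I. u i) = (\<Sum>i\<in>I. L2_mult g (u i))"
 by (rule linear_sum[OF bounded_linear.linear[OF bounded_linear_L2_mult]])

lemma L2_mult_L2_mult:
 assumes "bdd_mult g" "bdd_mult h"
 shows "L2_mult g (L2_mult h u) = L2_mult (%x. g x * h x) u"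
 by (rule L2_cases[of u])
   (simp add: L2_mult_abs assms sqi_bdd_mult bdd_mult_mult mult.assoc)

lemma L2_mult_one [simp]: "L2_mult (%_. 1) u = u"
 by (rule L2_cases[of u]) (simp add: L2_mult_abs)

lemma L2_mult_zero_left [simp]: "L2_mult (%_. 0) u = 0"
 by (rule L2_cases[of u]) (simp add: L2_mult_abs abs_L2_zero)

lemma L2_mult_add_left:
 assumes "bdd_mult g" "bdd_mult h"
 shows "L2_mult (%x. g x + h x) u = L2_mult g u + L2_mult h u"
 by (rule L2_cases[of u])
   (simp add: L2_mult_abs assms sqi_bdd_mult bdd_mult_add abs_L2_plus distrib_right)

lemma L2_mult_diff_left:
 assumes "bdd_mult g" "bdd_mult h"
 shows "L2_mult (%x. g x - h x) u = L2_mult g u - L2_mult h u"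
 by (rule L2_cases[of u])
   (simp add: L2_mult_abs assms sqi_bdd_mult bdd_mult_diff abs_L2_minus left_diff_distrib)

lemma norm_L2_mult_le:
 assumes "bdd_mult g" "!!x. cmod (g x) <= B"
 shows "norm (L2_mult g u) <= B * norm u"
proof -
 have B: "0 <= B" using assms(2) norm_ge_zero order_trans by blast
 have "(norm (L2_mult g u))\<^sup>2 <= (B * norm u)\<^sup>2"
  using L2_mult_inner_le[of g B u] assms
  by (simp add: power2_norm_eq_inner power_mult_distrib bdd_mult_def)
 then show ?thesis by (rule power2_le_imp_le) (simp add: B)
qed

lemma L2_scaleC_abs: "sqi f ==> L2_scaleC c (abs_L2 f) = abs_L2 (%x. c * f x)"
 by (simp add: L2_scaleC_def L2_mult_abs)

lemma L2_mult_scaleC: 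
 assumes "bdd_mult g" shows "L2_mult g (L2_scaleC c u) = L2_scaleC c (L2_mult g u)"
 by (simp add: L2_scaleC_def L2_mult_L2_mult assms mult.commute)

lemma L2_mult_scaleC_left: "bdd_mult g ==> L2_mult (%x. c * g x) u = L2_scaleC c (L2_mult g u)"
 by (simp add: L2_scaleC_def L2_mult_L2_mult)

lemma L2_scaleC_add: "L2_scaleC c (u + v) = L2_scaleC c u + L2_scaleC c v"
 by (simp add: L2_scaleC_def L2_mult_add)

lemma L2_scaleC_diff: "L2_scaleC c (u - v) = L2_scaleC c u - L2_scaleC c v"
 by (simp add: L2_scaleC_def L2_mult_diff)

lemma L2_scaleC_zero [simp]: "L2_scaleC c 0 = 0" "L2_scaleC 0 u = 0"
 by (simp_all add: L2_scaleC_def)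

lemma L2_scaleC_one [simp]: "L2_scaleC 1 u = u"
 by (simp add: L2_scaleC_def)

lemma L2_scaleC_scaleR: "L2_scaleC c (r *\<^sub>R u) = r *\<^sub>R L2_scaleC c u"
 by (simp add: L2_scaleC_def L2_mult_scaleR)

lemma L2_scaleC_sum: "L2_scaleC c (\<Sum>i\<in>I. u i) = (\<Sum>i\<in>I. L2_scaleC c (u i))"
 by (simp add: L2_scaleC_def L2_mult_sum)

lemma L2_scaleC_add_left: "L2_scaleC (c + d) u = L2_scaleC c u + L2_scaleC d u"
 by (simp add: L2_scaleC_def L2_mult_add_left[symmetric])

lemma L2_scaleC_diff_left: "L2_scaleC (c - d) u = L2_scaleC c u - L2_scaleC d u"
 by (simp add: L2_scaleC_def L2_mult_diff_left[symmetric])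

lemma L2_scaleC_scaleC [simp]: "L2_scaleC c (L2_scaleC d u) = L2_scaleC (c * d) u"
 by (simp add: L2_scaleC_def L2_mult_L2_mult)

lemma L2_scaleC_of_real: "L2_scaleC (of_real r) u = r *\<^sub>R u"
 by (rule L2_cases[of u]) (simp add: L2_scaleC_abs abs_L2_scaleR scaleR_conv_of_real)

lemma L2_scaleC_minus: "L2_scaleC c (- u) = - L2_scaleC c u"
 using L2_scaleC_diff[of c 0 u] by simp

lemma norm_L2_scaleC [simp]: "norm (L2_scaleC c u) = cmod c * norm u"
proof (rule L2_cases[of u])
 fix f assume f: "sqi f" "u = abs_L2 f"
 have "(norm (L2_scaleC c u))\<^sup>2 = (cmod c * norm u)\<^sup>2"
  using f by (simp add: L2_scaleC_abs abs_L2_norm power_mult_distrib norm_mult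
    sqi_bdd_mult)
 then show ?thesis by simp
qed

lemma complex_linear_scaleC: "complex_linear T ==> T (L2_scaleC c u) = L2_scaleC c (T u)"
 by (simp add: complex_linear_def)

lemma complex_linear_mult_op [simp]: "bdd_mult g ==> complex_linear (mult_op g)"
 by (simp add: complex_linear_def L2_mult_scaleC)

lemma complex_linear_comp [intro]:
 "complex_linear S ==> complex_linear T ==> complex_linear (S oL T)"
 by (simp add: complex_linear_def)

lemma complex_linear_add [intro]:
 "complex_linear S ==> complex_linear T ==> complex_linear (S + T)"
 by (simp add: complex_linear_def blinfun.add_left L2_scaleC_add)

lemma complex_linear_diff [intro]:
 "complex_linear S ==> complex_linear T ==> complex_linear (S - T)"
 by (simp add: complex_linear_def blinfun.diff_left L2_scaleC_diff)

lemma complex_linear_scaleR [intro]: "complex_linear S ==> complex_linear (r *\<^sub>R S)"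
 by (simp add: complex_linear_def blinfun.scaleR_left L2_scaleC_scaleR)

lemma complex_linear_zero [simp]: "complex_linear 0"
 by (simp add: complex_linear_def)

lemma complex_linear_id [simp]: "complex_linear I1"
 by (simp add: complex_linear_def)

lemma complex_linear_sum [intro]:
 "(!!i. i \<in> I ==> complex_linear (S i)) ==> complex_linear (\<Sum>i\<in>I. S i)"
 by (induction I rule: infinite_finite_induct) auto

lemma op_scaleC_apply [simp]: "ap (op_scaleC c T) u = L2_scaleC c (T u)"
 by (simp add: op_scaleC_def L2_scaleC_def)

lemma complex_linear_op_scaleC [intro]: "complex_linear S ==> complex_linear (op_scaleC c S)"
 by (simp add: complex_linear_def mult.commute)

lemma complex_linear_lim:
 assumes "!!n. complex_linear (X n)" "X ----> T"
 shows "complex_linear T"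
proof -
 have "T (L2_scaleC c u) = L2_scaleC c (T u)" for c u
 proof (rule LIMSEQ_unique)
  have *: "(%n. X n v) ----> T v" for v
   by (rule bounded_linear.tendsto[OF blinfun.bounded_linear_left assms(2)]) 
  show "(%n. X n (L2_scaleC c u)) ----> T (L2_scaleC c u)" by (rule *)
  have "(%n. L2_scaleC c (X n u)) ----> L2_scaleC c (T u)"
   unfolding L2_scaleC_def by (intro bounded_linear.tendsto[OF bounded_linear_L2_mult] *)
  then show "(%n. X n (L2_scaleC c u)) ----> L2_scaleC c (T u)"
   using assms(1) by (simp add: complex_linear_scaleC)
 qed
 then show ?thesis by (simp add: complex_linear_def)
qed

lemma complex_linear_suminf:
 assumes "!!n. complex_linear (X n)" "summable X"
 shows "complex_linear (suminf X)"
 by (rule complex_linear_lim[OF _ summable_LIMSEQ[OF assms(2)]]) (intro complex_linear_sum assms)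

lemma complex_linear_inverse:
 assumes "complex_linear M" "M oL N = I1" "N oL M = I1"
 shows "complex_linear N"
proof -
 have 1: "N (M u) = u" "M (N u) = u" for u
  using assms(2,3) by (metis blinfun_apply_blinfun_compose blinfun_apply_id_blinfun id_apply)+
 have "N (L2_scaleC c u) = L2_scaleC c (N u)" for c u
  using 1(1)[of "L2_scaleC c (N u)"] by (simp add: complex_linear_scaleC[OF assms(1)] 1(2))
 then show ?thesis by (simp add: complex_linear_def)
qed

lemma norm_mult_op_le:
 assumes "bdd_mult g" "!!x. cmod (g x) <= B"
 shows "norm (mult_op g) <= B"
proof (rule norm_blinfun_bound)
 show "0 <= B" using assms(2) norm_ge_zero order_trans by blast
qed (use norm_L2_mult_le[OF assms] in simp)

lemma norm_op_scaleC_le: "norm (op_scaleC c T) <= cmod c * norm T"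
 by (rule norm_blinfun_bound) 
   (auto simp: mult.assoc intro!: mult_left_mono norm_blinfun)

lemma bounded_linear_op_scaleC: "bounded_linear (%w. op_scaleC w T)"
proof (rule bounded_linear_intro)
 show "op_scaleC (x + y) T = op_scaleC x T + op_scaleC y T" for x y
  by (rule blinfun_eqI) (simp add: blinfun.add_left L2_scaleC_add_left)
 show "op_scaleC (r *\<^sub>R x) T = r *\<^sub>R op_scaleC x T" for r x
  by (rule blinfun_eqI)
    (simp add: blinfun.scaleR_left scaleR_conv_of_real L2_scaleC_of_real[symmetric])
 show "norm (op_scaleC x T) <= norm x * norm T" for x by (rule norm_op_scaleC_le)
qed

section \<open>The bilinear pairing\<close>

lemma integrable_mult_sqi:
 fixes f g :: "'n::finite cfun"
 assumes f: "sqi f" and g: "sqi g"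
 shows "integrable lborel (%x. f x * g x)"
proof (rule Bochner_Integration.integrable_bound)
 show "integrable lborel (%x. (cmod (f x))\<^sup>2 + (cmod (g x))\<^sup>2)"
  using f g unfolding square_integrable_def
  by (intro Bochner_Integration.integrable_add) simp_all
 show "(%x. f x * g x) \<in> bm lborel"
  using f g by measurable
 have "cmod a * cmod b <= (cmod a)\<^sup>2 + (cmod b)\<^sup>2" for a b :: complex
 proof -
  have "0 <= cmod a * cmod b" by simp
  then show ?thesis using sum_squares_bound[of "cmod a" "cmod b"] unfolding mult.assoc by linarith
 qed
 then show "AE x in lborel. norm (f x * g x) <= norm ((cmod (f x))\<^sup>2 + (cmod (g x))\<^sup>2)"
  by (simp add: norm_mult)
qed

text \<open>Without conjugation the pairing is complex bilinear: matrix elements of holomorphic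
  families are holomorphic, and multiplication operators and the Fourier transform are their own
  transposes.\<close>

lift_definition pair :: "'n L2 => 'n::finite L2 => complex" is
 "%f g. LI (%x. f x * g x)"
proof -
 fix f f' g g' :: "real^'n => complex"
 assume "L2_rel f f'" "L2_rel g g'"
 then have [measurable]: "f \<in> bm lborel" "f' \<in> bm lborel"
   "g \<in> bm lborel" "g' \<in> bm lborel"
  and ae: "AE x in lborel. f x = f' x" "AE x in lborel. g x = g' x"
  by (simp_all add: L2_rel_def square_integrable_def)
 show "LI (%x. f x * g x) = LI (%x. f' x * g' x)"
 proof (rule integral_cong_AE)
  from ae show "AE x in lborel. f x * g x = f' x * g' x" by eventually_elim simp
 qed measurable
qed

lift_definition cnj_L2 :: "'n L2 => 'n::finite L2" is "%f x. cnj (f x)"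
 by (erule L2_rel_map) (auto simp: square_integrable_def intro: borel_measurable_cnj_comp)

lemma square_integrable_cnj: "sqi f ==> sqi (%x. cnj (f x))"
 by (auto simp: square_integrable_def intro: borel_measurable_cnj_comp)

lemma cnj_L2_abs: "sqi f ==> cnj_L2 (abs_L2 f) = abs_L2 (%x. cnj (f x))"
 by (simp add: cnj_L2.abs_eq)

lemma pair_abs:
 "sqi f ==> sqi g ==>
  pair (abs_L2 f) (abs_L2 g) = LI (%x. f x * g x)"
 by (simp add: pair.abs_eq)

lemma pair_commute: "pair u v = pair v u"
 by transfer (simp add: mult.commute)

lemma pair_add_left: "pair (u + v) w = pair u w + pair v w"
 by (rule L2_cases[of u], rule L2_cases[of v], rule L2_cases[of w])
   (simp add: abs_L2_plus pair_abs square_integrable_add distrib_right integrable_mult_sqi)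

lemma pair_add_right: "pair w (u + v) = pair w u + pair w v"
 by (metis pair_add_left pair_commute)

lemma pair_L2_mult: 
 assumes "bdd_mult g" shows "pair (L2_mult g u) v = pair u (L2_mult g v)"
 by (rule L2_cases[of u], rule L2_cases[of v])
   (simp add: L2_mult_abs assms pair_abs sqi_bdd_mult, simp add: mult_ac)

lemma pair_scaleC_left: "pair (L2_scaleC c u) v = c * pair u v"
 by (rule L2_cases[of u], rule L2_cases[of v])
   (simp add: L2_scaleC_abs pair_abs sqi_bdd_mult mult.assoc)

lemma pair_scaleC_right: "pair u (L2_scaleC c v) = c * pair u v"
 by (metis pair_scaleC_left pair_commute)

lemma pair_scaleR_left: "pair (r *\<^sub>R u) v = r *\<^sub>R pair u v"
 by (simp add: L2_scaleC_of_real[symmetric] pair_scaleC_left scaleR_conv_of_real)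

lemma inner_eq_pair: "u \<bullet> v = Re (pair u (cnj_L2 v))"
proof (rule L2_cases[of u], rule L2_cases[of v])
 fix f g assume f: "sqi f" "u = abs_L2 f" and g: "sqi g" "v = abs_L2 g"
 have "Re (pair u (cnj_L2 v)) = Re (LI (%x. f x * cnj (g x)))"
  by (simp add: f g cnj_L2_abs pair_abs square_integrable_cnj)
 also have "... = LI (%x. Re (f x * cnj (g x)))"
  by (rule integral_Re[symmetric]) (intro integrable_mult_sqi square_integrable_cnj f g)
 also have "... = u \<bullet> v"
  by (simp add: f g abs_L2_inner inner_complex_def)
 finally show ?thesis by simp
qed

lemma cnj_L2_cnj_L2 [simp]: "cnj_L2 (cnj_L2 u) = u"
 by (rule L2_cases[of u]) (simp add: cnj_L2_abs square_integrable_cnj)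

lemma norm_cnj_L2 [simp]: "norm (cnj_L2 u) = norm u"
proof -
 have "(norm (cnj_L2 u))\<^sup>2 = (norm u)\<^sup>2"
  by (rule L2_cases[of u]) (simp add: cnj_L2_abs abs_L2_norm square_integrable_cnj)
 then show ?thesis by simp
qed

lemma cnj_L2_add: "cnj_L2 (u + v) = cnj_L2 u + cnj_L2 v"
 by (rule L2_cases[of u], rule L2_cases[of v])
   (simp add: cnj_L2_abs abs_L2_plus square_integrable_cnj square_integrable_add)

lemma cnj_L2_scaleC: "cnj_L2 (L2_scaleC c u) = L2_scaleC (cnj c) (cnj_L2 u)"
 by (rule L2_cases[of u])
   (simp add: cnj_L2_abs L2_scaleC_abs square_integrable_cnj sqi_bdd_mult)

text \<open>Multiplying \<open>u\<close> by the unimodular \<open>c\<close> turns the pairing into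
  its own modulus, which is a real inner product with \<open>cnj_L2 v\<close>; the real
  Cauchy-Schwarz inequality then applies.\<close>

lemma norm_pair_le: "cmod (pair u v) <= norm u * norm v"
proof (cases "pair u v = 0")
 case False
 define c where "c = cnj (pair u v) / cmod (pair u v)"
 have "cmod c = 1" using False by (simp add: c_def norm_divide)
 have "cor (cmod (pair u v)) = c * pair u v"
  using complex_norm_square[of "pair u v"] False
  by (simp add: c_def field_simps power2_eq_square)
 then have "cmod (pair u v) = Re (c * pair u v)" by (metis Re_complex_of_real)
 also have "... = L2_scaleC c u \<bullet> cnj_L2 v" by (simp add: inner_eq_pair pair_scaleC_left)
 also have "... <= norm (L2_scaleC c u) * norm (cnj_L2 v)" by (rule norm_cauchy_schwarz)
 finally show ?thesis using \<open>cmod c = 1\<close> by simp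
qed simp

lemma bounded_linear_pair_left: "bounded_linear (%u. pair u v)"
 by (rule bounded_linear_intro[of _ "norm v"])
   (auto simp: pair_add_left pair_scaleR_left norm_pair_le)

lemma bounded_linear_pair_right: "bounded_linear (%v. pair u v)"
 unfolding pair_commute[of u] by (rule bounded_linear_pair_left)

lemma pair_zero [simp]: "pair 0 v = 0" "pair u 0 = 0"
 using pair_scaleC_left[of 0 0 v] pair_scaleC_right[of u 0 0] by simp_all

lemma pair_diff_left: "pair (u - v) w = pair u w - pair v w"
 by (rule linear_diff[OF bounded_linear.linear[OF bounded_linear_pair_left]])

lemma pair_sum_left: "pair (\<Sum>i\<in>I. f i) w = (\<Sum>i\<in>I. pair (f i) w)"
 by (rule linear_sum[OF bounded_linear.linear[OF bounded_linear_pair_left]])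

lemma pair_sum_right: "pair w (\<Sum>i\<in>I. f i) = (\<Sum>i\<in>I. pair w (f i))"
 by (rule linear_sum[OF bounded_linear.linear[OF bounded_linear_pair_right]])

lemma pair_eq_zeroD: 
 assumes "!!v. pair u v = 0" shows "u = 0"
proof -
 have "u \<bullet> u = 0" using assms by (simp add: inner_eq_pair)
 then show ?thesis by simp
qed

lemma pair_eqD: 
 assumes "!!v. pair u v = pair w v" shows "u = w"
 using pair_eq_zeroD[of "u - w"] assms by (simp add: pair_diff_left)

text \<open>The pairing of \<open>u\<close> with its conjugate is real, so testing with
  \<open>\<i> u\<close> isolates the imaginary part of the spectral parameter. This is the source of
  the resolvent bound \<open>1 / Im z\<close>.\<close>

lemma inner_scaleC_i: "L2_scaleC c u \<bullet> L2_scaleC \<i> u = Im c * (norm u)\<^sup>2"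
proof -
 have "pair u (cnj_L2 u) = of_real ((norm u)\<^sup>2)"
 proof (rule L2_cases[of u])
  fix f assume f: "sqi f" "u = abs_L2 f"
  have "pair u (cnj_L2 u) = LI (%x. cor ((cmod (f x))\<^sup>2))"
   using f by (simp add: cnj_L2_abs pair_abs square_integrable_cnj complex_norm_square[symmetric])
  also have "... = of_real ((norm u)\<^sup>2)"
   using f by (simp add: abs_L2_norm integral_complex_of_real del: of_real_power)
  finally show ?thesis .
 qed
 then show ?thesis
  by (simp add: inner_eq_pair cnj_L2_scaleC pair_scaleC_left pair_scaleC_right 
     del: of_real_power)
qed

section \<open>Holomorphic families of operators\<close>

text \<open>Complex linearity of the values is carried along for the sake of the product rule: the
  scalar can be pulled out of \<open>F z oL op_scaleC w D'\<close> only if \<open>F z\<close> is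
  complex linear.\<close>

definition holo :: "(complex => 'n::finite L2_op) => complex set => bool" where
 "holo F S \<longleftrightarrow> op_holomorphic_on F S & (\<forall>z\<in>S. complex_linear (F z))"

lemma holoI:
 assumes "!!z. z \<in> S ==> (F has_derivative (%w. op_scaleC w (D z))) (at z)"
  "!!z. z \<in> S ==> complex_linear (F z)"
 shows "holo F S"
 using assms by (auto simp: holo_def op_holomorphic_on_def)

lemma holo_complex_linear: "holo F S ==> z \<in> S ==> complex_linear (F z)"
 by (simp add: holo_def)

lemma holo_imp_op_holomorphic: "holo F S ==> op_holomorphic_on F S"
 by (simp add: holo_def)

lemma holo_derivE:
 assumes "holo F S" "z \<in> S"
 obtains D where "(F has_derivative (%w. op_scaleC w D)) (at z)"
 using assms by (auto simp: holo_def op_holomorphic_on_def)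

lemma holo_subset: "holo F S ==> T \<subseteq> S ==> holo F T"
 by (auto simp: holo_def op_holomorphic_on_def)

lemma holo_transform:
 assumes F: "holo F S" "open S" and eq: "!!z. z \<in> S ==> G z = F z"
 shows "holo G S"
 unfolding holo_def op_holomorphic_on_def
proof (intro conjI ballI)
 fix z assume z: "z \<in> S"
 then obtain D where D: "(F has_derivative (%w. op_scaleC w D)) (at z)" using F holo_derivE by blast
 have "(G has_derivative (%w. op_scaleC w D)) (at z)"
  by (rule has_derivative_transform_within_open[OF D F(2) z]) (simp add: eq)
 then show "\<exists>D. (G has_derivative (%w. op_scaleC w D)) (at z)" ..
 show "complex_linear (G z)" using z F eq holo_complex_linear by metis
qed

lemma holo_continuous: "holo F S ==> z \<in> S ==> isCont F z"
 by (meson has_derivative_continuous holo_derivE)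

lemma holo_const: "complex_linear T ==> holo (%_. T) S"
proof (rule holoI)
 have "(%w. op_scaleC w 0) = (%w. 0 :: 'a L2_op)"
  by (intro ext blinfun_eqI) simp
 then show "((%_. T) has_derivative (%w. op_scaleC w 0)) (at z)" for z by simp
qed auto

lemma holo_add:
 assumes "holo F S" "holo G S" shows "holo (%z. F z + G z) S"
 unfolding holo_def op_holomorphic_on_def
proof (intro conjI ballI)
 fix z assume z: "z \<in> S"
 obtain D D' where D: "(F has_derivative (%w. op_scaleC w D)) (at z)"
  "(G has_derivative (%w. op_scaleC w D')) (at z)" using assms z holo_derivE by metis
 have "(%w. op_scaleC w D + op_scaleC w D') = (%w. op_scaleC w (D + D'))"
  by (intro ext blinfun_eqI) (simp add: blinfun.add_left L2_scaleC_add)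
 then show "\<exists>D. ((%z. F z + G z) has_derivative (%w. op_scaleC w D)) (at z)"
  using has_derivative_add[OF D] by metis
 show "complex_linear (F z + G z)" using assms z by (auto intro: holo_complex_linear)
qed

lemma holo_comp:
 assumes "holo F S" "holo G S" shows "holo (%z. F z oL G z) S"
 unfolding holo_def op_holomorphic_on_def
proof (intro conjI ballI)
 fix z assume z: "z \<in> S"
 obtain D D' where D: "(F has_derivative (%w. op_scaleC w D)) (at z)"
  "(G has_derivative (%w. op_scaleC w D')) (at z)" using assms z holo_derivE by metis
 have "complex_linear (F z)" using assms z by (auto intro: holo_complex_linear)
 then have "(%w. (F z oL op_scaleC w D') + (op_scaleC w D oL G z))
   = (%w. op_scaleC w ((F z oL D') + (D oL G z)))"
  by (intro ext blinfun_eqI) (simp add: blinfun.add_left L2_scaleC_add complex_linear_scaleC)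
 then show "\<exists>D. ((%z. F z oL G z) has_derivative (%w. op_scaleC w D)) (at z)"
  using bounded_bilinear.FDERIV[OF bounded_bilinear_blinfun_compose D] by metis
 show "complex_linear (F z oL G z)" using assms z by (auto intro: holo_complex_linear)
qed

lemma holo_scalar:
 assumes f: "f holomorphic_on S" "open S"
 shows "holo (%z. op_scaleC (f z) (I1 :: 'n::finite L2_op)) S"
proof (rule holoI)
 fix z assume "z \<in> S"
 then have "(f has_field_derivative deriv f z) (at z)" using f holomorphic_derivI by blast
 then have "(f has_derivative (%w. deriv f z * w)) (at z)" by (simp add: has_field_derivative_def)
 then have "((%z. op_scaleC (f z) (I1 :: 'n::finite L2_op)) has_derivative
   (%w. op_scaleC (deriv f z * w) (I1 :: 'n::finite L2_op))) (at z)"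
  by (rule bounded_linear.has_derivative[OF bounded_linear_op_scaleC])
 moreover have "(%w. op_scaleC (deriv f z * w) (I1 :: 'n::finite L2_op))
   = (%w. op_scaleC w (op_scaleC (deriv f z) (I1 :: 'n::finite L2_op)))"
  by (intro ext blinfun_eqI) (simp add: mult.commute)
 ultimately show "((%z. op_scaleC (f z) (I1 :: 'n::finite L2_op)) has_derivative
   (%w. op_scaleC w (op_scaleC (deriv f z) (I1 :: 'n::finite L2_op)))) (at z)" by (simp only:)
qed auto

lemma holo_op_scaleC:
 assumes f: "f holomorphic_on S" "open S" and F: "holo F S"
 shows "holo (%z. op_scaleC (f z) (F z)) S"
proof -
 have "(%z. op_scaleC (f z) (F z)) = (%z. op_scaleC (f z) I1 oL F z)"
  by (intro ext blinfun_eqI) simp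
 then show ?thesis using holo_comp[OF holo_scalar[OF f] F] by simp
qed

lemma holo_scaleR:
 assumes F: "holo F S"
 shows "holo (%z. r *\<^sub>R F z) S"
proof -
 have "(%z. r *\<^sub>R F z) = (%z. r *\<^sub>R I1 oL F z)"
  by (intro ext blinfun_eqI) (simp add: blinfun.scaleR_left)
 then show ?thesis
  using holo_comp[OF holo_const[OF complex_linear_scaleR[OF complex_linear_id]] F] by simp
qed

lemma holo_diff:
 assumes "holo F S" "holo G S" shows "holo (%z. F z - G z) S"
 using holo_add[OF assms(1) holo_scaleR[OF assms(2), of "-1"]] by simp

lemma holo_sum:
 "(!!i. i \<in> I ==> holo (F i) S) ==> holo (%z. \<Sum>i\<in>I. F i z) S"
 by (induction I rule: infinite_finite_induct) (auto intro: holo_const holo_add)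

lemma holo_pair:
 assumes "holo F S" "open S" shows "(%z. pair (F z u) v) holomorphic_on S"
proof -
 have "\<exists>D. ((%z. pair (F z u) v) has_field_derivative D) (at z)" if z: "z \<in> S" for z
 proof -
  obtain D where D: "(F has_derivative (%w. op_scaleC w D)) (at z)" using assms z holo_derivE by metis
  have "((%z. F z u) has_derivative (%w. (op_scaleC w D) u)) (at z)"
   by (rule bounded_linear.has_derivative[OF blinfun.bounded_linear_left D])
  then have "((%z. pair (F z u) v) has_derivative (%w. pair ((op_scaleC w D) u) v)) (at z)"
   by (rule bounded_linear.has_derivative[OF bounded_linear_pair_left])
  moreover have "(%w. pair ((op_scaleC w D) u) v) = (%w. pair (D u) v * w)"
   by (simp add: pair_scaleC_left mult.commute)
  ultimately show ?thesis by (auto simp: has_field_derivative_def)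
 qed
 then show ?thesis
  using assms(2) by (auto simp: holomorphic_on_open)
qed

text \<open>Reduced to the scalar identity theorem for the matrix elements
  \<open>pair (F z u) v\<close>, which separate operators.\<close>

lemma holo_identity:
 assumes F: "holo F S" "holo G S" and S: "open S" "connected S"
  and T: "open T" "T ~= {}" "T \<subseteq> S" and eq: "!!z. z \<in> T ==> F z = G z" and z: "z \<in> S"
 shows "F z = G z"
proof (rule blinfun_eqI)
 fix u
 show "F z u = G z u"
 proof (rule pair_eqD)
  fix v
  show "pair (F z u) v = pair (G z u) v"
   by (rule analytic_continuation_open[OF T(1) S(1) T(2) S(2) T(3)
      holo_pair[OF F(1) S(1)] holo_pair[OF F(2) S(1)] _ z])
     (simp add: eq)
 qed
qed

text \<open>The identity \<open>N w = N z - N z (M w - M z) N z + N w (M w - M z) N z (M w - M z) N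
  z\<close> exhibits the derivative \<open>- N z D N z\<close>. Its last term is quadratic in
  \<open>w - z\<close> once \<open>N\<close> is bounded near \<open>z\<close>; as no continuity of
  \<open>N\<close> is assumed, that bound comes first.\<close>

lemma holo_inverse:
 assumes M: "holo M S" and inv: "!!z. z \<in> S ==> M z oL N z = I1"
   "!!z. z \<in> S ==> N z oL M z = I1" and S: "open S"
 shows "holo N S"
 unfolding holo_def op_holomorphic_on_def
proof (intro conjI ballI)
 fix z assume z: "z \<in> S"
 show cl: "complex_linear (N z)"
  using complex_linear_inverse[OF holo_complex_linear[OF M z] inv[OF z]] .
 obtain D where D: "(M has_derivative (%w. op_scaleC w D)) (at z)" using M z holo_derivE by metis
 have app: "M w (N w u) = u" "N w (M w u) = u" if "w \<in> S" for w u
  using inv[OF that] by (metis blinfun_apply_blinfun_compose blinfun_apply_id_blinfun id_apply)+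
 define R where "R w = (N w oL (M w - M z) oL N z) oL ((M w - M z) oL N z)" for w
 define L where "L w = N z - (N z oL (M w - M z) oL N z)" for w
 have NLR: "N w = L w + R w" if "w \<in> S" for w
  by (rule blinfun_eqI)
    (simp add: L_def R_def blinfun.add_left blinfun.diff_left blinfun.diff_right app that z)
 have dL: "(L has_derivative (%w. op_scaleC w (- (N z oL D oL N z)))) (at z)"
 proof -
  have 1: "((%w. M w - M z) has_derivative (%w. op_scaleC w D)) (at z)"
   using has_derivative_diff[OF D has_derivative_const[of "M z"]] by simp
  have "((%w. (N z oL (M w - M z)) oL N z) has_derivative (%w. (N z oL op_scaleC w D) oL N z)) (at z)"
   by (rule bounded_linear.has_derivative[OF
      bounded_bilinear.bounded_linear_left[OF bounded_bilinear_blinfun_compose]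
      bounded_linear.has_derivative[OF
      bounded_bilinear.bounded_linear_right[OF bounded_bilinear_blinfun_compose] 1]])
  then have "(L has_derivative (%w. 0 - ((N z oL op_scaleC w D) oL N z))) (at z)"
   unfolding L_def by (intro has_derivative_diff has_derivative_const)
  moreover have "(%w. 0 - ((N z oL op_scaleC w D) oL N z)) = (%w. op_scaleC w (- (N z oL D oL N z)))"
   by (intro ext blinfun_eqI)
     (simp add: blinfun.minus_left L2_scaleC_minus complex_linear_scaleC[OF cl])
  ultimately show ?thesis by simp
 qed
 define K where "K = norm D"
 obtain d1 where d1: "d1 > 0" "!!y. norm (y - z) < d1 ==>
   norm (M y - M z - op_scaleC (y - z) D) <= 1 * norm (y - z)"
  using D unfolding has_derivative_at_alt by (metis zero_less_one)
 have lip: "norm (M y - M z) <= (1 + K) * norm (y - z)" if "norm (y - z) < d1" for y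
  using d1(2)[OF that] norm_op_scaleC_le[of "y - z" D]
   norm_triangle_ineq2[of "M y - M z" "op_scaleC (y - z) D"]
  by (simp add: K_def algebra_simps)
 obtain d2 where d2: "d2 > 0" "ball z d2 \<subseteq> S" using S z openE by blast
 \<comment> \<open>Chosen so that \<open>norm (M y - M z) * norm (N z)\<close> is at most 1/2 for
   \<open>y\<close> this close to \<open>z\<close>; the term containing \<open>N y\<close> can then
   be absorbed into the left side. The 1 added to \<open>norm (N z)\<close> keeps the denominator
   positive.\<close>
 define q where "q = 1 / (2 * (norm (N z) + 1) * (1 + K))"
 have K0: "K \<ge> 0" by (simp add: K_def)
 have q0: "q > 0" unfolding q_def using K0 by (intro divide_pos_pos mult_pos_pos) (auto intro: add_nonneg_pos)
 define d where "d = min d1 (min d2 q)"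
 have d0: "d > 0" using d1 d2 q0 by (simp add: d_def)
 have Nb: "norm (N y) <= 2 * norm (N z)" if y: "norm (y - z) < d" for y
 proof -
  have yS: "y \<in> S" using d2 y by (auto simp: d_def dist_norm norm_minus_commute subset_iff)
  have "N y = N z - (N y oL (M y - M z) oL N z)"
   by (rule blinfun_eqI)
    (simp add: blinfun.diff_left blinfun.diff_right app yS z)
  then have "norm (N y) <= norm (N z) + norm (N y oL (M y - M z) oL N z)"
   by (metis norm_triangle_ineq4)
  also have "norm (N y oL (M y - M z) oL N z) <= norm (N y) * norm (M y - M z) * norm (N z)"
   by (meson norm_blinfun_compose order_trans mult_right_mono norm_ge_zero)
  also have "... <= norm (N y) * (1/2)"
  proof -
   have "norm (M y - M z) * norm (N z) <= ((1 + K) * q) * (norm (N z) + 1)"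
    using lip[of y] y K0
    by (intro mult_mono order_trans[OF lip[of y]] mult_left_mono) (auto simp: d_def q0 less_imp_le)
   also have "... = 1/2" 
   proof -
    have "norm (N z) + 1 ~= 0" "1 + K ~= 0" using K0 norm_ge_zero[of "N z"] by linarith+
    moreover have "b * (1 / (2 * a * b)) * a = 1/2" if "a ~= 0" "b ~= 0" for a b :: real
     using that by simp
    ultimately show ?thesis unfolding q_def by blast
   qed
   finally show ?thesis unfolding mult.assoc by (intro mult_left_mono) auto
  qed
  finally show ?thesis by simp
 qed
 have Rb: "norm (R y) <= (2 * norm (N z) ^ 3 * (1 + K)\<^sup>2) * (norm (y - z))\<^sup>2" if y: "norm (y - z) < d" for y
 proof -
  have "norm (R y) <= (norm (N y) * norm (M y - M z) * norm (N z)) * (norm (M y - M z) * norm (N z))"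
   unfolding R_def
   by (meson norm_blinfun_compose order_trans mult_right_mono mult_mono norm_ge_zero mult_nonneg_nonneg)
  also have "... <= ((2 * norm (N z)) * ((1 + K) * norm (y - z)) * norm (N z)) * (((1 + K) * norm (y - z)) * norm (N z))"
   using Nb[OF y] lip[of y] y K0
   by (intro mult_mono) (auto simp: d_def)
  also have "... = (2 * norm (N z) ^ 3 * (1 + K)\<^sup>2) * (norm (y - z))\<^sup>2"
   by (simp add: power2_eq_square power3_eq_cube)
  finally show ?thesis .
 qed
 have dR: "(R has_derivative (%w. 0)) (at z)"
  unfolding has_derivative_at_alt
 proof (intro conjI allI impI)
  fix e :: real assume e: "0 < e"
  define C where "C = 2 * norm (N z) ^ 3 * (1 + K)\<^sup>2"
  have C0: "C \<ge> 0" by (simp add: C_def)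
  have Rz: "R z = 0" by (simp add: R_def)
  have "norm (R y - R z - 0) <= e * norm (y - z)" if y: "norm (y - z) < min d (e / (C + 1))" for y
  proof -
   have "norm (R y) <= C * (norm (y - z))\<^sup>2" using Rb[of y] y by (simp add: C_def)
   also have "... = (C * norm (y - z)) * norm (y - z)" by (simp add: power2_eq_square)
   also have "... <= ((C + 1) * (e / (C + 1))) * norm (y - z)"
    using y C0 by (intro mult_right_mono mult_mono) auto
   also have "... = e * norm (y - z)" using C0 by simp
   finally show ?thesis using Rz by simp
  qed
  moreover have "min d (e / (C + 1)) > 0" using d0 e C0 by simp
  ultimately show "\<exists>d>0. \<forall>y. norm (y - z) < d --> norm (R y - R z - 0) <= e * norm (y - z)" by blast
 qed auto
 have "((%w. L w + R w) has_derivative (%w. op_scaleC w (- (N z oL D oL N z)))) (at z)"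
  using has_derivative_add[OF dL dR] by simp
 then have "(N has_derivative (%w. op_scaleC w (- (N z oL D oL N z)))) (at z)"
  by (rule has_derivative_transform_within_open[OF _ S z]) (simp add: NLR)
 then show "\<exists>D. (N has_derivative (%w. op_scaleC w D)) (at z)" ..
qed

lemma blinfun_compose_assoc: "(S oL T) oL U = S oL (T oL U)"
 by (rule blinfun_eqI) simp

text \<open>The terms are built by composing with \<open>- T\<close> on the left; \<open>P'\<close>
  shows that composing on the right gives the same operators, so one series is both a left and a
  right inverse.\<close>

lemma Neumann:
 fixes T :: "'a::banach \<Rightarrow>\<^sub>L 'a"
 assumes T: "norm T < 1"
 obtains N where "(I1 + T) oL N = I1" "N oL (I1 + T) = I1"
  "norm N <= 1 / (1 - norm T)"
proof -
 define P where "P = rec_nat I1 (%_ X. - (T oL X))"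
 have P: "P 0 = I1" "P (Suc n) = - (T oL P n)" for n by (simp_all add: P_def)
 have P': "P (Suc n) = - (P n oL T)" for n
 proof (induction n)
  case (Suc n)
  have "P (Suc (Suc n)) = - (T oL - (P n oL T))" using P(2)[of "Suc n"] Suc by simp
  also have "... = - (P (Suc n) oL T)"
   by (rule blinfun_eqI) (simp add: P(2) blinfun.minus_left blinfun.minus_right)
  finally show ?case .
 qed (simp add: P, rule blinfun_eqI, simp add: blinfun.minus_left)
 have nP: "norm (P n) <= norm T ^ n" for n
 proof (induction n)
  case 0 then show ?case using norm_blinfun_id_le by (simp add: P)
 next
  case (Suc n)
  have "norm (P (Suc n)) <= norm T * norm (P n)" by (simp add: P norm_blinfun_compose)
  also have "... <= norm T * norm T ^ n" by (intro mult_left_mono Suc) simp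
  finally show ?case by simp
 qed
 have sg: "summable (%n. norm T ^ n)" using T by (simp add: summable_geometric)
 have snP: "summable (%n. norm (P n))" by (rule summable_comparison_test'[OF sg]) (use nP in simp)
 have sP: "summable P" by (rule summable_norm_cancel[OF snP])
 define N where "N = suminf P"
 have split: "N = I1 + (\<Sum>n. P (Suc n))"
  using suminf_split_head[OF sP] by (simp add: N_def P)
 have 1: "T oL N = (\<Sum>n. T oL P n)"
  unfolding N_def
  by (rule bounded_linear.suminf[OF bounded_bilinear.bounded_linear_right[OF bounded_bilinear_blinfun_compose] sP])
 have 2: "N oL T = (\<Sum>n. P n oL T)"
  unfolding N_def
  by (rule bounded_linear.suminf[OF bounded_bilinear.bounded_linear_left[OF bounded_bilinear_blinfun_compose] sP])
 have s1: "summable (%n. T oL P n)"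
  by (rule bounded_linear.summable[OF bounded_bilinear.bounded_linear_right[OF bounded_bilinear_blinfun_compose] sP])
 have s2: "summable (%n. P n oL T)"
  by (rule bounded_linear.summable[OF bounded_bilinear.bounded_linear_left[OF bounded_bilinear_blinfun_compose] sP])
 have "N = I1 - (T oL N)" using split 1 s1 by (simp add: P(2) suminf_minus)
 then have *: "N u = u - T (N u)" for u
  by (metis blinfun.diff_left blinfun_apply_blinfun_compose blinfun_apply_id_blinfun id_apply)
 have a: "(I1 + T) oL N = I1"
  by (rule blinfun_eqI) (use * in \<open>simp add: blinfun.add_left algebra_simps\<close>)
 have "N = I1 - (N oL T)" using split 2 s2 by (simp add: P' suminf_minus)
 then have *: "N u = u - N (T u)" for u
  by (metis blinfun.diff_left blinfun_apply_blinfun_compose blinfun_apply_id_blinfun id_apply)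
 have b: "N oL (I1 + T) = I1"
  by (rule blinfun_eqI) (use * in \<open>simp add: blinfun.add_left blinfun.add_right algebra_simps\<close>)
 have "norm N <= (\<Sum>n. norm (P n))" unfolding N_def by (rule summable_norm[OF snP])
 also have "... <= (\<Sum>n. norm T ^ n)" by (rule suminf_le[OF nP snP sg])
 also have "... = 1 / (1 - norm T)" using T by (simp add: suminf_geometric)
 finally show thesis using that a b by blast
qed

unbundle no fps_syntax

section \<open>Smooth functions and test functions\<close>

definition smooth :: "(real^'n::finite => 'b::real_normed_vector) => bool" where
 "smooth f \<longleftrightarrow> (\<forall>k. C_k k f)"

lemma partial_derivI:
 "(f has_derivative f') (at x) ==> pd i f x = f' (axis i 1)"
 using frechet_derivative_at by (auto simp: partial_deriv_def)

lemma differentiable_has_derivative: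
 "f differentiable (at x) ==> (f has_derivative frechet_derivative f (at x)) (at x)"
 by (simp add: frechet_derivative_works)

lemma C_k_SucD: "C_k (Suc k) f ==> C_k k f"
proof (induction k arbitrary: f)
 case 0 then show ?case using C_k_continuous[of "Suc 0" f] by simp
next
 case (Suc k)
 then show ?case by (metis C_k.simps(2))
qed

lemma C_k_const: "C_k k ((%_. c) :: real^'n::finite => 'b::real_normed_vector)"
proof (induction k arbitrary: c)
 case (Suc k)
 have "pd i (%_. c) = ((%_. 0) :: real^'n::finite => 'b)" for i
  by (rule ext, subst partial_derivI[OF has_derivative_const]) simp
 then show ?case using Suc by simp
qed simp

lemma C_k_add:
 fixes f g :: "real^'n::finite => 'b::real_normed_vector"
 shows "C_k k f ==> C_k k g ==> C_k k (%x. f x + g x)"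
proof (induction k arbitrary: f g)
 case 0 then show ?case by (auto intro: continuous_intros)
next
 case (Suc k)
 then have d: "f differentiable (at x)" "g differentiable (at x)" for x by auto
 have "pd i (%x. f x + g x) = (%x. pd i f x + pd i g x)" for i
  by (rule ext, subst partial_derivI[OF has_derivative_add[OF d[THEN differentiable_has_derivative]]])
    (simp add: partial_deriv_def)
 then show ?case using Suc d by (auto intro: differentiable_add)
qed

lemma C_k_bilinear:
 fixes f :: "real^'n::finite => 'b::real_normed_vector" and g :: "real^'n => 'c::real_normed_vector"
 assumes B: "bounded_bilinear B"
 shows "C_k k f ==> C_k k g ==> C_k k (%x. B (f x) (g x))"
proof (induction k arbitrary: f g)
 case 0 then show ?case by (auto intro: bounded_bilinear.continuous_on[OF B])
next
 case (Suc k)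
 then have d: "f differentiable (at x)" "g differentiable (at x)" for x by auto
 note D = bounded_bilinear.FDERIV[OF B d[THEN differentiable_has_derivative]]
 have "pd i (%x. B (f x) (g x)) =
   (%x. B (f x) (pd i g x) + B (pd i f x) (g x))" for i
  by (rule ext, subst partial_derivI[OF D]) (simp add: partial_deriv_def)
 moreover have "C_k k (%x. B (f x) (pd i g x) + B (pd i f x) (g x))" for i
  by (intro C_k_add Suc.IH) (use Suc.prems C_k_SucD in auto)
 moreover have "(%x. B (f x) (g x)) differentiable (at x)" for x
  using D by (auto simp: differentiable_def)
 ultimately show ?case by simp
qed

lemma C_k_linear_comp:
 fixes f :: "real^'n::finite => 'b::real_normed_vector"
 assumes L: "bounded_linear L"
 shows "C_k k f ==> C_k k (%x. L (f x))"
proof (induction k arbitrary: f)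
 case 0 then show ?case by (auto intro: bounded_linear.continuous_on[OF L])
next
 case (Suc k)
 then have d: "f differentiable (at x)" for x by auto
 note D = bounded_linear.has_derivative[OF L d[THEN differentiable_has_derivative]]
 have "pd i (%x. L (f x)) = (%x. L (pd i f x))" for i
  by (rule ext, subst partial_derivI[OF D]) (simp add: partial_deriv_def)
 moreover have "(%x. L (f x)) differentiable (at x)" for x
  using D by (auto simp: differentiable_def)
 ultimately show ?case using Suc by simp
qed

lemma C_k_linear:
 assumes L: "bounded_linear (L :: real^'n::finite => 'b::real_normed_vector)" shows "C_k k L"
proof (cases k)
 case 0 then show ?thesis using bounded_linear.continuous_on[OF L continuous_on_id] by simp
next
 case (Suc m)
 note D = bounded_linear_imp_has_derivative[OF L]
 have "pd i L = (%x. L (axis i 1))" for i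
  by (rule ext, subst partial_derivI[OF D]) simp
 moreover have "L differentiable (at x)" for x using D by (auto simp: differentiable_def)
 ultimately show ?thesis using Suc by (simp add: C_k_const)
qed

text \<open>The outer function is given together with all its derivatives, as a family. The chain
  rule sends \<open>g j\<close> to \<open>g (Suc j)\<close>, so the induction on \<open>k\<close>
  runs for all \<open>j\<close> at once.\<close>

lemma C_k_comp_family:
 fixes q :: "real^'n::finite => real" and g :: "nat => real => real"
 assumes g: "!!j y. (g j has_real_derivative g (Suc j) y) (at y)" and q: "!!k. C_k k q"
 shows "C_k k (%x. g j (q x))"
proof (induction k arbitrary: j)
 case 0
 have "continuous_on UNIV (g j)" 
  by (intro continuous_at_imp_continuous_on ballI DERIV_isCont[OF g])
 moreover have "continuous_on UNIV q" using q[of 0] by simp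
 ultimately show ?case using continuous_on_compose2[of UNIV "g j" UNIV q] by auto
next
 case (Suc k)
 have "q differentiable (at x)" for x using q[of "Suc 0"] by simp
 then have "(q has_derivative frechet_derivative q (at x)) (at x)" for x
  by (rule differentiable_has_derivative)
 then have D: "((%x. g j (q x)) has_derivative (%h. g (Suc j) (q x) * frechet_derivative q (at x) h)) (at x)" for x
  using g[of j "q x"] has_derivative_compose[of q _ x UNIV "g j"]
  by (metis has_field_derivative_def)
 have "pd i (%x. g j (q x)) = (%x. g (Suc j) (q x) * pd i q x)" for i
  by (rule ext, subst partial_derivI[OF D]) (simp add: partial_deriv_def)
 moreover have "C_k k (%x. g (Suc j) (q x) * pd i q x)" for i
  by (intro C_k_bilinear[OF bounded_bilinear_mult] Suc.IH) (use q[of "Suc k"] in auto)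
 moreover have "(%x. g j (q x)) differentiable (at x)" for x
  using D by (auto simp: differentiable_def)
 ultimately show ?case by simp
qed

lemma C_k_inverse:
 fixes f :: "real^'n::finite => real"
 assumes f: "!!k. C_k k f" "!!x. f x ~= 0"
 shows "C_k k (%x. inverse (f x))"
proof (induction k)
 case 0 then show ?case using f(1)[of 0] f(2) by (auto intro: continuous_intros)
next
 case (Suc k)
 have d: "f differentiable (at x)" for x using f(1)[of "Suc 0"] by simp
 note D = Deriv.has_derivative_inverse[OF f(2) differentiable_has_derivative[OF d]]
 have "pd i (%x. inverse (f x)) =
   (%x. (- 1) * (inverse (f x) * (pd i f x * inverse (f x))))" for i
  by (rule ext, subst partial_derivI[OF D]) (simp add: partial_deriv_def)
 moreover have "C_k k (%x. (- 1) * (inverse (f x) * (pd i f x * inverse (f x))))" for i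
  by (intro C_k_bilinear[OF bounded_bilinear_mult] C_k_const Suc.IH) (use f(1)[of "Suc k"] in auto)
 moreover have "(%x. inverse (f x)) differentiable (at x)" for x
  using D by (auto simp: differentiable_def)
 ultimately show ?case by simp
qed

lemma smooth_const [simp]: "smooth (%_. c)" by (simp add: smooth_def C_k_const)
lemma smooth_add: "smooth f ==> smooth g ==> smooth (%x. f x + g x)" by (simp add: smooth_def C_k_add)
lemma smooth_mult:
 fixes f :: "real^'n::finite => 'b::real_normed_algebra"
 shows "smooth f ==> smooth g ==> smooth (%x. f x * g x)"
 by (simp add: smooth_def C_k_bilinear[OF bounded_bilinear_mult])
lemma smooth_of_real: "smooth f ==> smooth (%x. cor (f x))"
 by (simp add: smooth_def C_k_linear_comp[OF bounded_linear_of_real])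
lemma smooth_linear: "bounded_linear L ==> smooth L" by (simp add: smooth_def C_k_linear)
lemma smooth_inverse:
 fixes f :: "real^'n::finite => real"
 shows "smooth f ==> (!!x. f x ~= 0) ==> smooth (%x. inverse (f x))"
 by (simp add: smooth_def C_k_inverse)
lemma smooth_diff:
 fixes f :: "real^'n::finite => 'b::real_normed_algebra_1"
 assumes "smooth f" "smooth g" shows "smooth (%x. f x - g x)"
 using smooth_add[OF assms(1) smooth_mult[OF smooth_const[of "-1"] assms(2)]] by simp
lemma smooth_comp_family:
 fixes g :: "nat => real => real"
 assumes "!!j y. (g j has_real_derivative g (Suc j) y) (at y)" "smooth q"
 shows "smooth (%x. g j (q x))"
 using C_k_comp_family[of g q] assms by (simp add: smooth_def)
lemma smooth_sum: 
 "(!!i. i \<in> I ==> smooth (f i)) ==> smooth (%x. \<Sum>i\<in>I. f i x)"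
 by (induction I rule: infinite_finite_induct) (auto intro: smooth_add)
lemma smooth_prod: 
 fixes f :: "'i => real^'n::finite => 'b::{real_normed_algebra,comm_ring_1}"
 shows "(!!i. i \<in> I ==> smooth (f i)) ==> smooth (%x. \<Prod>i\<in>I. f i x)"
 by (induction I rule: infinite_finite_induct) (auto intro: smooth_mult)
lemma smooth_component: "smooth (%x::real^'n::finite. x $ i)"
 by (rule smooth_linear[OF bounded_linear_vec_nth])
lemma smooth_sq_dist: "smooth (%x::real^'n::finite. (norm (x - a))\<^sup>2)"
proof -
 have "(%x. (norm (x - a))\<^sup>2) = (%x::real^'n. \<Sum>i\<in>UNIV. (x $ i - a $ i) * (x $ i - a $ i))"
  by (simp add: norm_vec_def L2_set_def sum_nonneg power2_eq_square)
 moreover have "smooth (%x::real^'n. \<Sum>i\<in>UNIV. (x $ i - a $ i) * (x $ i - a $ i))"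
  by (intro smooth_sum smooth_mult smooth_diff smooth_component smooth_const)
 ultimately show ?thesis by simp
qed

lemma smooth_partial_deriv: "smooth f ==> smooth (pd i f)"
 unfolding smooth_def by (metis C_k.simps(2))
lemma smooth_differentiable: "smooth f ==> f differentiable (at x)"
 unfolding smooth_def using C_k.simps(2) by blast
lemma smooth_has_derivative:
 "smooth f ==> (f has_derivative frechet_derivative f (at x)) (at x)"
 by (simp add: smooth_differentiable differentiable_has_derivative)
lemma smooth_continuous: "smooth f ==> continuous_on UNIV f"
 unfolding smooth_def by (metis C_k.simps(1))
lemma smooth_measurable: 
 fixes f :: "real^'n::finite => 'b::real_normed_vector"
 shows "smooth f ==> f \<in> bm lborel"
 using borel_measurable_continuous_onI[OF smooth_continuous] by simp

lemma C0_infinity_iff: "C0_infinity f \<longleftrightarrow> smooth f & compact (supp f)"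
 by (simp add: C0_infinity_def smooth_def)

lemma smooth_partial_mult:
 fixes f :: "real^'n::finite => 'b::real_normed_algebra"
 assumes "smooth f" "smooth g"
 shows "pd i (%x. f x * g x) x = f x * pd i g x + pd i f x * g x"
 by (subst partial_derivI[OF has_derivative_mult[OF smooth_has_derivative[OF assms(1)]
   smooth_has_derivative[OF assms(2)]]]) (simp add: partial_deriv_def)

lemma partial_deriv_const [simp]: "pd i (%_. c) x = 0"
 by (subst partial_derivI[OF has_derivative_const]) simp

lemma C0_infinity_mult:
 fixes f :: "real^'n::finite => 'b::real_normed_algebra"
 assumes "smooth f" "C0_infinity g"
 shows "C0_infinity (%x. f x * g x)" "C0_infinity (%x. g x * f x)"
proof -
 have g: "smooth g" "compact (supp g)" using assms(2) by (auto simp: C0_infinity_iff)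
 have "supp (%x. f x * g x) \<subseteq> supp g" "supp (%x. g x * f x) \<subseteq> supp g"
  unfolding supp_def by (auto intro!: closure_mono)
 moreover have "closed (supp h)" for h :: "real^'n => 'b" by (simp add: supp_def)
 ultimately have "compact (supp (%x. f x * g x))" "compact (supp (%x. g x * f x))"
  using g(2) compact_Int_closed[of "supp g"] by (metis inf.absorb_iff2)+
 then show "C0_infinity (%x. f x * g x)" "C0_infinity (%x. g x * f x)"
  using g(1) assms(1) by (auto simp: C0_infinity_iff smooth_mult)
qed

lemma C0_infinityI:
 assumes "smooth f" "!!x. norm x > R ==> f x = 0" shows "C0_infinity f"
proof -
 have "{x. f x ~= 0} \<subseteq> cball 0 R" using assms(2) by (force simp: not_less[symmetric])
 then have "supp f \<subseteq> cball 0 R" unfolding supp_def by (simp add: closure_minimal)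
 then have "compact (supp f)"
  unfolding supp_def by (metis bounded_cball bounded_subset closed_closure compact_eq_bounded_closed)
 then show ?thesis using assms(1) by (simp add: C0_infinity_iff)
qed

lemma supp_zero: "x \<notin> supp f ==> f x = 0"
 using closure_subset[of "{x. f x ~= 0}"] by (auto simp: supp_def)

lemma partial_deriv_outside_supp: 
 fixes f :: "real^'n::finite => 'b::real_normed_vector"
 assumes "x \<notin> supp f" shows "pd i f x = 0"
proof -
 have "open (- supp f)" by (simp add: supp_def open_Compl)
 then have "(f has_derivative (%_. 0)) (at x)"
  by (rule has_derivative_transform_within_open[OF has_derivative_const[of 0]])
    (use assms supp_zero in auto)
 then show ?thesis by (simp add: partial_derivI)
qed

lemma partial_deriv_locally_const:
 fixes f :: "real^'n::finite => 'b::real_normed_vector"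
 assumes "open S" "x \<in> S" "!!y. y \<in> S ==> f y = c" shows "pd i f x = 0"
proof -
 have "(f has_derivative (%_. 0)) (at x)"
  by (rule has_derivative_transform_within_open[OF has_derivative_const[of c] assms(1,2)])
    (use assms in auto)
 then show ?thesis by (simp add: partial_derivI)
qed

lemma C0_infinity_boundedE:
 fixes f :: "real^'n::finite => 'b::real_normed_vector"
 assumes "C0_infinity f" obtains R where "R > 0" "!!x. norm x > R ==> f x = 0"
proof -
 have "bounded (supp f)" using assms by (simp add: C0_infinity_iff compact_imp_bounded)
 then obtain R where "!!x. x \<in> supp f ==> norm x <= R" by (auto simp: bounded_iff)
 then have "!!x. norm x > max R 1 ==> f x = 0" using supp_zero by fastforce
 then show thesis using that[of "max R 1"] by simp
qed

lemma C0_infinity_partial_deriv: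
 fixes f :: "real^'n::finite => 'b::real_normed_vector"
 assumes "C0_infinity f" shows "C0_infinity (pd i f)"
proof -
 obtain R where R: "!!x. norm x > R ==> f x = 0" using assms C0_infinity_boundedE by metis
 have "supp f \<subseteq> cball 0 R" unfolding supp_def
  by (intro closure_minimal) (use R in \<open>force simp: not_less[symmetric]\<close>)+
 then have "norm x > R ==> pd i f x = 0" for x
  by (intro partial_deriv_outside_supp) auto
 then show ?thesis using assms by (intro C0_infinityI[of _ R] smooth_partial_deriv) (auto simp: C0_infinity_iff)
qed

lemma integrable_bounded_support:
 fixes f :: "real^'n::finite => 'b::{banach,second_countable_topology}"
 assumes [measurable]: "f \<in> bm lborel" and B: "!!x. norm (f x) <= B"
  and R: "!!x. norm x > R ==> f x = 0"
 shows "integrable lborel f"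
proof (rule Bochner_Integration.integrable_bound)
 show "integrable lborel (%x::real^'n. B * indicator (cball 0 R) x)"
  using emeasure_lborel_cball_finite[of "0::real^'n" R] by (simp add: less_top)
 show "AE x in lborel. norm (f x) <= norm (B * indicator (cball 0 R) x)"
  using B R by (intro AE_I2) (auto simp: indicator_def intro: order_trans[OF B abs_ge_self])
qed auto

lemma C0_integrable:
 assumes "C0_infinity (f :: 'n::finite cfun)"
 shows "integrable lborel f" "sqi f" "bdd_mult f"
proof -
 obtain R where R: "!!x. norm x > R ==> f x = 0" using assms C0_infinity_boundedE by metis
 obtain B where B: "!!x. cmod (f x) <= B" 
  using bounded_range_C0_infinity[OF assms] by (auto simp: bounded_iff)
 have [measurable]: "f \<in> bm lborel" using C0_infinity_measurable[OF assms] by simp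
 show "integrable lborel f" by (rule integrable_bounded_support[OF _ B R]) auto
 have "integrable lborel (%x. (cmod (f x))\<^sup>2)"
  by (rule integrable_bounded_support[where B="B\<^sup>2" and R=R]) (auto simp: R B intro!: power_mono)
 then show "sqi f" by (simp add: square_integrable_def)
 show "bdd_mult f" by (rule bdd_multI[OF _ B]) auto
qed

section \<open>Bump functions\<close>

text \<open>With \<open>y = 1/t\<close> the derivative of \<open>p(y) exp(-y)\<close> is
  \<open>y^2 (p - p')(y) exp(-y)\<close>, a function of the same form. The class is closed under
  differentiation, and the exponential beats the polynomial at 0, so all members are smooth on the
  whole line.\<close>

definition flat :: "real poly => real => real" where
 "flat p t = (if t > 0 then poly p (1/t) * exp (- (1/t)) else 0)"

lemma flat_tendsto_0: "(flat p \<longlongrightarrow> 0) (at 0)"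
proof -
 have "((%y. poly p y / exp y) \<longlongrightarrow> (\<Sum>i\<le>degree p. coeff p i * 0)) at_top" 
 proof -
  have "((%y. \<Sum>i\<le>degree p. coeff p i * (y ^ i / exp y)) \<longlongrightarrow> (\<Sum>i\<le>degree p. coeff p i * 0)) at_top"
   by (intro tendsto_sum tendsto_mult tendsto_const tendsto_power_div_exp_0)
  then show ?thesis by (simp add: poly_altdef sum_divide_distrib)
 qed
 then have "((%t. poly p (inverse t) / exp (inverse t)) \<longlongrightarrow> 0) (at_right 0)"
  using filterlim_compose[OF _ filterlim_inverse_at_top_right] by simp
 then have r: "(flat p \<longlongrightarrow> 0) (at_right 0)"
  by (rule Lim_transform_eventually, intro eventually_mono[OF eventually_at_right_less[of 0]])
    (simp add: flat_def exp_minus divide_inverse)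
 have l: "(flat p \<longlongrightarrow> 0) (at_left 0)"
  by (rule Lim_transform_eventually[OF tendsto_const], rule eventually_at_leftI[of "-1"])
    (auto simp: flat_def)
 show ?thesis using filterlim_split_at[OF l r] .
qed

lemma flat_deriv:
 "(flat p has_real_derivative flat ((p - pderiv p) * [:0, 0, 1:]) t) (at t)"
proof -
 consider "t > 0" | "t < 0" | "t = 0" by linarith
 then show ?thesis
 proof cases
  case 1
  have "((%t. poly p (1/t) * exp (- (1/t))) has_real_derivative
    flat ((p - pderiv p) * [:0, 0, 1:]) t) (at t)"
   using 1 by (auto intro!: derivative_eq_intros simp: flat_def field_simps power2_eq_square)
  then show ?thesis
   by (rule has_field_derivative_transform_within_open[where S="{0<..}"]) (use 1 in \<open>auto simp: flat_def\<close>)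
 next
  case 2
  have "((%t. 0) has_real_derivative flat ((p - pderiv p) * [:0, 0, 1:]) t) (at t)"
   using 2 by (simp add: flat_def)
  then show ?thesis
   by (rule has_field_derivative_transform_within_open[where S="{..<0}"]) (use 2 in \<open>auto simp: flat_def\<close>)
 next
  case 3
  \<comment> \<open>The difference quotient at 0 is again a flat function: dividing by
    \<open>h\<close> multiplies the polynomial by its variable.\<close>
  have "((%h. (flat p (0 + h) - flat p 0) / h) \<longlongrightarrow> 0) (at 0)"
  proof (rule Lim_transform_eventually[OF flat_tendsto_0[of "p * [:0, 1:]"]])
   show "\<forall>\<^sub>F h in at 0. flat (p * [:0, 1:]) h = (flat p (0 + h) - flat p 0) / h"
    by (auto simp: eventually_at flat_def field_simps intro!: exI[of _ 1])
  qed
  then show ?thesis using 3 by (simp add: DERIV_def flat_def)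
 qed
qed

definition flat_seq :: "nat => real poly" where
 "flat_seq k = ((%p. (p - pderiv p) * [:0, 0, 1:]) ^^ k) 1"

lemma smooth_flat: "smooth q ==> smooth (%x. flat 1 (q x))"
 using smooth_comp_family[of "%k. flat (flat_seq k)" q 0] flat_deriv
 by (simp add: flat_seq_def)

lemma flat_1: "flat 1 t = (if t > 0 then exp (- (1/t)) else 0)" by (simp add: flat_def)

lemma flat_1_bounds: "0 <= flat 1 t" "flat 1 t <= 1" "t > 0 ==> 0 < flat 1 t" "t <= 0 ==> flat 1 t = 0"
 by (auto simp: flat_1)

text \<open>The quotient \<open>N / (N + M)\<close>, where \<open>N\<close> is positive inside
  radius \<open>b\<close> and \<open>M\<close> outside radius \<open>a\<close>. As
  \<open>a < b\<close> these two regions cover the space and the denominator never vanishes.\<close>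

lemma smooth_cutoff_exists:
 assumes "0 < a" "a < b"
 obtains \<psi> :: "real^'n::finite => real" where "smooth \<psi>" "!!x. norm x <= a ==> \<psi> x = 1"
  "!!x. norm x \<ge> b ==> \<psi> x = 0" "!!x. 0 <= \<psi> x" "!!x. \<psi> x <= 1"
proof
 define N where "N x = flat 1 (b\<^sup>2 - (norm x)\<^sup>2)" for x :: "real^'n"
 define M where "M x = flat 1 ((norm x)\<^sup>2 - a\<^sup>2)" for x :: "real^'n"
 have q: "smooth (%x::real^'n. (norm x)\<^sup>2)" using smooth_sq_dist[of 0] by simp
 have s: "smooth N" "smooth M" unfolding N_def M_def
  by (intro smooth_flat smooth_diff q smooth_const)+
 have b: "0 <= N x" "0 <= M x" for x by (auto simp: N_def M_def flat_1_bounds)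
 have NM: "N x + M x > 0" for x
 proof -
  have ab: "a\<^sup>2 < b\<^sup>2" using assms by (simp add: power_strict_mono)
  then consider "b\<^sup>2 - (norm x)\<^sup>2 > 0" | "(norm x)\<^sup>2 - a\<^sup>2 > 0" by linarith
  then show ?thesis
  proof cases
   case 1
   then have "N x > 0" unfolding N_def by (rule flat_1_bounds)
   then show ?thesis using b(2)[of x] by linarith
  next
   case 2
   then have "M x > 0" unfolding M_def by (rule flat_1_bounds)
   then show ?thesis using b(1)[of x] by linarith
  qed
 qed
 show "smooth (%x. N x * inverse (N x + M x))"
  by (intro smooth_mult smooth_inverse smooth_add s) (use NM in \<open>simp add: less_imp_neq[symmetric]\<close>)
 show "N x * inverse (N x + M x) = 1" if "norm x <= a" for x
 proof -
  have "M x = 0" unfolding M_def using that by (intro flat_1_bounds) (auto intro: power_mono)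
  then show ?thesis using NM[of x] by simp
 qed
 show "N x * inverse (N x + M x) = 0" if "norm x \<ge> b" for x
 proof -
  have "N x = 0" unfolding N_def using that assms by (intro flat_1_bounds) (auto intro: power_mono)
  then show ?thesis by simp
 qed
 show "0 <= N x * inverse (N x + M x)" for x using b NM[of x] by simp
 show "N x * inverse (N x + M x) <= 1" for x using b[of x] NM[of x] by (simp add: field_simps)
qed

section \<open>Integration by parts and totality of test functions\<close>

lemma integral_translation:
 fixes f :: "real^'n::finite => 'b::{banach,second_countable_topology}"
 assumes "f \<in> bm lborel"
 shows "LI (%x. f (x + c)) = LI f"
 using integral_distr[of "(+) c" lborel borel f] assms
 by (simp add: lborel_distr_plus add.commute)

lemma integrable_translation:
 fixes f :: "real^'n::finite => 'b::{banach,second_countable_topology}"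
 assumes "integrable lborel f"
 shows "integrable lborel (%x. f (x + c))"
 using integrable_distr_eq[of "(+) c" lborel borel f] assms
 by (simp add: lborel_distr_plus add.commute)

text \<open>Translation invariance is differentiated: the difference quotients have integral 0 and
  are dominated by a multiple of the indicator of a ball, so their limit has integral 0 as
  well.\<close>

lemma integral_partial_deriv_eq_0:
 fixes F :: "'n::finite cfun"
 assumes "C0_infinity F"
 shows "LI (pd i F) = 0"
proof -
 obtain R where R: "R > 0" "!!x. norm x > R ==> F x = 0" using assms C0_infinity_boundedE by metis
 obtain B where B: "!!x. cmod (pd i F x) <= B" 
  using bounded_range_C0_infinity[OF C0_infinity_partial_deriv[OF assms]] by (auto simp: bounded_iff)
 have smooth: "smooth F" using assms by (simp add: C0_infinity_iff)
 note [measurable] = C0_infinity_measurable(1)[OF assms] C0_infinity_measurable(2)[OF assms]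
 define e where "e = (axis i 1 :: real^'n)"
 have ne: "norm e = 1" by (simp add: e_def norm_axis_1)
 have B0: "B \<ge> 0" using B norm_ge_zero order_trans by blast
 define t where "t m = 1 / real (Suc m)" for m
 have t: "t m > 0" "t m <= 1" for m by (auto simp: t_def)
 have dF: "((%s. F (x + s *\<^sub>R e)) has_vector_derivative pd i F (x + s *\<^sub>R e)) (at s within S)" for x s S
 proof -
  have "((%s. x + s *\<^sub>R e) has_derivative (%h. h *\<^sub>R e)) (at s within S)"
   by (auto intro!: derivative_eq_intros)
  from has_derivative_compose[OF this smooth_has_derivative[OF smooth]]
  have "((%s. F (x + s *\<^sub>R e)) has_derivative
    (%h. frechet_derivative F (at (x + s *\<^sub>R e)) (h *\<^sub>R e))) (at s within S)" .
  moreover have "linear (frechet_derivative F (at (x + s *\<^sub>R e)))"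
   using smooth_has_derivative[OF smooth] has_derivative_linear by blast
  ultimately show ?thesis
   by (simp add: has_vector_derivative_def linear_scale partial_deriv_def e_def)
 qed
 define D where "D m x = (F (x + t m *\<^sub>R e) - F x) /\<^sub>R t m" for m x
 have "(%m. LI (D m)) ----> LI (pd i F)"
 proof (rule integral_dominated_convergence[where w="%x. B * indicator (cball 0 (R + 1)) x"])
  show "D m \<in> bm lborel" for m unfolding D_def[abs_def] by measurable
  show "integrable lborel (%x::real^'n. B * indicator (cball 0 (R + 1)) x)"
   using emeasure_lborel_cball_finite[of "0::real^'n" "R+1"] by (simp add: less_top)
  show "AE x in lborel. (%m. D m x) ----> pd i F x"
  proof (rule AE_I2)
   fix x
   have "((%h. (F (x + h *\<^sub>R e) - F x) /\<^sub>R h) \<longlongrightarrow> pd i F x) (at 0)"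
   proof (rule LIM_zero_cancel, rule tendsto_norm_zero_cancel)
    have "(%h. norm (F (x + h *\<^sub>R e) - F x - h *\<^sub>R pd i F x) / norm h) \<midarrow>0\<rightarrow> 0"
     using dF[of x 0 UNIV] by (simp add: has_vector_derivative_def has_derivative_at)
    then show "(%h. norm ((F (x + h *\<^sub>R e) - F x) /\<^sub>R h - pd i F x)) \<midarrow>0\<rightarrow> 0"
    proof (rule Lim_transform_eventually)
     have "norm (a - h *\<^sub>R v) / norm h = norm (a /\<^sub>R h - v)" if "h ~= 0" for h and a v :: complex
     proof -
      have "a /\<^sub>R h - v = (a - h *\<^sub>R v) /\<^sub>R h" using that by (simp add: scaleR_diff_right)
      then show ?thesis using that by (simp add: divide_inverse mult.commute)
     qed
     then show "\<forall>\<^sub>F h in at 0. norm (F (x + h *\<^sub>R e) - F x - h *\<^sub>R pd i F x) / norm h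
       = norm ((F (x + h *\<^sub>R e) - F x) /\<^sub>R h - pd i F x)"
      by (auto simp: eventually_at intro!: exI[of _ 1])
    qed
   qed
   moreover have "filterlim t (at 0) sequentially"
   proof -
    have "t = (%m. inverse (real (Suc m)))" by (simp add: t_def[abs_def] inverse_eq_divide)
    then have "t ----> 0" using LIMSEQ_inverse_real_of_nat by metis
    then show ?thesis unfolding filterlim_at using t by (auto simp: less_imp_neq[symmetric])
   qed
   ultimately show "(%m. D m x) ----> pd i F x"
    unfolding D_def by (rule filterlim_compose)
  qed
  show "AE x in lborel. norm (D m x) <= B * indicator (cball 0 (R + 1)) x" for m
  proof (rule AE_I2)
   fix x
   show "norm (D m x) <= B * indicator (cball 0 (R + 1)) x"
   proof (cases "norm x <= R + 1")
    case True
    have "norm (F (x + t m *\<^sub>R e) - F (x + 0 *\<^sub>R e)) <= B * norm (t m - 0)"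
    proof (rule differentiable_bound[where S="{0..t m}" and f="%s. F (x + s *\<^sub>R e)"])
     fix s assume "s \<in> {0..t m}"
     show "((%s. F (x + s *\<^sub>R e)) has_derivative (%h. h *\<^sub>R pd i F (x + s *\<^sub>R e))) (at s within {0..t m})"
      using dF by (simp add: has_vector_derivative_def)
     show "onorm (%h. h *\<^sub>R pd i F (x + s *\<^sub>R e)) <= B"
     proof (rule onorm_bound[OF B0])
      show "norm (h *\<^sub>R pd i F (x + s *\<^sub>R e)) <= B * norm h" for h
       unfolding norm_scaleR mult.commute[of B] real_norm_def by (intro mult_left_mono B) auto
     qed
    qed (use t[of m] in auto)
    moreover have "norm (D m x) = norm (F (x + t m *\<^sub>R e) - F x) / t m"
     using t[of m] by (simp add: D_def divide_inverse mult.commute)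
    ultimately show ?thesis using True t[of m] by (simp add: pos_divide_le_eq)
   next
    case False
    then have "norm x > R" by simp
    moreover have "norm (x + t m *\<^sub>R e) > R"
     using norm_triangle_ineq4[of "x + t m *\<^sub>R e" "t m *\<^sub>R e"] t[of m] ne False by simp
    ultimately show ?thesis using R(2) False by (simp add: D_def)
   qed
  qed
 qed measurable
 moreover have "LI (D m) = 0" for m
 proof -
  have "integrable lborel F" by (rule C0_integrable[OF assms])
  then show ?thesis unfolding D_def[abs_def]
   by (simp add: integrable_translation integral_translation)
 qed
 ultimately show ?thesis by (simp add: LIMSEQ_const_iff)
qed

lemma integration_by_parts:
 fixes f ph :: "'n::finite cfun"
 assumes "smooth f" "C0_infinity ph"
 shows "LI (%x. f x * pd i ph x) = - LI (%x. pd i f x * ph x)"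
proof -
 have s: "smooth ph" using assms by (simp add: C0_infinity_iff)
 have "integrable lborel (%x. f x * pd i ph x)" "integrable lborel (%x. pd i f x * ph x)"
  by (intro C0_integrable C0_infinity_mult C0_infinity_partial_deriv smooth_partial_deriv assms)+
 moreover have "pd i (%x. f x * ph x) = (%x. f x * pd i ph x + pd i f x * ph x)"
  by (rule ext) (rule smooth_partial_mult[OF assms(1) s])
 ultimately have "LI (%x. f x * pd i ph x) + LI (%x. pd i f x * ph x)
   = LI (pd i (%x. f x * ph x))"
  by simp
 also have "... = 0" by (rule integral_partial_deriv_eq_0[OF C0_infinity_mult(1)[OF assms]])
 finally show ?thesis by (simp add: eq_neg_iff_add_eq_0)
qed

lemma square_integrable_indicator:
 assumes "A \<in> sets borel" "emeasure lborel A < \<infinity>"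
 shows "sqi (indicator A)"
proof -
 have "(%x. (cmod (indicator A x))\<^sup>2) = (%x. indicator A x :: real)"
  by (auto simp: indicator_def)
 then show ?thesis using assms by (simp add: square_integrable_def integrable_real_indicator)
qed

text \<open>The product of \<open>flat 1\<close> factors at scale \<open>Suc m\<close> vanishes
  outside the box and tends to 1 at each inner point, since \<open>exp (- 1 / (Suc m * c))\<close>
  tends to 1. Test functions thus approximate the indicator of the open box from inside.\<close>

lemma integral_box_eq_0:
 fixes f :: "'n::finite cfun"
 assumes f: "sqi f"
  and 0: "!!ph. C0_infinity ph ==> LI (%x. f x * ph x) = 0"
 shows "LI (%x. f x * indicator (box a b) x) = 0"
proof -
 define r where "r m x = (\<Prod>i\<in>UNIV. flat 1 (real (Suc m) * (x $ i - a $ i)) * flat 1 (real (Suc m) * (b $ i - x $ i)))"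
  for m and x :: "real^'n"
 have r0: "r m x = 0" if x: "x \<notin> box a b" for m x
 proof -
  obtain i where "x $ i <= a $ i \<or> b $ i <= x $ i" using x by (auto simp: mem_box_cart not_less)
  then have "flat 1 (real (Suc m) * (x $ i - a $ i)) = 0 \<or> flat 1 (real (Suc m) * (b $ i - x $ i)) = 0"
   by (auto intro!: flat_1_bounds mult_nonneg_nonpos simp del: of_nat_Suc)
  then show ?thesis unfolding r_def by (intro prod_zero) (auto intro!: bexI[of _ i])
 qed
 have r01: "0 <= r m x" "r m x <= 1" for m x
  unfolding r_def by (intro prod_nonneg prod_le_1 ballI conjI mult_nonneg_nonneg mult_le_one flat_1_bounds)+
 have rs: "smooth (r m)" for m
  unfolding r_def by (intro smooth_prod smooth_mult smooth_flat smooth_diff smooth_const smooth_component)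
 have rC: "C0_infinity (%x. cor (r m x))" for m
 proof -
  obtain R where "!!x. x \<in> box a b ==> norm x <= R" using bounded_box[of a b] by (auto simp: bounded_iff)
  then show ?thesis by (intro C0_infinityI[of _ R] smooth_of_real rs) (use r0 in force)
 qed
 have rl: "(%m. r m x) ----> indicator (box a b) x" for x
 proof (cases "x \<in> box a b")
  case True
  have fl: "(%m. flat 1 (real (Suc m) * c)) ----> 1" if c: "c > 0" for c
  proof -
   have "(%m. exp (- (inverse (real (Suc m)) * (1/c)))) ----> exp (- (0 * (1/c)))"
    by (intro tendsto_intros LIMSEQ_inverse_real_of_nat)
   moreover have "flat 1 (real (Suc m) * c) = exp (- (inverse (real (Suc m)) * (1/c)))" for m
    using c by (simp add: flat_1 divide_inverse del: of_nat_Suc)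
   ultimately show ?thesis by simp
  qed
  have "(%m. r m x) ----> (\<Prod>i\<in>(UNIV::'n set). 1 * 1)"
   unfolding r_def by (intro tendsto_prod tendsto_mult fl) (use True in \<open>auto simp: mem_box_cart\<close>)
  then show ?thesis using True by simp
 qed (simp add: r0)
 have [measurable]: "f \<in> bm borel" "r m \<in> bm borel" for m
  using f rs smooth_measurable by (force simp: square_integrable_def)+
 have fi: "integrable lborel (%x. f x * indicator (box a b) x)"
 proof -
  have "sqi (indicator (box a b))"
   by (rule square_integrable_indicator) (use emeasure_lborel_box_finite[of a b] in \<open>auto simp: less_top\<close>)
  then show ?thesis by (rule integrable_mult_sqi[OF f])
 qed
 have "(%m. LI (%x. f x * cor (r m x)))
   ----> LI (%x. f x * indicator (box a b) x)"
 proof (rule integral_dominated_convergence[where w="%x. cmod (f x * indicator (box a b) x)"])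
  show "integrable lborel (%x. cmod (f x * indicator (box a b) x))" using fi by simp
  show "AE x in lborel. (%m. f x * cor (r m x)) ----> f x * indicator (box a b) x"
  proof (rule AE_I2)
   fix x
   have "(%m. f x * cor (r m x)) ----> f x * cor (indicator (box a b) x)"
    by (intro tendsto_intros rl)
   then show "(%m. f x * cor (r m x)) ----> f x * indicator (box a b) x"
    by (cases "x \<in> box a b") auto
  qed
  show "AE x in lborel. norm (f x * cor (r m x)) <= cmod (f x * indicator (box a b) x)" for m
   using r0 r01 by (intro AE_I2) (auto simp: norm_mult indicator_def intro!: mult_left_le)
 qed auto
 then show ?thesis using 0[OF rC] by (simp add: LIMSEQ_const_iff)
qed

text \<open>Boxes are stable under intersection and generate the Borel sets, so vanishing integrals
  spread to all Borel sets. The truncation \<open>g N\<close> to a large box is integrable, which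
  the steps for complements and disjoint unions use.\<close>

lemma AE_zero_if_box_integrals_zero:
 fixes f :: "'n::finite cfun"
 assumes f: "sqi f"
  and 0: "!!a b. LI (%x. f x * indicator (box a b) x) = 0"
 shows "AE x in lborel. f x = 0"
proof -
 have [measurable]: "f \<in> bm borel" using f by (simp add: square_integrable_def)
 define g where "g N x = indicator (box (- (real N *\<^sub>R One)) (real N *\<^sub>R One)) x *\<^sub>R f x" for N x
 have gi: "integrable lborel (g N)" for N
 proof -
  have "sqi (indicator (box (- (real N *\<^sub>R One)) (real N *\<^sub>R One)))"
   by (rule square_integrable_indicator) (use emeasure_lborel_box_finite[of "- (real N *\<^sub>R One)" "real N *\<^sub>R One"] in \<open>auto simp: less_top\<close>)
  moreover have "g N = (%x. f x * indicator (box (- (real N *\<^sub>R One)) (real N *\<^sub>R One)) x)"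
   by (auto simp: g_def indicator_def)
  ultimately show ?thesis using integrable_mult_sqi[OF f] by simp
 qed
 have zero: "set_lebesgue_integral lborel A (g N) = 0" if A: "A \<in> sets borel" for A N
 proof -
  have "Int_stable (range (%(a, b). box a b :: (real^'n) set))"
   by (auto simp: Int_stable_def box_Int_box)
  moreover have "range (%(a, b). box a b :: (real^'n) set) \<subseteq> Pow UNIV" by simp
  moreover have "A \<in> sigma_sets UNIV (range (%(a, b). box a b))" using A by (simp add: borel_eq_box)
  ultimately show ?thesis
  proof (induction rule: sigma_sets_induct_disjoint)
   case (basic A)
   then obtain a b where A: "A = box a b" by auto
   obtain c d where cd: "box a b \<inter> box (- (real N *\<^sub>R One)) (real N *\<^sub>R One) = box c d"
    by (simp add: box_Int_box)
   have "set_lebesgue_integral lborel A (g N) = LI (%x. f x * indicator (box c d) x)"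
    unfolding set_lebesgue_integral_def cd[symmetric] A
    by (rule Bochner_Integration.integral_cong) (auto simp: g_def indicator_def)
   then show ?case using 0 by simp
  next
   case empty then show ?case by (simp add: set_lebesgue_integral_def)
  next
   case (compl A)
   then have [measurable]: "A \<in> sets borel" by (simp add: borel_eq_box)
   have "LI (g N) = LI (%x. f x * indicator (box (- (real N *\<^sub>R One)) (real N *\<^sub>R One)) x)"
    by (rule Bochner_Integration.integral_cong) (auto simp: g_def indicator_def)
   then have "LI (g N) = 0" using 0 by simp
   moreover have "set_lebesgue_integral lborel (UNIV - A) (g N)
     = LI (%x. g N x - indicator A x *\<^sub>R g N x)"
    unfolding set_lebesgue_integral_def
    by (rule Bochner_Integration.integral_cong) (auto simp: indicator_def)
   moreover have "integrable lborel (%x. indicator A x *\<^sub>R g N x)"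
    by (rule integrable_mult_indicator[OF _ gi]) simp
   ultimately show ?case using compl gi by (simp add: set_lebesgue_integral_def)
  next
   case (union A)
   then have [measurable]: "A i \<in> sets borel" for i by (auto simp: borel_eq_box)
   have "set_lebesgue_integral lborel (\<Union>i. A i) (g N) = (\<Sum>i. set_lebesgue_integral lborel (A i) (g N))"
   proof (rule lebesgue_integral_countable_add)
    show "set_integrable lborel (\<Union> (range A)) (g N)"
     unfolding set_integrable_def by (rule integrable_mult_indicator[OF _ gi]) auto
    show "A i \<inter> A j = {}" if "i ~= j" for i j
     using union that by (auto simp: disjoint_family_on_def)
   qed auto
   then show ?case using union by simp
  qed
 qed
 have "AE x in lborel. g N x = 0" for N
  by (rule sigma_finite_measure.density_zero[OF sigma_finite_lborel gi]) (use zero in \<open>auto simp: set_lebesgue_integral_def\<close>)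
 then have "AE x in lborel. \<forall>N. g N x = 0" by (simp add: AE_all_countable)
 then show ?thesis
 proof eventually_elim
  fix x assume x: "\<forall>N. g N x = 0"
  obtain N where "x \<in> box (- (real N *\<^sub>R One)) (real N *\<^sub>R One)"
   using UN_box_eq_UNIV[where 'a="real^'n"] by blast
  with x show "f x = 0" by (auto simp: g_def indicator_def dest: spec[of _ N])
 qed
qed

lemma test_functions_total:
 assumes "!!ph. C0_infinity ph ==> pair u (abs_L2 ph) = 0"
 shows "u = 0"
proof (rule L2_cases[of u])
 fix f assume f: "sqi f" "u = abs_L2 f"
 have "AE x in lborel. f x = 0"
 proof (intro AE_zero_if_box_integrals_zero integral_box_eq_0 f)
  fix ph :: "real^'a => complex" assume "C0_infinity ph"
  then show "LI (%x. f x * ph x) = 0"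
   using assms[of ph] f by (simp add: pair_abs C0_integrable(2))
 qed
 then show ?thesis using f by (simp add: abs_L2_zero[symmetric] abs_L2_eq_iff)
qed

section \<open>Gaussian integrals\<close>

text \<open>Read off from the characteristic function of the standard normal distribution.\<close>

lemma gauss_integral_1:
 "integrable lborel (%x::real. cor (exp (- (x\<^sup>2) / 2)) * exp (\<i> * cor (t * x)))"
 "LI (%x::real. cor (exp (- (x\<^sup>2) / 2)) * exp (\<i> * cor (t * x)))
  = cor (sqrt (2 * pi) * exp (- (t\<^sup>2) / 2))"
proof -
 have s0: "sqrt (2 * pi) ~= 0" by simp
 have eq: "(%x. cor (exp (- (x\<^sup>2) / 2)) * exp (\<i> * cor (t * x)))
   = (%x. cor (sqrt (2 * pi)) * (std_normal_density x *\<^sub>R iexp (t * x)))"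
  using s0 by (auto simp: fun_eq_iff std_normal_density_def scaleR_conv_of_real)
 have int: "integrable lborel (%x. std_normal_density x *\<^sub>R iexp (t * x))"
 proof (rule Bochner_Integration.integrable_bound)
  show "integrable lborel std_normal_density" by simp
  show "AE x in lborel. norm (std_normal_density x *\<^sub>R iexp (t * x)) <= norm (std_normal_density x)"
   by (simp add: std_normal_density_def)
 qed measurable
 show "integrable lborel (%x::real. cor (exp (- (x\<^sup>2) / 2)) * exp (\<i> * cor (t * x)))"
  unfolding eq by (intro integrable_mult_right int)
 have "char std_normal_distribution t = LI (%x. std_normal_density x *\<^sub>R iexp (t * x))"
  unfolding char_def by (subst integral_density) auto
 then have "LI (%x::real. cor (exp (- (x\<^sup>2) / 2)) * exp (\<i> * cor (t * x)))
  = cor (sqrt (2 * pi)) * char std_normal_distribution t"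
  unfolding eq integral_mult_right_zero by simp
 then show "LI (%x::real. cor (exp (- (x\<^sup>2) / 2)) * exp (\<i> * cor (t * x)))
  = cor (sqrt (2 * pi) * exp (- (t\<^sup>2) / 2))"
  by (simp add: char_std_normal_distribution)
qed

lemma gauss_integral:
 fixes x :: "'a::euclidean_space"
 shows "integrable lborel (%y::'a. cor (exp (- ((norm y)\<^sup>2) / 2)) * exp (\<i> * cor (x \<bullet> y)))"
  "LI (%y::'a. cor (exp (- ((norm y)\<^sup>2) / 2)) * exp (\<i> * cor (x \<bullet> y)))
  = cor (sqrt (2 * pi) ^ DIM('a) * exp (- ((norm x)\<^sup>2) / 2))"
proof -
 interpret product_sigma_finite "%_::'a. lborel :: real measure" by standard
 define G where "G y = cor (exp (- ((norm y)\<^sup>2) / 2)) * exp (\<i> * cor (x \<bullet> y))" for y :: 'a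
 define g where "g b s = cor (exp (- (s\<^sup>2) / 2)) * exp (\<i> * cor ((x \<bullet> b) * s))" for b :: 'a and s
 have Gg: "G y = (\<Prod>b\<in>Basis. g b (y \<bullet> b))" for y
 proof -
  have "(norm y)\<^sup>2 = (\<Sum>b\<in>Basis. (y \<bullet> b)\<^sup>2)"
   unfolding power2_norm_eq_inner by (subst euclidean_inner) (simp add: power2_eq_square)
  then have "exp (- ((norm y)\<^sup>2) / 2) = (\<Prod>b\<in>Basis. exp (- ((y \<bullet> b)\<^sup>2) / 2))"
   by (simp add: exp_sum[symmetric] sum_negf sum_divide_distrib)
  moreover have "exp (\<i> * cor (x \<bullet> y)) = (\<Prod>b\<in>Basis. exp (\<i> * cor ((x \<bullet> b) * (y \<bullet> b))))"
   by (subst euclidean_inner) (simp add: exp_sum[symmetric] sum_distrib_left)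
  ultimately show ?thesis by (simp add: G_def g_def prod.distrib)
 qed
 have [measurable]: "G \<in> bm borel" unfolding G_def by measurable
 have sumB: "(\<Sum>b\<in>Basis. f b *\<^sub>R b) \<bullet> c = f c" if "c \<in> Basis" for f and c :: 'a
  using that by (simp add: inner_sum_left inner_Basis if_distrib cong: if_cong)
 have Gf: "G (\<Sum>b\<in>Basis. f b *\<^sub>R b) = (\<Prod>b\<in>Basis. g b (f b))" for f
  unfolding Gg by (intro prod.cong) (auto simp: sumB)
 have gi: "integrable lborel (g b)" and gI: "LI (g b) = cor (sqrt (2 * pi) * exp (- ((x \<bullet> b)\<^sup>2) / 2))" for b
  unfolding g_def using gauss_integral_1 by blast+
 have "integrable (\<Pi>\<^sub>M b\<in>Basis. lborel) (%f. \<Prod>b\<in>Basis. g b (f b))"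
  by (rule product_integrable_prod) (auto simp: gi)
 then have "integrable (\<Pi>\<^sub>M b\<in>(Basis::'a set). lborel) (%f. G (\<Sum>b\<in>Basis. f b *\<^sub>R b))" by (simp add: Gf)
 then have "integrable lborel G"
  by (subst lborel_eq, subst integrable_distr_eq) (auto simp: measurable_lborel1)
 then show "integrable lborel (%y::'a. cor (exp (- ((norm y)\<^sup>2) / 2)) * exp (\<i> * cor (x \<bullet> y)))"
  by (simp add: G_def[abs_def])
 have "LI G = integral\<^sup>L (\<Pi>\<^sub>M b\<in>Basis. lborel) (%f. \<Prod>b\<in>Basis. g b (f b))"
  by (subst lborel_eq, subst integral_distr) (auto simp: Gf)
 also have "... = (\<Prod>b\<in>Basis. cor (sqrt (2 * pi) * exp (- ((x \<bullet> b)\<^sup>2) / 2)))"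
  by (subst product_integral_prod) (auto simp: gi gI)
 also have "... = cor (sqrt (2 * pi) ^ DIM('a) * exp (- ((norm x)\<^sup>2) / 2))"
 proof -
  have "(norm x)\<^sup>2 = (\<Sum>b\<in>Basis. (x \<bullet> b)\<^sup>2)"
   unfolding power2_norm_eq_inner by (subst euclidean_inner) (simp add: power2_eq_square)
  then have "exp (- ((norm x)\<^sup>2) / 2) = (\<Prod>b\<in>Basis. exp (- ((x \<bullet> b)\<^sup>2) / 2))"
   by (simp add: exp_sum[symmetric] sum_negf sum_divide_distrib)
  then show ?thesis by (simp add: prod.distrib of_real_prod[symmetric] del: of_real_prod)
 qed
 finally show "LI (%y::'a. cor (exp (- ((norm y)\<^sup>2) / 2)) * exp (\<i> * cor (x \<bullet> y)))
  = cor (sqrt (2 * pi) ^ DIM('a) * exp (- ((norm x)\<^sup>2) / 2))"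
  by (simp add: G_def[abs_def])
qed

section \<open>Dilations and the heat kernel\<close>

lemma lborel_scaleR:
 assumes "c > 0"
 shows "lborel = density (distr lborel borel (%x::'a::euclidean_space. c *\<^sub>R x)) (%_. ennreal (c ^ DIM('a)))"
 using lborel_affine[of c "0::'a"] assms by simp

lemma integral_scaleR_arg:
 fixes f :: "'a::euclidean_space => 'b::{banach,second_countable_topology}"
 assumes "c > 0" and [measurable]: "f \<in> bm borel"
 shows "LI f = c ^ DIM('a) *\<^sub>R LI (%x. f (c *\<^sub>R x))"
  "integrable lborel f \<longleftrightarrow> integrable lborel (%x. f (c *\<^sub>R x))"
proof -
 show "LI f = c ^ DIM('a) *\<^sub>R LI (%x. f (c *\<^sub>R x))"
  using assms by (subst lborel_scaleR[OF assms(1)]) (simp add: integral_density integral_distr)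
 have "integrable lborel (%x. a *\<^sub>R g x) \<longleftrightarrow> integrable lborel g" if "a ~= 0" for a and g :: "'a => 'b"
  using integrable_scaleR_right[of a lborel g] integrable_scaleR_right[of "1/a" lborel "%x. a *\<^sub>R g x"] that
  by auto
 then show "integrable lborel f \<longleftrightarrow> integrable lborel (%x. f (c *\<^sub>R x))"
  using assms by (subst lborel_scaleR[OF assms(1)]) (simp add: integrable_density integrable_distr_eq)
qed

lemma nn_integral_scaleR_arg:
 assumes "c > 0" and [measurable]: "g \<in> bm borel"
 shows "integral\<^sup>N lborel g = ennreal (c ^ DIM('a)) * integral\<^sup>N lborel (%x::'a::euclidean_space. g (c *\<^sub>R x))"
 using assms by (subst lborel_scaleR[OF assms(1)]) (simp add: nn_integral_density nn_integral_distr nn_integral_cmult)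

definition gauss :: "real => real^'n => real" where
 "gauss ep xx = exp (- ((norm (ep *\<^sub>R xx))\<^sup>2) / 2)"

text \<open>\<open>(2 \<pi>)^(n/2)\<close>, the norm on L2 of the Fourier transform without
  normalising factor; inversion therefore carries \<open>fconst\<close> squared.\<close>

definition fconst :: "'n::finite itself => real" where
 "fconst _ = sqrt (2 * pi) ^ CARD('n)"

text \<open>The Fourier transform of \<open>gauss ep\<close>: an approximate identity as
  \<open>ep\<close> tends to 0, of total mass \<open>fconst\<close> squared for every
  \<open>ep\<close>.\<close>

definition heat :: "real => real^'n::finite => real" where
 "heat ep x = (fconst TYPE('n) / ep ^ CARD('n)) * exp (- ((norm (x /\<^sub>R ep))\<^sup>2) / 2)"

lemma fconst_pos [simp]: "fconst TYPE('n::finite) > 0" by (simp add: fconst_def)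

lemma gauss_measurable [measurable]: "gauss ep \<in> bm borel"
 unfolding gauss_def[abs_def] by measurable

lemma heat_measurable [measurable]: "heat ep \<in> bm borel"
 unfolding heat_def[abs_def] by measurable

lemma heat_nonneg: "ep > 0 ==> heat ep x \<ge> 0"
 unfolding heat_def by (intro mult_nonneg_nonneg divide_nonneg_nonneg) (auto intro: less_imp_le)

lemma gauss_fourier:
 assumes "ep > 0"
 shows "integrable lborel (%xx::real^'n::finite. cor (gauss ep xx) * exp (\<i> * cor (x \<bullet> xx)))"
  "LI (%xx::real^'n::finite. cor (gauss ep xx) * exp (\<i> * cor (x \<bullet> xx)))
   = cor (heat ep x)"
proof -
 define f where "f y = cor (exp (- ((norm y)\<^sup>2) / 2)) * exp (\<i> * cor ((x /\<^sub>R ep) \<bullet> y))" for y :: "real^'n"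
 have [measurable]: "f \<in> bm borel" unfolding f_def by measurable
 have fe: "f (ep *\<^sub>R xx) = cor (gauss ep xx) * exp (\<i> * cor (x \<bullet> xx))" for xx
 proof -
  have "(x /\<^sub>R ep) \<bullet> (ep *\<^sub>R xx) = x \<bullet> xx" using assms by simp
  then show ?thesis by (simp only: f_def gauss_def)
 qed
 have "integrable lborel f" unfolding f_def by (rule gauss_integral)
 then show "integrable lborel (%xx::real^'n::finite. cor (gauss ep xx) * exp (\<i> * cor (x \<bullet> xx)))"
  using integral_scaleR_arg(2)[OF assms, of f] by (simp add: fe)
 have "cor (fconst TYPE('n) * exp (- ((norm (x /\<^sub>R ep))\<^sup>2) / 2)) = LI f"
  unfolding f_def gauss_integral(2) by (simp add: fconst_def)
 also have "... = ep ^ CARD('n) *\<^sub>R LI (%xx. f (ep *\<^sub>R xx))"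
  using integral_scaleR_arg(1)[OF assms, of f] by simp
 finally show "LI (%xx::real^'n::finite. cor (gauss ep xx) * exp (\<i> * cor (x \<bullet> xx)))
   = cor (heat ep x)"
  using assms by (simp add: fe heat_def scaleR_conv_of_real[where 'a=complex] field_simps)
qed

lemma gauss_bounds: "0 < gauss ep xx" "gauss ep xx <= 1"
 by (auto simp: gauss_def)

lemma gauss_integrable:
 assumes "ep > 0" shows "integrable lborel (gauss ep :: real^'n::finite => real)"
proof -
 have "integrable lborel (%xx::real^'n. Re (cor (gauss ep xx) * exp (\<i> * cor (0 \<bullet> xx))))"
  by (intro integrable_Re gauss_fourier assms)
 then show ?thesis by simp
qed

lemma heat_nn_integral:
 assumes "ep > 0"
 shows "integral\<^sup>N lborel (%x::real^'n::finite. ennreal (heat ep x)) = ennreal ((fconst TYPE('n))\<^sup>2)" (is "?L = _")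
  "integrable lborel (heat ep :: real^'n => real)"
proof -
 have e: "heat ep (ep *\<^sub>R x) = (fconst TYPE('n) / ep ^ CARD('n)) * gauss 1 x" for x :: "real^'n"
  using assms by (simp add: heat_def gauss_def)
 have gi: "integrable lborel (gauss 1 :: real^'n => real)" by (rule gauss_integrable) simp
 have gI: "LI (gauss 1 :: real^'n => real) = fconst TYPE('n)"
 proof -
  have "cor (LI (gauss 1 :: real^'n => real)) = cor (fconst TYPE('n))"
   using gauss_fourier(2)[of 1 "0::real^'n"] by (simp add: heat_def integral_complex_of_real)
  then show ?thesis by simp
 qed
 have "?L = ennreal (ep ^ CARD('n)) * integral\<^sup>N lborel (%x::real^'n. ennreal (heat ep (ep *\<^sub>R x)))"
  by (subst nn_integral_scaleR_arg[OF assms]) auto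
 also have "integral\<^sup>N lborel (%x::real^'n. ennreal (heat ep (ep *\<^sub>R x)))
   = ennreal (LI (%x::real^'n. (fconst TYPE('n) / ep ^ CARD('n)) * gauss 1 x))"
  unfolding e using assms gauss_bounds[of 1]
  by (intro nn_integral_eq_integral integrable_mult_right gi AE_I2 mult_nonneg_nonneg divide_nonneg_nonneg)
    (auto intro: less_imp_le)
 also have "ennreal (ep ^ CARD('n)) * ... = ennreal ((fconst TYPE('n))\<^sup>2)"
  using assms by (simp add: gI ennreal_mult[symmetric] power2_eq_square)
 finally show *: "?L = ennreal ((fconst TYPE('n))\<^sup>2)" .
 show "integrable lborel (heat ep :: real^'n => real)"
  using * heat_nonneg[OF assms] by (intro integrableI_nonneg) auto
qed

section \<open>The Fourier transform of integrable functions\<close>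

text \<open>The parameter \<open>c\<close> is meant to be 1 or -1, so that one definition covers the
  transform and, up to \<open>fconst\<close> squared, its inverse.\<close>

definition fhat :: "real => ('n::finite cfun) => real^'n => complex" where
 "fhat c f xx = LI (%x. exp (\<i> * cor (c * (x \<bullet> xx))) * f x)"

lemma integrable_exp_mult:
 fixes f :: "'n::finite cfun"
 assumes "integrable lborel f"
 shows "integrable lborel (%x. exp (\<i> * cor (c * (x \<bullet> xx))) * f x)"
proof (rule Bochner_Integration.integrable_bound[OF assms])
 have [measurable]: "f \<in> bm borel" using assms by auto
 show "(%x. exp (\<i> * cor (c * (x \<bullet> xx))) * f x) \<in> bm lborel" by measurable
qed (simp add: norm_mult)

lemma fhat_measurable [measurable]:
 assumes "integrable lborel f" shows "fhat c f \<in> bm borel"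
proof -
 have [measurable]: "f \<in> bm borel" using assms by auto
 show ?thesis unfolding fhat_def[abs_def] by measurable
qed

lemma fhat_bound: "cmod (fhat c f xx) <= LI (%x. cmod (f x))"
proof -
 have "cmod (fhat c f xx) <= LI (%x. cmod (exp (\<i> * cor (c * (x \<bullet> xx))) * f x))"
  unfolding fhat_def by (rule integral_norm_bound)
 then show ?thesis by (simp add: norm_mult)
qed

lemma fhat_bdd_mult: "integrable lborel f ==> bdd_mult (fhat c f)"
 by (rule bdd_multI[OF _ fhat_bound]) simp

lemma fhat_add: "integrable lborel f ==> integrable lborel g ==> fhat c (%x. f x + g x) xx = fhat c f xx + fhat c g xx"
 unfolding fhat_def distrib_left
 by (intro Bochner_Integration.integral_add integrable_exp_mult)

lemma fhat_diff: "integrable lborel f ==> integrable lborel g ==> fhat c (%x. f x - g x) xx = fhat c f xx - fhat c g xx"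
 unfolding fhat_def right_diff_distrib
 by (intro Bochner_Integration.integral_diff integrable_exp_mult)

lemma fhat_mult: "fhat c (%x. a * f x) xx = a * fhat c f xx"
proof -
 have "(%x. exp (\<i> * cor (c * (x \<bullet> xx))) * (a * f x)) = (%x. a * (exp (\<i> * cor (c * (x \<bullet> xx))) * f x))"
  by (simp add: mult_ac)
 then show ?thesis unfolding fhat_def by (simp only: integral_mult_right_zero)
qed

lemma fhat_cnj: "fhat c (%x. cnj (f x)) xx = cnj (fhat (- c) f xx)"
proof -
 have "(%x. exp (\<i> * cor (c * (x \<bullet> xx))) * cnj (f x))
   = (%x. cnj (exp (\<i> * cor (- c * (x \<bullet> xx))) * f x))"
  by (simp add: exp_cnj)
 then show ?thesis unfolding fhat_def by (simp only: Bochner_Integration.integral_cnj)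
qed

lemma fhat_cong_AE:
 assumes "integrable lborel f" "integrable lborel g" "AE x in lborel. f x = g x"
 shows "fhat c f = fhat c g"
proof
 fix xx
 show "fhat c f xx = fhat c g xx"
  unfolding fhat_def
 proof (rule integral_cong_AE)
  show "AE x in lborel. exp (\<i> * cor (c * (x \<bullet> xx))) * f x = exp (\<i> * cor (c * (x \<bullet> xx))) * g x"
   using assms(3) by eventually_elim simp
 qed (use integrable_exp_mult assms in auto)
qed

lemma integrable_pair_product:
 fixes f g :: "'n::finite cfun"
 assumes f: "integrable lborel f" and g: "integrable lborel g"
  and [measurable]: "(%(x, y). k x y) \<in> bm (lborel \<Otimes>\<^sub>M lborel)"
  and k: "!!x y. cmod (k x y) <= cmod (f x) * cmod (g y)"
 shows "integrable (lborel \<Otimes>\<^sub>M lborel) (%(x, y). k x y)"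
proof (rule lborel_pair.Fubini_integrable)
 have [measurable]: "f \<in> bm borel" "g \<in> bm borel" using f g by auto
 have bi: "integrable lborel (%y. k x y)" for x
 proof (rule Bochner_Integration.integrable_bound)
  show "integrable lborel (%y. cmod (f x) * cmod (g y))" by (intro integrable_mult_right integrable_norm g)
  show "AE y in lborel. norm (k x y) <= norm (cmod (f x) * cmod (g y))" using k by simp
 qed measurable
 then show "AE x in lborel. integrable lborel (%y. case (x, y) of (x, y) => k x y)" by simp
 show "integrable lborel (%x. \<integral>y. norm (case (x, y) of (x, y) => k x y) \<partial>lborel)"
 proof (rule Bochner_Integration.integrable_bound)
  show "integrable lborel (%x. cmod (f x) * (\<integral>y. cmod (g y) \<partial>lborel))"
   by (intro integrable_mult_left integrable_norm f)
  show "AE x in lborel. norm (\<integral>y. norm (case (x, y) of (x, y) => k x y) \<partial>lborel) <= norm (cmod (f x) * (\<integral>y. cmod (g y) \<partial>lborel))"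
  proof (rule AE_I2)
   fix x
   have "(\<integral>y. norm (k x y) \<partial>lborel) <= (\<integral>y. cmod (f x) * cmod (g y) \<partial>lborel)"
    by (rule integral_mono) (use bi k g in auto)
   then show "norm (\<integral>y. norm (case (x, y) of (x, y) => k x y) \<partial>lborel) <= norm (cmod (f x) * (\<integral>y. cmod (g y) \<partial>lborel))"
    by (simp add: integral_nonneg_AE)
  qed
 qed measurable
qed (use assms in simp)

lemma fhat_multiplication_formula:
 assumes f: "integrable lborel f" and g: "integrable lborel g"
 shows "LI (%x. fhat c f x * g x) = LI (%x. f x * fhat c g x)"
proof -
 have [measurable]: "f \<in> bm borel" "g \<in> bm borel" using f g by auto
 define k where "k x y = exp (\<i> * cor (c * (x \<bullet> y))) * f x * g y" for x y
 have "LI (%y. fhat c f y * g y) = (\<integral>y. (\<integral>x. k x y \<partial>lborel) \<partial>lborel)"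
  by (simp add: k_def fhat_def)
 also have "... = (\<integral>x. (\<integral>y. k x y \<partial>lborel) \<partial>lborel)"
 proof (rule lborel_pair.Fubini_integral)
  show "integrable (lborel \<Otimes>\<^sub>M lborel) (%(x, y). k x y)"
   by (rule integrable_pair_product[OF f g]) (auto simp: k_def norm_mult)
 qed
 also have "... = LI (%x. f x * fhat c g x)"
 proof (rule Bochner_Integration.integral_cong)
  fix x
  have "(%y. k x y) = (%y. f x * (exp (\<i> * cor (c * (y \<bullet> x))) * g y))"
   by (auto simp: k_def inner_commute mult_ac)
  then show "(\<integral>y. k x y \<partial>lborel) = f x * fhat c g x"
   by (simp only: fhat_def integral_mult_right_zero)
 qed simp
 finally show ?thesis .
qed

lemma fhat_gauss_mod:
 assumes c: "\<bar>c\<bar> = 1" and e: "ep > 0"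
 shows "fhat (- c) (%xx. cor (gauss ep xx) * exp (\<i> * cor (c * (x \<bullet> xx)))) y = cor (heat ep (x - y))"
proof -
 have "fhat (- c) (%xx. cor (gauss ep xx) * exp (\<i> * cor (c * (x \<bullet> xx)))) y
   = LI (%xx. cor (gauss ep xx) * exp (\<i> * cor ((c *\<^sub>R (x - y)) \<bullet> xx)))"
  unfolding fhat_def
  by (rule Bochner_Integration.integral_cong)
    (auto simp: exp_add[symmetric] exp_diff inner_diff_left inner_commute exp_minus algebra_simps divide_inverse)
 also have "... = cor (heat ep (c *\<^sub>R (x - y)))" by (rule gauss_fourier(2)[OF e])
 also have "... = cor (heat ep (x - y))" using c by (simp add: heat_def abs_mult)
 finally show ?thesis .
qed

lemma integrable_gauss_mult:
 assumes "ep > 0" "bdd_mult h"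
 shows "integrable lborel (%xx. cor (gauss ep xx) * h xx)"
proof -
 obtain B where B: "!!x. cmod (h x) <= B" using assms(2) bdd_multE by metis
 have [measurable]: "h \<in> bm borel" using assms(2) bdd_mult_borel by blast
 show ?thesis
 proof (rule Bochner_Integration.integrable_bound)
  show "integrable lborel (%xx::real^'a. gauss ep xx * B)" by (intro integrable_mult_left gauss_integrable assms)
  have "gauss ep x * cmod (h x) <= \<bar>gauss ep x * B\<bar>" for x
   using gauss_bounds(1)[of ep x] B[of x] by (intro order_trans[OF _ abs_ge_self] mult_left_mono) auto
  then show "AE x in lborel. norm (cor (gauss ep x) * h x) <= norm (gauss ep x * B)"
   unfolding norm_mult norm_of_real abs_of_pos[OF gauss_bounds(1)] real_norm_def
    real_norm_def[of "gauss _ _ * B"] by (intro AE_I2)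
 qed measurable
qed

text \<open>The Gaussian restores the integrability that \<open>fhat\<close> lacks, so the
  multiplication formula applies twice; the damped pairing of two transforms becomes an average with
  the heat kernel.\<close>

lemma fhat_gauss_fhat:
 assumes c: "\<bar>c\<bar> = 1" and e: "ep > 0" and f: "integrable lborel f" and g: "integrable lborel g"
 shows "LI (%xx. fhat c f xx * (cor (gauss ep xx) * fhat (- c) g xx))
  = LI (%x. f x * LI (%y. cor (heat ep (x - y)) * g y))"
proof -
 have "LI (%xx. fhat c f xx * (cor (gauss ep xx) * fhat (- c) g xx))
   = LI (%x. f x * fhat c (%xx. cor (gauss ep xx) * fhat (- c) g xx) x)"
  by (intro fhat_multiplication_formula f integrable_gauss_mult e fhat_bdd_mult g)
 also have "... = LI (%x. f x * LI (%y. cor (heat ep (x - y)) * g y))"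
 proof (rule Bochner_Integration.integral_cong)
  fix x
  have "fhat c (%xx. cor (gauss ep xx) * fhat (- c) g xx) x
    = LI (%xx. fhat (- c) g xx * (cor (gauss ep xx) * exp (\<i> * cor (c * (x \<bullet> xx)))))"
   unfolding fhat_def[of c] by (rule Bochner_Integration.integral_cong) (auto simp: inner_commute mult_ac)
  also have "... = LI (%y. g y * fhat (- c) (%xx. cor (gauss ep xx) * exp (\<i> * cor (c * (x \<bullet> xx)))) y)"
   by (intro fhat_multiplication_formula g integrable_gauss_mult e bdd_multI[of _ 1]) auto
  also have "... = LI (%y. g y * cor (heat ep (x - y)))"
   by (simp only: fhat_gauss_mod[OF c e])
  finally show "f x * fhat c (%xx. cor (gauss ep xx) * fhat (- c) g xx) x
    = f x * LI (%y. cor (heat ep (x - y)) * g y)"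
   by (simp add: mult.commute)
 qed simp
 finally show ?thesis .
qed

lemma heat_translate:
 fixes x y :: "real^'n::finite"
 assumes "ep > 0"
 shows "(\<integral>\<^sup>+x. ennreal (heat ep (x - y)) \<partial>lborel) = ennreal ((fconst TYPE('n))\<^sup>2)"
  "(\<integral>\<^sup>+y. ennreal (heat ep (x - y)) \<partial>lborel) = ennreal ((fconst TYPE('n))\<^sup>2)"
proof -
 have 1: "(\<integral>\<^sup>+x. ennreal (heat ep (x - y)) \<partial>lborel) = ennreal ((fconst TYPE('n))\<^sup>2)" for y :: "real^'n"
 proof -
  have "(\<integral>\<^sup>+(x::real^'n). ennreal (heat ep x) \<partial>lborel) = (\<integral>\<^sup>+x. ennreal (heat ep (- y + x)) \<partial>lborel)"
  proof -
   have "(\<integral>\<^sup>+(x::real^'n). ennreal (heat ep x) \<partial>lborel) = (\<integral>\<^sup>+(x::real^'n). ennreal (heat ep x) \<partial>(distr lborel borel ((+) (- y))))"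
    by (simp only: lborel_distr_plus)
   also have "... = (\<integral>\<^sup>+x. ennreal (heat ep (- y + x)) \<partial>lborel)" by (subst nn_integral_distr) auto
   finally show ?thesis .
  qed
  then show ?thesis using heat_nn_integral(1)[OF assms, where 'n='n] by simp
 qed
 show "(\<integral>\<^sup>+x. ennreal (heat ep (x - y)) \<partial>lborel) = ennreal ((fconst TYPE('n))\<^sup>2)" by (rule 1)
 have "heat ep (x - y) = heat ep (y - x)" for x y :: "real^'n"
  unfolding heat_def by (metis norm_minus_commute scaleR_diff_right)
 then show "(\<integral>\<^sup>+y. ennreal (heat ep (x - y)) \<partial>lborel) = ennreal ((fconst TYPE('n))\<^sup>2)"
  using 1[of x] by simp
qed

lemma norm_integral_le_nn_integral:
 fixes f :: "'a => 'b::{banach,second_countable_topology}"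
 shows "ennreal (norm (integral\<^sup>L M f)) <= (\<integral>\<^sup>+x. ennreal (norm (f x)) \<partial>M)"
 by (cases "integrable M f") (auto intro: integral_norm_bound_ennreal simp: not_integrable_integral_eq)

text \<open>A Schur test. By \<open>fhat_gauss_fhat\<close> the left side is a double integral of
  \<open>f x * cnj (f y)\<close> against the heat kernel; the product of the moduli is at most half
  the sum of their squares, and each marginal of the kernel has mass \<open>fconst\<close>
  squared.\<close>

lemma Bessel_gauss:
 fixes f :: "'n::finite cfun"
 assumes c: "\<bar>c\<bar> = 1" and e: "ep > 0" and f: "integrable lborel f" and f2: "sqi f"
 shows "(\<integral>\<^sup>+xx. ennreal (gauss ep xx * (cmod (fhat c f xx))\<^sup>2) \<partial>lborel) <= ennreal ((fconst TYPE('n) * norm (abs_L2 f))\<^sup>2)"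
proof -
 have [measurable]: "f \<in> bm borel" using f by auto
 let ?K = "ennreal ((fconst TYPE('n))\<^sup>2)"
 define G where "G xx = gauss ep xx * (cmod (fhat c f xx))\<^sup>2" for xx
 have fc: "integrable lborel (%x. cnj (f x))" using f by simp
 have Gc: "cor (G xx) = fhat c f xx * (cor (gauss ep xx) * fhat (- c) (%x. cnj (f x)) xx)" for xx
  using complex_norm_square[of "fhat c f xx"] by (simp add: G_def fhat_cnj mult_ac)
 have Gi: "integrable lborel G"
 proof -
  have "integrable lborel (%xx. Re (cor (gauss ep xx) * (fhat c f xx * fhat (- c) (%x. cnj (f x)) xx)))"
   by (intro integrable_Re integrable_gauss_mult e bdd_mult_mult fhat_bdd_mult f fc)
  moreover have "cor (gauss ep xx) * (fhat c f xx * fhat (- c) (%x. cnj (f x)) xx) = cor (G xx)" for xx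
   unfolding Gc by (simp add: mult_ac)
  ultimately show ?thesis by simp
 qed
 have G0: "0 <= G xx" for xx using gauss_bounds(1)[of ep xx] by (simp add: G_def)
 have "(\<integral>\<^sup>+xx. ennreal (G xx) \<partial>lborel) = ennreal (LI G)"
  by (rule nn_integral_eq_integral[OF Gi]) (simp add: G0)
 also have "LI G = cmod (cor (LI G))"
  by (simp add: integral_nonneg_AE G0)
 also have "cor (LI G) = LI (%xx. cor (G xx))"
  by (simp add: integral_complex_of_real)
 also have "... = LI (%x. f x * LI (%y. cor (heat ep (x - y)) * cnj (f y)))"
  unfolding Gc by (rule fhat_gauss_fhat[OF c e f fc])
 also have "ennreal (cmod ...) <= (\<integral>\<^sup>+x. ennreal (cmod (f x * LI (%y. cor (heat ep (x - y)) * cnj (f y)))) \<partial>lborel)"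
  by (rule norm_integral_le_nn_integral)
 also have "... <= (\<integral>\<^sup>+x. \<integral>\<^sup>+y. ennreal (cmod (f x)) * ennreal (heat ep (x - y) * cmod (f y)) \<partial>lborel \<partial>lborel)"
 proof (rule nn_integral_mono)
  fix x
  have "ennreal (cmod (f x * LI (%y. cor (heat ep (x - y)) * cnj (f y))))
    <= ennreal (cmod (f x)) * (\<integral>\<^sup>+y. ennreal (cmod (cor (heat ep (x - y)) * cnj (f y))) \<partial>lborel)"
  proof -
   have "ennreal (cmod (f x * b)) = ennreal (cmod (f x)) * ennreal (cmod b)" for b
    by (simp add: norm_mult ennreal_mult)
   then show ?thesis by (simp only:) (intro mult_left_mono norm_integral_le_nn_integral, simp)
  qed
  also have "... = (\<integral>\<^sup>+y. ennreal (cmod (f x)) * ennreal (heat ep (x - y) * cmod (f y)) \<partial>lborel)"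
   by (subst nn_integral_cmult[symmetric]) (auto simp: norm_mult heat_nonneg[OF e])
  finally show "ennreal (cmod (f x * LI (%y. cor (heat ep (x - y)) * cnj (f y))))
    <= (\<integral>\<^sup>+y. ennreal (cmod (f x)) * ennreal (heat ep (x - y) * cmod (f y)) \<partial>lborel)" .
 qed
 also have "... <= (\<integral>\<^sup>+x. \<integral>\<^sup>+y. ennreal ((cmod (f x))\<^sup>2 / 2) * ennreal (heat ep (x - y)) + ennreal ((cmod (f y))\<^sup>2 / 2) * ennreal (heat ep (x - y)) \<partial>lborel \<partial>lborel)"
 proof (intro nn_integral_mono)
  fix x y
  have "cmod (f x) * (heat ep (x - y) * cmod (f y)) <= (cmod (f x))\<^sup>2 / 2 * heat ep (x - y) + (cmod (f y))\<^sup>2 / 2 * heat ep (x - y)"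
  proof -
   have "cmod (f x) * cmod (f y) * heat ep (x - y) <= (((cmod (f x))\<^sup>2 + (cmod (f y))\<^sup>2) / 2) * heat ep (x - y)"
    using sum_squares_bound[of "cmod (f x)" "cmod (f y)"] heat_nonneg[OF e, of "x - y"] by (intro mult_right_mono) auto
   then show ?thesis by (simp add: field_simps)
  qed
  then show "ennreal (cmod (f x)) * ennreal (heat ep (x - y) * cmod (f y))
    <= ennreal ((cmod (f x))\<^sup>2 / 2) * ennreal (heat ep (x - y)) + ennreal ((cmod (f y))\<^sup>2 / 2) * ennreal (heat ep (x - y))"
   using heat_nonneg[OF e, of "x - y"]
   by (simp add: ennreal_mult[symmetric] ennreal_plus[symmetric] ennreal_leI del: ennreal_plus)
 qed
 also have "... = (\<integral>\<^sup>+x. \<integral>\<^sup>+y. ennreal ((cmod (f x))\<^sup>2 / 2) * ennreal (heat ep (x - y)) \<partial>lborel \<partial>lborel)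
   + (\<integral>\<^sup>+x. \<integral>\<^sup>+y. ennreal ((cmod (f y))\<^sup>2 / 2) * ennreal (heat ep (x - y)) \<partial>lborel \<partial>lborel)"
  by (simp add: nn_integral_add)
 also have "(\<integral>\<^sup>+x. \<integral>\<^sup>+y. ennreal ((cmod (f y))\<^sup>2 / 2) * ennreal (heat ep (x - y)) \<partial>lborel \<partial>lborel)
   = (\<integral>\<^sup>+y. \<integral>\<^sup>+x. ennreal ((cmod (f y))\<^sup>2 / 2) * ennreal (heat ep (x - y)) \<partial>lborel \<partial>lborel)"
  by (rule lborel_pair.Fubini') measurable
 also have "(\<integral>\<^sup>+x. \<integral>\<^sup>+y. ennreal ((cmod (f x))\<^sup>2 / 2) * ennreal (heat ep (x - y)) \<partial>lborel \<partial>lborel) + ...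
   = (\<integral>\<^sup>+x. ennreal ((cmod (f x))\<^sup>2 / 2) * ?K \<partial>lborel) + (\<integral>\<^sup>+x. ennreal ((cmod (f x))\<^sup>2 / 2) * ?K \<partial>lborel)"
  by (simp add: nn_integral_cmult heat_translate[OF e])
 also have "... = (\<integral>\<^sup>+x. ennreal ((cmod (f x))\<^sup>2) * ?K \<partial>lborel)"
  by (subst nn_integral_add[symmetric]) (auto intro!: nn_integral_cong simp: distrib_right[symmetric] ennreal_plus[symmetric] simp del: ennreal_plus)
 also have "... = (\<integral>\<^sup>+x. ennreal ((cmod (f x))\<^sup>2) \<partial>lborel) * ?K"
  by (rule nn_integral_multc) measurable
 also have "... = ennreal ((fconst TYPE('n) * norm (abs_L2 f))\<^sup>2)"
  by (simp add: abs_L2_norm_nn[OF f2] ennreal_mult[symmetric] power_mult_distrib mult.commute)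
 finally show ?thesis by (simp add: G_def)
qed

lemma gauss_tendsto_1: "(%m. gauss (1 / real (Suc m)) xx) ----> 1"
proof -
 have "(%m. exp (- ((norm (inverse (real (Suc m)) *\<^sub>R xx))\<^sup>2) / 2)) ----> exp (- ((norm (0 *\<^sub>R xx))\<^sup>2) / 2)"
  by (intro tendsto_intros LIMSEQ_inverse_real_of_nat) auto
 then show ?thesis by (simp add: gauss_def inverse_eq_divide)
qed

text \<open>The damping is removed with Fatou's lemma, so only an inequality comes out.\<close>

lemma Bessel:
 fixes f :: "'n::finite cfun"
 assumes c: "\<bar>c\<bar> = 1" and f: "integrable lborel f" and f2: "sqi f"
 shows "sqi (fhat c f)" "norm (abs_L2 (fhat c f)) <= fconst TYPE('n) * norm (abs_L2 f)"
proof -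
 have [measurable]: "fhat c f \<in> bm borel" using f by simp
 have "(\<integral>\<^sup>+xx. ennreal ((cmod (fhat c f xx))\<^sup>2) \<partial>lborel)
   = (\<integral>\<^sup>+xx. liminf (%m. ennreal (gauss (1 / real (Suc m)) xx * (cmod (fhat c f xx))\<^sup>2)) \<partial>lborel)"
 proof (rule nn_integral_cong)
  fix xx
  have "(%m. ennreal (gauss (1 / real (Suc m)) xx * (cmod (fhat c f xx))\<^sup>2)) ----> ennreal (1 * (cmod (fhat c f xx))\<^sup>2)"
   by (intro tendsto_ennrealI tendsto_mult tendsto_const gauss_tendsto_1)
  then show "ennreal ((cmod (fhat c f xx))\<^sup>2) = liminf (%m. ennreal (gauss (1 / real (Suc m)) xx * (cmod (fhat c f xx))\<^sup>2))"
   using lim_imp_Liminf[OF sequentially_bot] by fastforce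
 qed
 also have "... <= liminf (%m. \<integral>\<^sup>+xx. ennreal (gauss (1 / real (Suc m)) xx * (cmod (fhat c f xx))\<^sup>2) \<partial>lborel)"
  by (rule nn_integral_liminf) measurable
 also have "... <= liminf (%m. ennreal ((fconst TYPE('n) * norm (abs_L2 f))\<^sup>2))"
  by (intro Liminf_mono always_eventually allI Bessel_gauss[OF c _ f f2]) simp
 also have "... = ennreal ((fconst TYPE('n) * norm (abs_L2 f))\<^sup>2)" by (simp add: Liminf_const)
 finally show "sqi (fhat c f)" "norm (abs_L2 (fhat c f)) <= fconst TYPE('n) * norm (abs_L2 f)"
  by (auto intro!: square_integrable_norm_leI mult_nonneg_nonneg simp: less_imp_le)
qed

lemma heat_convolution_limit:
 fixes ph :: "'n::finite cfun"
 assumes cont: "continuous_on UNIV ph" and B: "!!x. cmod (ph x) <= B"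
 defines "h \<equiv> %m x. LI (%y. cor (heat (1 / real (Suc m)) (x - y)) * ph y)"
 shows "(%m. h m x) ----> cor ((fconst TYPE('n))\<^sup>2) * ph x"
  "cmod (h m x) <= (fconst TYPE('n))\<^sup>2 * B"
proof -
 have [measurable]: "ph \<in> bm borel" using cont by (rule borel_measurable_continuous_onI)
 \<comment> \<open>The substitution \<open>y = x + ep u\<close> moves the dependence on
   \<open>m\<close> from the kernel into the argument of \<open>ph\<close>, so that one fixed
   Gaussian dominates.\<close>
 have heq: "h m x = LI (%u. cor (fconst TYPE('n) * gauss 1 u) * ph (x + (1 / real (Suc m)) *\<^sub>R u))" for m x
 proof -
  define ep where "ep = 1 / real (Suc m)"
  have e: "ep > 0" by (simp add: ep_def)
  have sym: "heat ep (x - (y + x)) = heat ep y" for y by (simp add: heat_def)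
  have "h m x = LI (%y. cor (heat ep (x - (y + x))) * ph (y + x))"
   unfolding h_def ep_def[symmetric]
   using integral_translation[of "%y. cor (heat ep (x - y)) * ph y" x] by simp
  also have "... = LI (%y. cor (heat ep y) * ph (y + x))" by (simp only: sym)
  also have "... = ep ^ CARD('n) *\<^sub>R LI (%u. cor (heat ep (ep *\<^sub>R u)) * ph (ep *\<^sub>R u + x))"
   by (subst integral_scaleR_arg(1)[OF e]) auto
  also have "... = LI (%u. ep ^ CARD('n) *\<^sub>R (cor (heat ep (ep *\<^sub>R u)) * ph (ep *\<^sub>R u + x)))"
   by (rule integral_scaleR_right[symmetric])
  also have "... = LI (%u. cor (fconst TYPE('n) * gauss 1 u) * ph (x + ep *\<^sub>R u))"
   using e by (intro Bochner_Integration.integral_cong)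
    (auto simp: heat_def gauss_def scaleR_conv_of_real[where 'a=complex] add.commute)
  finally show ?thesis by (simp add: ep_def)
 qed
 have gi: "integrable lborel (%u::real^'n. fconst TYPE('n) * gauss 1 u)"
  by (intro integrable_mult_right gauss_integrable) simp
 have gI: "LI (%u::real^'n. fconst TYPE('n) * gauss 1 u) = (fconst TYPE('n))\<^sup>2"
 proof -
  have "cor (LI (gauss 1 :: real^'n => real)) = cor (fconst TYPE('n))"
   using gauss_fourier(2)[of 1 "0::real^'n"] by (simp add: heat_def integral_complex_of_real)
  then show ?thesis by (simp add: power2_eq_square)
 qed
 have g0: "fconst TYPE('n) * gauss 1 u \<ge> 0" for u :: "real^'n"
  using gauss_bounds(1)[of 1 u] by (intro mult_nonneg_nonneg) (auto intro: less_imp_le)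
 have B0: "0 <= B" using B norm_ge_zero order_trans by blast
 have bd: "cmod (cor (fconst TYPE('n) * gauss 1 u) * ph y) <= fconst TYPE('n) * gauss 1 u * B" for u :: "real^'n" and y
  unfolding norm_mult[of _ "ph y"] norm_of_real abs_of_nonneg[OF g0] by (intro mult_left_mono B g0)
 have "(%m. LI (%u. cor (fconst TYPE('n) * gauss 1 u) * ph (x + (1 / real (Suc m)) *\<^sub>R u)))
   ----> LI (%u::real^'n. cor (fconst TYPE('n) * gauss 1 u) * ph x)"
 proof (rule integral_dominated_convergence[where w="%u. fconst TYPE('n) * gauss 1 u * B"])
  show "integrable lborel (%u::real^'n. fconst TYPE('n) * gauss 1 u * B)" by (intro integrable_mult_left gi)
  show "AE u in lborel. (%m. cor (fconst TYPE('n) * gauss 1 u) * ph (x + (1 / real (Suc m)) *\<^sub>R u))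
    ----> cor (fconst TYPE('n) * gauss 1 u) * ph x"
  proof (rule AE_I2)
   fix u :: "real^'n"
   have "isCont ph x" using cont by (simp add: continuous_on_eq_continuous_at)
   moreover have "(%m. x + inverse (real (Suc m)) *\<^sub>R u) ----> x + 0 *\<^sub>R u"
    by (intro tendsto_intros LIMSEQ_inverse_real_of_nat)
   ultimately have "(%m. ph (x + inverse (real (Suc m)) *\<^sub>R u)) ----> ph x"
    using isCont_tendsto_compose by fastforce
   then show "(%m. cor (fconst TYPE('n) * gauss 1 u) * ph (x + (1 / real (Suc m)) *\<^sub>R u))
    ----> cor (fconst TYPE('n) * gauss 1 u) * ph x"
    unfolding inverse_eq_divide by (intro tendsto_mult tendsto_const)
  qed
 qed (use bd in auto)
 then show "(%m. h m x) ----> cor ((fconst TYPE('n))\<^sup>2) * ph x"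
  unfolding heq using gI integral_complex_of_real[of lborel "%u::real^'n. fconst TYPE('n) * gauss 1 u"]
  by (simp del: of_real_mult of_real_power)
 have "cmod (h m x) <= LI (%u::real^'n. fconst TYPE('n) * gauss 1 u * B)"
  unfolding heq
 proof (rule order_trans[OF integral_norm_bound integral_mono])
  show *: "integrable lborel (%u::real^'n. fconst TYPE('n) * gauss 1 u * B)" by (intro integrable_mult_left gi)
  have "integrable lborel (%u::real^'n. cor (fconst TYPE('n) * gauss 1 u) * ph (x + (1 / real (Suc m)) *\<^sub>R u))"
   by (rule Bochner_Integration.integrable_bound[OF *]) (use bd in \<open>auto intro!: order_trans[OF bd] abs_ge_self simp del: of_real_mult\<close>)
  then show "integrable lborel (%u::real^'n. cmod (cor (fconst TYPE('n) * gauss 1 u) * ph (x + (1 / real (Suc m)) *\<^sub>R u)))"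
   by (rule integrable_norm)
 qed (rule bd)
 also have "... = (fconst TYPE('n))\<^sup>2 * B" using gI by simp
 finally show "cmod (h m x) <= (fconst TYPE('n))\<^sup>2 * B" .
qed

text \<open>The second function is a test function because the limit of its heat averages is taken
  pointwise, by continuity, and dominated by its sup norm. The restriction is harmless for
  inversion, since test functions are total.\<close>

lemma Parseval_test:
 fixes f ph :: "'n::finite cfun"
 assumes c: "\<bar>c\<bar> = 1" and f: "integrable lborel f" and f2: "sqi f" and phi: "C0_infinity ph"
 shows "pair (abs_L2 (fhat c f)) (abs_L2 (fhat (- c) ph)) = cor ((fconst TYPE('n))\<^sup>2) * pair (abs_L2 f) (abs_L2 ph)"
proof -
 note p = C0_integrable[OF phi]
 obtain B where B: "!!x. cmod (ph x) <= B" using p(3) bdd_multE by metis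
 have cont: "continuous_on UNIV ph" using phi smooth_continuous by (auto simp: C0_infinity_iff)
 have [measurable]: "f \<in> bm borel" "ph \<in> bm borel" "fhat c f \<in> bm borel"
   "fhat (- c) ph \<in> bm borel" using f p(1) by auto
 have s: "sqi (fhat c f)" "sqi (fhat (- c) ph)"
  using Bessel(1)[OF c f f2] Bessel(1)[of "- c", OF _ p(1,2)] c by auto
 define h where "h m x = LI (%y. cor (heat (1 / real (Suc m)) (x - y)) * ph y)" for m x
 have [measurable]: "h m \<in> bm borel" for m unfolding h_def[abs_def] by measurable
 have "(%m. LI (%xx. fhat c f xx * (cor (gauss (1 / real (Suc m)) xx) * fhat (- c) ph xx)))
   ----> LI (%xx. fhat c f xx * (cor 1 * fhat (- c) ph xx))"
 proof (rule integral_dominated_convergence[where w="%xx. cmod (fhat c f xx * fhat (- c) ph xx)"])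
  show "integrable lborel (%xx. cmod (fhat c f xx * fhat (- c) ph xx))"
   by (intro integrable_norm integrable_mult_sqi s)
  show "AE x in lborel. (%m. fhat c f x * (cor (gauss (1 / real (Suc m)) x) * fhat (- c) ph x))
    ----> fhat c f x * (cor 1 * fhat (- c) ph x)"
   by (intro AE_I2 tendsto_intros gauss_tendsto_1)
  show "AE x in lborel. norm (fhat c f x * (cor (gauss (1 / real (Suc m)) x) * fhat (- c) ph x))
    <= cmod (fhat c f x * fhat (- c) ph x)" for m
  proof (rule AE_I2)
   fix x :: "real^'n"
   have "\<bar>gauss (1 / real (Suc m)) x\<bar> <= 1" using gauss_bounds[of "1 / real (Suc m)" x] by linarith
   then show "norm (fhat c f x * (cor (gauss (1 / real (Suc m)) x) * fhat (- c) ph x))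
    <= cmod (fhat c f x * fhat (- c) ph x)"
    by (simp add: norm_mult mult_left_mono mult_left_le_one_le)
  qed
 qed measurable
 moreover have "LI (%xx. fhat c f xx * (cor (gauss (1 / real (Suc m)) xx) * fhat (- c) ph xx))
   = LI (%x. f x * h m x)" for m
  unfolding h_def by (rule fhat_gauss_fhat[OF c _ f p(1)]) simp
 moreover have "(%m. LI (%x. f x * h m x))
   ----> LI (%x. f x * (cor ((fconst TYPE('n))\<^sup>2) * ph x))"
 proof (rule integral_dominated_convergence[where w="%x. cmod (f x) * ((fconst TYPE('n))\<^sup>2 * B)"])
  show "integrable lborel (%x. cmod (f x) * ((fconst TYPE('n))\<^sup>2 * B))"
   by (intro integrable_mult_left integrable_norm f)
  show "AE x in lborel. (%m. f x * h m x) ----> f x * (cor ((fconst TYPE('n))\<^sup>2) * ph x)"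
   unfolding h_def by (intro AE_I2 tendsto_mult tendsto_const heat_convolution_limit(1)[OF cont B])
  show "AE x in lborel. norm (f x * h m x) <= cmod (f x) * ((fconst TYPE('n))\<^sup>2 * B)" for m
   unfolding norm_mult h_def by (intro AE_I2 mult_left_mono heat_convolution_limit(2)[OF cont B]) auto
 qed measurable
 ultimately have "LI (%xx. fhat c f xx * (cor 1 * fhat (- c) ph xx))
   = LI (%x. f x * (cor ((fconst TYPE('n))\<^sup>2) * ph x))"
  using LIMSEQ_unique by auto
 moreover have "(%x. f x * (cor ((fconst TYPE('n))\<^sup>2) * ph x)) = (%x. cor ((fconst TYPE('n))\<^sup>2) * (f x * ph x))"
  by (simp add: mult_ac)
 ultimately show ?thesis
  using f2 p s by (simp add: pair_abs)
qed

section \<open>The Fourier transform on L2\<close>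

lemma fconst_nonzero [simp]: "fconst TYPE('n::finite) ~= 0"
 using fconst_pos[where 'n='n] by linarith

definition L12 :: "('n::finite cfun) => bool" where
 "L12 f \<longleftrightarrow> integrable lborel f & sqi f"

definition trunc :: "nat => ('n::finite cfun) => real^'n => complex" where
 "trunc m f x = indicator (cball 0 (real m)) x * f x"

lemma bdd_mult_indicator: "A \<in> sets borel ==> bdd_mult (indicator A)"
 by (rule bdd_multI[of _ 1]) (auto simp: indicator_def)

lemma integrable_indicator_cball_mult:
 fixes f :: "'n::finite cfun"
 assumes "sqi f" shows "integrable lborel (%x. indicator (cball 0 R) x * f x)"
proof -
 have "sqi (indicator (cball 0 R) :: real^'n => complex)"
  by (rule square_integrable_indicator)
    (use emeasure_lborel_cball_finite[of "0::real^'n" R] in \<open>auto simp: less_top\<close>)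
 from integrable_mult_sqi[OF this assms] show ?thesis .
qed

lemma trunc_L12: "sqi f ==> L12 (trunc m f)"
 unfolding L12_def trunc_def[abs_def]
 by (intro conjI integrable_indicator_cball_mult sqi_bdd_mult bdd_mult_indicator) auto

lemma trunc_tendsto:
 assumes "sqi f" shows "(%m. abs_L2 (trunc m f)) ----> abs_L2 f"
proof -
 have [measurable]: "f \<in> bm borel" using assms by (simp add: square_integrable_def)
 have st: "sqi (trunc m f)" for m using trunc_L12[OF assms] by (simp add: L12_def)
 then have [measurable]: "trunc m f \<in> bm borel" for m by (simp add: square_integrable_def)
 have "(%m. LI (%x. (cmod (trunc m f x - f x))\<^sup>2)) ----> LI (%x::real^'a. 0)"
 proof (rule integral_dominated_convergence[where w="%x. (cmod (f x))\<^sup>2"])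
  show "integrable lborel (%x. (cmod (f x))\<^sup>2)" using assms by (simp add: square_integrable_def)
  show "AE x in lborel. (%m. (cmod (trunc m f x - f x))\<^sup>2) ----> 0"
  proof (rule AE_I2)
   fix x :: "real^'a"
   obtain M where M: "norm x <= real M" using real_arch_simple by blast
   have "\<forall>\<^sub>F m in sequentially. (cmod (trunc m f x - f x))\<^sup>2 = 0"
    using eventually_ge_at_top[of M]
    by eventually_elim (use M in \<open>auto simp: trunc_def indicator_def\<close>)
   then show "(%m. (cmod (trunc m f x - f x))\<^sup>2) ----> 0" by (rule tendsto_eventually)
  qed
  show "AE x in lborel. norm ((cmod (trunc m f x - f x))\<^sup>2) <= (cmod (f x))\<^sup>2" for m
   by (auto simp: trunc_def indicator_def)
 qed measurable
 then have "(%m. (norm (abs_L2 (trunc m f) - abs_L2 f))\<^sup>2) ----> 0"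
  by (simp add: abs_L2_minus st assms abs_L2_norm square_integrable_diff)
 then have "(%m. sqrt ((norm (abs_L2 (trunc m f) - abs_L2 f))\<^sup>2)) ----> sqrt 0"
  by (rule tendsto_real_sqrt)
 then have "(%m. norm (abs_L2 (trunc m f) - abs_L2 f)) ----> 0" by simp
 then show ?thesis by (rule LIM_zero_cancel[OF tendsto_norm_zero_cancel])
qed

lemma eq_on_L12:
 assumes S: "continuous_on UNIV S" and T: "continuous_on UNIV T"
  and eq: "!!f. L12 f ==> S (abs_L2 f) = (T (abs_L2 f) :: 'b::t2_space)"
 shows "S u = T u"
proof (rule L2_cases[of u])
 fix f assume f: "sqi f" "u = abs_L2 f"
 have "(%m. S (abs_L2 (trunc m f))) ----> S u"
  unfolding f(2) by (rule isCont_tendsto_compose[OF _ trunc_tendsto[OF f(1)]])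
   (use S in \<open>simp add: continuous_on_eq_continuous_at\<close>)
 moreover have "(%m. T (abs_L2 (trunc m f))) ----> T u"
  unfolding f(2) by (rule isCont_tendsto_compose[OF _ trunc_tendsto[OF f(1)]])
   (use T in \<open>simp add: continuous_on_eq_continuous_at\<close>)
 ultimately show "S u = T u" using eq[OF trunc_L12[OF f(1)]] LIMSEQ_unique by auto
qed

text \<open>A concrete form of the extension by continuity: transforms of the truncations of a
  chosen representative to balls. The choice does not matter, as \<open>fhat\<close> ignores null
  sets.\<close>

definition Ft_vec :: "real => 'n::finite L2 => 'n L2" where
 "Ft_vec c u = lim (%m. abs_L2 (fhat c (trunc m (rep_L2 u))))"

lemma fhat_L12_dist:
 fixes f g :: "'n::finite cfun"
 assumes c: "\<bar>c\<bar> = 1" and f: "L12 f" and g: "L12 g"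
 shows "sqi (fhat c f)"
  "norm (abs_L2 (fhat c f) - abs_L2 (fhat c g)) <= fconst TYPE('n) * norm (abs_L2 f - abs_L2 g)"
proof -
 have i: "integrable lborel f" "integrable lborel g" and s: "sqi f" "sqi g"
  using f g by (auto simp: L12_def)
 have sf: "sqi (fhat c f)" "sqi (fhat c g)"
  using Bessel(1)[OF c] i s by auto
 then show "sqi (fhat c f)" by simp
 have "abs_L2 (fhat c f) - abs_L2 (fhat c g) = abs_L2 (%xx. fhat c (%x. f x - g x) xx)"
  by (simp add: abs_L2_minus sf fhat_diff i)
 then show "norm (abs_L2 (fhat c f) - abs_L2 (fhat c g)) <= fconst TYPE('n) * norm (abs_L2 f - abs_L2 g)"
  using Bessel(2)[OF c, of "%x. f x - g x"] i s by (simp add: abs_L2_minus square_integrable_diff)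
qed

lemma Ft_vec_tendsto:
 assumes c: "\<bar>c\<bar> = 1" and f: "sqi f"
 shows "(%m. abs_L2 (fhat c (trunc m f))) ----> Ft_vec c (abs_L2 (f :: 'n::finite cfun))"
proof -
 define g where "g = rep_L2 (abs_L2 f)"
 have g: "sqi g" "abs_L2 g = abs_L2 f"
  using Quotient3_rep_reflp[OF Quotient3_L2, of "abs_L2 f"] Quotient3_abs_rep[OF Quotient3_L2, of "abs_L2 f"]
  by (auto simp: g_def)
 have ae: "AE x in lborel. g x = f x" using g f by (simp add: abs_L2_eq_iff)
 have eq: "fhat c (trunc m g) = fhat c (trunc m f)" for m
 proof (rule fhat_cong_AE)
  show "AE x in lborel. trunc m g x = trunc m f x" using ae by eventually_elim (simp add: trunc_def)
 qed (use trunc_L12 f g in \<open>auto simp: L12_def\<close>)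
 have "Cauchy (%m. abs_L2 (fhat c (trunc m f)))"
 proof (rule metric_CauchyI)
  fix e :: real assume e: "e > 0"
  have "Cauchy (%m. abs_L2 (trunc m f))" by (rule LIMSEQ_imp_Cauchy[OF trunc_tendsto[OF f]])
  then obtain M where M: "!!m k. m \<ge> M ==> k \<ge> M ==> dist (abs_L2 (trunc m f)) (abs_L2 (trunc k f)) < e / fconst TYPE('n)"
   using metric_CauchyD e fconst_pos[where 'n='n] by (metis divide_pos_pos)
  have "dist (abs_L2 (fhat c (trunc m f))) (abs_L2 (fhat c (trunc k f))) < e" if "m \<ge> M" "k \<ge> M" for m k
   using fhat_L12_dist(2)[OF c trunc_L12[OF f] trunc_L12[OF f], of m k] M[OF that] fconst_pos[where 'n='n]
   unfolding dist_norm by (simp add: pos_less_divide_eq mult.commute)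
  then show "\<exists>M. \<forall>m\<ge>M. \<forall>n\<ge>M. dist (abs_L2 (fhat c (trunc m f))) (abs_L2 (fhat c (trunc n f))) < e" by blast
 qed
 then have "convergent (%m. abs_L2 (fhat c (trunc m f)))" by (simp add: Cauchy_convergent_iff)
 then show ?thesis
  by (simp add: Ft_vec_def g_def[symmetric] eq convergent_LIMSEQ_iff)
qed

lemma Ft_vec_L12:
 assumes c: "\<bar>c\<bar> = 1" and f: "L12 (f :: 'n::finite cfun)"
 shows "Ft_vec c (abs_L2 f) = abs_L2 (fhat c f)"
proof -
 have s: "sqi f" using f by (simp add: L12_def)
 have "(%m. fconst TYPE('n) * norm (abs_L2 (trunc m f) - abs_L2 f)) ----> fconst TYPE('n) * 0"
  by (intro tendsto_mult tendsto_const tendsto_norm_zero LIM_zero trunc_tendsto s)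
 then have "(%m. fconst TYPE('n) * norm (abs_L2 (trunc m f) - abs_L2 f)) ----> 0" by simp
 then have "(%m. abs_L2 (fhat c (trunc m f)) - abs_L2 (fhat c f)) ----> 0"
  by (rule Lim_null_comparison[OF always_eventually[OF allI[OF fhat_L12_dist(2)[OF c trunc_L12[OF s] f]]]])
 then have "(%m. abs_L2 (fhat c (trunc m f))) ----> abs_L2 (fhat c f)" by (rule LIM_zero_cancel)
 then show ?thesis by (rule LIMSEQ_unique[OF Ft_vec_tendsto[OF c s]])
qed

definition Ft :: "real => 'n::finite L2_op" where "Ft c = Blinfun (Ft_vec c)"

lemma bounded_linear_Ft_vec:
 assumes c: "\<bar>c\<bar> = 1"
 shows "bounded_linear (Ft_vec c :: 'n::finite L2 => _)" "norm (Ft_vec c (u :: 'n L2)) <= fconst TYPE('n) * norm u"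
proof -
 have nb: "norm (Ft_vec c u) <= fconst TYPE('n) * norm u" for u :: "'n L2"
 proof (rule L2_cases[of u])
  fix f assume f: "sqi f" "u = abs_L2 f"
  have *: "norm (abs_L2 (fhat c (trunc m f))) <= fconst TYPE('n) * norm (abs_L2 (trunc m f))" for m
   using trunc_L12[OF f(1), of m] Bessel(2)[OF c] by (auto simp: L12_def)
  show "norm (Ft_vec c u) <= fconst TYPE('n) * norm u"
   unfolding f(2)
   by (rule LIMSEQ_le[OF tendsto_norm[OF Ft_vec_tendsto[OF c f(1)]]
      tendsto_mult[OF tendsto_const tendsto_norm[OF trunc_tendsto[OF f(1)]]]])
     (use * in auto)
 qed
 then show "norm (Ft_vec c u) <= fconst TYPE('n) * norm u" .
 show "bounded_linear (Ft_vec c :: 'n L2 => _)"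
 proof (rule bounded_linear_intro[where K="fconst TYPE('n)"])
  fix u v :: "'n L2" and r :: real
  show "Ft_vec c (u + v) = Ft_vec c u + Ft_vec c v"
  proof (rule L2_cases[of u], rule L2_cases[of v])
   fix f g assume f: "sqi f" "u = abs_L2 f" and g: "sqi g" "v = abs_L2 g"
   have "abs_L2 (fhat c (trunc m (%x. f x + g x))) = abs_L2 (fhat c (trunc m f)) + abs_L2 (fhat c (trunc m g))" for m
   proof -
    have 1: "integrable lborel (trunc m f)" "integrable lborel (trunc m g)"
     using trunc_L12 f g by (auto simp: L12_def)
    have "trunc m (%x. f x + g x) = (%x. trunc m f x + trunc m g x)" by (auto simp: trunc_def distrib_left)
    then have "fhat c (trunc m (%x. f x + g x)) = (%xx. fhat c (trunc m f) xx + fhat c (trunc m g) xx)"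
     by (simp only:) (rule ext, rule fhat_add[OF 1])
    then show ?thesis
     by (simp add: abs_L2_plus fhat_L12_dist(1)[OF c trunc_L12[OF f(1)] trunc_L12[OF f(1)]]
      fhat_L12_dist(1)[OF c trunc_L12[OF g(1)] trunc_L12[OF g(1)]])
   qed
   moreover have "(%m. abs_L2 (fhat c (trunc m f)) + abs_L2 (fhat c (trunc m g))) ----> Ft_vec c u + Ft_vec c v"
    unfolding f(2) g(2) by (intro tendsto_add Ft_vec_tendsto c f g)
   moreover have "(%m. abs_L2 (fhat c (trunc m (%x. f x + g x)))) ----> Ft_vec c (u + v)"
    unfolding f(2) g(2) by (simp add: abs_L2_plus f g Ft_vec_tendsto c square_integrable_add)
   ultimately show ?thesis using LIMSEQ_unique by auto
  qed
  show "Ft_vec c (r *\<^sub>R u) = r *\<^sub>R Ft_vec c u"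
  proof (rule L2_cases[of u])
   fix f assume f: "sqi f" "u = abs_L2 f"
   have "abs_L2 (fhat c (trunc m (%x. r *\<^sub>R f x))) = r *\<^sub>R abs_L2 (fhat c (trunc m f))" for m
   proof -
    have "trunc m (%x. r *\<^sub>R f x) = (%x. cor r * trunc m f x)" by (auto simp: trunc_def scaleR_conv_of_real)
    then have "fhat c (trunc m (%x. r *\<^sub>R f x)) = (%xx. r *\<^sub>R fhat c (trunc m f) xx)"
     by (simp only:) (simp add: fun_eq_iff fhat_mult scaleR_conv_of_real)
    then show ?thesis
     by (simp add: abs_L2_scaleR fhat_L12_dist(1)[OF c trunc_L12[OF f(1)] trunc_L12[OF f(1)]])
   qed
   moreover have "(%m. r *\<^sub>R abs_L2 (fhat c (trunc m f))) ----> r *\<^sub>R Ft_vec c u"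
    unfolding f(2) by (intro tendsto_scaleR tendsto_const Ft_vec_tendsto c f)
   moreover have "(%m. abs_L2 (fhat c (trunc m (%x. r *\<^sub>R f x)))) ----> Ft_vec c (r *\<^sub>R u)"
    unfolding f(2) by (simp add: abs_L2_scaleR f Ft_vec_tendsto c square_integrable_scaleR)
   ultimately show ?thesis using LIMSEQ_unique by auto
  qed
  show "norm (Ft_vec c u) <= norm u * fconst TYPE('n)" using nb[of u] by (simp add: mult.commute)
 qed
qed

lemma Ft_apply: "\<bar>c\<bar> = 1 ==> ap (Ft c) u = Ft_vec c u"
 by (simp add: Ft_def bounded_linear_Ft_vec bounded_linear_Blinfun_apply)

lemma Ft_abs: "\<bar>c\<bar> = 1 ==> L12 f ==> ap (Ft c) (abs_L2 f) = abs_L2 (fhat c f)"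
 by (simp add: Ft_apply Ft_vec_L12)

lemma norm_Ft_le: "\<bar>c\<bar> = 1 ==> norm (ap (Ft c) (u :: 'n::finite L2)) <= fconst TYPE('n) * norm u"
 by (simp add: Ft_apply bounded_linear_Ft_vec)

lemma continuous_blinfun_pair: "continuous_on UNIV (%u. pair (ap T u) v)"
 by (intro linear_continuous_on bounded_linear_compose[OF bounded_linear_pair_left blinfun.bounded_linear_right])

lemma continuous_pair_left: "continuous_on UNIV (%u. pair u v)"
 by (intro linear_continuous_on bounded_linear_pair_left)

lemma pair_Ft:
 assumes c: "\<bar>c\<bar> = 1" shows "pair (Ft c u) v = pair u (Ft c v)"
proof -
 have 1: "pair (Ft c (abs_L2 f)) (abs_L2 g) = pair (abs_L2 f) (Ft c (abs_L2 g))" if f: "L12 f" "L12 g"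
  for f g :: "real^'a => complex"
 proof -
  have "sqi (fhat c f)" "sqi (fhat c g)" by (rule fhat_L12_dist[OF c]; use f in simp)+
  then show ?thesis
   using f fhat_multiplication_formula[of f g c] by (simp add: Ft_abs c pair_abs L12_def)
 qed
 have 2: "pair (Ft c u) (abs_L2 g) = pair u (Ft c (abs_L2 g))" if g: "L12 g" for g :: "real^'a => complex"
  by (rule eq_on_L12[OF continuous_blinfun_pair continuous_pair_left 1[OF _ g]])
 have "pair v (Ft c u) = pair (Ft c v) u"
  by (rule eq_on_L12[OF continuous_pair_left continuous_blinfun_pair]) (metis 2 pair_commute)
 then show ?thesis by (metis pair_commute)
qed

lemma C0_infinity_L12: "C0_infinity ph ==> L12 ph"
 by (simp add: L12_def C0_integrable)

text \<open>Both sides agree on \<open>L12\<close> after pairing with any test function, by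
  \<open>Parseval_test\<close>; totality of test functions and density of \<open>L12\<close> do the
  rest.\<close>

lemma Ft_inverse:
 assumes c: "\<bar>c\<bar> = 1" shows "Ft (- c) (Ft c u) = (fconst TYPE('n::finite))\<^sup>2 *\<^sub>R (u :: 'n L2)"
proof (rule eq_on_L12[where S="%u. Ft (- c) (Ft c u)"])
 have c': "\<bar>- c\<bar> = 1" using c by simp
 show "continuous_on UNIV (%u. ap (Ft (- c)) (ap (Ft c) u))"
  by (intro linear_continuous_on bounded_linear_compose[OF blinfun.bounded_linear_right blinfun.bounded_linear_right])
 show "continuous_on UNIV ((*\<^sub>R) ((fconst TYPE('n))\<^sup>2) :: 'n L2 => _)" by (intro continuous_intros)
 fix f :: "real^'n => complex" assume f: "L12 f"
 have "Ft (- c) (Ft c (abs_L2 f)) - (fconst TYPE('n))\<^sup>2 *\<^sub>R abs_L2 f = 0"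
 proof (rule test_functions_total)
  fix ph :: "real^'n => complex" assume phi: "C0_infinity ph"
  have "pair (Ft (- c) (Ft c (abs_L2 f))) (abs_L2 ph) = pair (abs_L2 (fhat c f)) (abs_L2 (fhat (- c) ph))"
   using f phi by (simp add: pair_Ft[OF c'] Ft_abs c c' C0_infinity_L12)
  also have "... = pair ((fconst TYPE('n))\<^sup>2 *\<^sub>R abs_L2 f) (abs_L2 ph)"
   using Parseval_test[OF c _ _ phi, of f] f by (simp add: L12_def pair_scaleR_left scaleR_conv_of_real)
  finally show "pair (Ft (- c) (Ft c (abs_L2 f)) - (fconst TYPE('n))\<^sup>2 *\<^sub>R abs_L2 f) (abs_L2 ph) = 0"
   by (simp add: pair_diff_left)
 qed
 then show "Ft (- c) (Ft c (abs_L2 f)) = (fconst TYPE('n))\<^sup>2 *\<^sub>R abs_L2 f" by simp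
qed

lemma pair_Ft_Ft:
 assumes c: "\<bar>c\<bar> = 1" shows "pair (Ft c u) (Ft (- c) v) = of_real ((fconst TYPE('n::finite))\<^sup>2) * pair (u :: 'n L2) v"
proof -
 have "\<bar>- c\<bar> = 1" using c by simp
 then have "pair (Ft c u) (Ft (- c) v) = pair (Ft (- c) (Ft c u)) v" by (rule pair_Ft[symmetric])
 then show ?thesis by (simp add: Ft_inverse[OF c] pair_scaleR_left scaleR_conv_of_real)
qed

lemma Ft_injective:
 assumes c: "\<bar>c\<bar> = 1" and "ap (Ft c) u = Ft c v" shows "u = (v :: 'n::finite L2)"
proof -
 have "(fconst TYPE('n))\<^sup>2 *\<^sub>R u = (fconst TYPE('n))\<^sup>2 *\<^sub>R v"
  using assms(2) by (metis Ft_inverse[OF c])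
 then show ?thesis using fconst_pos[where 'n='n] by simp
qed

lemma Ft_cnj: 
 assumes c: "\<bar>c\<bar> = 1" shows "cnj_L2 (Ft c u) = Ft (- c) (cnj_L2 u)"
proof (rule eq_on_L12[where S="%u. cnj_L2 (Ft c u)"])
 have c': "\<bar>- c\<bar> = 1" using c by simp
 have bl: "bounded_linear (cnj_L2 :: 'a L2 => _)"
 proof (rule bounded_linear_intro[where K=1])
  show "cnj_L2 (r *\<^sub>R u) = r *\<^sub>R cnj_L2 u" for r and u :: "'a L2"
   using cnj_L2_scaleC[of "of_real r" u] by (simp add: L2_scaleC_of_real)
 qed (auto simp: cnj_L2_add)
 show "continuous_on UNIV (%u. cnj_L2 (ap (Ft c) u) :: 'a L2)"
  by (intro linear_continuous_on bounded_linear_compose[OF bl blinfun.bounded_linear_right])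
 show "continuous_on UNIV (%u. ap (Ft (- c)) (cnj_L2 u) :: 'a L2)"
  by (intro linear_continuous_on bounded_linear_compose[OF blinfun.bounded_linear_right bl])
 fix f :: "real^'a => complex" assume f: "L12 f"
 then have f': "L12 (%x. cnj (f x))" by (simp add: L12_def square_integrable_cnj)
 have "sqi (fhat c f)" using fhat_L12_dist(1)[OF c f f] .
 moreover have "fhat (- c) (%x. cnj (f x)) = (%x. cnj (fhat c f x))" by (rule ext) (simp add: fhat_cnj)
 ultimately show "cnj_L2 (Ft c (abs_L2 f)) = Ft (- c) (cnj_L2 (abs_L2 f))"
  using f f' by (simp add: Ft_abs c c' cnj_L2_abs L12_def)
qed

lemma complex_linear_Ft:
 assumes c: "\<bar>c\<bar> = 1" shows "complex_linear (Ft c)"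
 unfolding complex_linear_def
proof (intro allI)
 fix a :: complex and u :: "'a L2"
 show "Ft c (L2_scaleC a u) = L2_scaleC a (Ft c u)"
  by (rule pair_eqD) (simp add: pair_Ft c pair_scaleC_left)
qed

section \<open>Weak derivatives on the Fourier side\<close>

text \<open>A nowhere vanishing weight that decays like \<open>|xx|^-2\<close>. It makes the
  unbounded factor \<open>xi i\<close> a bounded multiplier, so that the relation between the
  transforms of a function and of its derivative can be stated with \<open>L2_mult\<close>.\<close>

definition jb :: "'n::finite cfun" where "jb xx = cor (inverse (1 + (norm xx)\<^sup>2))"

text \<open>The symbol of the derivative in direction \<open>i\<close> when \<open>Ft (- 1)\<close>
  is the forward transform.\<close>

definition xi :: "'n => real^'n => complex" where "xi i xx = \<i> * cor (xx $ i)"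

lemma xi_measurable [measurable]: "xi i \<in> bm borel"
 unfolding xi_def[abs_def] by measurable

lemma jb_nonzero: "jb xx ~= 0"
 by (simp add: jb_def add_pos_nonneg less_imp_neq[symmetric] del: of_real_add)

lemma norm_component_le: "cmod (xi i xx) <= 1 + (norm xx)\<^sup>2"
proof -
 have "\<bar>xx $ i\<bar> <= norm xx" by (rule component_le_norm_cart)
 also have "norm xx <= 1 + (norm xx)\<^sup>2"
 proof -
  have "2 * norm xx <= 1 + (norm xx)\<^sup>2" using sum_squares_bound[of 1 "norm xx"] by simp
  then show ?thesis using norm_ge_zero[of xx] by linarith
 qed
 finally show ?thesis by (simp add: xi_def norm_mult)
qed

lemma bdd_mult_jb: "bdd_mult jb"
proof (rule bdd_multI[of _ 1])
 show "jb \<in> bm lborel" unfolding jb_def[abs_def] by measurable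
 show "cmod (jb x) <= 1" for x :: "real^'a"
 proof -
  have "1 + (norm x)\<^sup>2 \<ge> 1" by simp
  then have "inverse (1 + (norm x)\<^sup>2) <= 1" by (rule inverse_le_1_iff[THEN iffD2, OF disjI2])
  moreover have "0 <= inverse (1 + (norm x)\<^sup>2)" by (simp add: add_nonneg_nonneg)
  ultimately show ?thesis unfolding jb_def norm_of_real by linarith
 qed
qed

lemma bdd_mult_xi_jb: "bdd_mult (%xx. xi i xx * jb xx)"
proof (rule bdd_multI[of _ 1])
 show "(%xx. xi i xx * jb xx) \<in> bm lborel" unfolding jb_def[abs_def] by measurable
 show "cmod (xi i x * jb x) <= 1" for x
 proof -
  have p: "0 < 1 + (norm x)\<^sup>2" by (simp add: add_pos_nonneg)
  have "cmod (xi i x * jb x) = cmod (xi i x) * inverse (1 + (norm x)\<^sup>2)"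
   using p unfolding norm_mult jb_def norm_of_real by (simp add: abs_of_pos)
  also have "... <= (1 + (norm x)\<^sup>2) * inverse (1 + (norm x)\<^sup>2)"
   by (intro mult_right_mono norm_component_le) (use p in auto)
  also have "... = 1" using p by simp
  finally show ?thesis .
 qed
qed

lemma L2_mult_cancel:
 assumes b: "bdd_mult b" "!!x. b x ~= 0" and eq: "L2_mult b u = L2_mult b v"
 shows "u = v"
proof (rule L2_cases[of u], rule L2_cases[of v])
 fix f g assume f: "sqi f" "u = abs_L2 f" and g: "sqi g" "v = abs_L2 g"
 have "AE x in lborel. b x * f x = b x * g x"
  using eq f g b by (simp add: L2_mult_abs abs_L2_eq_iff sqi_bdd_mult)
 then have "AE x in lborel. f x = g x" by eventually_elim (simp add: b)
 then show "u = v" using f g by (simp add: abs_L2_eq_iff)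
qed

lemma smooth_exp_inner: "smooth (%x. exp (\<i> * cor (c * (x \<bullet> xx))))"
proof -
 have q: "smooth (%x. c * (x \<bullet> xx))"
  by (intro smooth_mult smooth_const smooth_linear bounded_linear_inner_left)
 \<comment> \<open>The successive derivatives of cosine and sine, written as phase shifts by
   \<open>j * pi / 2\<close>: this puts them into the shape of a family closed under
   differentiation.\<close>
 define C where "C j y = cos (y + real j * (pi/2))" for j y
 define S where "S j y = sin (y + real j * (pi/2))" for j y
 have shift: "y + real (Suc j) * (pi/2) = (y + real j * (pi/2)) + pi/2" for y j
  by (simp add: algebra_simps add_divide_distrib)
 have "smooth (%x. C 0 (c * (x \<bullet> xx)))"
 proof (rule smooth_comp_family[OF _ q])
  show "(C j has_real_derivative C (Suc j) y) (at y)" for j y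
  proof -
   have "C (Suc j) y = - sin (y + real j * (pi/2))"
    unfolding C_def shift by (simp only: cos_add[of _ "pi/2"] cos_pi_half sin_pi_half mult_zero_right mult_1_right diff_0)
   then show ?thesis unfolding C_def by (auto intro!: derivative_eq_intros)
  qed
 qed
 moreover have "smooth (%x. S 0 (c * (x \<bullet> xx)))"
 proof (rule smooth_comp_family[OF _ q])
  show "(S j has_real_derivative S (Suc j) y) (at y)" for j y
  proof -
   have "S (Suc j) y = cos (y + real j * (pi/2))"
    unfolding S_def shift by (simp only: sin_add[of _ "pi/2"] cos_pi_half sin_pi_half mult_zero_right mult_1_right add_0)
   then show ?thesis unfolding S_def by (auto intro!: derivative_eq_intros)
  qed
 qed
 ultimately have "smooth (%x. cor (C 0 (c * (x \<bullet> xx))) + \<i> * cor (S 0 (c * (x \<bullet> xx))))"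
  by (intro smooth_add smooth_mult smooth_of_real smooth_const)
 moreover have "cor (C 0 (c * (x \<bullet> xx))) + \<i> * cor (S 0 (c * (x \<bullet> xx)))
   = exp (\<i> * cor (c * (x \<bullet> xx)))" for x
  by (simp add: C_def S_def cis_conv_exp[symmetric] complex_eq_iff del: of_real_mult)
 ultimately show ?thesis by simp
qed

lemma partial_deriv_exp_inner:
 "pd i (%x. exp (\<i> * cor (c * (x \<bullet> xx)))) x
  = \<i> * cor (c * xx $ i) * exp (\<i> * cor (c * (x \<bullet> xx)))"
proof -
 have 1: "((%x. \<i> * cor (c * (x \<bullet> xx))) has_derivative (%h. \<i> * cor (c * (h \<bullet> xx)))) (at x)"
  by (auto intro!: derivative_eq_intros)
 have "((%x. exp (\<i> * cor (c * (x \<bullet> xx)))) has_derivative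
   (%h. exp (\<i> * cor (c * (x \<bullet> xx))) * (\<i> * cor (c * (h \<bullet> xx))))) (at x)"
  using has_derivative_compose[OF 1 DERIV_exp[unfolded has_field_derivative_def]] by simp
 from partial_derivI[OF this] show ?thesis by (simp add: inner_axis_axis inner_commute[of "axis i 1"] inner_axis)
qed

lemma smooth_scale:
 fixes f :: "real^'n::finite => 'b::real_normed_vector"
 assumes "smooth f" shows "smooth (%x. f (s *\<^sub>R x))" "pd i (%x. f (s *\<^sub>R x)) x = s *\<^sub>R pd i f (s *\<^sub>R x)"
proof -
 have D: "((%x. f (s *\<^sub>R x)) has_derivative (%h. frechet_derivative f (at (s *\<^sub>R x)) (s *\<^sub>R h))) (at x)"
  if "f differentiable (at (s *\<^sub>R x))" for f :: "real^'n => 'b" and x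
  by (rule has_derivative_compose[of "%x. s *\<^sub>R x" _ x UNIV f, OF _ differentiable_has_derivative[OF that]])
    (auto intro!: derivative_eq_intros)
 have P: "pd i (%x. f (s *\<^sub>R x)) x = s *\<^sub>R pd i f (s *\<^sub>R x)"
  if "f differentiable (at (s *\<^sub>R x))" for f :: "real^'n => 'b" and x i
 proof -
  have "linear (frechet_derivative f (at (s *\<^sub>R x)))"
   using differentiable_has_derivative[OF that] has_derivative_linear by blast
  then show ?thesis using partial_derivI[OF D[OF that], of i] by (simp add: linear_scale partial_deriv_def)
 qed
 have "C_k k f ==> C_k k (%x. f (s *\<^sub>R x))" for k and f :: "real^'n => 'b"
 proof (induction k arbitrary: f)
  case 0
  then have f: "continuous_on UNIV f" by simp
  have "continuous_on UNIV (%x::real^'n. s *\<^sub>R x)" by (intro continuous_intros)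
  from continuous_on_compose2[OF f this] show ?case by simp
 next
  case (Suc k)
  then have d: "f differentiable (at x)" for x by simp
  have "pd i (%x. f (s *\<^sub>R x)) = (%x. s *\<^sub>R pd i f (s *\<^sub>R x))" for i
   by (rule ext) (rule P[OF d])
  moreover have "C_k k (%x. s *\<^sub>R pd i f (s *\<^sub>R x))" for i
   by (rule C_k_linear_comp[OF bounded_linear_scaleR_right]) (use Suc in auto)
  moreover have "(%x. f (s *\<^sub>R x)) differentiable (at x)" for x
   using D[OF d] by (auto simp: differentiable_def)
  ultimately show ?case by simp
 qed
 then show "smooth (%x. f (s *\<^sub>R x))" using assms by (simp add: smooth_def)
 show "pd i (%x. f (s *\<^sub>R x)) x = s *\<^sub>R pd i f (s *\<^sub>R x)"
  by (rule P[OF smooth_differentiable[OF assms]])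
qed

text \<open>Multiplying \<open>ph\<close> by \<open>\<rho>(s x)\<close> with \<open>s\<close>
  tending to 0 gives admissible test functions. The derivative of the cut-off is of size
  \<open>s\<close>, and the integrability hypotheses dominate everything; so functions without
  compact support, such as Gaussians, may be tested with.\<close>

lemma weak_partial_extend:
 fixes f g ph :: "'n::finite cfun"
 assumes fg: "!!\<psi>. C0_infinity \<psi> ==> LI (%x. f x * pd i \<psi> x) = - LI (%x. g x * \<psi> x)"
  and m: "f \<in> bm borel" "g \<in> bm borel" and phi: "smooth ph"
  and int: "integrable lborel (%x. f x * ph x)" "integrable lborel (%x. f x * pd i ph x)" "integrable lborel (%x. g x * ph x)"
 shows "LI (%x. f x * pd i ph x) = - LI (%x. g x * ph x)"
proof -
 note [measurable] = m smooth_measurable[OF phi, simplified] smooth_measurable[OF smooth_partial_deriv[OF phi], simplified]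
 obtain \<rho>0 :: "real^'n => real" where r0: "smooth \<rho>0" "!!x. norm x <= 1 ==> \<rho>0 x = 1" "!!x. norm x \<ge> 2 ==> \<rho>0 x = 0"
   "!!x. 0 <= \<rho>0 x" "!!x. \<rho>0 x <= 1"
  using smooth_cutoff_exists[of 1 2] by auto
 define \<rho> where "\<rho> x = cor (\<rho>0 x)" for x
 have rs: "smooth \<rho>" unfolding \<rho>_def by (intro smooth_of_real r0)
 have rC: "C0_infinity \<rho>" by (rule C0_infinityI[OF rs, of 2]) (use r0 in \<open>auto simp: \<rho>_def\<close>)
 obtain B where B: "B > 0" "!!x. cmod (pd i \<rho> x) <= B"
  using C0_integrable(3)[OF C0_infinity_partial_deriv[OF rC]] bdd_multE by metis
 define s where "s m = inverse (real (Suc m))" for m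
 have s: "0 < s m" "s m <= 1" for m by (auto simp: s_def inverse_le_1_iff)
 have s0: "s ----> 0" unfolding s_def by (rule LIMSEQ_inverse_real_of_nat)
 define r where "r m x = \<rho> (s m *\<^sub>R x)" for m x
 have rm: "smooth (r m)" for m unfolding r_def by (rule smooth_scale[OF rs])
 have dr: "pd i (r m) x = s m *\<^sub>R pd i \<rho> (s m *\<^sub>R x)" for m x
  unfolding r_def by (rule smooth_scale[OF rs])
 have rC: "C0_infinity (r m)" for m
 proof (rule C0_infinityI[OF rm, of "2 / s m"])
  fix x :: "real^'n" assume "2 / s m < norm x"
  then have "2 <= norm (s m *\<^sub>R x)" using s[of m] by (simp add: pos_divide_less_eq mult.commute)
  then show "r m x = 0" using r0(3) by (simp add: r_def \<rho>_def)
 qed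
 have r1: "cmod (r m x) <= 1" for m x using r0(4,5) by (simp add: r_def \<rho>_def)
 have rl: "(%m. r m x) ----> 1" for x
 proof -
  have "(%m. s m * norm x) ----> 0 * norm x" by (intro tendsto_intros s0)
  then have "\<forall>\<^sub>F m in sequentially. s m * norm x < 1" by (rule order_tendstoD) simp
  then have "\<forall>\<^sub>F m in sequentially. r m x = 1"
   by eventually_elim (use r0(2) s in \<open>auto simp: r_def \<rho>_def less_imp_le abs_of_pos\<close>)
  then show ?thesis by (rule tendsto_eventually)
 qed
 have drb: "cmod (pd i (r m) x) <= s m * B" for m x
  unfolding dr using s[of m] B(2) by (simp add: mult_left_mono)
 have drb1: "cmod (pd i (r m) x) <= B" for m x
  using drb[of m x] s[of m] B(1) by (meson mult_left_le_one_le less_imp_le order_trans)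
 have drl: "(%m. pd i (r m) x) ----> 0" for x
 proof (rule Lim_null_comparison[OF always_eventually[OF allI[OF drb]]])
  show "(%m. s m * B) ----> 0" using tendsto_mult[OF s0 tendsto_const[of B]] by simp
 qed
 note [measurable] = smooth_measurable[OF rm, simplified] smooth_measurable[OF smooth_partial_deriv[OF rm], simplified]
 have prod: "pd i (%x. r m x * ph x) x = r m x * pd i ph x + pd i (r m) x * ph x" for m x
  by (rule smooth_partial_mult[OF rm phi])
 have L: "(%m. LI (%x. f x * pd i (%x. r m x * ph x) x))
   ----> LI (%x. f x * (1 * pd i ph x + 0 * ph x))"
  unfolding prod
 proof (rule integral_dominated_convergence[where w="%x. cmod (f x * pd i ph x) + B * cmod (f x * ph x)"])
  show "integrable lborel (%x. cmod (f x * pd i ph x) + B * cmod (f x * ph x))"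
   by (intro Bochner_Integration.integrable_add integrable_mult_right integrable_norm int)
  show "AE x in lborel. (%m. f x * (r m x * pd i ph x + pd i (r m) x * ph x))
    ----> f x * (1 * pd i ph x + 0 * ph x)"
   by (intro AE_I2 tendsto_intros rl drl)
  show "AE x in lborel. norm (f x * (r m x * pd i ph x + pd i (r m) x * ph x))
    <= cmod (f x * pd i ph x) + B * cmod (f x * ph x)" for m
  proof (rule AE_I2)
   fix x
   have "norm (f x * (r m x * pd i ph x + pd i (r m) x * ph x))
     <= cmod (r m x) * cmod (f x * pd i ph x) + cmod (pd i (r m) x) * cmod (f x * ph x)"
    unfolding distrib_left by (rule order_trans[OF norm_triangle_ineq]) (simp add: norm_mult mult_ac)
   also have "... <= 1 * cmod (f x * pd i ph x) + B * cmod (f x * ph x)"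
    by (intro add_mono mult_right_mono r1 drb1) auto
   finally show "norm (f x * (r m x * pd i ph x + pd i (r m) x * ph x))
    <= cmod (f x * pd i ph x) + B * cmod (f x * ph x)" by simp
  qed
 qed measurable
 have R: "(%m. LI (%x. g x * (r m x * ph x))) ----> LI (%x. g x * (1 * ph x))"
 proof (rule integral_dominated_convergence[where w="%x. cmod (g x * ph x)"])
  show "integrable lborel (%x. cmod (g x * ph x))" by (intro integrable_norm int)
  show "AE x in lborel. (%m. g x * (r m x * ph x)) ----> g x * (1 * ph x)"
   by (intro AE_I2 tendsto_intros rl)
  show "AE x in lborel. norm (g x * (r m x * ph x)) <= cmod (g x * ph x)" for m
  proof (rule AE_I2)
   fix x
   have "norm (g x * (r m x * ph x)) = cmod (r m x) * cmod (g x * ph x)" by (simp add: norm_mult mult_ac)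
   also have "... <= 1 * cmod (g x * ph x)" by (intro mult_right_mono r1) simp
   finally show "norm (g x * (r m x * ph x)) <= cmod (g x * ph x)" by simp
  qed
 qed measurable
 have "LI (%x. f x * pd i (%x. r m x * ph x) x) = - LI (%x. g x * (r m x * ph x))" for m
  by (rule fg[OF C0_infinity_mult(2)[OF phi rC]])
 with L R have "LI (%x. f x * (1 * pd i ph x + 0 * ph x)) = - LI (%x. g x * (1 * ph x))"
  using tendsto_minus[OF R] LIMSEQ_unique by auto
 then show ?thesis by simp
qed

text \<open>In \<open>weak_partial_extend\<close> the exponential takes the part of
  \<open>f\<close>, with its classical derivative as \<open>g\<close>, and \<open>ph\<close> is the
  test function.\<close>

lemma fhat_partial_deriv:
 fixes ph :: "'n::finite cfun"
 assumes phi: "smooth ph" and i: "integrable lborel ph" "integrable lborel (pd i ph)"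
 shows "fhat c (pd i ph) xx = - cor c * xi i xx * fhat c ph xx"
proof -
 let ?e = "%x. exp (\<i> * cor (c * (x \<bullet> xx)))"
 have "LI (%x. ?e x * pd i ph x) = - LI (%x. (\<i> * cor (c * xx $ i) * ?e x) * ph x)"
 proof (rule weak_partial_extend[OF _ _ _ phi])
  fix \<psi> :: "real^'n => complex" assume "C0_infinity \<psi>"
  from integration_by_parts[OF smooth_exp_inner this, of c xx i]
  show "LI (%x. ?e x * pd i \<psi> x) = - LI (%x. (\<i> * cor (c * xx $ i) * ?e x) * \<psi> x)"
   by (simp only: partial_deriv_exp_inner)
 next
  show "integrable lborel (%x. ?e x * ph x)" "integrable lborel (%x. ?e x * pd i ph x)"
   by (intro integrable_exp_mult i)+
  have "integrable lborel (%x. (\<i> * cor (c * xx $ i)) * (?e x * ph x))"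
   by (intro integrable_mult_right integrable_exp_mult i)
  then show "integrable lborel (%x. (\<i> * cor (c * xx $ i) * ?e x) * ph x)" by (simp add: mult.assoc)
 qed measurable
 also have "(%x. (\<i> * cor (c * xx $ i) * ?e x) * ph x) = (%x. (\<i> * cor (c * xx $ i)) * (?e x * ph x))"
  by (simp add: mult.assoc)
 finally have "fhat c (pd i ph) xx = - ((\<i> * cor (c * xx $ i)) * fhat c ph xx)"
  unfolding fhat_def by (simp only: integral_mult_right_zero)
 then show ?thesis by (simp add: xi_def mult_ac)
qed

lemma weak_partial_pair:
 "weak_partial i u v \<longleftrightarrow> (\<forall>ph. C0_infinity ph --> pair u (abs_L2 (pd i ph)) = - pair v (abs_L2 ph))"
proof (rule L2_cases[of u], rule L2_cases[of v])
 fix f g assume f: "sqi f" "u = abs_L2 f" and g: "sqi g" "v = abs_L2 g"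
 show ?thesis
  by (simp add: f g weak_partial.abs_eq pair_abs C0_integrable(2) C0_infinity_partial_deriv)
qed

lemma Fourier_imp_weak_partial:
 fixes u v :: "'n::finite L2"
 assumes eq: "L2_mult (%xx. xi i xx * jb xx) (Ft (- 1) u) = L2_mult jb (Ft (- 1) v)"
 shows "weak_partial i u v"
 unfolding weak_partial_pair
proof (intro allI impI)
 fix ph :: "real^'n => complex" assume phi: "C0_infinity ph"
 have sm: "smooth ph" using phi by (simp add: C0_infinity_iff)
 note d = C0_infinity_partial_deriv[OF phi, of i]
 obtain a where a: "sqi a" "Ft (- 1) u = abs_L2 a" using L2_cases by blast
 obtain b where b: "sqi b" "Ft (- 1) v = abs_L2 b" using L2_cases by blast
 have [measurable]: "a \<in> bm borel" "b \<in> bm borel"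
  using a b by (auto simp: square_integrable_def)
 have "AE x in lborel. xi i x * jb x * a x = jb x * b x"
  using eq a b by (simp add: L2_mult_abs abs_L2_eq_iff sqi_bdd_mult bdd_mult_xi_jb bdd_mult_jb)
 then have ae: "AE x in lborel. xi i x * a x = b x"
  by eventually_elim (metis jb_nonzero mult.commute mult.left_commute mult_cancel_left)
 let ?K = "cor ((fconst TYPE('n))\<^sup>2)"
 have s: "sqi (fhat 1 ph)" "sqi (fhat 1 (pd i ph))"
  using fhat_L12_dist(1)[of 1] C0_infinity_L12 phi d by (metis abs_one)+
 have [measurable]: "fhat 1 ph \<in> bm borel"
   "fhat 1 (pd i ph) \<in> bm borel" using s by (auto simp: square_integrable_def)
 have "?K * pair u (abs_L2 (pd i ph)) = pair (Ft (- 1) u) (Ft 1 (abs_L2 (pd i ph)))"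
  using pair_Ft_Ft[of "- 1" u] by simp
 also have "... = LI (%xx. a xx * fhat 1 (pd i ph) xx)"
  using d by (simp add: Ft_abs C0_infinity_L12 a pair_abs s)
 also have "... = LI (%xx. - (b xx * fhat 1 ph xx))"
 proof (rule integral_cong_AE)
  show "AE xx in lborel. a xx * fhat 1 (pd i ph) xx = - (b xx * fhat 1 ph xx)"
   using ae
   by eventually_elim
    (auto simp: fhat_partial_deriv[OF sm] C0_integrable(1)[OF phi] C0_integrable(1)[OF d] mult_ac)
 qed measurable
 also have "... = - pair (Ft (- 1) v) (Ft 1 (abs_L2 ph))"
  using phi by (simp add: Ft_abs C0_infinity_L12 b pair_abs s)
 also have "... = ?K * (- pair v (abs_L2 ph))"
  using pair_Ft_Ft[of "- 1" v "abs_L2 ph"] by simp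
 finally have "?K * pair u (abs_L2 (pd i ph)) = ?K * (- pair v (abs_L2 ph))" .
 moreover have "?K ~= 0" using fconst_pos[where 'n='n] by simp
 ultimately show "pair u (abs_L2 (pd i ph)) = - pair v (abs_L2 ph)"
  by (metis mult_cancel_left)
qed

lemma gauss_L2:
 "smooth (%x::real^'n::finite. cor (gauss 1 (x - a)))"
 "L12 (%x::real^'n. cor (gauss 1 (x - a)))"
 "L12 (pd i (%x::real^'n. cor (gauss 1 (x - a))))"
 "bdd_mult (%x::real^'n. cor (gauss 1 x))"
 "bdd_mult (%x::real^'n. xi i x * cor (gauss 1 x))"
 "L12 (%x::real^'n. xi i x * cor (gauss 1 x))"
proof -
 have sg: "smooth (%x::real^'n. exp ((-1/2) * (norm (x - a))\<^sup>2))"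
  by (rule smooth_comp_family[of "%j. exp", OF DERIV_exp]) (intro smooth_mult smooth_const smooth_sq_dist)
 then show s: "smooth (%x::real^'n. cor (gauss 1 (x - a)))"
  unfolding gauss_def by (intro smooth_of_real) (simp add: mult.commute)
 have b: "bdd_mult (%x::real^'n. cor (gauss 1 x))"
  by (rule bdd_multI[of _ 1]) (auto simp: gauss_def)
 then show "bdd_mult (%x::real^'n. cor (gauss 1 x))" .
 have gi: "integrable lborel (%x::real^'n. gauss (1/2) x)" by (rule gauss_integrable) simp
 \<comment> \<open>\<open>gauss (1/2)\<close> is \<open>gauss 1\<close> times
   \<open>exp (3 |x|^2 / 8)\<close>, and \<open>|x|\<close> is at most twice that exponential; so
   the wider Gaussian dominates the product of \<open>gauss 1\<close> with a coordinate.\<close>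
 have bnd: "\<bar>x $ i\<bar> * gauss 1 x <= 2 * gauss (1/2) x" for x :: "real^'n"
 proof -
  have "norm x <= 2 * (1 + (3 * (norm x)\<^sup>2 / 8))"
  proof -
   have "0 <= (norm x - 1)\<^sup>2" by simp
   then have "2 * norm x <= (norm x)\<^sup>2 + 1" by (simp add: power2_eq_square algebra_simps)
   moreover have "n <= 2 * (1 + (3 * q / 8))" if "2 * n <= q + 1" "0 <= q" for n q :: real
    using that by (simp add: field_simps)
   ultimately show ?thesis using zero_le_power2 by blast
  qed
  also have "1 + (3 * (norm x)\<^sup>2 / 8) <= exp (3 * (norm x)\<^sup>2 / 8)" by (rule exp_ge_add_one_self)
  finally have *: "\<bar>x $ i\<bar> <= 2 * exp (3 * (norm x)\<^sup>2 / 8)"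
   using component_le_norm_cart[of x i] by simp
  have "\<bar>x $ i\<bar> * gauss 1 x <= 2 * exp (3 * (norm x)\<^sup>2 / 8) * gauss 1 x"
   by (intro mult_right_mono *) (simp add: gauss_def)
  also have "... = 2 * gauss (1/2) x"
   by (simp add: gauss_def exp_add[symmetric] power_divide field_simps)
  finally show ?thesis .
 qed
 have L12I: "L12 f" if m: "f \<in> bm borel" and f: "!!x. cmod (f x) <= 2 * gauss (1/2) x"
  for f :: "real^'n => complex"
  unfolding L12_def
 proof
  show "integrable lborel f"
   by (rule Bochner_Integration.integrable_bound[OF integrable_mult_right[OF gi, of 2]])
     (use m f in \<open>auto intro: order_trans[OF f abs_ge_self]\<close>)
  have "(cmod (f x))\<^sup>2 <= 4 * gauss (1/2) x" for x
  proof -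
   have "(cmod (f x))\<^sup>2 <= (2 * gauss (1/2) x)\<^sup>2" by (intro power_mono f) auto
   also have "... = 4 * gauss (1/2) x * gauss (1/2) x" by (simp add: power2_eq_square)
   also have "... <= 4 * gauss (1/2) x * 1"
    using gauss_bounds[of "1/2" x] by (intro mult_left_mono) auto
   finally show ?thesis by simp
  qed
  then show "sqi f"
   by (intro square_integrable_dominated[OF _ integrable_mult_right[OF gi, of 4]]) (use m in auto)
 qed
 have g2: "gauss 1 x <= 2 * gauss (1/2) x" for x :: "real^'n"
 proof -
  have "gauss 1 x <= gauss (1/2) x" by (simp add: gauss_def power_divide)
  then show ?thesis using gauss_bounds(1)[of "1/2" x] by linarith
 qed
 have x: "cmod (xi i x * cor (gauss 1 x)) <= 2 * gauss (1/2) x" for x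
  using bnd[of x] gauss_bounds(1)[of 1 x] by (simp add: norm_mult xi_def abs_of_pos)
 show L: "L12 (%x::real^'n. xi i x * cor (gauss 1 x))"
  by (rule L12I[OF _ x]) measurable
 show "bdd_mult (%x::real^'n. xi i x * cor (gauss 1 x))"
  using gauss_bounds(2)[of "1/2"] by (intro bdd_multI[of _ 2] order_trans[OF x]) auto
 have tr: "L12 (%x. f (x - a))" if "L12 f" for f :: "real^'n => complex"
  using that integrable_translation[of f "- a"] integrable_translation[of "%x. (cmod (f x))\<^sup>2" "- a"]
   measurable_compose[of "%x. x + (- a)" borel borel f borel]
  by (auto simp: L12_def square_integrable_def)
 have "L12 (%x::real^'n. cor (gauss 1 x))"
  by (intro L12I) (use g2 in \<open>auto simp: abs_of_pos[OF gauss_bounds(1)]\<close>)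
 from tr[OF this] show "L12 (%x::real^'n. cor (gauss 1 (x - a)))" .
 have pd: "pd i (%x::real^'n. cor (gauss 1 (x - a))) x = \<i> * (xi i (x - a) * cor (gauss 1 (x - a)))" for x
 proof -
  have "((%x. gauss 1 (x - a)) has_derivative (%h. - ((x - a) \<bullet> h) * gauss 1 (x - a))) (at x)"
   unfolding gauss_def power2_norm_eq_inner
   by (auto intro!: derivative_eq_intros simp: fun_eq_iff inner_commute algebra_simps diff_divide_distrib)
  from bounded_linear.has_derivative[OF bounded_linear_of_real this]
  have "((%x. cor (gauss 1 (x - a))) has_derivative (%h. cor (- ((x - a) \<bullet> h) * gauss 1 (x - a)))) (at x)" .
  from partial_derivI[OF this, of i] show ?thesis by (simp add: inner_axis xi_def)
 qed
 have "L12 (%x::real^'n. \<i> * (xi i x * cor (gauss 1 x)))"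
  using L by (auto simp: L12_def intro: sqi_bdd_mult[OF _ bdd_mult_const])
 from tr[OF this] show "L12 (pd i (%x::real^'n. cor (gauss 1 (x - a))))"
  by (simp add: pd[abs_def])
qed

text \<open>The relation is tested on Gaussians centred at every \<open>y\<close>. On the Fourier
  side the translation becomes a factor \<open>exp (\<i> (x . y))\<close>, so the tests say that the
  transform of \<open>h = gauss 1 * (b - xi i * a)\<close> vanishes at every \<open>y\<close>. The
  Gaussian makes \<open>h\<close> integrable, and injectivity of the transform gives
  \<open>h = 0\<close>.\<close>

lemma weak_partial_imp_Fourier:
 fixes u v :: "'n::finite L2"
 assumes wp: "weak_partial i u v"
 shows "L2_mult (%xx. xi i xx * jb xx) (Ft (- 1) u) = L2_mult jb (Ft (- 1) v)"
proof -
 obtain f where f: "sqi f" "u = abs_L2 f" using L2_cases by blast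
 obtain g where g: "sqi g" "v = abs_L2 g" using L2_cases by blast
 obtain a where a: "sqi a" "Ft (- 1) u = abs_L2 a" using L2_cases by blast
 obtain b where b: "sqi b" "Ft (- 1) v = abs_L2 b" using L2_cases by blast
 have [measurable]: "a \<in> bm borel" "b \<in> bm borel" "f \<in> bm borel" "g \<in> bm borel"
  using a b f g by (auto simp: square_integrable_def)
 define h where "h x = b x * cor (gauss 1 x) - a x * (xi i x * cor (gauss 1 x))" for x
 note G = gauss_L2
 have hL: "L12 h"
 proof -
  have "sqi (%x. cor (gauss 1 x) * b x)" "sqi (%x. (xi i x * cor (gauss 1 x)) * a x)"
   by (intro sqi_bdd_mult a b G)+
  then have "sqi h" unfolding h_def[abs_def]
   by (intro square_integrable_diff) (simp_all add: mult_ac)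
  moreover have "integrable lborel h" unfolding h_def[abs_def]
   using G(2)[of 0] G(6)[of i]
   by (intro Bochner_Integration.integrable_diff integrable_mult_sqi a b) (auto simp: L12_def)
  ultimately show ?thesis by (simp add: L12_def)
 qed
 have h0: "fhat 1 h y = 0" for y
 proof -
  let ?ph = "%x::real^'n. cor (gauss 1 (x - y))"
  have sq: "sqi ?ph" "sqi (pd i ?ph)"
   and ii: "integrable lborel ?ph" "integrable lborel (pd i ?ph)"
   using G(2,3) by (auto simp: L12_def)
  have "LI (%x. f x * pd i ?ph x) = - LI (%x. g x * ?ph x)"
  proof (rule weak_partial_extend[OF _ _ _ G(1)])
   show "C0_infinity \<psi> ==> LI (%x. f x * pd i \<psi> x) = - LI (%x. g x * \<psi> x)" for \<psi>
    using wp f g by (simp add: weak_partial.abs_eq)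
  qed (use sq f g in \<open>auto intro: integrable_mult_sqi\<close>)
  then have "pair u (abs_L2 (pd i ?ph)) = - pair v (abs_L2 ?ph)"
   by (simp add: f g pair_abs sq)
  then have "pair (Ft (- 1) u) (Ft 1 (abs_L2 (pd i ?ph))) = - pair (Ft (- 1) v) (Ft 1 (abs_L2 ?ph))"
   using pair_Ft_Ft[of "- 1" u] pair_Ft_Ft[of "- 1" v] by simp
  then have "pair (abs_L2 a) (abs_L2 (fhat 1 (pd i ?ph))) = - pair (abs_L2 b) (abs_L2 (fhat 1 ?ph))"
   by (simp add: a b Ft_abs G)
  moreover have s: "sqi (fhat 1 (pd i ?ph))" "sqi (fhat 1 ?ph)"
   using fhat_L12_dist(1)[of 1] G(2,3) by (metis abs_one)+
  ultimately have "LI (%x. a x * fhat 1 (pd i ?ph) x) + LI (%x. b x * fhat 1 ?ph x) = 0"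
   by (simp add: pair_abs a b)
  moreover have "integrable lborel (%x. a x * fhat 1 (pd i ?ph) x)" "integrable lborel (%x. b x * fhat 1 ?ph x)"
   by (intro integrable_mult_sqi a b s)+
  ultimately have "LI (%x. a x * fhat 1 (pd i ?ph) x + b x * fhat 1 ?ph x) = 0"
   by simp
  moreover have "a x * fhat 1 (pd i ?ph) x + b x * fhat 1 ?ph x
    = cor (fconst TYPE('n)) * (exp (\<i> * cor (1 * (x \<bullet> y))) * h x)" for x
  proof -
   have "fhat 1 ?ph x = LI (%z. exp (\<i> * cor (1 * ((z + y) \<bullet> x))) * cor (gauss 1 z))"
    using integral_translation[of "%z. exp (\<i> * cor (1 * (z \<bullet> x))) * cor (gauss 1 (z - y))" y]
    unfolding fhat_def by simp
   also have "... = LI (%z. exp (\<i> * cor (x \<bullet> y)) * (cor (gauss 1 z) * exp (\<i> * cor (x \<bullet> z))))"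
    by (rule Bochner_Integration.integral_cong)
      (auto simp: inner_commute[of _ x] inner_add_right distrib_left exp_add)
   also have "... = exp (\<i> * cor (x \<bullet> y)) * cor (heat 1 x)"
    by (simp only: integral_mult_right_zero gauss_fourier(2)[OF zero_less_one])
   also have "heat 1 x = fconst TYPE('n) * gauss 1 x" by (simp add: heat_def gauss_def)
   finally have "fhat 1 ?ph x = exp (\<i> * cor (x \<bullet> y)) * cor (fconst TYPE('n) * gauss 1 x)" .
   then show ?thesis by (simp add: fhat_partial_deriv[OF G(1) ii] h_def algebra_simps)
  qed
  ultimately have "cor (fconst TYPE('n)) * fhat 1 h y = 0"
   unfolding fhat_def by (simp only: integral_mult_right_zero)
  then show ?thesis using fconst_pos[where 'n='n] by simp
 qed
 have "Ft 1 (abs_L2 h) = Ft 1 0"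
 proof -
  have "fhat 1 h = (%_. 0)" using h0 by (simp add: fun_eq_iff)
  then show ?thesis by (simp add: Ft_abs hL abs_L2_zero blinfun.zero_right)
 qed
 then have "abs_L2 h = 0" by (rule Ft_injective[of 1, rotated]) simp
 then have "abs_L2 h = abs_L2 (%_. 0)" by (simp add: abs_L2_zero)
 then have "AE x in lborel. h x = 0" using hL by (subst (asm) abs_L2_eq_iff) (auto simp: L12_def)
 then have "AE x in lborel. xi i x * jb x * a x = jb x * b x"
 proof eventually_elim
  fix x assume "h x = 0"
  moreover have "h x = cor (gauss 1 x) * (b x - xi i x * a x)" by (simp add: h_def algebra_simps)
  ultimately have "b x = xi i x * a x" using gauss_bounds(1)[of 1 x] by simp
  then show "xi i x * jb x * a x = jb x * b x" by simp
 qed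
 then show ?thesis
  unfolding a b by (subst (1 2) L2_mult_abs)
   (auto simp: abs_L2_eq_iff sqi_bdd_mult bdd_mult_xi_jb bdd_mult_jb a b)
qed

section \<open>Calculus of weak derivatives\<close>

lemma weak_partial_iff_Fourier:
 "weak_partial i u v \<longleftrightarrow> L2_mult (%xx. xi i xx * jb xx) (Ft (- 1) u) = L2_mult jb (Ft (- 1) v)"
 using Fourier_imp_weak_partial weak_partial_imp_Fourier by blast

lemma weak_partial_unique:
 assumes "weak_partial i u v" "weak_partial i u w" shows "v = w"
proof -
 have "L2_mult jb (Ft (- 1) v) = L2_mult jb (Ft (- 1) w)"
  using assms by (simp add: weak_partial_iff_Fourier)
 then have "ap (Ft (- 1)) v = Ft (- 1) w"
  by (rule L2_mult_cancel[OF bdd_mult_jb jb_nonzero])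
 then show ?thesis by (rule Ft_injective[rotated]) simp
qed

lemma weak_deriv_eq: "weak_partial i u v ==> weak_deriv i u = v"
 unfolding weak_deriv_def using weak_partial_unique by (metis the_equality)

lemma weak_partial_add: "weak_partial i u v ==> weak_partial i u' v' ==> weak_partial i (u + u') (v + v')"
 by (simp add: weak_partial_pair pair_add_left)

lemma weak_partial_scaleC: "weak_partial i u v ==> weak_partial i (L2_scaleC c u) (L2_scaleC c v)"
 by (simp add: weak_partial_pair pair_scaleC_left)

lemma weak_partial_diff: "weak_partial i u v ==> weak_partial i u' v' ==> weak_partial i (u - u') (v - v')"
 by (simp add: weak_partial_pair pair_diff_left)

lemma weak_partial_L2_mult:
 fixes \<theta> :: "'n::finite cfun"
 assumes wp: "weak_partial i u v" and th: "smooth \<theta>" "bdd_mult \<theta>" "bdd_mult (pd i \<theta>)"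
 shows "weak_partial i (L2_mult \<theta> u) (L2_mult \<theta> v + L2_mult (pd i \<theta>) u)"
 unfolding weak_partial_pair
proof (intro allI impI)
 fix ph :: "real^'n => complex" assume phi: "C0_infinity ph"
 note s = C0_integrable(2)[OF phi] C0_integrable(2)[OF C0_infinity_partial_deriv[OF phi, of i]]
 have tp: "C0_infinity (%x. \<theta> x * ph x)" by (rule C0_infinity_mult(1)[OF th(1) phi])
 have "pd i (%x. \<theta> x * ph x) = (%x. \<theta> x * pd i ph x + pd i \<theta> x * ph x)"
  by (rule ext, rule smooth_partial_mult[OF th(1)]) (use phi in \<open>simp add: C0_infinity_iff\<close>)
 then have *: "abs_L2 (pd i (%x. \<theta> x * ph x))
   = L2_mult \<theta> (abs_L2 (pd i ph)) + L2_mult (pd i \<theta>) (abs_L2 ph)"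
  by (simp add: L2_mult_abs s th abs_L2_plus sqi_bdd_mult)
 have "pair u (abs_L2 (pd i (%x. \<theta> x * ph x))) = - pair v (abs_L2 (%x. \<theta> x * ph x))"
  using wp tp by (simp add: weak_partial_pair)
 also have "abs_L2 (%x. \<theta> x * ph x) = L2_mult \<theta> (abs_L2 ph)" by (simp add: L2_mult_abs s th)
 finally have "pair u (L2_mult \<theta> (abs_L2 (pd i ph))) + pair u (L2_mult (pd i \<theta>) (abs_L2 ph))
   = - pair v (L2_mult \<theta> (abs_L2 ph))"
  unfolding * pair_add_right .
 moreover have "a = - (c + b)" if "a + b = - c" for a b c :: complex
  using that by algebra
 ultimately show "pair (L2_mult \<theta> u) (abs_L2 (pd i ph))
   = - pair (L2_mult \<theta> v + L2_mult (pd i \<theta>) u) (abs_L2 ph)"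
  unfolding pair_add_left pair_L2_mult[OF th(2)] pair_L2_mult[OF th(3)] by blast
qed

lemma pair_cnj: "pair (cnj_L2 u) (cnj_L2 v) = cnj (pair u v)"
proof (rule L2_cases[of u], rule L2_cases[of v])
 fix f g assume "sqi f" "u = abs_L2 f" "sqi g" "v = abs_L2 g"
 then show ?thesis
  by (simp add: cnj_L2_abs pair_abs square_integrable_cnj Bochner_Integration.integral_cnj[symmetric]
    del: Bochner_Integration.integral_cnj)
qed

lemma weak_partial_cnj:
 fixes u v :: "'n::finite L2"
 assumes wp: "weak_partial i u v" shows "weak_partial i (cnj_L2 u) (cnj_L2 v)"
 unfolding weak_partial_pair
proof (intro allI impI)
 fix ph :: "real^'n => complex" assume phi: "C0_infinity ph"
 note s = C0_integrable(2)[OF phi] C0_integrable(2)[OF C0_infinity_partial_deriv[OF phi, of i]]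
 have sm: "smooth ph" using phi by (simp add: C0_infinity_iff)
 have "pd i (%x. cnj (ph x)) x = cnj (pd i ph x)" for x
  using partial_derivI[OF bounded_linear.has_derivative[OF bounded_linear_cnj smooth_has_derivative[OF sm]]]
  by (simp add: partial_deriv_def)
 then have d: "pd i (%x. cnj (ph x)) = (%x. cnj (pd i ph x))" by blast
 obtain R where R: "!!x. norm x > R ==> ph x = 0" using phi C0_infinity_boundedE by metis
 have "C0_infinity (%x. cnj (ph x))"
  using sm R by (intro C0_infinityI[of _ R]) (auto simp: smooth_def C_k_linear_comp[OF bounded_linear_cnj])
 then have "pair u (abs_L2 (pd i (%x. cnj (ph x)))) = - pair v (abs_L2 (%x. cnj (ph x)))"
  using wp by (simp add: weak_partial_pair)
 then have "pair u (cnj_L2 (abs_L2 (pd i ph))) = - pair v (cnj_L2 (abs_L2 ph))"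
  by (simp add: d cnj_L2_abs s)
 then have "pair (cnj_L2 u) (cnj_L2 (cnj_L2 (abs_L2 (pd i ph)))) = - pair (cnj_L2 v) (cnj_L2 (cnj_L2 (abs_L2 ph)))"
  unfolding pair_cnj by simp
 then show "pair (cnj_L2 u) (abs_L2 (pd i ph)) = - pair (cnj_L2 v) (abs_L2 ph)" by simp
qed

lemma weak_partial_AE:
 assumes wp: "weak_partial i u v" and a: "sqi a" "Ft (- 1) u = abs_L2 a"
  and b: "sqi b" "Ft (- 1) v = abs_L2 b"
 shows "AE x in lborel. xi i x * a x = b x"
proof -
 have "AE x in lborel. xi i x * jb x * a x = jb x * b x"
  using wp a b by (simp add: weak_partial_iff_Fourier L2_mult_abs abs_L2_eq_iff
    sqi_bdd_mult bdd_mult_xi_jb bdd_mult_jb)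
 then show ?thesis
  by eventually_elim (metis jb_nonzero mult.commute mult.left_commute mult_cancel_left)
qed

text \<open>Neither function is a test function, so the identity is proved on the Fourier side,
  where the sign comes from \<open>xi i\<close> being purely imaginary.\<close>

lemma weak_partial_by_parts:
 fixes u v w s :: "'n::finite L2"
 assumes "weak_partial i u v" "weak_partial i w s"
 shows "pair v w = - pair u s"
proof -
 obtain a where a: "sqi a" "Ft (- 1) u = abs_L2 a" using L2_cases by blast
 obtain b where b: "sqi b" "Ft (- 1) v = abs_L2 b" using L2_cases by blast
 obtain p where p: "sqi p" "Ft (- 1) (cnj_L2 w) = abs_L2 p" using L2_cases by blast
 obtain q where q: "sqi q" "Ft (- 1) (cnj_L2 s) = abs_L2 q" using L2_cases by blast
 have [measurable]: "a \<in> bm borel" "b \<in> bm borel"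
   "p \<in> bm borel" "q \<in> bm borel"
  using a b p q by (auto simp: square_integrable_def)
 have F: "Ft 1 w = abs_L2 (%x. cnj (p x))" "Ft 1 s = abs_L2 (%x. cnj (q x))"
  using Ft_cnj[of "- 1" "cnj_L2 w"] Ft_cnj[of "- 1" "cnj_L2 s"] by (simp_all add: p q cnj_L2_abs)
 have ab: "AE x in lborel. xi i x * a x = b x" by (rule weak_partial_AE[OF assms(1) a b])
 have pq: "AE x in lborel. xi i x * p x = q x" by (rule weak_partial_AE[OF weak_partial_cnj[OF assms(2)] p q])
 let ?K = "cor ((fconst TYPE('n))\<^sup>2)"
 have "?K * pair v w = LI (%x. b x * cnj (p x))"
  using pair_Ft_Ft[of "- 1" v w] by (simp add: F b pair_abs square_integrable_cnj p)
 also have "... = LI (%x. - (a x * cnj (q x)))"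
 proof (rule integral_cong_AE)
  show "AE x in lborel. b x * cnj (p x) = - (a x * cnj (q x))"
   using ab pq
  proof eventually_elim
   fix x assume "xi i x * a x = b x" "xi i x * p x = q x"
   then have "b x = xi i x * a x" "q x = xi i x * p x" by auto
   then show "b x * cnj (p x) = - (a x * cnj (q x))" by (simp add: xi_def mult_ac)
  qed
 qed measurable
 also have "... = ?K * (- pair u s)"
  using pair_Ft_Ft[of "- 1" u s] by (simp add: F a pair_abs square_integrable_cnj q)
 finally have "?K * pair v w = ?K * (- pair u s)" .
 moreover have "?K ~= 0" by simp
 ultimately show ?thesis by (metis mult_cancel_left)
qed

section \<open>Fourier multipliers\<close>

text \<open>The Fourier multiplier with symbol \<open>m\<close>; the scalar makes up for the missing
  normalisation of the two transforms.\<close>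

definition Mop :: "(real^'n => complex) => 'n::finite L2_op" where
 "Mop m = (1 / (fconst TYPE('n))\<^sup>2) *\<^sub>R (Ft 1 oL mult_op m oL Ft (- 1))"

lemma Mop_apply: "ap (Mop m) (u :: 'n::finite L2) = (1 / (fconst TYPE('n))\<^sup>2) *\<^sub>R Ft 1 (L2_mult m (Ft (- 1) u))"
 by (simp add: Mop_def blinfun.scaleR_left)

lemma Ft_Mop: "ap (Ft (- 1)) (Mop m u) = L2_mult m (Ft (- 1) u)"
 by (simp add: Mop_apply blinfun.scaleR_right Ft_inverse)

lemma Ft_minus_injective: "ap (Ft (- 1)) u = Ft (- 1) v ==> u = v"
 by (rule Ft_injective[rotated]) auto

lemma Mop_one: "ap (Mop (%_. 1)) u = u"
 by (rule Ft_minus_injective) (simp add: Ft_Mop)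

lemma Mop_add: "bdd_mult m ==> bdd_mult m' ==> ap (Mop (%xx. m xx + m' xx)) u = Mop m u + Mop m' u"
 by (rule Ft_minus_injective) (simp add: Ft_Mop L2_mult_add_left blinfun.add_right)

lemma Mop_diff: "bdd_mult m ==> bdd_mult m' ==> ap (Mop (%xx. m xx - m' xx)) u = Mop m u - Mop m' u"
 by (rule Ft_minus_injective) (simp add: Ft_Mop L2_mult_diff_left blinfun.diff_right)

lemma Mop_scaleC: "bdd_mult m ==> ap (Mop (%xx. c * m xx)) u = L2_scaleC c (Mop m u)"
 by (rule Ft_minus_injective)
  (simp add: Ft_Mop L2_mult_scaleC_left complex_linear_scaleC[OF complex_linear_Ft])

lemma bdd_mult_sum: "(!!i. i \<in> I ==> bdd_mult (m i)) ==> bdd_mult (%xx. \<Sum>i\<in>I. m i xx)"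
 by (induction I rule: infinite_finite_induct) auto

lemma Mop_sum: "finite I ==> (!!i. i \<in> I ==> bdd_mult (m i)) ==> ap (Mop (%xx. \<Sum>i\<in>I. m i xx)) u = (\<Sum>i\<in>I. Mop (m i) u)"
proof (induction I rule: finite_induct)
 case empty
 show ?case by (rule Ft_minus_injective) (simp add: Ft_Mop blinfun.zero_right)
qed (simp add: Mop_add bdd_mult_sum)

lemma complex_linear_Mop: "bdd_mult m ==> complex_linear (Mop m)"
 unfolding Mop_def by (intro complex_linear_scaleR complex_linear_comp complex_linear_Ft complex_linear_mult_op) auto

lemma norm_Mop_le:
 assumes m: "bdd_mult m" "!!xx. cmod (m xx) <= B"
 shows "norm (ap (Mop m) (u :: 'n::finite L2)) <= B * norm u"
proof -
 have B: "B \<ge> 0" using m(2) norm_ge_zero order_trans by blast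
 let ?K = "fconst TYPE('n)"
 have "norm (ap (Mop m) u) <= (1 / ?K\<^sup>2) * (?K * (B * (?K * norm u)))"
  unfolding Mop_apply norm_scaleR
  by (intro mult_mono order_trans[OF norm_Ft_le] mult_left_mono order_trans[OF norm_L2_mult_le[OF m]] B)
    (auto simp: less_imp_le B)
 also have "... = B * norm u" by (simp add: power2_eq_square)
 finally show ?thesis .
qed

lemma weak_partial_Mop:
 assumes m: "bdd_mult m" "bdd_mult (%xx. xi i xx * m xx)"
 shows "weak_partial i (Mop m f) (Mop (%xx. xi i xx * m xx) f)"
 unfolding weak_partial_iff_Fourier Ft_Mop
 by (simp add: L2_mult_L2_mult m bdd_mult_xi_jb bdd_mult_jb, simp add: mult_ac)

text \<open>A derivative falling on the argument is absorbed into the symbol. This later removes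
  derivatives of the unknown from commutator terms.\<close>

lemma Mop_weak_partial:
 assumes wp: "weak_partial i u v" and m: "bdd_mult m" "bdd_mult (%xx. xi i xx * m xx)"
 shows "ap (Mop m) v = Mop (%xx. xi i xx * m xx) u"
proof (rule Ft_minus_injective, rule L2_mult_cancel[OF bdd_mult_jb jb_nonzero])
 have "L2_mult m (L2_mult (%xx. xi i xx * jb xx) (Ft (- 1) u)) = L2_mult m (L2_mult jb (Ft (- 1) v))"
  using wp by (simp add: weak_partial_iff_Fourier)
 then have "L2_mult (%xx. m xx * (xi i xx * jb xx)) (Ft (- 1) u) = L2_mult (%xx. m xx * jb xx) (Ft (- 1) v)"
  by (simp add: L2_mult_L2_mult m bdd_mult_xi_jb bdd_mult_jb)
 then show "L2_mult jb (ap (Ft (- 1)) (Mop m v)) = L2_mult jb (Ft (- 1) (Mop (%xx. xi i xx * m xx) u))"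
  by (simp add: Ft_Mop L2_mult_L2_mult m bdd_mult_jb, simp add: mult_ac)
qed

text \<open>Symbols of order -2: the decay with which \<open>Mop m\<close> maps into
  \<open>H2\<close> and can absorb a Laplacian.\<close>

definition decay :: "('n::finite cfun) => bool" where
 "decay m \<longleftrightarrow> m \<in> bm borel & (\<exists>B. \<forall>xx. cmod (m xx) * (1 + (norm xx)\<^sup>2) <= B)"

lemma decay_bdd:
 assumes "decay m"
 shows "bdd_mult m" "bdd_mult (%xx. xi i xx * m xx)" "bdd_mult (%xx. xi j xx * (xi i xx * m xx))"
  "bdd_mult (%xx. cor ((norm xx)\<^sup>2) * m xx)"
proof -
 obtain B where B: "!!xx. cmod (m xx) * (1 + (norm xx)\<^sup>2) <= B" and [measurable]: "m \<in> bm borel"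
  using assms by (auto simp: decay_def)
 have *: "bdd_mult (%xx. p xx * m xx)" if [measurable]: "p \<in> bm borel" and p: "!!xx. cmod (p xx) <= 1 + (norm xx)\<^sup>2" for p
 proof (rule bdd_multI[of _ B])
  fix x
  have "cmod (p x * m x) <= (1 + (norm x)\<^sup>2) * cmod (m x)"
   unfolding norm_mult by (intro mult_right_mono p) auto
  then show "cmod (p x * m x) <= B" using B[of x] by (simp add: mult.commute)
 qed measurable
 show "bdd_mult m" using *[of "%_. 1"] by simp
 show "bdd_mult (%xx. xi i xx * m xx)" by (rule *[OF _ norm_component_le]) measurable
 show "bdd_mult (%xx. cor ((norm xx)\<^sup>2) * m xx)" by (rule *) (auto simp: norm_power)
 have "cmod (xi j xx * xi i xx) <= 1 + (norm xx)\<^sup>2" for xx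
 proof -
  have "\<bar>xx $ j\<bar> * \<bar>xx $ i\<bar> <= norm xx * norm xx" by (intro mult_mono component_le_norm_cart) auto
  then show ?thesis by (simp add: xi_def norm_mult power2_eq_square)
 qed
 then have "bdd_mult (%xx. (xi j xx * xi i xx) * m xx)" by (rule *[rotated]) measurable
 then show "bdd_mult (%xx. xi j xx * (xi i xx * m xx))" by (simp add: mult.assoc)
qed

lemma H2I:
 assumes "!!i. weak_partial i u (v i)" "!!i j. weak_partial j (v i) (w i j)"
 shows "u \<in> H2" "laplacian u = (\<Sum>i\<in>UNIV. w i i)" "weak_deriv i u = v i"
proof -
 show "u \<in> H2" using assms unfolding H2_def by blast
 show "weak_deriv i u = v i" for i by (rule weak_deriv_eq[OF assms(1)])
 then show "laplacian u = (\<Sum>i\<in>UNIV. w i i)" unfolding laplacian_def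
  by (simp add: weak_deriv_eq[OF assms(2)])
qed

lemma H2_weak_partial:
 assumes "u \<in> H2"
 shows "weak_partial i u (weak_deriv i u)" "weak_partial j (weak_deriv i u) (weak_deriv j (weak_deriv i u))"
proof -
 obtain v where v: "weak_partial i u v" "\<forall>j. \<exists>w. weak_partial j v w" using assms unfolding H2_def by blast
 have "weak_deriv i u = v" by (rule weak_deriv_eq[OF v(1)])
 then show "weak_partial i u (weak_deriv i u)" "weak_partial j (weak_deriv i u) (weak_deriv j (weak_deriv i u))"
  using v weak_deriv_eq by metis+
qed

lemma H2_diff:
 assumes "u \<in> H2" "v \<in> H2" shows "u - v \<in> H2" "laplacian (u - v) = laplacian u - laplacian v"
proof -
 note H = H2I[of "u - v" "%i. weak_deriv i u - weak_deriv i v" "%i j. weak_deriv j (weak_deriv i u) - weak_deriv j (weak_deriv i v)",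
   OF weak_partial_diff[OF assms[THEN H2_weak_partial(1)]] weak_partial_diff[OF assms[THEN H2_weak_partial(2)]]]
 show "u - v \<in> H2" by (rule H(1))
 show "laplacian (u - v) = laplacian u - laplacian v" unfolding H(2) laplacian_def[of u] laplacian_def[of v]
  by (simp add: sum_subtractf)
qed

lemma H2_add:
 assumes "u \<in> H2" "v \<in> H2" shows "u + v \<in> H2" "laplacian (u + v) = laplacian u + laplacian v"
proof -
 note H = H2I[of "u + v" "%i. weak_deriv i u + weak_deriv i v" "%i j. weak_deriv j (weak_deriv i u) + weak_deriv j (weak_deriv i v)",
   OF weak_partial_add[OF assms[THEN H2_weak_partial(1)]] weak_partial_add[OF assms[THEN H2_weak_partial(2)]]]
 show "u + v \<in> H2" by (rule H(1))
 show "laplacian (u + v) = laplacian u + laplacian v" unfolding H(2) laplacian_def[of u] laplacian_def[of v]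
  by (simp add: sum.distrib)
qed

lemma H2_scaleC:
 assumes "u \<in> H2" shows "L2_scaleC c u \<in> H2" "laplacian (L2_scaleC c u) = L2_scaleC c (laplacian u)"
proof -
 note H = H2I[of "L2_scaleC c u" "%i. L2_scaleC c (weak_deriv i u)" "%i j. L2_scaleC c (weak_deriv j (weak_deriv i u))",
   OF weak_partial_scaleC[OF assms[THEN H2_weak_partial(1)]] weak_partial_scaleC[OF assms[THEN H2_weak_partial(2)]]]
 show "L2_scaleC c u \<in> H2" by (rule H(1))
 show "laplacian (L2_scaleC c u) = L2_scaleC c (laplacian u)" unfolding H(2) laplacian_def[of u]
  by (simp add: L2_scaleC_sum)
qed

lemma sum_xi_sq: "(\<Sum>i\<in>UNIV. xi i xx * (xi i xx * m)) = - (cor ((norm xx)\<^sup>2) * m)"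
proof -
 have "(norm xx)\<^sup>2 = (\<Sum>i\<in>UNIV. xx $ i * xx $ i)" unfolding power2_norm_eq_inner inner_vec_def by simp
 then have "cor ((norm xx)\<^sup>2) * m = (\<Sum>i\<in>UNIV. cor (xx $ i * xx $ i) * m)"
  by (simp add: sum_distrib_right)
 moreover have "xi i xx * (xi i xx * m) = - (cor (xx $ i * xx $ i) * m)" for i
  by (simp add: xi_def algebra_simps)
 ultimately show ?thesis by (simp add: sum_negf)
qed

lemma laplacian_Mop:
 assumes m: "decay m"
 shows "ap (Mop m) f \<in> H2" "laplacian (Mop m f) = - Mop (%xx. cor ((norm xx)\<^sup>2) * m xx) f"
  "weak_deriv i (Mop m f) = Mop (%xx. xi i xx * m xx) f"
proof -
 note b = decay_bdd[OF m]
 note H = H2I[of "Mop m f" "%i. Mop (%xx. xi i xx * m xx) f" "%i j. Mop (%xx. xi j xx * (xi i xx * m xx)) f",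
   OF weak_partial_Mop[OF b(1,2)] weak_partial_Mop[OF b(2,3)]]
 show "ap (Mop m) f \<in> H2" by (rule H(1))
 show "weak_deriv i (Mop m f) = Mop (%xx. xi i xx * m xx) f" by (rule H(3))
 have "laplacian (Mop m f) = Mop (%xx. \<Sum>i\<in>UNIV. xi i xx * (xi i xx * m xx)) f"
  unfolding H(2) by (rule Mop_sum[symmetric]) (auto intro: b)
 also have "... = - Mop (%xx. cor ((norm xx)\<^sup>2) * m xx) f"
  using Mop_scaleC[OF b(4), of "- 1" f] L2_scaleC_of_real[of "- 1"] unfolding sum_xi_sq by simp
 finally show "laplacian (Mop m f) = - Mop (%xx. cor ((norm xx)\<^sup>2) * m xx) f" .
qed

lemma Mop_laplacian:
 assumes m: "decay m" and u: "u \<in> H2"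
 shows "ap (Mop m) (laplacian u) = - Mop (%xx. cor ((norm xx)\<^sup>2) * m xx) u"
proof -
 note b = decay_bdd[OF m]
 have "Mop m (weak_deriv i (weak_deriv i u)) = Mop (%xx. xi i xx * (xi i xx * m xx)) u" for i
  using Mop_weak_partial[OF H2_weak_partial(2)[OF u] b(1,2)] Mop_weak_partial[OF H2_weak_partial(1)[OF u] b(2,3)] by metis
 then have "Mop m (laplacian u) = Mop (%xx. \<Sum>i\<in>UNIV. xi i xx * (xi i xx * m xx)) u"
  unfolding laplacian_def blinfun.sum_right by (subst Mop_sum) (auto intro: b)
 also have "... = - Mop (%xx. cor ((norm xx)\<^sup>2) * m xx) u"
  using Mop_scaleC[OF b(4), of "- 1" u] L2_scaleC_of_real[of "- 1"] unfolding sum_xi_sq by simp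
 finally show ?thesis .
qed

section \<open>The free resolvent\<close>

definition rz :: "real => complex => 'n::finite cfun" where
 "rz h z xx = 1 / (cor (h\<^sup>2 * (norm xx)\<^sup>2) - z)"

definition P0 :: "real => 'n::finite L2 => 'n L2" where
 "P0 h u = - (h\<^sup>2 *\<^sub>R laplacian u)"

definition free_resolvent :: "real => complex => 'n::finite L2_op" where "free_resolvent h z = Mop (rz h z)"

lemma rz_denominator: 
 assumes "Im z > 0" shows "Im z <= cmod (cor t - z)" "cor t - z ~= 0"
proof -
 have "\<bar>Im (cor t - z)\<bar> <= cmod (cor t - z)" by (rule abs_Im_le_cmod)
 then show "Im z <= cmod (cor t - z)" using assms by simp
 then show "cor t - z ~= 0" using assms by auto
qed

lemma norm_rz_le: "Im z > 0 ==> cmod (rz h z xx) <= 1 / Im z"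
 unfolding rz_def norm_divide norm_one by (rule frac_le[OF _ _ _ rz_denominator(1)]) auto

lemma rz_measurable [measurable]: "rz h z \<in> bm borel"
 unfolding rz_def[abs_def] by measurable

text \<open>With \<open>d\<close> the denominator, \<open>h^2 |xx|^2\<close> is at most
  \<open>|d| + |z|\<close>, and \<open>|z|\<close> is at most \<open>|z| |d| / Im z\<close> because
  \<open>|d| \<ge> Im z\<close>.\<close>

lemma decay_rz:
 assumes h: "h > 0" and z: "Im z > 0" shows "decay (rz h z)"
 unfolding decay_def
proof (intro conjI exI allI)
 fix xx :: "real^'a"
 let ?d = "cor (h\<^sup>2 * (norm xx)\<^sup>2) - z"
 have d: "Im z <= cmod ?d" "?d ~= 0" using rz_denominator[OF z] by blast+
 have "h\<^sup>2 * (norm xx)\<^sup>2 = cmod (?d + z)" by (simp add: norm_mult norm_power)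
 also have "... <= cmod ?d + cmod z" by (rule norm_triangle_ineq)
 also have "... <= cmod ?d + cmod z * (cmod ?d / Im z)"
 proof -
  have "1 <= cmod ?d / Im z" using d(1) z by simp
  then have "cmod z * 1 <= cmod z * (cmod ?d / Im z)" by (rule mult_left_mono) simp
  then show ?thesis by simp
 qed
 finally have 1: "(norm xx)\<^sup>2 <= cmod ?d * ((1 + cmod z / Im z) / h\<^sup>2)"
  using h by (simp add: field_simps)
 have 2: "1 <= cmod ?d * (1 / Im z)" using d(1) z by simp
 have "1 + (norm xx)\<^sup>2 <= cmod ?d * (1 / Im z + (1 + cmod z / Im z) / h\<^sup>2)"
  using 1 2 by (simp add: distrib_left)
 then show "cmod (rz h z xx) * (1 + (norm xx)\<^sup>2) <= 1 / Im z + (1 + cmod z / Im z) / h\<^sup>2"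
  unfolding rz_def norm_divide using d(2) by (simp add: pos_divide_le_eq mult.commute del: of_real_mult)
qed measurable

lemma rz_eq:
 assumes "Im z > 0"
 shows "cor (h\<^sup>2) * (cor ((norm xx)\<^sup>2) * rz h z xx) - z * rz h z xx = 1"
proof -
 have "cor (h\<^sup>2) * (cor ((norm xx)\<^sup>2) * rz h z xx) - z * rz h z xx
   = (cor (h\<^sup>2 * (norm xx)\<^sup>2) - z) * rz h z xx" by (simp add: algebra_simps)
 then show ?thesis using rz_denominator(2)[OF assms] by (simp add: rz_def del: of_real_mult)
qed

lemma free_resolvent_props:
 fixes f u :: "'n::finite L2"
 assumes h: "h > 0" and z: "Im z > 0"
 shows "ap (free_resolvent h z) f \<in> H2" "P0 h (free_resolvent h z f) - L2_scaleC z (free_resolvent h z f) = f"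
  "u \<in> H2 ==> free_resolvent h z (P0 h u - L2_scaleC z u) = u"
  "norm (ap (free_resolvent h z) f) <= norm f / Im z" "complex_linear (free_resolvent h z :: 'n L2_op)"
proof -
 have d: "decay (rz h z :: real^'n => complex)" by (rule decay_rz[OF h z])
 note b = decay_bdd[OF d]
 have *: "(h\<^sup>2) *\<^sub>R Mop (%xx. cor ((norm xx)\<^sup>2) * rz h z xx) f - L2_scaleC z (Mop (rz h z) f) = f" for f :: "'n L2"
 proof -
  have "(h\<^sup>2) *\<^sub>R Mop (%xx. cor ((norm xx)\<^sup>2) * rz h z xx) f - L2_scaleC z (Mop (rz h z) f)
   = Mop (%xx. cor (h\<^sup>2) * (cor ((norm xx)\<^sup>2) * rz h z xx)) f - Mop (%xx. z * rz h z xx) f"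
   by (simp only: Mop_scaleC[OF b(4)] Mop_scaleC[OF b(1)] L2_scaleC_of_real)
  also have "... = Mop (%xx. cor (h\<^sup>2) * (cor ((norm xx)\<^sup>2) * rz h z xx) - z * rz h z xx) f"
   by (rule Mop_diff[symmetric]) (intro bdd_mult_mult bdd_mult_const b)+
  also have "... = f" by (simp only: rz_eq[OF z] Mop_one)
  finally show ?thesis .
 qed
 show "ap (free_resolvent h z) f \<in> H2" unfolding free_resolvent_def by (rule laplacian_Mop[OF d])
 show "P0 h (free_resolvent h z f) - L2_scaleC z (free_resolvent h z f) = f"
  using *[of f] by (simp add: free_resolvent_def P0_def laplacian_Mop[OF d])
 show "free_resolvent h z (P0 h u - L2_scaleC z u) = u" if u: "u \<in> H2"
  using *[of u] u
  by (simp add: free_resolvent_def P0_def blinfun.diff_right blinfun.minus_right blinfun.scaleR_right Mop_laplacian[OF d]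
   complex_linear_scaleC[OF complex_linear_Mop[OF b(1)]])
 show "norm (ap (free_resolvent h z) f) <= norm f / Im z"
  using norm_Mop_le[OF b(1) norm_rz_le[OF z], of f] by (simp add: free_resolvent_def)
 show "complex_linear (free_resolvent h z :: 'n L2_op)" unfolding free_resolvent_def by (rule complex_linear_Mop[OF b(1)])
qed

section \<open>The resolvent of the Schroedinger operator in the upper half-plane\<close>

lemma bdd_mult_potential:
 assumes "C0_infinity (V :: real^'n::finite => real)" shows "bdd_mult (%x. cor (V x))"
proof -
 obtain B where B: "!!x. norm (V x) <= B" 
  using bounded_range_C0_infinity[OF assms] by (auto simp: bounded_iff)
 have [measurable]: "V \<in> bm borel"
  using smooth_measurable[of V] assms by (simp add: C0_infinity_iff)
 show ?thesis by (rule bdd_multI[of _ B]) (use B in auto)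
qed

lemma real_mult_symmetric:
 assumes "bdd_mult (%x. cor (V x))"
 shows "L2_mult (%x. cor (V x)) u \<bullet> L2_scaleC \<i> u = 0"
proof (rule L2_cases[of u])
 fix f assume f: "sqi f" "u = abs_L2 f"
 have "(cor v * a) \<bullet> (\<i> * a) = 0" for v and a :: complex
  by (simp add: inner_complex_def algebra_simps)
 then show ?thesis
  by (simp add: f L2_mult_abs assms L2_scaleC_abs abs_L2_inner sqi_bdd_mult del: inner_complex_def)
qed

lemma P0_symmetric:
 fixes u :: "'n::finite L2"
 assumes "u \<in> H2" shows "P0 h u \<bullet> L2_scaleC \<i> u = 0"
proof -
 have "weak_deriv i (weak_deriv i u) \<bullet> L2_scaleC \<i> u = 0" for i
 proof -
  have "weak_partial i (cnj_L2 (L2_scaleC \<i> u)) (cnj_L2 (L2_scaleC \<i> (weak_deriv i u)))"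
   by (intro weak_partial_cnj weak_partial_scaleC H2_weak_partial assms)
  from weak_partial_by_parts[OF H2_weak_partial(2)[OF assms, of i i] this]
  have "weak_deriv i (weak_deriv i u) \<bullet> L2_scaleC \<i> u = - (weak_deriv i u \<bullet> L2_scaleC \<i> (weak_deriv i u))"
   by (simp add: inner_eq_pair)
  also have "... = 0" using inner_scaleC_i[of 1 "weak_deriv i u"] by simp
  finally show ?thesis .
 qed
 then show ?thesis by (simp add: P0_def laplacian_def inner_sum_left)
qed

text \<open>The coupling \<open>t\<close> runs from the free operator at 0 to \<open>P - z\<close>
  at 1; surjectivity in the upper half-plane is obtained by the method of continuity.\<close>

definition Pt :: "(real^'n => real) => real => complex => real => 'n::finite L2 => 'n L2" where
 "Pt V h z t u = P0 h u + t *\<^sub>R L2_mult (%x. cor (V x)) u - L2_scaleC z u"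

text \<open>Testing with \<open>\<i> u\<close> kills both symmetric terms, so the constant
  \<open>Im z\<close> is the same for all couplings.\<close>

lemma Pt_estimate:
 assumes V: "bdd_mult (%x. cor (V x))" and u: "u \<in> H2" and z: "Im z > 0"
 shows "Im z * norm u <= norm (Pt V h z t u)"
proof (cases "u = 0")
 case False
 have "Pt V h z t u \<bullet> L2_scaleC \<i> u = - Im z * (norm u)\<^sup>2"
  by (simp add: Pt_def inner_add_left inner_diff_left P0_symmetric[OF u] real_mult_symmetric[OF V] inner_scaleC_i)
 then have "Im z * (norm u)\<^sup>2 = \<bar>Pt V h z t u \<bullet> L2_scaleC \<i> u\<bar>" using z by (simp add: abs_mult)
 also have "... <= norm (Pt V h z t u) * norm (L2_scaleC \<i> u)" by (rule Cauchy_Schwarz_ineq2)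
 finally have "(Im z * norm u) * norm u <= norm (Pt V h z t u) * norm u" by (simp add: power2_eq_square)
 then show ?thesis using False by simp
qed simp

text \<open>The a priori bound gives the right inverse norm at most \<open>1 / Im z\<close>, so a
  change of \<open>t\<close> below \<open>Im z / B\<close> is a Neumann perturbation. The admissible
  step is the same everywhere, and finitely many steps lead from 0 to 1.\<close>

lemma Pt_surj_step:
 fixes S :: "'n::finite L2_op"
 assumes V: "bdd_mult (%x. cor (V x))" "!!x. cmod (cor (V x)) <= B" and B: "B > 0"
  and z: "Im z > 0" and S: "!!f. ap S f \<in> H2" "!!f. Pt V h z t (S f) = f"
  and t: "\<bar>t' - t\<bar> * B < Im z"
 shows "\<exists>S'::'n L2_op. \<forall>f. ap S' f \<in> H2 & Pt V h z t' (S' f) = f"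
proof -
 let ?V = "%x. cor (V x)"
 define T where "T = (t' - t) *\<^sub>R (mult_op ?V oL S)"
 have nS: "norm (ap S f) <= norm f / Im z" for f
  using Pt_estimate[OF V(1) S(1) z, of f h t] S(2)[of f] z by (simp add: field_simps)
 have "norm T <= \<bar>t' - t\<bar> * (B / Im z)"
 proof (rule norm_blinfun_bound)
  show "0 <= \<bar>t' - t\<bar> * (B / Im z)" using B z by simp
  fix f
  have "norm (ap T f) = \<bar>t' - t\<bar> * norm (L2_mult ?V (S f))"
   by (simp add: T_def blinfun.scaleR_left)
  also have "... <= \<bar>t' - t\<bar> * (B * (norm f / Im z))"
   using B by (intro mult_left_mono order_trans[OF norm_L2_mult_le[OF V]] nS) auto
  finally show "norm (ap T f) <= \<bar>t' - t\<bar> * (B / Im z) * norm f" by simp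
 qed
 also have "... < 1" using t z by (simp add: field_simps)
 finally obtain N where N: "(I1 + T) oL N = I1" using Neumann by blast
 have N': "N f + T (N f) = f" for f
  using N by (metis blinfun.add_left blinfun_apply_blinfun_compose blinfun_apply_id_blinfun id_apply)
 have "Pt V h z t' (S (N f)) = f" for f
 proof -
  have "T (N f) = (t' - t) *\<^sub>R L2_mult ?V (S (N f))" by (simp add: T_def blinfun.scaleR_left)
  then have "Pt V h z t' (S (N f)) = Pt V h z t (S (N f)) + T (N f)"
   by (simp add: Pt_def scaleR_diff_left)
  then show ?thesis using N'[of f] S(2) by simp
 qed
 then show ?thesis using S(1) by (intro exI[of _ "S oL N"]) simp
qed

lemma Pt_surj:
 fixes V :: "real^'n::finite => real"
 assumes V: "bdd_mult (%x. cor (V x))" and h: "h > 0" and z: "Im z > 0"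
 shows "\<exists>S::'n L2_op. \<forall>f. ap S f \<in> H2 & Pt V h z 1 (S f) = f"
proof -
 obtain B where B: "B > 0" "!!x. cmod (cor (V x)) <= B" using bdd_multE[OF V] by metis
 obtain N where N: "real N > B / Im z" using reals_Archimedean2 by blast
 have N0: "real N > 0" using N B(1) z by (meson divide_pos_pos less_trans)
 have "\<exists>S::'n L2_op. \<forall>f. ap S f \<in> H2 & Pt V h z (real k / real N) (S f) = f" for k
 proof (induction k)
  case 0
  show ?case by (intro exI[of _ "free_resolvent h z"]) (simp add: Pt_def free_resolvent_props(1,2)[OF h z])
 next
  case (Suc k)
  then obtain S where S: "!!f. ap S f \<in> H2" "!!f. Pt V h z (real k / real N) (ap S f) = f" by blast
  have "\<bar>real (Suc k) / real N - real k / real N\<bar> * B < Im z"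
   using N N0 z by (simp add: diff_divide_distrib[symmetric] field_simps)
  then show ?case by (rule Pt_surj_step[OF V B(2,1) z S])
 qed
 from this[of N] show ?thesis using N0 by simp
qed

text \<open>\<open>resolvent\<close> is \<open>Blinfun\<close> of a set-theoretic inverse on
  \<open>H2\<close>. It acquires its meaning from the bounded right inverse of
  \<open>Pt_surj\<close>, which coincides with that inverse by injectivity.\<close>

lemma resolvent_props:
 fixes V :: "real^'n::finite => real"
 assumes V: "bdd_mult (%x. cor (V x))" and h: "h > 0" and z: "Im z > 0"
 shows "ap (resolvent V h z) f \<in> H2"
  "schroedinger V h (resolvent V h z f) - L2_scaleC z (resolvent V h z f) = f"
  "u \<in> H2 ==> resolvent V h z (schroedinger V h u - L2_scaleC z u) = u"
  "complex_linear (resolvent V h z)"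
proof -
 let ?H = "%u. schroedinger V h u - L2_scaleC z u"
 have HP: "?H = Pt V h z 1" by (auto simp: schroedinger_def Pt_def P0_def)
 obtain S :: "'n L2_op" where S: "!!f. ap S f \<in> H2" "!!f. ?H (S f) = f"
  using Pt_surj[OF V h z] HP by metis
 have dif: "?H (u - v) = ?H u - ?H v" if "u \<in> H2" "v \<in> H2" for u v
  using H2_diff(2)[OF that] by (simp add: schroedinger_def L2_mult_diff L2_scaleC_diff scaleR_diff_right)
 have inj: "inj_on ?H H2"
 proof (rule inj_onI)
  fix u v :: "'n L2" assume uv: "u \<in> H2" "v \<in> H2" "?H u = ?H v"
  have "Im z * norm (u - v) <= norm (?H (u - v))"
   using Pt_estimate[OF V H2_diff(1)[OF uv(1,2)] z, of h 1] by (simp add: fun_cong[OF HP, symmetric])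
  also have "... = 0" using dif[OF uv(1,2)] uv(3) by simp
  finally show "u = v" using z by (simp add: mult_le_0_iff)
 qed
 have "the_inv_into H2 ?H f = S f" for f
  using the_inv_into_f_f[OF inj S(1)[of f]] S(2) by simp
 then have "the_inv_into H2 ?H = ap S" by (rule ext)
 then have RS: "resolvent V h z = S" unfolding resolvent_def by (simp only: blinfun_apply_inverse)
 show 1: "ap (resolvent V h z) f \<in> H2" "?H (resolvent V h z f) = f" for f
  using S by (simp_all add: RS)
 show inv: "resolvent V h z (?H u) = u" if "u \<in> H2" for u
  by (rule inj_onD[OF inj _ 1(1) that]) (rule 1(2))
 show "complex_linear (resolvent V h z)"
  unfolding complex_linear_def
 proof (intro allI)
  fix c :: complex and f :: "'n L2"
  let ?u = "ap (resolvent V h z) f"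
  have "?H (L2_scaleC c ?u) = L2_scaleC c (?H ?u)"
   using H2_scaleC(2)[OF 1(1), of c f] V
   by (simp add: schroedinger_def L2_mult_scaleC L2_scaleC_add L2_scaleC_minus L2_scaleC_scaleR L2_scaleC_diff mult.commute)
  then show "resolvent V h z (L2_scaleC c f) = L2_scaleC c ?u"
   using inv[OF H2_scaleC(1)[OF 1(1)]] 1(2) by metis
 qed
qed

section \<open>Operators with a kernel and exponential series of operators\<close>

text \<open>The integral is required to exist at every \<open>xx\<close> and for every
  representative. Such a kernel determines the operator, so identities between operators reduce to
  identities between kernels.\<close>

definition has_kernel :: "'n::finite L2_op => (real^'n => real^'n => complex) => bool" where
 "has_kernel T ka \<longleftrightarrow> (\<forall>f. sqi f --> (\<forall>xx. integrable lborel (%x. ka xx x * f x)) &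
   sqi (%xx. LI (%x. ka xx x * f x)) &
   ap T (abs_L2 f) = abs_L2 (%xx. LI (%x. ka xx x * f x)))"

lemma has_kernelD:
 assumes "has_kernel T ka" "sqi f"
 shows "integrable lborel (%x. ka xx x * f x)"
  "sqi (%xx. LI (%x. ka xx x * f x))"
  "ap T (abs_L2 f) = abs_L2 (%xx. LI (%x. ka xx x * f x))"
 using assms by (auto simp: has_kernel_def)

lemma has_kernel_unique:
 assumes "has_kernel S ka" "has_kernel T ka" shows "S = T"
proof (rule blinfun_eqI)
 fix u
 show "ap S u = T u"
  by (rule L2_cases[of u]) (simp add: has_kernelD(3)[OF assms(1)] has_kernelD(3)[OF assms(2)])
qed

lemma has_kernel_Ft:
 fixes ch :: "'n::finite cfun"
 assumes c: "\<bar>c\<bar> = 1" and chi: "bdd_mult ch" "!!x. norm x > R ==> ch x = 0"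
 shows "has_kernel (Ft c oL mult_op ch) (%xx x. exp (\<i> * cor (c * (x \<bullet> xx))) * ch x)"
 unfolding has_kernel_def
proof (intro allI impI)
 fix f :: "real^'n => complex" assume f: "sqi f"
 have s: "sqi (%x. ch x * f x)" by (rule sqi_bdd_mult[OF f chi(1)])
 have eq: "(%x. indicator (cball 0 R) x * (ch x * f x)) = (%x. ch x * f x)"
  using chi(2) by (force simp: indicator_def fun_eq_iff)
 have i: "integrable lborel (%x. ch x * f x)"
  using integrable_indicator_cball_mult[OF s, of R] by (simp only: eq)
 have L: "L12 (%x. ch x * f x)" using i s by (simp add: L12_def)
 have fh: "fhat c (%x. ch x * f x) = (%xx. LI (%x. exp (\<i> * cor (c * (x \<bullet> xx))) * ch x * f x))"
  by (simp add: fhat_def[abs_def] mult.assoc)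
 have "integrable lborel (%x. exp (\<i> * cor (c * (x \<bullet> xx))) * ch x * f x)" for xx
  using integrable_exp_mult[OF i, of c xx] by (simp only: mult.assoc)
 moreover have "sqi (fhat c (%x. ch x * f x))" by (rule fhat_L12_dist(1)[OF c L L])
 moreover have "(Ft c oL mult_op ch) (abs_L2 f) = abs_L2 (fhat c (%x. ch x * f x))"
  by (simp add: L2_mult_abs f chi(1) Ft_abs c L)
 ultimately show "(\<forall>xx. integrable lborel (%x. exp (\<i> * cor (c * (x \<bullet> xx))) * ch x * f x)) &
   sqi (%xx. LI (%x. exp (\<i> * cor (c * (x \<bullet> xx))) * ch x * f x)) &
   (Ft c oL mult_op ch) (abs_L2 f) = abs_L2 (%xx. LI (%x. exp (\<i> * cor (c * (x \<bullet> xx))) * ch x * f x))"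
  unfolding fh by blast
qed

lemma has_kernel_mult:
 fixes T :: "'n::finite L2_op"
 assumes T: "has_kernel T ka" and a: "bdd_mult a" and b: "bdd_mult b"
 shows "has_kernel (mult_op a oL T oL mult_op b) (%xx x. a xx * ka xx x * b x)"
 unfolding has_kernel_def
proof (intro allI impI conjI)
 fix f :: "real^'n => complex" assume f: "sqi f"
 have s: "sqi (%x. b x * f x)" by (rule sqi_bdd_mult[OF f b])
 note K = has_kernelD[OF T s]
 have e1: "(%x. a xx * ka xx x * b x * f x) = (%x. a xx * (ka xx x * (b x * f x)))" for xx
  by (simp add: mult.assoc)
 show "integrable lborel (%x. a xx * ka xx x * b x * f x)" for xx
  unfolding e1 by (intro integrable_mult_right K)
 have e2: "(%xx. LI (%x. a xx * ka xx x * b x * f x))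
   = (%xx. a xx * LI (%x. ka xx x * (b x * f x)))"
  unfolding e1 by simp
 show "sqi (%xx. LI (%x. a xx * ka xx x * b x * f x))"
  unfolding e2 by (rule sqi_bdd_mult[OF K(2) a])
 show "(mult_op a oL T oL mult_op b) (abs_L2 f) = abs_L2 (%xx. LI (%x. a xx * ka xx x * b x * f x))"
  unfolding e2 by (simp add: L2_mult_abs f b K a)
qed

lemma has_kernel_scaleR:
 fixes T :: "'n::finite L2_op"
 assumes T: "has_kernel T ka"
 shows "has_kernel (r *\<^sub>R T) (%xx x. cor r * ka xx x)"
 unfolding has_kernel_def
proof (intro allI impI conjI)
 fix f :: "real^'n => complex" assume f: "sqi f"
 note K = has_kernelD[OF T f]
 show "integrable lborel (%x. cor r * ka xx x * f x)" for xx
  unfolding mult.assoc by (intro integrable_mult_right K)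
 have e2: "(%xx. LI (%x. cor r * ka xx x * f x))
   = (%xx. r *\<^sub>R LI (%x. ka xx x * f x))"
  by (simp add: mult.assoc scaleR_conv_of_real)
 show "sqi (%xx. LI (%x. cor r * ka xx x * f x))"
  unfolding e2 by (rule square_integrable_scaleR[OF K(2)])
 show "(r *\<^sub>R T) (abs_L2 f) = abs_L2 (%xx. LI (%x. cor r * ka xx x * f x))"
  unfolding e2 by (simp add: blinfun.scaleR_left K abs_L2_scaleR)
qed

lemma has_kernel_add:
 fixes S T :: "'n::finite L2_op"
 assumes S: "has_kernel S ka" and T: "has_kernel T ka'"
 shows "has_kernel (S + T) (%xx x. ka xx x + ka' xx x)"
 unfolding has_kernel_def
proof (intro allI impI conjI)
 fix f :: "real^'n => complex" assume f: "sqi f"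
 note K = has_kernelD[OF S f] has_kernelD[OF T f]
 show "integrable lborel (%x. (ka xx x + ka' xx x) * f x)" for xx
  unfolding distrib_right by (intro Bochner_Integration.integrable_add K)
 have e2: "(%xx. LI (%x. (ka xx x + ka' xx x) * f x))
   = (%xx. LI (%x. ka xx x * f x) + LI (%x. ka' xx x * f x))"
  unfolding distrib_right by (intro ext Bochner_Integration.integral_add K)
 show "sqi (%xx. LI (%x. (ka xx x + ka' xx x) * f x))"
  unfolding e2 by (intro square_integrable_add K)
 show "(S + T) (abs_L2 f) = abs_L2 (%xx. LI (%x. (ka xx x + ka' xx x) * f x))"
  unfolding e2 by (simp add: blinfun.add_left K abs_L2_plus)
qed

lemma has_kernel_zero: "has_kernel 0 (%xx x. 0)"
 by (simp add: has_kernel_def abs_L2_zero)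

lemma has_kernel_sum:
 "finite I ==> (!!i. i \<in> I ==> has_kernel (S i) (ka i)) ==> has_kernel (\<Sum>i\<in>I. S i) (%xx x. \<Sum>i\<in>I. ka i xx x)"
 by (induction I rule: finite_induct) (auto intro: has_kernel_zero has_kernel_add)

section \<open>Rank one operators and exponential series\<close>

definition rank1 :: "'n::finite L2 => 'n L2 => 'n L2_op" where
 "rank1 ph \<psi> = Blinfun (%u. L2_scaleC (pair u \<psi>) ph)"

lemma rank1_apply [simp]: "ap (rank1 ph \<psi>) u = L2_scaleC (pair u \<psi>) ph"
proof -
 have "bounded_linear (%u. L2_scaleC (pair u \<psi>) ph)"
 proof (rule bounded_linear_intro)
  show "norm (L2_scaleC (pair u \<psi>) ph) <= norm u * (norm \<psi> * norm ph)" for u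
   using norm_pair_le[of u \<psi>] by (simp add: mult.assoc[symmetric] mult_right_mono)
  show "L2_scaleC (pair (r *\<^sub>R u) \<psi>) ph = r *\<^sub>R L2_scaleC (pair u \<psi>) ph" for r u
   unfolding pair_scaleR_left scaleR_conv_of_real[where 'a=complex]
   by (simp add: L2_scaleC_of_real[symmetric])
 qed (simp add: pair_add_left L2_scaleC_add_left)
 then show ?thesis by (simp add: rank1_def bounded_linear_Blinfun_apply)
qed

lemma complex_linear_rank1 [simp]: "complex_linear (rank1 ph \<psi>)"
 by (simp add: complex_linear_def pair_scaleC_left)

lemma has_kernel_rank1:
 assumes "sqi a" "sqi b"
 shows "has_kernel (rank1 (abs_L2 a) (abs_L2 b)) (%xx x. a xx * b x)"
 unfolding has_kernel_def
proof (intro allI impI conjI)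
 fix f :: "real^'a => complex" assume f: "sqi f"
 show "integrable lborel (%x. a xx * b x * f x)" for xx
  unfolding mult.assoc by (intro integrable_mult_right integrable_mult_sqi assms f)
 have e: "(%xx. LI (%x. a xx * b x * f x)) = (%xx. LI (%x. f x * b x) * a xx)"
 proof
  fix xx
  have "(%x. a xx * b x * f x) = (%x. a xx * (f x * b x))" by (simp add: mult_ac)
  then show "LI (%x. a xx * b x * f x) = LI (%x. f x * b x) * a xx"
   by (simp only: integral_mult_right_zero) (simp add: mult.commute)
 qed
 show "sqi (%xx. LI (%x. a xx * b x * f x))"
  unfolding e by (rule sqi_bdd_mult[OF assms(1) bdd_mult_const])
 show "ap (rank1 (abs_L2 a) (abs_L2 b)) (abs_L2 f) = abs_L2 (%xx. LI (%x. a xx * b x * f x))"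
  unfolding e by (simp add: pair_abs f assms L2_scaleC_abs)
qed

text \<open>If \<open>T\<close> has kernel \<open>ka\<close>, the term of index \<open>m\<close> has
  kernel \<open>w^m / m! * ka\<close> with \<open>w = \<Sum>j. a j xx * b j x\<close>. A factor
  \<open>exp w\<close>, which couples both variables of the kernel, is thus produced by bounded
  multiplications on either side.\<close>

primrec exp_term :: "'n::finite L2_op => ('n => real^'n => complex) => ('n => real^'n => complex) => nat => 'n L2_op" where
 "exp_term T a b 0 = T"
| "exp_term T a b (Suc m) = (1 / real (Suc m)) *\<^sub>R (\<Sum>j\<in>UNIV. mult_op (a j) oL exp_term T a b m oL mult_op (b j))"

definition exp_op :: "'n::finite L2_op => ('n => real^'n => complex) => ('n => real^'n => complex) => 'n L2_op" where
 "exp_op T a b = (\<Sum>m. exp_term T a b m)"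

lemma norm_exp_term_le:
 fixes T :: "'n::finite L2_op"
 assumes a: "!!j. bdd_mult (a j)" "!!j x. cmod (a j x) <= L" and b: "!!j. bdd_mult (b j)" "!!j x. cmod (b j x) <= R"
 shows "norm (exp_term T a b m) <= norm T * ((real CARD('n) * L * R) ^ m / fact m)"
proof (induction m)
 case (Suc m)
 have L: "0 <= L" "0 <= R" using a(2) b(2) norm_ge_zero order_trans by blast+
 let ?M = "norm T * ((real CARD('n) * L * R) ^ m / fact m)"
 have "norm (\<Sum>j\<in>UNIV. mult_op (a j) oL exp_term T a b m oL mult_op (b j)) <= (\<Sum>j\<in>(UNIV::'n set). L * ?M * R)"
 proof (rule sum_norm_le)
  fix j
  have "norm (mult_op (a j) oL exp_term T a b m oL mult_op (b j))
    <= norm (mult_op (a j) oL exp_term T a b m) * norm (mult_op (b j))" by (rule norm_blinfun_compose)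
  also have "... <= (norm (mult_op (a j)) * norm (exp_term T a b m)) * norm (mult_op (b j))"
   by (intro mult_right_mono norm_blinfun_compose) auto
  also have "... <= (L * ?M) * R"
   by (intro mult_mono norm_mult_op_le a b Suc mult_nonneg_nonneg L) (auto simp: L)
  finally show "norm (mult_op (a j) oL exp_term T a b m oL mult_op (b j)) <= L * ?M * R" .
 qed
 then have S: "norm (\<Sum>j\<in>UNIV. mult_op (a j) oL exp_term T a b m oL mult_op (b j)) <= real CARD('n) * (L * ?M * R)"
  by simp
 have "norm (exp_term T a b (Suc m)) = (1 / real (Suc m)) * norm (\<Sum>j\<in>UNIV. mult_op (a j) oL exp_term T a b m oL mult_op (b j))"
  unfolding exp_term.simps norm_scaleR by simp
 also have "... <= (1 / real (Suc m)) * (real CARD('n) * (L * ?M * R))"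
  by (rule mult_left_mono[OF S]) simp
 also have "... = norm T * ((real CARD('n) * L * R) ^ Suc m / fact (Suc m))"
  by (simp add: field_simps del: of_nat_Suc)
 finally show ?case .
qed simp

lemma exp_op_summable:
 fixes T :: "'n::finite L2_op"
 assumes a: "!!j. bdd_mult (a j)" "!!j x. cmod (a j x) <= L" and b: "!!j. bdd_mult (b j)" "!!j x. cmod (b j x) <= R"
 shows "summable (exp_term T a b)" "norm (exp_op T a b) <= norm T * exp (real CARD('n) * L * R)"
proof -
 let ?y = "real CARD('n) * L * R"
 have e: "(%m. norm T * (?y ^ m / fact m)) sums (norm T * exp ?y)"
  using sums_mult[OF exp_converges[of ?y], of "norm T"] by (simp add: scaleR_conv_of_real field_simps)
 have sn: "summable (%m. norm (exp_term T a b m))"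
  by (rule summable_comparison_test'[OF sums_summable[OF e]]) (use norm_exp_term_le[of a L b R, OF a b] in simp)
 then show "summable (exp_term T a b)" by (rule summable_norm_cancel)
 have "norm (exp_op T a b) <= (\<Sum>m. norm (exp_term T a b m))" unfolding exp_op_def by (rule summable_norm[OF sn])
 also have "... <= (\<Sum>m. norm T * (?y ^ m / fact m))"
  by (rule suminf_le[OF norm_exp_term_le[of a L b R, OF a b] sn sums_summable[OF e]])
 also have "... = norm T * exp ?y" using e by (rule sums_unique[symmetric])
 finally show "norm (exp_op T a b) <= norm T * exp ?y" .
qed

lemma complex_linear_exp_op:
 assumes T: "complex_linear T" and a: "!!j. bdd_mult (a j)" "!!j x. cmod (a j x) <= L" and b: "!!j. bdd_mult (b j)" "!!j x. cmod (b j x) <= R"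
 shows "complex_linear (exp_op T a b)"
proof -
 have "complex_linear (exp_term T a b m)" for m
  by (induction m) (auto intro!: T complex_linear_sum complex_linear_comp complex_linear_scaleR complex_linear_mult_op a b simp del: of_nat_Suc)
 then show ?thesis unfolding exp_op_def by (intro complex_linear_suminf exp_op_summable[of a L b R, OF a b])
qed

lemma pair_exp_op:
 assumes T: "!!u v. pair (ap T u) v = pair u (ap T' v)"
  and a: "!!j. bdd_mult (a j)" "!!j x. cmod (a j x) <= L" and b: "!!j. bdd_mult (b j)" "!!j x. cmod (b j x) <= R"
 shows "pair (exp_op T a b u) v = pair u (exp_op T' b a v)"
proof -
 have *: "pair (exp_term T a b m u) v = pair u (exp_term T' b a m v)" for m u v
 proof (induction m arbitrary: u v)
  case (Suc m)
  have "pair (L2_mult (a j) (exp_term T a b m (L2_mult (b j) u))) v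
    = pair u (L2_mult (b j) (exp_term T' b a m (L2_mult (a j) v)))" for j
   by (simp add: pair_L2_mult a b Suc)
  moreover have "pair u (r *\<^sub>R w) = r *\<^sub>R pair u w" for r w
   by (metis pair_commute pair_scaleR_left)
  ultimately show ?case
   by (simp add: blinfun.scaleR_left blinfun.sum_left pair_scaleR_left pair_sum_left pair_sum_right del: of_nat_Suc)
 qed (simp add: T)
 have s: "summable (exp_term T a b)" "summable (exp_term T' b a)"
  using exp_op_summable(1)[of a L b R, OF a b] exp_op_summable(1)[of b R a L, OF b a] by auto
 have 1: "pair (exp_op T a b u) v = (\<Sum>m. pair (exp_term T a b m u) v)"
  unfolding exp_op_def
  by (rule bounded_linear.suminf[OF bounded_linear_compose[OF bounded_linear_pair_left blinfun.bounded_linear_left] s(1)])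
 have 2: "pair u (exp_op T' b a v) = (\<Sum>m. pair u (exp_term T' b a m v))"
  unfolding exp_op_def
  by (rule bounded_linear.suminf[OF bounded_linear_compose[OF bounded_linear_pair_right blinfun.bounded_linear_left] s(2)])
 show ?thesis unfolding 1 2 * ..
qed

lemma integral_exp_sums:
 fixes f w :: "'n::finite cfun"
 assumes f: "integrable lborel f" and [measurable]: "w \<in> bm borel"
  and w: "!!x. f x ~= 0 ==> cmod (w x) <= M"
 shows "integrable lborel (%x. exp (w x) * f x)"
  "integrable lborel (%x. (w x ^ m / fact m) * f x)"
  "(%m. LI (%x. (w x ^ m / fact m) * f x)) sums LI (%x. exp (w x) * f x)"
proof -
 have [measurable]: "f \<in> bm borel" using f by auto
 have bnd: "cmod (\<Sum>i<N. w x ^ i / fact i) * cmod (f x) <= exp M * cmod (f x)" for N x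
 proof (cases "f x = 0")
  case False
  then have M0: "0 <= M" using w[OF False] norm_ge_zero order_trans by blast
  have "cmod (\<Sum>i<N. w x ^ i / fact i) <= (\<Sum>i<N. M ^ i / fact i)"
   by (rule sum_norm_le) (auto simp: norm_divide norm_power intro!: divide_right_mono power_mono w False)
  also have "... <= (\<Sum>i. M ^ i / fact i)"
   using summable_exp_generic[of M] M0 by (intro sum_le_suminf) (auto simp: scaleR_conv_of_real field_simps)
  also have "... = exp M" by (simp add: exp_def scaleR_conv_of_real field_simps)
  finally show ?thesis by (intro mult_right_mono) auto
 qed simp
 \<comment> \<open>A single term is the difference of two consecutive partial sums and inherits
   twice their bound.\<close>
 have bnd1: "cmod (w x ^ m / fact m) * cmod (f x) <= (exp M + exp M) * cmod (f x)" for m x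
 proof -
  have "w x ^ m / fact m = (\<Sum>i<Suc m. w x ^ i / fact i) - (\<Sum>i<m. w x ^ i / fact i)" by simp
  then have "cmod (w x ^ m / fact m) * cmod (f x) <= (cmod (\<Sum>i<Suc m. w x ^ i / fact i) + cmod (\<Sum>i<m. w x ^ i / fact i)) * cmod (f x)"
   by (metis norm_triangle_ineq4 mult_right_mono norm_ge_zero)
  then show ?thesis using bnd[where N="Suc m" and x=x] bnd[where N=m and x=x] by (simp only: distrib_right)
 qed
 have fi: "integrable lborel (%x. c * cmod (f x))" for c by (intro integrable_mult_right integrable_norm f)
 show ti: "integrable lborel (%x. (w x ^ m / fact m) * f x)" for m
 proof (rule Bochner_Integration.integrable_bound[OF fi[of "exp M + exp M"]])
  show "AE x in lborel. norm ((w x ^ m / fact m) * f x) <= norm ((exp M + exp M) * cmod (f x))"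
  proof (rule AE_I2)
   fix x
   have "norm ((w x ^ m / fact m) * f x) = cmod (w x ^ m / fact m) * cmod (f x)" by (rule norm_mult)
   also have "... <= (exp M + exp M) * cmod (f x)" by (rule bnd1)
   also have "... <= norm ((exp M + exp M) * cmod (f x))" unfolding real_norm_def by (rule abs_ge_self)
   finally show "norm ((w x ^ m / fact m) * f x) <= norm ((exp M + exp M) * cmod (f x))" .
  qed
 qed measurable
 have ebnd: "cmod (exp (w x) * f x) <= exp M * cmod (f x)" for x
 proof (cases "f x = 0")
  case False
  have "cmod (exp (w x)) <= exp (cmod (w x))" by (rule norm_exp)
  also have "... <= exp M" using w[OF False] by simp
  finally show ?thesis by (simp add: norm_mult mult_right_mono)
 qed simp
 show "integrable lborel (%x. exp (w x) * f x)"
  by (rule Bochner_Integration.integrable_bound[OF fi[of "exp M"]])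
    (use ebnd in \<open>auto intro: order_trans[OF _ abs_ge_self]\<close>)
 have "(%N. LI (%x. (\<Sum>i<N. w x ^ i / fact i) * f x)) ----> LI (%x. exp (w x) * f x)"
 proof (rule integral_dominated_convergence[OF _ _ fi[of "exp M"]])
  show "AE x in lborel. (%N. (\<Sum>i<N. w x ^ i / fact i) * f x) ----> exp (w x) * f x"
  proof (rule AE_I2)
   fix x
   have "(%n. w x ^ n / fact n) sums exp (w x)"
    using exp_converges[of "w x"] by (simp add: scaleR_conv_of_real field_simps)
   then show "(%N. (\<Sum>i<N. w x ^ i / fact i) * f x) ----> exp (w x) * f x"
    unfolding sums_def by (intro tendsto_mult tendsto_const)
  qed
  show "AE x in lborel. norm ((\<Sum>i<N. w x ^ i / fact i) * f x) <= exp M * cmod (f x)" for N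
   using bnd by (simp add: norm_mult)
 qed measurable
 moreover have "LI (%x. (\<Sum>i<N. w x ^ i / fact i) * f x) = (\<Sum>i<N. LI (%x. (w x ^ i / fact i) * f x))" for N
  unfolding sum_distrib_right by (rule Bochner_Integration.integral_sum) (rule ti)
 ultimately show "(%m. LI (%x. (w x ^ m / fact m) * f x)) sums LI (%x. exp (w x) * f x)"
  by (simp add: sums_def)
qed

text \<open>The partial sums converge in operator norm to \<open>exp_op\<close> and, at each
  \<open>xx\<close>, to the integral with \<open>exp w\<close>; \<open>Cauchy_L2_pointwise\<close>
  identifies the two limits.\<close>

lemma has_kernel_exp_op:
 fixes T :: "'n::finite L2_op"
 assumes T: "has_kernel T ka"
  and a: "!!j. bdd_mult (a j)" "!!j x. cmod (a j x) <= L" and b: "!!j. bdd_mult (b j)" "!!j x. cmod (b j x) <= R"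
 shows "has_kernel (exp_op T a b) (%xx x. exp (\<Sum>j\<in>UNIV. a j xx * b j x) * ka xx x)"
proof -
 define w where "w xx x = (\<Sum>j\<in>UNIV. a j xx * b j x)" for xx x
 have tk: "has_kernel (exp_term T a b m) (%xx x. (w xx x ^ m / fact m) * ka xx x)" for m
 proof (induction m)
  case 0 then show ?case using T by simp
 next
  case (Suc m)
  have "has_kernel (exp_term T a b (Suc m))
    (%xx x. cor (1 / real (Suc m)) * (\<Sum>j\<in>UNIV. a j xx * ((w xx x ^ m / fact m) * ka xx x) * b j x))"
   unfolding exp_term.simps by (intro has_kernel_scaleR has_kernel_sum has_kernel_mult a b Suc) auto
  moreover have "cor (1 / real (Suc m)) * (\<Sum>j\<in>UNIV. a j xx * ((w xx x ^ m / fact m) * ka xx x) * b j x)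
    = (w xx x ^ Suc m / fact (Suc m)) * ka xx x" for xx x
  proof -
   have "(\<Sum>j\<in>UNIV. a j xx * ((w xx x ^ m / fact m) * ka xx x) * b j x) = (\<Sum>j\<in>UNIV. (a j xx * b j x) * ((w xx x ^ m / fact m) * ka xx x))"
    by (rule sum.cong) (auto simp: mult_ac)
   also have "... = (\<Sum>j\<in>UNIV. a j xx * b j x) * ((w xx x ^ m / fact m) * ka xx x)" by (rule sum_distrib_right[symmetric])
   also have "(\<Sum>j\<in>UNIV. a j xx * b j x) = w xx x" by (simp add: w_def)
   finally show ?thesis by (simp add: field_simps del: of_nat_Suc)
  qed
  ultimately show ?case by simp
 qed
 have bnd: "cmod (w xx x) <= real CARD('n) * (L * R)" for xx x
 proof -
  have L: "0 <= L" "0 <= R" using a(2) b(2) norm_ge_zero order_trans by blast+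
  have "cmod (w xx x) <= (\<Sum>j\<in>(UNIV::'n set). L * R)" unfolding w_def
   by (rule sum_norm_le) (auto simp: norm_mult L intro!: mult_mono a b)
  then show ?thesis by simp
 qed
 have wm [measurable]: "w xx \<in> bm borel" for xx
  unfolding w_def using b(1)[THEN bdd_mult_borel] by measurable
 have s: "summable (exp_term T a b)" by (rule exp_op_summable(1)[of a L b R, OF a b])
 show ?thesis
  unfolding has_kernel_def w_def[symmetric]
 proof (intro allI impI)
  fix f :: "real^'n => complex" assume f: "sqi f"
  note E = integral_exp_sums[OF has_kernelD(1)[OF T f] wm bnd]
  let ?t = "%m xx. LI (%x. (w xx x ^ m / fact m) * ka xx x * f x)"
  let ?F = "%xx. LI (%x. exp (w xx x) * ka xx x * f x)"
  have st: "sqi (?t m)" for m by (rule has_kernelD(2)[OF tk f])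
  have ta: "ap (exp_term T a b m) (abs_L2 f) = abs_L2 (?t m)" for m by (rule has_kernelD(3)[OF tk f])
  have ps: "sqi (%xx. \<Sum>m<N. ?t m xx)" for N by (intro square_integrable_sum st)
  have pa: "abs_L2 (%xx. \<Sum>m<N. ?t m xx) = (\<Sum>m<N. exp_term T a b m) (abs_L2 f)" for N
   unfolding blinfun.sum_left ta by (rule abs_L2_sum) (rule st)
  have lim: "(%N. abs_L2 (%xx. \<Sum>m<N. ?t m xx)) ----> exp_op T a b (abs_L2 f)"
   unfolding pa exp_op_def by (rule bounded_linear.tendsto[OF blinfun.bounded_linear_left summable_LIMSEQ[OF s]])
  have pt: "(%N. \<Sum>m<N. ?t m xx) ----> ?F xx" for xx
   using E(3)[of xx] by (simp add: sums_def mult.assoc)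
  have [measurable]: "(%xx. \<Sum>m<N. ?t m xx) \<in> bm borel" for N
   using ps[of N] by (simp add: square_integrable_def)
  have "?F \<in> bm borel"
   by (rule borel_measurable_LIMSEQ_metric[OF _ pt]) measurable
  then have Fm: "?F \<in> bm lborel" by simp
  note C = Cauchy_L2_pointwise[OF ps LIMSEQ_imp_Cauchy[OF lim] Fm AE_I2[OF pt]]
  have "exp_op T a b (abs_L2 f) = abs_L2 ?F" by (rule LIMSEQ_unique[OF lim C(2)])
  then show "(\<forall>xx. integrable lborel (%x. exp (w xx x) * ka xx x * f x)) & sqi ?F & exp_op T a b (abs_L2 f) = abs_L2 ?F"
   using C(1) E(1) by (simp add: mult.assoc)
 qed
qed

section \<open>Operators of finite rank and their limits\<close>

inductive fin_rank :: "'n::finite L2_op => bool" where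
 zero: "fin_rank 0"
| step: "fin_rank K ==> fin_rank (K + rank1 ph \<psi>)"

text \<open>A stand-in for compactness: finite rank up to a small error is the form in which the
  Fredholm argument uses it.\<close>

definition approximable :: "'n::finite L2_op => bool" where
 "approximable T \<longleftrightarrow> (\<forall>e>0. \<exists>K. fin_rank K & norm (T - K) < e)"

lemma fin_rank_add: "fin_rank K' ==> fin_rank K ==> fin_rank (K + K')"
 by (induction rule: fin_rank.induct) (auto simp: add.assoc[symmetric] intro: fin_rank.intros)

lemma fin_rank_comp:
 assumes K: "fin_rank K" and S: "complex_linear S" and b: "bdd_mult b"
 shows "fin_rank (S oL K oL mult_op b)"
 using K
proof induction
 case zero
 have "S oL 0 oL mult_op b = 0" by (rule blinfun_eqI) (simp add: blinfun.zero_right)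
 then show ?case by (simp add: fin_rank.zero)
next
 case (step K ph \<psi>)
 have "S oL (K + rank1 ph \<psi>) oL mult_op b = (S oL K oL mult_op b) + rank1 (S ph) (L2_mult b \<psi>)"
  by (rule blinfun_eqI)
    (simp add: blinfun.add_left blinfun.add_right complex_linear_scaleC[OF S] pair_L2_mult b)
 then show ?case using step.IH by (simp add: fin_rank.step)
qed

lemma approximable_comp:
 assumes T: "approximable T" and S: "complex_linear S" and b: "bdd_mult b"
 shows "approximable (S oL T oL mult_op b)"
 unfolding approximable_def
proof (intro allI impI)
 fix e :: real assume e: "e > 0"
 let ?M = "(norm S + 1) * (norm (mult_op b :: 'a L2_op) + 1)"
 have M: "?M > 0" by (intro mult_pos_pos) (auto intro: add_nonneg_pos)
 obtain K where K: "fin_rank K" "norm (T - K) < e / ?M"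
  using T e M unfolding approximable_def by (meson divide_pos_pos)
 have "(S oL T oL mult_op b) - (S oL K oL mult_op b) = S oL (T - K) oL mult_op b"
  by (rule blinfun_eqI) (simp add: blinfun.diff_left blinfun.diff_right)
 also have "norm ... <= (norm S * norm (T - K)) * norm (mult_op b :: 'a L2_op)"
  by (meson norm_blinfun_compose order_trans mult_right_mono norm_ge_zero)
 also have "... <= ((norm S + 1) * norm (T - K)) * (norm (mult_op b :: 'a L2_op) + 1)"
  by (intro mult_mono) auto
 also have "... = norm (T - K) * ?M" by (simp add: mult_ac)
 also have "... < e" using K(2) M by (simp add: pos_less_divide_eq)
 finally show "\<exists>K. fin_rank K & norm ((S oL T oL mult_op b) - K) < e"
  using fin_rank_comp[OF K(1) S b] by blast
qed

lemma approximable_add: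
 assumes "approximable S" "approximable T" shows "approximable (S + T)"
 unfolding approximable_def
proof (intro allI impI)
 fix e :: real assume e: "e > 0"
 obtain K K' where K: "fin_rank K" "norm (S - K) < e/2" "fin_rank K'" "norm (T - K') < e/2"
  using assms e unfolding approximable_def by (meson half_gt_zero)
 have "norm ((S + T) - (K + K')) < e" 
  using norm_triangle_ineq[of "S - K" "T - K'"] K by (simp add: algebra_simps)
 then show "\<exists>K. fin_rank K & norm (S + T - K) < e" using fin_rank_add[OF K(3,1)] by blast
qed

lemma approximable_fin_rank: "fin_rank K ==> approximable K"
 unfolding approximable_def by (intro allI impI exI[of _ K]) simp

lemma approximable_sum: "finite I ==> (!!i. i \<in> I ==> approximable (S i)) ==> approximable (\<Sum>i\<in>I. S i)"
 by (induction I rule: finite_induct) (auto intro: approximable_add approximable_fin_rank fin_rank.zero)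

lemma approximable_lim:
 assumes "!!e. e > 0 ==> \<exists>S. approximable S & norm (T - S) < e" shows "approximable T"
 unfolding approximable_def
proof (intro allI impI)
 fix e :: real assume e: "e > 0"
 obtain S where S: "approximable S" "norm (T - S) < e/2" using assms[of "e/2"] e by auto
 obtain K where K: "fin_rank K" "norm (S - K) < e/2" using S(1) e unfolding approximable_def by (meson half_gt_zero)
 have "norm (T - K) < e" using norm_triangle_ineq[of "T - S" "S - K"] S K by simp
 then show "\<exists>K. fin_rank K & norm (T - K) < e" using K(1) by blast
qed

lemma approximable_suminf:
 assumes "!!m. approximable (X m)" "summable X" shows "approximable (suminf X)"
proof (rule approximable_lim)
 fix e :: real assume "e > 0"
 then obtain N where "norm (suminf X - (\<Sum>m<N. X m)) < e"
  using summable_LIMSEQ[OF assms(2)] unfolding LIMSEQ_iff by (metis norm_minus_commute order_refl)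
 then show "\<exists>S. approximable S & norm (suminf X - S) < e"
  using approximable_sum[of "{..<N}" X] assms(1) by blast
qed

lemma approximable_scaleR: 
 assumes "approximable (T :: 'n::finite L2_op)" shows "approximable (r *\<^sub>R T)"
proof -
 have "r *\<^sub>R T = (r *\<^sub>R I1) oL T oL mult_op (%_. 1)" by (rule blinfun_eqI) (simp add: blinfun.scaleR_left)
 then show ?thesis using approximable_comp[OF assms complex_linear_scaleR[OF complex_linear_id] bdd_mult_const[of 1], of r] by simp
qed

lemma approximable_exp_op:
 fixes T :: "'n::finite L2_op"
 assumes T: "approximable T"
  and a: "!!j. bdd_mult (a j)" "!!j x. cmod (a j x) <= L" and b: "!!j. bdd_mult (b j)" "!!j x. cmod (b j x) <= R"
 shows "approximable (exp_op T a b)"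
proof -
 have "approximable (exp_term T a b m)" for m
  by (induction m) (auto intro!: T approximable_scaleR approximable_sum approximable_comp complex_linear_mult_op a b simp del: of_nat_Suc)
 then show ?thesis unfolding exp_op_def by (intro approximable_suminf exp_op_summable(1)[of a L b R, OF a b])
qed

text \<open>On bounded sets of \<open>xx\<close> and \<open>x\<close> the exponent of the Fourier
  kernel is a finite sum of products of bounded functions. The truncated transform is therefore the
  exponential series applied to the rank one kernel \<open>indicator (cball 0 N) xx * ch x\<close>,
  and the series preserves approximability.\<close>

lemma approximable_Ft_cutoff:
 fixes ch :: "'n::finite cfun"
 assumes c: "\<bar>c\<bar> = 1" and chi: "bdd_mult ch" "sqi ch" "!!x. norm x > R ==> ch x = 0"
 shows "approximable (mult_op (indicator (cball 0 N)) oL Ft c oL mult_op ch)"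
proof -
 let ?I = "indicator (cball 0 N) :: real^'n => complex"
 have I: "bdd_mult ?I" "sqi ?I"
  using emeasure_lborel_cball_finite[of "0::real^'n" N]
  by (auto intro!: bdd_mult_indicator square_integrable_indicator simp: less_top)
 define a where "a j xx = \<i> * cor (c * xx $ j) * ?I xx" for j xx
 define b where "b j x = cor (x $ j) * indicator (cball 0 R) x" for j and x :: "real^'n"
 have "(indicator (cball 0 r) :: real^'n => complex) \<in> bm borel" for r
  by (rule bdd_mult_borel[OF bdd_mult_indicator]) simp
 then have [measurable]: "a j \<in> bm borel" "b j \<in> bm borel" for j
  unfolding a_def[abs_def] b_def[abs_def] by (intro borel_measurable_times; simp)+
 have ab: "cmod (a j x) <= \<bar>N\<bar>" for j x
  using component_le_norm_cart[of x j] c by (auto simp: a_def indicator_def norm_mult abs_mult)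
 have bb: "cmod (b j x) <= \<bar>R\<bar>" for j x
  using component_le_norm_cart[of x j] by (auto simp: b_def indicator_def norm_mult)
 have bd: "bdd_mult (a j)" "bdd_mult (b j)" for j
  by (rule bdd_multI[OF _ ab]) (rule bdd_multI[OF _ bb] | simp)+
 have k1: "has_kernel (exp_op (rank1 (abs_L2 ?I) (abs_L2 ch)) a b)
   (%xx x. exp (\<Sum>j\<in>UNIV. a j xx * b j x) * (?I xx * ch x))"
  by (rule has_kernel_exp_op[OF has_kernel_rank1[OF I(2) chi(2)] bd(1) ab bd(2) bb])
 have k2: "has_kernel (mult_op ?I oL (Ft c oL mult_op ch) oL mult_op (%_. 1))
   (%xx x. ?I xx * (exp (\<i> * cor (c * (x \<bullet> xx))) * ch x) * 1)"
  by (rule has_kernel_mult[OF has_kernel_Ft[OF c chi(1,3)] I(1) bdd_mult_const])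
 have "exp (\<Sum>j\<in>UNIV. a j xx * b j x) * (?I xx * ch x) = ?I xx * (exp (\<i> * cor (c * (x \<bullet> xx))) * ch x) * 1" for xx x
 proof (cases "norm xx <= N & norm x <= R")
  case True
  then have "(\<Sum>j\<in>UNIV. a j xx * b j x) = \<i> * cor (c * (x \<bullet> xx))"
   by (simp add: a_def b_def inner_vec_def sum_distrib_left mult_ac)
  then show ?thesis by (simp add: mult_ac)
 next
  case False
  then show ?thesis using chi(3)[of x] by (auto simp: indicator_def)
 qed
 then have "(%xx x. exp (\<Sum>j\<in>UNIV. a j xx * b j x) * (?I xx * ch x)) = (%xx x. ?I xx * (exp (\<i> * cor (c * (x \<bullet> xx))) * ch x) * 1)"
  by blast
 then have "mult_op ?I oL (Ft c oL mult_op ch) oL mult_op (%_. 1) = exp_op (rank1 (abs_L2 ?I) (abs_L2 ch)) a b"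
  using has_kernel_unique[OF k2] k1 by simp
 moreover have "mult_op ?I oL (Ft c oL mult_op ch) oL mult_op (%_. 1) = mult_op ?I oL Ft c oL mult_op ch"
  by (rule blinfun_eqI) simp
 moreover have "fin_rank (rank1 (abs_L2 ?I) (abs_L2 ch))"
  using fin_rank.step[OF fin_rank.zero] by simp
 then have "approximable (exp_op (rank1 (abs_L2 ?I) (abs_L2 ch)) a b)"
  by (intro approximable_exp_op[OF approximable_fin_rank _ ab _ bb] bd)
 ultimately show ?thesis by simp
qed

lemma approximable_mult_exp_term:
 fixes T :: "'n::finite L2_op"
 assumes I: "bdd_mult I" and T: "approximable (mult_op I oL T)"
  and a: "!!j. bdd_mult (a j)" and b: "!!j. bdd_mult (b j)"
 shows "approximable (mult_op I oL exp_term T a b m)"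
proof (induction m)
 case (Suc m)
 have "mult_op I oL exp_term T a b (Suc m)
   = (1 / real (Suc m)) *\<^sub>R (\<Sum>j\<in>UNIV. mult_op (a j) oL (mult_op I oL exp_term T a b m) oL mult_op (b j))"
  by (rule blinfun_eqI)
    (simp add: blinfun.scaleR_left blinfun.sum_left L2_mult_scaleR L2_mult_sum L2_mult_L2_mult I a mult.commute del: of_nat_Suc)
 then show ?case using Suc by (auto intro!: approximable_scaleR approximable_sum approximable_comp complex_linear_mult_op a b simp del: of_nat_Suc exp_term.simps)
qed (simp add: T)

lemma approximable_mult_exp_op:
 fixes T :: "'n::finite L2_op"
 assumes I: "bdd_mult I" and T: "approximable (mult_op I oL T)"
  and a: "!!j. bdd_mult (a j)" "!!j x. cmod (a j x) <= L" and b: "!!j. bdd_mult (b j)" "!!j x. cmod (b j x) <= R"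
 shows "approximable (mult_op I oL exp_op T a b)"
proof -
 note s = exp_op_summable(1)[of a L b R T, OF a b]
 note L = bounded_bilinear.bounded_linear_right[OF bounded_bilinear_blinfun_compose, of "mult_op I"]
 have "mult_op I oL exp_op T a b = (\<Sum>m. mult_op I oL exp_term T a b m)"
  unfolding exp_op_def by (rule bounded_linear.suminf[OF L s])
 then show ?thesis
  using approximable_suminf[OF approximable_mult_exp_term[of I T a b, OF I T a(1) b(1)] bounded_linear.summable[OF L s]]
  by simp
qed

section \<open>Integration along rays\<close>

lemma integrable_bounded_support_euclidean:
 fixes f :: "'a::euclidean_space => 'b::{banach,second_countable_topology}"
 assumes [measurable]: "f \<in> bm lborel" and B: "!!x. norm (f x) <= B"
  and R: "!!x. norm x > R ==> f x = 0"
 shows "integrable lborel f"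
proof (rule Bochner_Integration.integrable_bound)
 show "integrable lborel (%x::'a. B * indicator (cball 0 R) x)"
  using emeasure_lborel_cball_finite[of "0::'a" R] by (simp add: less_top)
 show "AE x in lborel. norm (f x) <= norm (B * indicator (cball 0 R) x)"
  using B R by (intro AE_I2) (auto simp: indicator_def intro: order_trans[OF B abs_ge_self])
qed auto

text \<open>The radii \<open>s\<close> for which \<open>r\<close> lies between \<open>s\<close> and
  \<open>2 s\<close> have logarithmic measure \<open>ln 2\<close>, whatever \<open>r\<close> is; so
  an average over rays sees every radius with the same weight.\<close>

lemma integral_inverse_dyadic:
 assumes r: "r > 0"
 shows "LI (%s::real. indicator {s. 0 < s & s <= r & r <= 2 * s} s * (1 / s)) = ln 2"
proof -
 have "has_bochner_integral lborel (%s. (1 / s) * indicator {r/2..r} s) (ln r - ln (r/2))"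
 proof (rule has_bochner_integral_FTC_Icc_real)
  show "r/2 <= r" using r by simp
  fix s assume s: "r/2 <= s" "s <= r"
  then have "s > 0" using r by simp
  then show "DERIV ln s :> 1 / s" "isCont ((/) 1) s"
   by (auto intro!: DERIV_ln_divide continuous_intros)
 qed
 moreover have "ln r - ln (r/2) = ln 2" using r by (simp add: ln_div)
 moreover have "(%s. (1 / s) * indicator {r/2..r} s) = (%s. indicator {s. 0 < s & s <= r & r <= 2 * s} s * (1 / s))"
  using r by (auto simp: indicator_def fun_eq_iff)
 ultimately show ?thesis by (simp add: has_bochner_integral_iff)
qed

text \<open>A substitute for polar coordinates: average the integrals along the rays through
  the points of the annulus \<open>1 \<le> |\<eta>| \<le> 2\<close>; Fubini and scaling give \<open>ln 2\<close> times the
  full integral.\<close>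

lemma integral_eq_0_if_ray_integrals_eq_0:
 fixes D :: "'n::finite cfun"
 assumes [measurable]: "D \<in> bm borel" and B: "!!xx. cmod (D xx) <= B"
  and supp: "!!xx. D xx ~= 0 ==> \<rho> <= norm xx & norm xx <= R" and rho: "\<rho> > 0"
  and zero: "!!\<eta>. 1 <= norm \<eta> ==> norm \<eta> <= 2 ==>
   LI (%s. indicator {0<..} s * (cor (s ^ (CARD('n) - 1)) * D (s *\<^sub>R \<eta>))) = 0"
 shows "LI D = 0"
proof -
 have B0: "0 <= B" using B norm_ge_zero order_trans by blast
 have R0: "0 <= R \<or> D = (%_. 0)" using supp norm_ge_zero order_trans by blast
 define G where "G s \<eta> = indicator {0<..} s * (indicator {\<eta>. 1 <= norm \<eta> & norm \<eta> <= 2} \<eta> * (cor (s ^ (CARD('n) - 1)) * D (s *\<^sub>R \<eta>)))" for s and \<eta> :: "real^'n"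
 define H where "H s xx = cor (indicator {s. 0 < s & s <= norm xx & norm xx <= 2 * s} s * (1 / s)) * D xx" for s and xx :: "real^'n"
 have Gs: "0 < s & s <= R & 1 <= norm \<eta> & norm \<eta> <= 2" if "G s \<eta> ~= 0" for s \<eta>
 proof -
  have 1: "0 < s" "1 <= norm \<eta>" "norm \<eta> <= 2" "D (s *\<^sub>R \<eta>) ~= 0"
   using that by (auto simp: G_def indicator_def split: if_splits)
  have "s * norm \<eta> <= R" using supp[OF 1(4)] 1(1) by simp
  moreover have "s * 1 <= s * norm \<eta>" using 1 by (intro mult_left_mono) auto
  ultimately have "s <= R" by linarith
  then show ?thesis using 1 by simp
 qed
 have Hs: "0 < s & s <= R & \<rho> <= 2 * s & norm xx <= R" if "H s xx ~= 0" for s xx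
 proof -
  have 1: "0 < s" "s <= norm xx" "norm xx <= 2 * s" "D xx ~= 0"
   using that by (auto simp: H_def indicator_def split: if_splits)
  then show ?thesis using supp[OF 1(4)] by auto
 qed
 have pnorm: "norm p <= norm (fst p) + norm (snd p)" for p :: "real \<times> (real^'n)"
  using norm_Pair_le[of "fst p" "snd p"] by simp
 have Gi: "integrable (lborel \<Otimes>\<^sub>M lborel) (%(s, \<eta>). G s \<eta>)"
  unfolding lborel_prod
 proof (rule integrable_bounded_support_euclidean[where B="\<bar>R\<bar> ^ (CARD('n) - 1) * B" and R="\<bar>R\<bar> + 2"])
  have "(%p. case p of (s, \<eta>) => G s \<eta>) \<in> bm (borel \<Otimes>\<^sub>M borel)" unfolding G_def by measurable
  then show "(%(s, \<eta>). G s \<eta>) \<in> bm lborel" by (simp add: borel_prod)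
  fix p :: "real \<times> (real^'n)"
  show "norm (case p of (s, \<eta>) => G s \<eta>) <= \<bar>R\<bar> ^ (CARD('n) - 1) * B"
  proof (cases "G (fst p) (snd p) = 0")
   case False
   from Gs[OF this] have "\<bar>fst p\<bar> <= \<bar>R\<bar>" by simp
   then have "cmod (cor (fst p ^ (CARD('n) - 1)) * D (fst p *\<^sub>R snd p)) <= \<bar>R\<bar> ^ (CARD('n) - 1) * B"
    unfolding norm_mult norm_of_real power_abs by (intro mult_mono power_mono B) auto
   moreover have "G (fst p) (snd p) = cor (fst p ^ (CARD('n) - 1)) * D (fst p *\<^sub>R snd p)"
    using Gs[OF False] by (simp add: G_def)
   ultimately show ?thesis by (simp add: case_prod_beta)
  qed (simp add: case_prod_beta B0)
  show "(case p of (s, \<eta>) => G s \<eta>) = 0" if "norm p > \<bar>R\<bar> + 2"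
   using Gs[of "fst p" "snd p"] pnorm[of p] that by (force simp: case_prod_beta)
 qed
 have Hi: "integrable (lborel \<Otimes>\<^sub>M lborel) (%(s, xx). H s xx)"
  unfolding lborel_prod
 proof (rule integrable_bounded_support_euclidean[where B="(2 / \<rho>) * B" and R="\<bar>R\<bar> + \<bar>R\<bar>"])
  have "(%p. case p of (s, \<eta>) => H s \<eta>) \<in> bm (borel \<Otimes>\<^sub>M borel)" unfolding H_def indicator_def by measurable
  then show "(%(s, xx). H s xx) \<in> bm lborel" by (simp add: borel_prod)
  fix p :: "real \<times> (real^'n)"
  show "norm (case p of (s, xx) => H s xx) <= (2 / \<rho>) * B"
  proof (cases "H (fst p) (snd p) = 0")
   case False
   note s = Hs[OF this]
   have "\<bar>1 / fst p\<bar> <= 2 / \<rho>" using s rho by (simp add: frac_le_eq field_simps)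
   then have "cmod (cor (1 / fst p) * D (snd p)) <= (2 / \<rho>) * B"
    unfolding norm_mult norm_of_real using rho by (intro mult_mono B) auto
   moreover have "H (fst p) (snd p) = cor (1 / fst p) * D (snd p)"
    using False by (auto simp: H_def indicator_def split: if_splits)
   ultimately show ?thesis by (simp add: case_prod_beta)
  qed (use rho in \<open>simp add: case_prod_beta B0\<close>)
  show "(case p of (s, xx) => H s xx) = 0" if "norm p > \<bar>R\<bar> + \<bar>R\<bar>"
   using Hs[of "fst p" "snd p"] pnorm[of p] that by (force simp: case_prod_beta)
 qed
 \<comment> \<open>The substitution \<open>xx = s *\<eta>\<close> carries the annulus between 1 and
   2 to the one between \<open>s\<close> and \<open>2 s\<close>. Of its Jacobian \<open>s^n\<close>
   one power goes against the weight \<open>1 / s\<close> in \<open>H\<close>, which leaves the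
   \<open>s^(n-1)\<close> of the ray integrals.\<close>
 have GH: "(\<integral>\<eta>. G s \<eta> \<partial>lborel) = (\<integral>xx. H s xx \<partial>lborel)" for s
 proof (cases "s > 0")
  case True
  define f where "f xx = indicator {xx. s <= norm xx & norm xx <= 2 * s} xx * D xx" for xx
  have [measurable]: "f \<in> bm borel" unfolding f_def by measurable
  have fs: "f (s *\<^sub>R \<eta>) = indicator {\<eta>. 1 <= norm \<eta> & norm \<eta> <= 2} \<eta> * D (s *\<^sub>R \<eta>)" for \<eta>
   using True by (simp add: f_def indicator_def)
  have fi: "LI f = s ^ CARD('n) *\<^sub>R LI (%\<eta>. f (s *\<^sub>R \<eta>))"
   using integral_scaleR_arg(1)[OF True, of f] by simp
  have "(\<integral>xx. H s xx \<partial>lborel) = (\<integral>xx. cor (1 / s) * f xx \<partial>lborel)"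
   by (rule Bochner_Integration.integral_cong) (use True in \<open>auto simp: H_def f_def indicator_def\<close>)
  also have "... = cor (1 / s) * (s ^ CARD('n) *\<^sub>R LI (%\<eta>. f (s *\<^sub>R \<eta>)))"
   by (subst integral_mult_right_zero) (rule arg_cong[OF fi])
  also have "... = cor (s ^ (CARD('n) - 1)) * LI (%\<eta>. f (s *\<^sub>R \<eta>))"
  proof -
   have "s ^ CARD('n) = s * s ^ (CARD('n) - 1)" by (metis power_eq_if zero_less_card_finite less_not_refl)
   then show ?thesis using True by (simp add: scaleR_conv_of_real)
  qed
  also have "... = (\<integral>\<eta>. cor (s ^ (CARD('n) - 1)) * f (s *\<^sub>R \<eta>) \<partial>lborel)" by (rule integral_mult_right_zero[symmetric])
  also have "... = (\<integral>\<eta>. G s \<eta> \<partial>lborel)"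
   by (rule Bochner_Integration.integral_cong) (use True in \<open>auto simp: G_def fs\<close>)
  finally show ?thesis by simp
 next
  case False
  then have "G s \<eta> = 0" "H s \<eta> = 0" for \<eta> by (auto simp: G_def H_def)
  then show ?thesis by simp
 qed
 have G0: "(\<integral>s. G s \<eta> \<partial>lborel) = 0" for \<eta>
 proof (cases "1 <= norm \<eta> & norm \<eta> <= 2")
  case True
  then show ?thesis using zero[of \<eta>] by (simp add: G_def)
 qed (auto simp: G_def)
 have "0 = (\<integral>\<eta>. (\<integral>s. G s \<eta> \<partial>lborel) \<partial>lborel)" by (simp add: G0)
 also have "... = (\<integral>s. (\<integral>\<eta>. G s \<eta> \<partial>lborel) \<partial>lborel)" by (rule lborel_pair.Fubini_integral[OF Gi])
 also have "... = (\<integral>s. (\<integral>xx. H s xx \<partial>lborel) \<partial>lborel)" by (simp add: GH)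
 also have "... = (\<integral>xx. (\<integral>s. H s xx \<partial>lborel) \<partial>lborel)" by (rule lborel_pair.Fubini_integral[OF Hi, symmetric])
 also have "... = (\<integral>xx. cor (ln 2) * D xx \<partial>lborel)"
 proof (rule Bochner_Integration.integral_cong)
  fix xx
  show "(\<integral>s. H s xx \<partial>lborel) = cor (ln 2) * D xx"
  proof (cases "D xx = 0")
   case False
   then have "norm xx > 0" using supp[OF False] rho by linarith
   from integral_inverse_dyadic[OF this] show ?thesis
    unfolding H_def by (simp only: integral_mult_left_zero integral_complex_of_real)
  qed (simp add: H_def)
 qed simp
 finally show ?thesis by simp
qed

section \<open>Contour deformation\<close>

text \<open>A triangular detour: near \<open>k0\<close> the radius is lowered by up to
  \<open>L\<close> into the lower half-plane, and at distance \<open>L\<close> or more it stays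
  real. Being piecewise linear, the path and its derivative are explicit, at the cost of
  kinks.\<close>

definition tent :: "real => real => real => real" where "tent k0 L r = max 0 (L - \<bar>r - k0\<bar>)"
definition zeta :: "real => real => real => complex" where "zeta k0 L r = Complex r (- tent k0 L r)"
definition dzeta :: "real => real => real => complex" where
 "dzeta k0 L r = (if \<bar>r - k0\<bar> < L then Complex 1 (sgn (r - k0)) else 1)"

lemma tent_continuous: "continuous_on A (tent k0 L)"
 unfolding tent_def[abs_def] by (intro continuous_intros)
lemma tent_measurable [measurable]: "tent k0 L \<in> bm borel"
 unfolding tent_def[abs_def] by measurable
lemma zeta_eq: "zeta k0 L r = cor r - \<i> * cor (tent k0 L r)"
 by (simp add: zeta_def complex_eq_iff)
lemma zeta_measurable [measurable]: "zeta k0 L \<in> bm borel"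
 unfolding zeta_eq[abs_def] by measurable
lemma dzeta_measurable [measurable]: "dzeta k0 L \<in> bm borel"
proof -
 have "dzeta k0 L = (%r. if \<bar>r - k0\<bar> < L then 1 + \<i> * cor (sgn (r - k0)) else 1)"
  by (auto simp: dzeta_def fun_eq_iff complex_eq_iff)
 then show ?thesis by simp
qed
lemma zeta_outside: "\<bar>r - k0\<bar> \<ge> L ==> zeta k0 L r = cor r" "\<bar>r - k0\<bar> \<ge> L ==> tent k0 L r = 0"
 by (auto simp: zeta_def tent_def complex_eq_iff)
lemma norm_dzeta_le: "cmod (dzeta k0 L r) <= 2"
 using cmod_le[of "dzeta k0 L r"] by (auto simp: dzeta_def sgn_if split: if_splits)
lemma tent_bounds: "0 <= tent k0 L r" "0 <= L ==> tent k0 L r <= L"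
 by (auto simp: tent_def)

text \<open>The integrand has a primitive on a convex region containing both paths, and these share
  their end points. The region is free of zeros of the denominator because \<open>z\<close> lies
  above the real axis while the detour goes below it.\<close>

lemma deformation_along_ray:
 fixes A :: "complex => complex"
 assumes A: "A holomorphic_on UNIV" and z: "Im z > 0" and c: "c > 0" and e: "e > 0"
  and L: "0 < L" "L < k0"
 defines "Q \<equiv> %t. A t / (cor c * t\<^sup>2 - z)"
 shows "LI (%s. indicator {0<..} s * (Q (zeta k0 L (s * e) / cor e) * dzeta k0 L (s * e) - Q (cor s))) = 0"
proof -
 define a where "a = (k0 - L) / e"
 define b where "b = (k0 + L) / e"
 define m where "m = k0 / e"
 have ab: "0 < a" "a < m" "m < b" using L e by (auto simp: a_def b_def m_def divide_strict_right_mono)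
 define t where "t s = zeta k0 L (s * e) / cor e" for s
 have t_eq: "t s = cor s - \<i> * cor (tent k0 L (s * e) / e)" for s
  using e by (simp add: t_def zeta_eq diff_divide_distrib)
 \<comment> \<open>For \<open>0 < Re w < b + 1\<close> and \<open>Im w < d\<close> the imaginary
   part of \<open>c w^2\<close> is at most \<open>2 c (b + 1) d = Im z / 2\<close>. So a thin strip
   above the real axis is still free of zeros, and the region can be open while containing the real
   path.\<close>
 define d where "d = Im z / (4 * c * (b + 1))"
 have d: "d > 0" using z c ab by (simp add: d_def)
 define S where "S = {w. 0 < Re w} \<inter> {w. Re w < b + 1} \<inter> {w. Im w < d}"
 have S: "open S" "convex S" unfolding S_def
  by (intro open_Int open_halfspace_Re_gt open_halfspace_Re_lt open_halfspace_Im_lt convex_Int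
    convex_halfspace_Re_gt convex_halfspace_Re_lt convex_halfspace_Im_lt)+
 have den: "cor c * w\<^sup>2 - z ~= 0" if "w \<in> S" for w
 proof -
  have w: "0 < Re w" "Re w < b + 1" "Im w < d" using that by (auto simp: S_def)
  have "Re w * Im w <= (b + 1) * d"
  proof (cases "Im w <= 0")
   case True
   then have "Re w * Im w <= 0" using w by (simp add: mult_nonneg_nonpos)
   also have "0 <= (b + 1) * d" using ab d by simp
   finally show ?thesis .
  qed (use w d in \<open>auto intro!: mult_mono\<close>)
  then have "c * (2 * (Re w * Im w)) <= c * (2 * ((b + 1) * d))" using c by simp
  also have "... = Im z / 2"
  proof -
   have "c * (2 * (y * (v / (4 * c * y)))) = v / 2" if "y ~= 0" for y v :: real using that c by simp
   moreover have "b + 1 ~= 0" using ab by linarith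
   ultimately show ?thesis unfolding d_def by blast
  qed
  also have "... < Im z" using z by simp
  finally have "Im (cor c * w\<^sup>2 - z) < 0" by (simp add: power2_eq_square algebra_simps)
  then show ?thesis by auto
 qed
 have Qh: "Q holomorphic_on S" unfolding Q_def
  by (intro holomorphic_intros holomorphic_on_subset[OF A] den) auto
 obtain H where H: "!!w. w \<in> S ==> (H has_field_derivative Q w) (at w within S)"
  by (rule holomorphic_convex_primitive'[OF S(2,1) Qh]) (rule that)
 have H': "(H has_field_derivative Q w) (at w)" if "w \<in> S" for w
  using H[OF that] unfolding at_within_open[OF that S(1)] .
 have tS: "t s \<in> S" "cor s \<in> S" if "s \<in> {a..b}" for s
  using that ab d tent_bounds(1)[of k0 L "s * e"] e by (auto simp: S_def t_eq intro: le_less_trans[of _ 0])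
 have tcont: "continuous_on {a..b} t"
  unfolding t_eq[abs_def]
  by (intro continuous_intros continuous_on_compose2[OF tent_continuous[of UNIV]]) (use e in auto)
 have Hc: "continuous_on S H" using H' by (meson DERIV_isCont continuous_at_imp_continuous_on)
 have Qc: "continuous_on S Q" using Qh by (rule holomorphic_on_imp_continuous_on)
 define f where "f s = Q (t s) * dzeta k0 L (s * e) - Q (cor s)" for s
 have tend: "t s = cor s" "dzeta k0 L (s * e) = 1" if "s <= a \<or> b <= s" for s
 proof -
  have "L <= \<bar>s * e - k0\<bar>" using that e by (auto simp: a_def b_def pos_le_divide_eq pos_divide_le_eq)
  then show "t s = cor s" "dzeta k0 L (s * e) = 1"
   using zeta_outside[of L "s * e" k0] e by (auto simp: t_def dzeta_def)
 qed
 \<comment> \<open>The path has its interior kink at \<open>m\<close>, which the exceptional set of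
   the fundamental theorem takes in. At \<open>a\<close> and \<open>b\<close> the path is real, so
   the boundary terms cancel.\<close>
 have "(f has_integral ((H (t b) - H (cor b)) - (H (t a) - H (cor a)))) {a..b}"
 proof (rule fundamental_theorem_of_calculus_interior_strong[where S="{m}"])
  show "continuous_on {a..b} (%s. H (t s) - H (cor s))"
   by (intro continuous_intros continuous_on_compose2[OF Hc] tcont) (use tS in auto)
  fix s assume s: "s \<in> {a<..<b} - {m}"
  then have sab: "s \<in> {a..b}" by auto
  have sb: "\<bar>s * e - k0\<bar> < L" using s e by (auto simp: a_def b_def abs_less_iff pos_less_divide_eq pos_divide_less_eq)
  have td: "(t has_vector_derivative dzeta k0 L (s * e)) (at s)"
  proof (cases "s < m")
   case True
   have "((%s. cor s - \<i> * cor ((L - k0 + s * e) / e)) has_vector_derivative (1 - \<i>)) (at s)"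
    using e by (auto intro!: derivative_eq_intros simp: has_vector_derivative_def scaleR_conv_of_real algebra_simps)
   then have "(t has_vector_derivative (1 - \<i>)) (at s)"
   proof (rule has_vector_derivative_transform_within_open[where S="{a<..<m}"])
    fix y assume "y \<in> {a<..<m}"
    then have "k0 - L < y * e" "y * e < k0" using e by (auto simp: a_def m_def pos_less_divide_eq pos_divide_less_eq)
    then show "cor y - \<i> * cor ((L - k0 + y * e) / e) = t y" by (simp add: t_eq tent_def)
   qed (use s True in auto)
   moreover have "s * e - k0 < 0" using True e by (simp add: m_def pos_less_divide_eq)
   then have "dzeta k0 L (s * e) = 1 - \<i>" using sb by (simp add: dzeta_def complex_eq_iff)
   ultimately show ?thesis by simp
  next
   case False
   then have sm: "m < s" using s by auto
   have "((%s. cor s - \<i> * cor ((L + k0 - s * e) / e)) has_vector_derivative (1 + \<i>)) (at s)"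
    using e by (auto intro!: derivative_eq_intros simp: has_vector_derivative_def scaleR_conv_of_real algebra_simps)
   then have "(t has_vector_derivative (1 + \<i>)) (at s)"
   proof (rule has_vector_derivative_transform_within_open[where S="{m<..<b}"])
    fix y assume "y \<in> {m<..<b}"
    then have "k0 < y * e" "y * e < k0 + L" using e by (auto simp: b_def m_def pos_less_divide_eq pos_divide_less_eq)
    then show "cor y - \<i> * cor ((L + k0 - y * e) / e) = t y" by (simp add: t_eq tent_def)
   qed (use s sm in auto)
   moreover have "s * e - k0 > 0" using sm e by (simp add: m_def pos_divide_less_eq)
   then have "dzeta k0 L (s * e) = 1 + \<i>" using sb by (simp add: dzeta_def complex_eq_iff)
   ultimately show ?thesis by simp
  qed
  have 1: "((H \<circ> t) has_vector_derivative (dzeta k0 L (s * e) * Q (t s))) (at s)"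
   by (rule field_vector_diff_chain_at[OF td H'[OF tS(1)[OF sab]]])
  have id: "(cor has_vector_derivative 1) (at s)"
   by (auto intro!: derivative_eq_intros simp: has_vector_derivative_def scaleR_conv_of_real)
  have 2: "((H \<circ> cor) has_vector_derivative (1 * Q (cor s))) (at s)"
   by (rule field_vector_diff_chain_at[OF id H'[OF tS(2)[OF sab]]])
  show "((%s. H (t s) - H (cor s)) has_vector_derivative f s) (at s)"
   using has_vector_derivative_diff[OF 1 2] by (simp add: f_def comp_def mult.commute)
 qed (use ab in auto)
 then have hi: "(f has_integral 0) {a..b}" using tend(1)[of a] tend(1)[of b] by simp
 define g where "g s = indicator {0<..} s * f s" for s
 have g_eq: "g s = (if s \<in> {a..b} then f s else 0)" for s
 proof (cases "s \<in> {a..b}")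
  case True then show ?thesis using ab by (simp add: g_def)
 next
  case False
  then have "f s = 0" using tend[of s] by (auto simp: f_def)
  then show ?thesis using False by (simp add: g_def)
 qed
 have gUNIV: "(g has_integral 0) UNIV" unfolding g_eq[abs_def] using hi by (simp only: has_integral_restrict_UNIV)
 have "integrable lborel g"
 proof -
  have c1: "continuous_on {a..b} (%s. Q (t s))" "continuous_on {a..b} (%s. Q (cor s))"
   by (intro continuous_on_compose2[OF Qc] tcont continuous_intros; use tS in auto)+
  obtain B1 where B1: "!!s. s \<in> {a..b} ==> cmod (Q (t s)) <= B1"
   using compact_continuous_image[OF c1(1) compact_Icc] compact_imp_bounded by (force simp: bounded_iff)
  obtain B2 where B2: "!!s. s \<in> {a..b} ==> cmod (Q (cor s)) <= B2"
   using compact_continuous_image[OF c1(2) compact_Icc] compact_imp_bounded by (force simp: bounded_iff)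
  have meq: "g = (%s. (indicator {a..b} s *\<^sub>R Q (t s)) * dzeta k0 L (s * e) - indicator {a..b} s *\<^sub>R Q (cor s))"
   by (auto simp: g_eq f_def indicator_def fun_eq_iff)
  have [measurable]: "(%s. indicator {a..b} s *\<^sub>R Q (t s)) \<in> bm borel"
    "(%s. indicator {a..b} s *\<^sub>R Q (cor s)) \<in> bm borel"
   by (intro borel_measurable_continuous_on_indicator c1 atLeastAtMost_borel)+
  have gm: "g \<in> bm lborel" unfolding meq by measurable
  show ?thesis
  proof (rule integrable_bounded_support_euclidean[OF gm, where B="\<bar>B1\<bar> * 2 + \<bar>B2\<bar>" and R=b])
   fix s
   show "cmod (g s) <= \<bar>B1\<bar> * 2 + \<bar>B2\<bar>"
   proof (cases "s \<in> {a..b}")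
    case True
    have "cmod (g s) <= cmod (Q (t s)) * cmod (dzeta k0 L (s * e)) + cmod (Q (cor s))"
     using True norm_triangle_ineq4[of "Q (t s) * dzeta k0 L (s * e)" "Q (cor s)"] by (simp add: g_eq f_def norm_mult)
    also have "... <= \<bar>B1\<bar> * 2 + \<bar>B2\<bar>"
     using B1[OF True] B2[OF True] by (intro add_mono mult_mono norm_dzeta_le) auto
    finally show ?thesis .
   qed (auto simp: g_eq)
   show "g s = 0" if "norm s > b" using that ab by (auto simp: g_eq)
  qed
 qed
 from has_integral_unique[OF has_integral_integral_lborel[OF this] gUNIV]
 show ?thesis by (simp only: g_def[abs_def] f_def t_def)
qed

lemma entire_exp_integral:
 fixes f :: "'n::finite cfun"
 assumes f: "integrable lborel f" "!!x. norm x > R ==> f x = 0"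
 shows "(%t. LI (%x. exp (c * t * cor (x \<bullet> \<eta>)) * f x)) holomorphic_on UNIV"
proof -
 let ?F = "%t. LI (%x. exp (c * t * cor (x \<bullet> \<eta>)) * f x)"
 define a where "a m = LI (%x. ((c * cor (x \<bullet> \<eta>)) ^ m / fact m) * f x)" for m
 have "(%m. a m * (t - 0) ^ m) sums ?F t" for t
 proof -
  have "(%m. LI (%x. ((c * t * cor (x \<bullet> \<eta>)) ^ m / fact m) * f x)) sums ?F t"
  proof (rule integral_exp_sums(3)[OF f(1), where M="cmod (c * t) * (\<bar>R\<bar> * norm \<eta>)"])
   fix x assume "f x ~= 0"
   then have "norm x <= \<bar>R\<bar>" using f(2)[of x] by fastforce
   then have "\<bar>x \<bullet> \<eta>\<bar> <= \<bar>R\<bar> * norm \<eta>"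
    by (intro order_trans[OF Cauchy_Schwarz_ineq2] mult_right_mono) auto
   then show "cmod (c * t * cor (x \<bullet> \<eta>)) <= cmod (c * t) * (\<bar>R\<bar> * norm \<eta>)"
    by (simp add: norm_mult mult_left_mono)
  qed measurable
  moreover have "LI (%x. ((c * t * cor (x \<bullet> \<eta>)) ^ m / fact m) * f x) = a m * (t - 0) ^ m" for m
  proof -
   have "(%x. ((c * t * cor (x \<bullet> \<eta>)) ^ m / fact m) * f x) = (%x. (((c * cor (x \<bullet> \<eta>)) ^ m / fact m) * f x) * t ^ m)"
    by (simp add: power_mult_distrib mult_ac)
   then show ?thesis unfolding a_def by (simp only: integral_mult_left_zero diff_zero)
  qed
  ultimately show ?thesis by simp
 qed
 then have "?F holomorphic_on ball 0 r" for r by (intro power_series_holomorphic[of 0 r a])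
 then have "?F holomorphic_on (\<Union>r. ball 0 r)" by (intro holomorphic_on_UN_open) auto
 moreover have "(\<Union>r. ball 0 r) = (UNIV :: complex set)" 
  by (auto intro: gt_ex)
 ultimately show ?thesis by simp
qed

section \<open>Holomorphic families of multiplication operators\<close>

lemma mult_op_diff: "bdd_mult f ==> bdd_mult g ==> mult_op (%x. f x - g x) = mult_op f - mult_op g"
 by (rule blinfun_eqI) (simp add: blinfun.diff_left L2_mult_diff_left)

lemma op_scaleC_mult_op: "bdd_mult f ==> op_scaleC c (mult_op f) = mult_op (%x. c * f x)"
 by (rule blinfun_eqI) (simp add: L2_mult_scaleC_left)

text \<open>\<open>g\<close> may be unbounded, as symbols of derivatives are; so one quotient
  \<open>g / (Q - z)\<close> is controlled by \<open>C\<close> and the further factors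
  \<open>1 / (Q - z)\<close> by \<open>1 / \<delta>\<close>. The remainder of the derivative is
  exactly \<open>(w - z)^2 g / ((Q - w) (Q - z)^2)\<close>.\<close>

lemma holo_mult_op_quotient:
 fixes g Q :: "'n::finite cfun"
 assumes S: "open S" and [measurable]: "g \<in> bm borel" "Q \<in> bm borel"
  and d: "\<delta> > 0" "!!z x. z \<in> S ==> \<delta> <= cmod (Q x - z)"
  and C: "!!z x. z \<in> S ==> cmod (g x) <= C * cmod (Q x - z)"
 shows "holo (%z. mult_op (%x. g x / (Q x - z))) S" "!!z. z \<in> S ==> bdd_mult (%x. g x / (Q x - z))"
proof -
 have nz: "Q x - z ~= 0" "cmod (Q x - z) > 0" if "z \<in> S" for z x
  using d(2)[OF that, of x] d(1) by auto
 have b1: "cmod (g x / (Q x - z)) <= C" if "z \<in> S" for z x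
  using C[OF that, of x] nz[OF that, of x] by (simp add: norm_divide pos_divide_le_eq)
 show bd: "bdd_mult (%x. g x / (Q x - z))" if "z \<in> S" for z
  by (rule bdd_multI[OF _ b1[OF that]]) measurable
 have inv: "cmod (1 / (Q x - z)) <= 1 / \<delta>" if "z \<in> S" for z x
  using d(2)[OF that, of x] d(1) by (simp add: norm_divide frac_le)
 have bdi: "bdd_mult (%x. 1 / (Q x - z))" if "z \<in> S" for z
  by (rule bdd_multI[OF _ inv[OF that]]) measurable
 show "holo (%z. mult_op (%x. g x / (Q x - z))) S"
 proof (rule holoI)
  fix z assume z: "z \<in> S"
  show "complex_linear (mult_op (%x. g x / (Q x - z)))" by (rule complex_linear_mult_op[OF bd[OF z]])
  obtain r where r: "r > 0" "ball z r \<subseteq> S" using S z openE by blast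
  have bD: "bdd_mult (%x. g x / (Q x - z) * (1 / (Q x - z)))" by (intro bdd_mult_mult bd bdi z)
  have C0: "0 <= C" using b1[OF z] norm_ge_zero order_trans by blast
  show "((%z. mult_op (%x. g x / (Q x - z))) has_derivative
    (%w. op_scaleC w (mult_op (%x. g x / (Q x - z) * (1 / (Q x - z)))))) (at z)"
   unfolding has_derivative_at_alt
  proof (intro conjI allI impI)
   show "bounded_linear (%w. op_scaleC w (mult_op (%x. g x / (Q x - z) * (1 / (Q x - z)))))"
    by (rule bounded_linear_op_scaleC)
   fix e :: real assume e: "e > 0"
   define K where "K = C * (1 / \<delta>) * (1 / \<delta>)"
   have K0: "K \<ge> 0" using C0 d(1) by (simp add: K_def)
   have main: "norm (mult_op (%x. g x / (Q x - w)) - mult_op (%x. g x / (Q x - z))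
     - op_scaleC (w - z) (mult_op (%x. g x / (Q x - z) * (1 / (Q x - z))))) <= K * cmod (w - z) * cmod (w - z)"
    if w: "w \<in> S" for w
   proof -
    have eq: "g x / (Q x - w) - g x / (Q x - z) - (w - z) * (g x / (Q x - z) * (1 / (Q x - z)))
      = (w - z) * (w - z) * (g x / (Q x - w) * (1 / (Q x - z)) * (1 / (Q x - z)))" for x
    proof -
     have "G / p - G / q - (q - p) * (G / q * (1 / q)) = (q - p) * (q - p) * (G / p * (1 / q) * (1 / q))"
      if "p ~= 0" "q ~= 0" for G p q :: complex
      using that by (simp add: field_simps)
     from this[OF nz(1)[OF w] nz(1)[OF z], of "g x" x x] show ?thesis by simp
    qed
    have "mult_op (%x. g x / (Q x - w)) - mult_op (%x. g x / (Q x - z))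
     - op_scaleC (w - z) (mult_op (%x. g x / (Q x - z) * (1 / (Q x - z))))
     = mult_op (%x. g x / (Q x - w) - g x / (Q x - z) - (w - z) * (g x / (Q x - z) * (1 / (Q x - z))))"
     by (simp only: op_scaleC_mult_op[OF bD] mult_op_diff[OF bdd_mult_diff[OF bd[OF w] bd[OF z]] bdd_mult_mult[OF bdd_mult_const bD]]
        mult_op_diff[OF bd[OF w] bd[OF z]])
    also have "norm ... <= K * cmod (w - z) * cmod (w - z)"
     unfolding eq
    proof (rule norm_mult_op_le)
     show "bdd_mult (%x. (w - z) * (w - z) * (g x / (Q x - w) * (1 / (Q x - z)) * (1 / (Q x - z))))"
      by (intro bdd_mult_mult bdd_mult_const bd bdi w z)
     fix x
     have "cmod (g x / (Q x - w) * (1 / (Q x - z)) * (1 / (Q x - z))) <= K"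
      unfolding norm_mult K_def using C0 d(1) by (intro mult_mono b1[OF w] inv[OF z]) auto
     then have "cmod ((w - z) * (w - z)) * cmod (g x / (Q x - w) * (1 / (Q x - z)) * (1 / (Q x - z))) <= cmod ((w - z) * (w - z)) * K"
      by (rule mult_left_mono) simp
     then show "cmod ((w - z) * (w - z) * (g x / (Q x - w) * (1 / (Q x - z)) * (1 / (Q x - z)))) <= K * cmod (w - z) * cmod (w - z)"
      by (simp only: norm_mult[of "(w - z) * (w - z)"] norm_mult[of "w - z"] mult.commute[of K] mult.assoc mult.left_commute[of K])
    qed
    finally show ?thesis .
   qed
   show "\<exists>da>0. \<forall>y. norm (y - z) < da -->
     norm (mult_op (%x. g x / (Q x - y)) - mult_op (%x. g x / (Q x - z))
     - op_scaleC (y - z) (mult_op (%x. g x / (Q x - z) * (1 / (Q x - z))))) <= e * norm (y - z)"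
   proof (intro exI[of _ "min r (e / (K + 1))"] conjI allI impI)
    show "0 < min r (e / (K + 1))" using r e K0 by simp
    fix y assume y: "norm (y - z) < min r (e / (K + 1))"
    then have "y \<in> S" using r(2) by (auto simp: dist_norm norm_minus_commute subset_iff)
    note main[OF this]
    also have "K * cmod (y - z) * cmod (y - z) <= ((K + 1) * (e / (K + 1))) * cmod (y - z)"
     using y K0 by (intro mult_right_mono mult_mono) auto
    also have "... = e * norm (y - z)" using K0 by simp
    finally show "norm (mult_op (%x. g x / (Q x - y)) - mult_op (%x. g x / (Q x - z))
     - op_scaleC (y - z) (mult_op (%x. g x / (Q x - z) * (1 / (Q x - z))))) <= e * norm (y - z)" .
   qed
  qed
 qed
qed

section \<open>Continuation of the cut-off free resolvent and its derivatives\<close>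

text \<open>A list of directions serves as multi-index; for \<open>Z = xi\<close> the product is the
  symbol of the iterated derivative.\<close>

definition pol :: "'n list => ('n => complex) => complex" where
 "pol \<alpha> Z = prod_list (map Z \<alpha>)"

text \<open>The free resolvent between two cut-offs, with the derivatives listed in
  \<open>\<alpha>\<close> applied before the outer one.\<close>

definition Tfree :: "('n::finite cfun) => real => 'n list => complex => 'n L2_op" where
 "Tfree ch h \<alpha> z = mult_op ch oL Mop (%xx. pol \<alpha> (%i. xi i xx) * rz h z xx) oL mult_op ch"

definition tau :: "real => real => 'n => 'n::finite cfun" where
 "tau k0 L j xx = cor (tent k0 L (norm xx) * (sgn xx $ j))"

definition coordR :: "real => 'n => 'n::finite cfun" where
 "coordR R j x = cor (x $ j) * indicator (cball 0 R) x"

text \<open>The cut-off Fourier transform at the complex frequency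
  \<open>zeta(|xx|) xx / |xx|\<close>. The exponential series supplies the factor
  \<open>exp (c tau . x)\<close> by which it differs from the ordinary transform; this factor is
  bounded because \<open>x\<close> is confined to the ball of radius \<open>R\<close>.\<close>

definition Wd :: "real => real => real => real => ('n::finite cfun) => 'n L2_op" where
 "Wd c k0 L R ch = exp_op (Ft c oL mult_op ch) (%j xx. cor c * tau k0 L j xx) (coordR R)"

definition Wt :: "real => real => real => ('n::finite cfun) => 'n L2_op" where
 "Wt k0 L R ch = exp_op (mult_op ch oL Ft 1) (coordR R) (%j xx. cor 1 * tau k0 L j xx)"

text \<open>The Jacobian, in polar coordinates, of sending \<open>xx\<close> to
  \<open>zeta(|xx|) xx / |xx|\<close>.\<close>

definition jac :: "real => real => nat => real => complex" where
 "jac k0 L n r = (if \<bar>r - k0\<bar> < L then (zeta k0 L r / cor r) ^ (n - 1) * dzeta k0 L r else 1)"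

definition symd :: "real => real => 'n list => 'n::finite cfun" where
 "symd k0 L \<alpha> xx = pol \<alpha> (%i. \<i> * zeta k0 L (norm xx) * cor (sgn xx $ i)) * jac k0 L CARD('n) (norm xx)"

definition qd :: "real => real => real => 'n::finite cfun" where
 "qd k0 L h xx = cor (h\<^sup>2) * (zeta k0 L (norm xx))\<^sup>2"

text \<open>The operator \<open>Tfree\<close> on the deformed contour. Its denominator
  \<open>qd - z\<close> stays away from 0 for \<open>z\<close> in a whole disc around
  \<open>h^2 k0^2\<close>, on both sides of the real axis.\<close>

definition Td :: "real => real => real => ('n::finite cfun) => real => 'n list => complex => 'n L2_op" where
 "Td k0 L R ch h \<alpha> z = (1 / (fconst TYPE('n))\<^sup>2) *\<^sub>R
   (Wt k0 L R ch oL mult_op (%xx. symd k0 L \<alpha> xx / (qd k0 L h xx - z)) oL Wd (- 1) k0 L R ch)"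

lemma norm_pol_le:
 assumes "!!i. cmod (Z i) <= B" shows "cmod (pol \<alpha> Z) <= B ^ length \<alpha>"
proof (induction \<alpha>)
 case (Cons i \<alpha>)
 have "0 <= B" using assms[of i] norm_ge_zero order_trans by blast
 then show ?case using Cons assms[of i] by (auto simp: pol_def norm_mult intro: mult_mono)
qed (simp add: pol_def)

lemma sgn_component_le: "\<bar>sgn xx $ i\<bar> <= 1" for xx :: "real^'n::finite"
 using component_le_norm_cart[of "sgn xx" i] by (simp add: norm_sgn split: if_splits)

lemma sgn_component_measurable [measurable]: "(%xx::real^'n::finite. sgn xx $ i) \<in> bm borel"
 unfolding sgn_vec_def by simp

lemma tau_measurable [measurable]: "tau k0 L j \<in> bm borel"
 unfolding tau_def[abs_def] by measurable

lemma norm_tau_le: "0 <= L ==> cmod (tau k0 L j xx) <= L"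
 using sgn_component_le[of xx j] tent_bounds(1)[of k0 L "norm xx"] tent_bounds(2)[of L k0 "norm xx"]
  mult_mono[of "tent k0 L (norm xx)" L "\<bar>sgn xx $ j\<bar>" 1]
 by (simp add: tau_def norm_mult abs_mult)

lemma bdd_mult_tau: 
 assumes "\<bar>c\<bar> = 1" "0 <= L" 
 shows "bdd_mult (%xx. cor c * tau k0 L j xx)" "cmod (cor c * tau k0 L j xx) <= L"
proof -
 show 1: "cmod (cor c * tau k0 L j xx) <= L" for xx using assms norm_tau_le by (simp add: norm_mult)
 show "bdd_mult (%xx. cor c * tau k0 L j xx)" by (rule bdd_multI[OF _ 1]) measurable
qed

lemma bdd_mult_coordR: 
 assumes "0 <= R" shows "bdd_mult (coordR R j)" "cmod (coordR R j x) <= R"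
proof -
 show 1: "cmod (coordR R j x) <= R" for x :: "real^'a"
  using component_le_norm_cart[of x j] assms by (auto simp: coordR_def indicator_def norm_mult)
 have "(indicator (cball 0 R) :: real^'a => complex) \<in> bm borel"
  by (rule bdd_mult_borel[OF bdd_mult_indicator]) simp
 then show "bdd_mult (coordR R j)" unfolding coordR_def[abs_def]
  by (intro bdd_multI[OF _ 1[unfolded coordR_def]] borel_measurable_times) simp_all
qed

lemma norm_Ft_op_le: "\<bar>c\<bar> = 1 ==> norm (Ft c :: 'n::finite L2_op) <= fconst TYPE('n)"
 by (rule norm_blinfun_bound) (auto intro: norm_Ft_le less_imp_le)

lemma norm_W_le:
 fixes ch :: "'n::finite cfun"
 assumes ch: "bdd_mult ch" "!!x. cmod (ch x) <= B" and L: "0 <= L" and R: "0 <= R"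
 shows "\<bar>c\<bar> = 1 ==> norm (Wd c k0 L R ch) <= fconst TYPE('n) * B * exp (real CARD('n) * L * R)"
  "norm (Wt k0 L R ch) <= fconst TYPE('n) * B * exp (real CARD('n) * L * R)"
proof -
 show "norm (Wd c k0 L R ch) <= fconst TYPE('n) * B * exp (real CARD('n) * L * R)" if c: "\<bar>c\<bar> = 1"
 proof -
  have "norm (Wd c k0 L R ch) <= norm (Ft c oL mult_op ch) * exp (real CARD('n) * L * R)"
   unfolding Wd_def by (rule exp_op_summable(2)[OF bdd_mult_tau[OF c L] bdd_mult_coordR[OF R]])
  also have "... <= (fconst TYPE('n) * B) * exp (real CARD('n) * L * R)"
   by (intro mult_right_mono order_trans[OF norm_blinfun_compose] mult_mono norm_Ft_op_le norm_mult_op_le ch c)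
     (auto intro: less_imp_le)
  finally show ?thesis .
 qed
 have "norm (Wt k0 L R ch) <= norm (mult_op ch oL Ft 1) * exp (real CARD('n) * R * L)"
  unfolding Wt_def by (rule exp_op_summable(2)[OF bdd_mult_coordR[OF R] bdd_mult_tau[OF _ L]]) auto
 also have "... <= (B * fconst TYPE('n)) * exp (real CARD('n) * R * L)"
 proof (intro mult_right_mono order_trans[OF norm_blinfun_compose] mult_mono norm_Ft_op_le norm_mult_op_le ch)
  show "0 <= B" using ch(2) norm_ge_zero order_trans by blast
 qed auto
 finally show "norm (Wt k0 L R ch) <= fconst TYPE('n) * B * exp (real CARD('n) * L * R)"
  by (simp add: mult_ac)
qed

lemma complex_linear_W:
 fixes ch :: "'n::finite cfun"
 assumes ch: "bdd_mult ch" and L: "0 <= L" and R: "0 <= R"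
 shows "\<bar>c\<bar> = 1 ==> complex_linear (Wd c k0 L R ch)" "complex_linear (Wt k0 L R ch)"
proof -
 show "complex_linear (Wd c k0 L R ch)" if c: "\<bar>c\<bar> = 1"
  unfolding Wd_def using ch c
  by (intro complex_linear_exp_op[OF _ bdd_mult_tau[OF c L] bdd_mult_coordR[OF R]] complex_linear_comp complex_linear_Ft complex_linear_mult_op)
 show "complex_linear (Wt k0 L R ch)"
  unfolding Wt_def using ch
  by (intro complex_linear_exp_op[OF _ bdd_mult_coordR[OF R] bdd_mult_tau[OF _ L]] complex_linear_comp complex_linear_Ft complex_linear_mult_op) auto
qed

lemma pair_Wt:
 assumes ch: "bdd_mult ch" and L: "0 <= L" and R: "0 <= R"
 shows "pair (Wt k0 L R ch u) v = pair u (Wd 1 k0 L R ch v)"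
 unfolding Wt_def Wd_def
proof (rule pair_exp_op[OF _ bdd_mult_coordR[OF R] bdd_mult_tau[OF _ L]])
 show "pair ((mult_op ch oL Ft 1) u) v = pair u ((Ft 1 oL mult_op ch) v)" for u v
  using ch by (simp add: pair_L2_mult pair_Ft)
qed auto

lemma norm_zeta_le: 
 assumes "0 <= r" "0 <= L" shows "cmod (zeta k0 L r) <= r + L"
 using cmod_le[of "zeta k0 L r"] tent_bounds(1)[of k0 L r] tent_bounds(2)[of L k0 r] assms by (simp add: zeta_def)

lemma norm_jac_le:
 assumes L: "0 < L" "L <= k0 / 2" and n: "n > 0"
 shows "cmod (jac k0 L n r) <= 2 ^ n"
proof (cases "\<bar>r - k0\<bar> < L")
 case True
 then have r: "r > L" using L by linarith
 then have "cmod (zeta k0 L r) <= 2 * r" using norm_zeta_le[of r L k0] L by linarith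
 then have "cmod (zeta k0 L r / cor r) <= 2" using r L by (simp add: norm_divide pos_divide_le_eq)
 then have "cmod ((zeta k0 L r / cor r) ^ (n - 1) * dzeta k0 L r) <= 2 ^ (n - 1) * 2"
  unfolding norm_mult norm_power by (intro mult_mono power_mono norm_dzeta_le) auto
 also have "... = 2 ^ n" using n by (metis Suc_diff_1 power_Suc2)
 finally show ?thesis using True by (simp add: jac_def)
qed (use n in \<open>simp add: jac_def\<close>)

lemma norm_symd_le:
 fixes xx :: "real^'n::finite"
 assumes L: "0 < L" "L <= k0 / 2"
 shows "cmod (symd k0 L \<alpha> xx) <= 2 ^ CARD('n) * cmod (zeta k0 L (norm xx)) ^ length \<alpha>"
proof -
 have "cmod (pol \<alpha> (%i. \<i> * zeta k0 L (norm xx) * cor (sgn xx $ i))) <= cmod (zeta k0 L (norm xx)) ^ length \<alpha>"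
  by (rule norm_pol_le) (use sgn_component_le[of xx] in \<open>simp add: norm_mult mult_left_le\<close>)
 then have "cmod (pol \<alpha> (%i. \<i> * zeta k0 L (norm xx) * cor (sgn xx $ i))) * cmod (jac k0 L CARD('n) (norm xx))
   <= cmod (zeta k0 L (norm xx)) ^ length \<alpha> * 2 ^ CARD('n)"
  by (intro mult_mono norm_jac_le[OF L]) auto
 then show ?thesis by (simp add: symd_def norm_mult mult.commute)
qed

lemma pol_measurable [measurable]:
 assumes "!!i. (%xx::real^'n::finite. Z i xx :: complex) \<in> bm borel"
 shows "(%xx. pol \<alpha> (%i. Z i xx)) \<in> bm borel"
 using assms by (induction \<alpha>) (auto simp: pol_def)

lemma symd_measurable [measurable]: "(symd k0 L \<alpha> :: 'n::finite cfun) \<in> bm borel"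
 unfolding symd_def[abs_def] jac_def by measurable

lemma qd_measurable [measurable]: "(qd k0 L h :: 'n::finite cfun) \<in> bm borel"
 unfolding qd_def[abs_def] by measurable

text \<open>Factor \<open>zeta^2 - k0^2\<close>. The distance to \<open>k0\<close> is at least
  \<open>L / 2\<close>, by the real part away from \<open>k0\<close> and by the depth of the tent
  near it; the distance to \<open>- k0\<close> is at least \<open>|xx| + k0\<close>. Moving
  \<open>z\<close> inside the disc costs half of the product.\<close>

lemma qd_lower_bound:
 fixes xx :: "real^'n::finite"
 assumes L: "0 < L" "L <= k0 / 2" and h: "h > 0"
  and z: "z \<in> ball (cor (h\<^sup>2 * k0\<^sup>2)) (h\<^sup>2 * L * k0 / 4)"
 shows "h\<^sup>2 * (L / 4) * (norm xx + k0) <= cmod (qd k0 L h xx - z)"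
proof -
 define r where "r = norm xx"
 have r: "0 <= r" by (simp add: r_def)
 define t where "t = zeta k0 L r"
 have 1: "L / 2 <= cmod (t - cor k0)"
 proof (cases "L / 2 <= \<bar>r - k0\<bar>")
  case True
  then show ?thesis using abs_Re_le_cmod[of "t - cor k0"] by (simp add: t_def zeta_def)
 next
  case False
  then have "L / 2 <= tent k0 L r" unfolding tent_def by linarith
  then show ?thesis using abs_Im_le_cmod[of "t - cor k0"] by (simp add: t_def zeta_def)
 qed
 have 2: "r + k0 <= cmod (t + cor k0)"
  using abs_Re_le_cmod[of "t + cor k0"] by (simp add: t_def zeta_def)
 have "h\<^sup>2 * (L / 2) * (r + k0) <= h\<^sup>2 * (cmod (t - cor k0) * cmod (t + cor k0))"
  unfolding mult.assoc using L r by (intro mult_left_mono mult_mono 1 2) auto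
 also have "... = cmod (cor (h\<^sup>2) * ((t - cor k0) * (t + cor k0)))"
  by (simp add: norm_mult norm_power)
 also have "cor (h\<^sup>2) * ((t - cor k0) * (t + cor k0)) = qd k0 L h xx - cor (h\<^sup>2 * k0\<^sup>2)"
  by (simp add: qd_def t_def r_def power2_eq_square algebra_simps)
 finally have 3: "h\<^sup>2 * (L / 2) * (r + k0) <= cmod (qd k0 L h xx - cor (h\<^sup>2 * k0\<^sup>2))" .
 have "cmod (z - cor (h\<^sup>2 * k0\<^sup>2)) <= h\<^sup>2 * L * k0 / 4"
  using z by (simp add: dist_norm norm_minus_commute)
 also have "... = h\<^sup>2 * (L / 4) * k0" by simp
 also have "... <= h\<^sup>2 * (L / 4) * (r + k0)" using L r by (intro mult_left_mono) auto
 finally have 4: "cmod (z - cor (h\<^sup>2 * k0\<^sup>2)) <= h\<^sup>2 * (L / 4) * (r + k0)" .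
 have "h\<^sup>2 * (L / 2) * (r + k0) = h\<^sup>2 * (L / 4) * (r + k0) + h\<^sup>2 * (L / 4) * (r + k0)" by (simp add: field_simps)
 then show ?thesis
  using 3 4 norm_triangle_ineq2[of "qd k0 L h xx - cor (h\<^sup>2 * k0\<^sup>2)" "z - cor (h\<^sup>2 * k0\<^sup>2)"]
  by (simp add: r_def)
qed

text \<open>The denominator is quadratic in the frequency, so up to two derivatives leave a bounded
  symbol; the constant is explicit so that it serves all \<open>z\<close> in the disc at
  once.\<close>

lemma qd_bounds:
 fixes xx :: "real^'n::finite" and \<alpha> :: "'n list"
 assumes L: "0 < L" "L <= k0 / 2" and h: "h > 0" and al: "length \<alpha> <= 2"
 defines "\<delta> \<equiv> h\<^sup>2 * (L / 4) * k0"
  and "B \<equiv> ball (cor (h\<^sup>2 * k0\<^sup>2)) (h\<^sup>2 * L * k0 / 4)"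
 shows "\<delta> > 0" "z \<in> B ==> \<delta> <= cmod (qd k0 L h xx - z)"
  "z \<in> B ==> cmod (symd k0 L \<alpha> xx) <=
    (2 ^ CARD('n) * (1 / \<delta> + (1 + (h\<^sup>2 * k0\<^sup>2 + h\<^sup>2 * L * k0 / 4) / \<delta>) / h\<^sup>2)) * cmod (qd k0 L h xx - z)"
proof -
 show d: "\<delta> > 0" using L h by (simp add: \<delta>_def)
 have k0: "k0 > 0" using L by linarith
 show lb: "\<delta> <= cmod (qd k0 L h xx - z)" if "z \<in> B"
 proof -
  have "\<delta> <= h\<^sup>2 * (L / 4) * (norm xx + k0)" unfolding \<delta>_def using L by (intro mult_left_mono) auto
  then show ?thesis using qd_lower_bound[OF L h that[unfolded B_def], of xx] by linarith
 qed
 assume z: "z \<in> B"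
 define M where "M = h\<^sup>2 * k0\<^sup>2 + h\<^sup>2 * L * k0 / 4"
 define q where "q = cmod (qd k0 L h xx - z)"
 have qd: "\<delta> <= q" using lb[OF z] by (simp add: q_def)
 have zM: "cmod z <= M"
 proof -
  have "cmod z <= cmod (cor (h\<^sup>2 * k0\<^sup>2)) + cmod (z - cor (h\<^sup>2 * k0\<^sup>2))"
   by (rule norm_triangle_sub)
  moreover have "cmod (z - cor (h\<^sup>2 * k0\<^sup>2)) <= h\<^sup>2 * L * k0 / 4"
   using z by (simp add: B_def dist_norm norm_minus_commute)
  moreover have "cmod (cor (h\<^sup>2 * k0\<^sup>2)) = h\<^sup>2 * k0\<^sup>2" by (simp add: norm_mult norm_power)
  ultimately show ?thesis by (simp add: M_def)
 qed
 have M0: "0 <= M" using zM norm_ge_zero order_trans by blast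
 define t where "t = cmod (zeta k0 L (norm xx))"
 have "h\<^sup>2 * t\<^sup>2 = cmod (qd k0 L h xx)" by (simp add: qd_def t_def norm_mult norm_power)
 also have "... <= q + M" unfolding q_def using norm_triangle_ineq[of "qd k0 L h xx - z" z] zM by simp
 also have "... <= q + M * (q / \<delta>)"
 proof -
  have "1 <= q / \<delta>" using qd d by simp
  then have "M * 1 <= M * (q / \<delta>)" by (rule mult_left_mono[OF _ M0])
  then show ?thesis by simp
 qed
 finally have t2: "t\<^sup>2 <= q * ((1 + M / \<delta>) / h\<^sup>2)" using h by (simp add: field_simps)
 have one: "1 <= q * (1 / \<delta>)" using qd d by simp
 have "t ^ length \<alpha> <= 1 + t\<^sup>2"
 proof -
  have t0: "0 <= t" by (simp add: t_def)
  have t1: "t <= 1 + t\<^sup>2" using zero_le_power2[of "t - 1"] t0 by (simp add: power2_eq_square algebra_simps)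
  have "length \<alpha> = 0 \<or> length \<alpha> = 1 \<or> length \<alpha> = 2" using al by linarith
  then show ?thesis using t1 by (elim disjE) simp_all
 qed
 also have "... <= q * (1 / \<delta> + (1 + M / \<delta>) / h\<^sup>2)" using t2 one by (simp add: distrib_left)
 finally have "2 ^ CARD('n) * t ^ length \<alpha> <= 2 ^ CARD('n) * (q * (1 / \<delta> + (1 + M / \<delta>) / h\<^sup>2))"
  by (rule mult_left_mono) simp
 from order_trans[OF norm_symd_le[OF L, of \<alpha> xx, folded t_def] this]
 show "cmod (symd k0 L \<alpha> xx) <=
    (2 ^ CARD('n) * (1 / \<delta> + (1 + (h\<^sup>2 * k0\<^sup>2 + h\<^sup>2 * L * k0 / 4) / \<delta>) / h\<^sup>2)) * cmod (qd k0 L h xx - z)"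
  by (simp add: q_def M_def mult_ac)
qed

lemma Td_holo:
 fixes ch :: "'n::finite cfun"
 assumes L: "0 < L" "L <= k0 / 2" and h: "h > 0" and al: "length \<alpha> <= 2" and ch: "bdd_mult ch" and R: "0 <= R"
 shows "holo (Td k0 L R ch h \<alpha>) (ball (cor (h\<^sup>2 * k0\<^sup>2)) (h\<^sup>2 * L * k0 / 4))"
  "z \<in> ball (cor (h\<^sup>2 * k0\<^sup>2)) (h\<^sup>2 * L * k0 / 4) ==> bdd_mult (%xx::real^'n. symd k0 L \<alpha> xx / (qd k0 L h xx - z))"
proof -
 note H = holo_mult_op_quotient[OF open_ball symd_measurable qd_measurable qd_bounds(1)[OF L h al] qd_bounds(2)[OF L h al] qd_bounds(3)[OF L h al]]
 show "holo (Td k0 L R ch h \<alpha>) (ball (cor (h\<^sup>2 * k0\<^sup>2)) (h\<^sup>2 * L * k0 / 4))"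
  unfolding Td_def using L by (intro holo_scaleR holo_comp holo_const complex_linear_W ch R H(1)) auto
 show "z \<in> ball (cor (h\<^sup>2 * k0\<^sup>2)) (h\<^sup>2 * L * k0 / 4) ==> bdd_mult (%xx::real^'n. symd k0 L \<alpha> xx / (qd k0 L h xx - z))"
  by (rule H(2))
qed

text \<open>With \<open>y = |xx| + k0\<close> the difference of the symbols is at most a constant
  times \<open>|z - z0| y^k / (h^2 L y)^2\<close>, and for \<open>k \<le> 2\<close> derivatives
  \<open>y^(k-2)\<close> is largest at \<open>y = k0\<close>. The exponential sees
  \<open>L * R\<close> only, so for \<open>L = 1\<close> and \<open>k0 = sqrt E / h\<close> the
  bound becomes \<open>|z - z0| h^(-2-k)\<close> up to a constant free of \<open>h\<close>.\<close>

lemma Td_Lipschitz: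
 fixes ch :: "'n::finite cfun"
 assumes L: "0 < L" "L <= k0 / 2" and h: "h > 0" and al: "length \<alpha> <= 2" and ch: "bdd_mult ch" "!!x. cmod (ch x) <= B" and R: "0 <= R"
 defines "z0 \<equiv> cor (h\<^sup>2 * k0\<^sup>2)"
 assumes z: "z \<in> ball z0 (h\<^sup>2 * L * k0 / 4)"
 shows "norm (Td k0 L R ch h \<alpha> z - Td k0 L R ch h \<alpha> z0)
  <= (B * exp (real CARD('n) * L * R))\<^sup>2 * 2 ^ CARD('n) * (cmod (z - z0) * (16 / (h ^ 4 * L\<^sup>2) * (k0 ^ length \<alpha> / k0\<^sup>2)))"
proof -
 have k0: "k0 > 0" using L by linarith
 have z0: "z0 \<in> ball z0 (h\<^sup>2 * L * k0 / 4)" using L h k0 by simp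
 note bd = Td_holo(2)[OF L h al ch(1) R]
 let ?K = "fconst TYPE('n)"
 let ?m = "%z xx. symd k0 L \<alpha> xx / (qd k0 L h xx - z)"
 let ?E = "exp (real CARD('n) * L * R)"
 define D where "D = cmod (z - z0) * (16 / (h ^ 4 * L\<^sup>2) * (k0 ^ length \<alpha> / k0\<^sup>2))"
 have pt: "cmod (?m z xx - ?m z0 xx) <= 2 ^ CARD('n) * D" for xx :: "real^'n"
 proof -
  define y where "y = norm xx + k0"
  have y: "y \<ge> k0" by (simp add: y_def)
  define a where "a = h\<^sup>2 * (L / 4) * y"
  have a: "a > 0" using h L k0 y by (simp add: a_def)
  have q: "a <= cmod (qd k0 L h xx - z)" "a <= cmod (qd k0 L h xx - z0)"
   using qd_lower_bound[OF L h z[unfolded z0_def], of xx] qd_lower_bound[OF L h z0[unfolded z0_def], of xx]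
   by (auto simp: a_def y_def z0_def)
  have nz: "qd k0 L h xx - z ~= 0" "qd k0 L h xx - z0 ~= 0" using q a by auto
  have "?m z xx - ?m z0 xx = symd k0 L \<alpha> xx * (z - z0) / ((qd k0 L h xx - z) * (qd k0 L h xx - z0))"
   using nz by (simp add: field_simps)
  then have "cmod (?m z xx - ?m z0 xx) = cmod (symd k0 L \<alpha> xx) * cmod (z - z0) / (cmod (qd k0 L h xx - z) * cmod (qd k0 L h xx - z0))"
   by (simp add: norm_mult norm_divide)
  also have "... <= (2 ^ CARD('n) * y ^ length \<alpha>) * cmod (z - z0) / (a * a)"
  proof (intro frac_le mult_mono q)
   have "cmod (zeta k0 L (norm xx)) <= y" using norm_zeta_le[of "norm xx" L k0] L by (simp add: y_def)
   then show "cmod (symd k0 L \<alpha> xx) <= 2 ^ CARD('n) * y ^ length \<alpha>"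
    by (intro order_trans[OF norm_symd_le[OF L]] mult_left_mono power_mono) auto
  qed (use a y k0 in auto)
  also have "... = 2 ^ CARD('n) * (cmod (z - z0) * (16 / (h ^ 4 * L\<^sup>2) * (y ^ length \<alpha> / y\<^sup>2)))"
   by (simp add: a_def power2_eq_square power4_eq_xxxx field_simps)
  also have "... <= 2 ^ CARD('n) * D"
  proof -
   have "y ^ length \<alpha> / y\<^sup>2 <= k0 ^ length \<alpha> / k0\<^sup>2"
   proof -
    consider "length \<alpha> = 0" | "length \<alpha> = 1" | "length \<alpha> = 2" using al by linarith
    then show ?thesis
    proof cases
     case 1 then show ?thesis using y k0 by (simp add: frac_le power_mono)
    next
     case 2 then show ?thesis using y k0 by (simp add: power2_eq_square frac_le)
    next
     case 3 then show ?thesis using y k0 by simp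
    qed
   qed
   then show ?thesis unfolding D_def using h L by (intro mult_left_mono) auto
  qed
  finally show ?thesis .
 qed
 have "Td k0 L R ch h \<alpha> z - Td k0 L R ch h \<alpha> z0
   = (1 / ?K\<^sup>2) *\<^sub>R (Wt k0 L R ch oL mult_op (%xx. ?m z xx - ?m z0 xx) oL Wd (- 1) k0 L R ch)"
  unfolding mult_op_diff[OF bd[OF z[unfolded z0_def]] bd[OF z0[unfolded z0_def]], folded z0_def] Td_def
  by (rule blinfun_eqI) (simp add: blinfun.diff_left blinfun.diff_right blinfun.scaleR_left scaleR_diff_right)
 also have "norm ... <= (1 / ?K\<^sup>2) * ((?K * B * ?E) * (2 ^ CARD('n) * D) * (?K * B * ?E))"
 proof -
  have nW: "norm (Wd (- 1) k0 L R ch) <= ?K * B * ?E" "norm (Wt k0 L R ch) <= ?K * B * ?E"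
   using norm_W_le[OF ch, of L R] L R by auto
  have W0: "0 <= ?K * B * ?E" using nW(1) norm_ge_zero order_trans by blast
  have nm: "norm (mult_op (%xx. ?m z xx - ?m z0 xx)) <= 2 ^ CARD('n) * D"
   using bd[OF z[unfolded z0_def]] bd[OF z0[unfolded z0_def]] by (intro norm_mult_op_le bdd_mult_diff pt) (auto simp: z0_def)
  have D0: "0 <= 2 ^ CARD('n) * D" using nm norm_ge_zero order_trans by blast
  have "norm (Wt k0 L R ch oL mult_op (%xx. ?m z xx - ?m z0 xx) oL Wd (- 1) k0 L R ch)
    <= (norm (Wt k0 L R ch) * norm (mult_op (%xx. ?m z xx - ?m z0 xx))) * norm (Wd (- 1) k0 L R ch)"
   by (meson norm_blinfun_compose order_trans mult_right_mono norm_ge_zero)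
  also have "... <= ((?K * B * ?E) * (2 ^ CARD('n) * D)) * (?K * B * ?E)"
   by (intro mult_mono nW nm mult_nonneg_nonneg W0 D0) auto
  finally show ?thesis unfolding norm_scaleR by (simp add: divide_right_mono)
 qed
 also have "... = (B * ?E)\<^sup>2 * 2 ^ CARD('n) * D" by (simp add: power2_eq_square)
 finally show ?thesis by (simp add: D_def)
qed

text \<open>Frequencies up to \<open>N\<close> contribute an approximable operator through the
  truncated transform; beyond \<open>N\<close> the symbol is of size \<open>1 / N\<close>, as its
  denominator is bounded below by a multiple of \<open>|xx|\<close>.\<close>

lemma approximable_Td:
 fixes ch :: "'n::finite cfun"
 assumes L: "0 < L" "L <= k0 / 2" and h: "h > 0" and ch: "bdd_mult ch" "sqi ch" "!!x. norm x > R ==> ch x = 0" and R: "0 <= R"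
  and z: "z \<in> ball (cor (h\<^sup>2 * k0\<^sup>2)) (h\<^sup>2 * L * k0 / 4)"
 shows "approximable (Td k0 L R ch h [] z)"
proof (rule approximable_lim)
 fix e :: real assume e: "e > 0"
 have k0: "k0 > 0" using L by linarith
 let ?m = "%xx::real^'n. symd k0 L [] xx / (qd k0 L h xx - z)"
 let ?S = "(1 / (fconst TYPE('n))\<^sup>2) *\<^sub>R (Wt k0 L R ch oL mult_op ?m)"
 let ?T = "(1 / (fconst TYPE('n))\<^sup>2) *\<^sub>R Wt k0 L R ch"
 let ?W = "Wd (- 1) k0 L R ch"
 have bm: "bdd_mult ?m" by (rule Td_holo(2)[OF L h _ ch(1) R z]) simp
 define C where "C = norm ?T * (2 ^ CARD('n) * (4 / (h\<^sup>2 * L))) * norm ?W"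
 have C0: "0 <= C" unfolding C_def using L by (intro mult_nonneg_nonneg) auto
 define N where "N = C / e + 1"
 have N: "N > 0" using C0 e by (simp add: N_def add_nonneg_pos)
 let ?I = "indicator (cball 0 N) :: real^'n => complex"
 have I: "bdd_mult ?I" by (rule bdd_mult_indicator) simp
 have "approximable (mult_op ?I oL (Ft (- 1) oL mult_op ch))"
 proof -
  have "mult_op ?I oL (Ft (- 1) oL mult_op ch) = mult_op ?I oL Ft (- 1) oL mult_op ch"
   by (rule blinfun_compose_assoc[symmetric])
  then show ?thesis using approximable_Ft_cutoff[of "- 1" ch R N] ch by simp
 qed
 then have A: "approximable (mult_op ?I oL ?W)"
  unfolding Wd_def using L R
  by (intro approximable_mult_exp_op[OF I _ bdd_mult_tau bdd_mult_coordR]) auto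
 have cl: "complex_linear ?S" using L
  by (intro complex_linear_scaleR complex_linear_comp complex_linear_W complex_linear_mult_op bm ch(1) R) auto
 have A2: "approximable (?S oL (mult_op ?I oL ?W) oL mult_op (%_. 1))"
  by (rule approximable_comp[OF A cl bdd_mult_const])
 have bt: "bdd_mult (%xx. ?m xx * (1 - ?I xx))" by (intro bdd_mult_mult bdd_mult_diff bdd_mult_const bm I)
 have "Td k0 L R ch h [] z - (?S oL (mult_op ?I oL ?W) oL mult_op (%_. 1)) = ?T oL mult_op (%xx. ?m xx * (1 - ?I xx)) oL ?W"
 proof (rule blinfun_eqI)
  fix u
  have "L2_mult (%xx. ?m xx * (1 - ?I xx)) v = L2_mult ?m v - L2_mult ?m (L2_mult ?I v)" for v
   by (simp only: L2_mult_L2_mult[OF bm bdd_mult_diff[OF bdd_mult_const I], symmetric]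
      L2_mult_diff_left[OF bdd_mult_const I] L2_mult_diff L2_mult_one)
  then show "ap (Td k0 L R ch h [] z - (?S oL (mult_op ?I oL ?W) oL mult_op (%_. 1))) u
    = (?T oL mult_op (%xx. ?m xx * (1 - ?I xx)) oL ?W) u"
   by (simp add: Td_def blinfun.diff_left blinfun.scaleR_left blinfun.diff_right scaleR_diff_right)
 qed
 also have "norm ... <= (norm ?T * norm (mult_op (%xx. ?m xx * (1 - ?I xx)))) * norm ?W"
  by (meson norm_blinfun_compose order_trans mult_right_mono norm_ge_zero)
 also have "... <= (norm ?T * (2 ^ CARD('n) * (4 / (h\<^sup>2 * L)) / N)) * norm ?W"
 proof (intro mult_right_mono mult_left_mono norm_mult_op_le bt)
  fix xx :: "real^'n"
  show "cmod (?m xx * (1 - ?I xx)) <= 2 ^ CARD('n) * (4 / (h\<^sup>2 * L)) / N"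
  proof (cases "norm xx <= N")
   case True then show ?thesis using N L by simp
  next
   case False
   have "h\<^sup>2 * (L / 4) * N <= h\<^sup>2 * (L / 4) * (norm xx + k0)" using False k0 L by (intro mult_left_mono) auto
   then have "h\<^sup>2 * (L / 4) * N <= cmod (qd k0 L h xx - z)" using qd_lower_bound[OF L h z, of xx] by linarith
   then have "cmod (?m xx) <= 2 ^ CARD('n) / (h\<^sup>2 * (L / 4) * N)"
    unfolding norm_divide using norm_symd_le[OF L, of "[]" xx] h L N by (intro frac_le) auto
   also have "... = 2 ^ CARD('n) * (4 / (h\<^sup>2 * L)) / N" using h L N by (simp add: field_simps)
   finally show ?thesis using False by simp
  qed
 qed auto
 also have "... = C / N" by (simp add: C_def)
 also have "... < e" using N C0 e by (simp add: N_def field_simps)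
 finally show "\<exists>S. approximable S & norm (Td k0 L R ch h [] z - S) < e" using A2 by blast
qed

section \<open>Comparison of the deformed and the real contour\<close>

definition ray_int :: "('n::finite cfun) => real => real^'n => complex => complex" where
 "ray_int f c \<eta> t = LI (%x. exp ((\<i> * cor c) * t * cor (x \<bullet> \<eta>)) * f x)"

lemma norm_ray_int_le:
 fixes f :: "'n::finite cfun"
 assumes f: "integrable lborel f" "!!x. norm x > R ==> f x = 0" and c: "\<bar>c\<bar> = 1"
  and t: "\<bar>Im t\<bar> * norm \<eta> <= L" and R: "0 <= R"
 shows "cmod (ray_int f c \<eta> t) <= exp (L * R) * LI (%x. cmod (f x))"
proof -
 have L0: "0 <= L" using t by (meson abs_ge_zero mult_nonneg_nonneg norm_ge_zero order_trans)
 have "cmod (exp ((\<i> * cor c) * t * cor (x \<bullet> \<eta>)) * f x) <= exp (L * R) * cmod (f x)" for x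
 proof (cases "norm x > R")
  case False
  have "Re ((\<i> * cor c) * t * cor (x \<bullet> \<eta>)) <= \<bar>c * Im t * (x \<bullet> \<eta>)\<bar>"
   by simp
  also have "... = \<bar>Im t\<bar> * \<bar>x \<bullet> \<eta>\<bar>" using c by (simp add: abs_mult)
  also have "... <= \<bar>Im t\<bar> * (norm x * norm \<eta>)" by (intro mult_left_mono Cauchy_Schwarz_ineq2) auto
  also have "... = (\<bar>Im t\<bar> * norm \<eta>) * norm x" by simp
  also have "... <= L * R" using False t R L0 by (intro mult_mono) auto
  finally show ?thesis by (auto simp: norm_mult intro!: mult_right_mono)
 qed (simp add: f)
 moreover have "integrable lborel (%x. exp ((\<i> * cor c) * t * cor (x \<bullet> \<eta>)) * f x)"
 proof (rule integral_exp_sums(1)[OF f(1), where M="cmod ((\<i> * cor c) * t) * (R * norm \<eta>)"])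
  fix x assume "f x ~= 0"
  then have "norm x <= R" using f(2)[of x] by (simp add: not_less[symmetric], blast)
  then have "\<bar>x \<bullet> \<eta>\<bar> <= R * norm \<eta>"
   by (intro order_trans[OF Cauchy_Schwarz_ineq2] mult_right_mono) auto
  then show "cmod ((\<i> * cor c) * t * cor (x \<bullet> \<eta>)) <= cmod ((\<i> * cor c) * t) * (R * norm \<eta>)"
   unfolding norm_mult[of "(\<i> * cor c) * t"] norm_of_real by (rule mult_left_mono) simp
 qed measurable
 ultimately have "cmod (ray_int f c \<eta> t) <= LI (%x. exp (L * R) * cmod (f x))"
  unfolding ray_int_def using f(1) by (intro Bochner_Integration.integral_norm_bound_integral) auto
 then show ?thesis by simp
qed

text \<open>Only the product of radius and direction enters. On either contour the transform at
  \<open>s *\<eta>\<close> is therefore a value of one and the same entire function attached to the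
  ray through \<open>\<eta>\<close>.\<close>

lemma ray_int_scale:
 assumes "t * cor r = t' * cor r'"
 shows "ray_int f c (r *\<^sub>R \<eta>) t = ray_int f c (r' *\<^sub>R \<eta>) t'"
proof -
 have "(\<i> * cor c) * t * cor (x \<bullet> (r *\<^sub>R \<eta>)) = (\<i> * cor c) * t' * cor (x \<bullet> (r' *\<^sub>R \<eta>))" for x
 proof -
  have "t * cor (r * (x \<bullet> \<eta>)) = t' * cor (r' * (x \<bullet> \<eta>))"
   unfolding of_real_mult using assms by (simp only: mult.assoc[symmetric])
  then show ?thesis by (simp only: inner_scaleR_right mult.assoc)
 qed
 then show ?thesis by (simp only: ray_int_def)
qed

lemma Wd_kernel:
 fixes ch :: "'n::finite cfun" and k0 :: real
 assumes c: "\<bar>c\<bar> = 1" and ch: "bdd_mult ch" "!!x. norm x > R ==> ch x = 0" and L: "0 <= L" and R: "0 <= R"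
  and f: "sqi f"
 defines "F \<equiv> %xx. ray_int (%x. ch x * f x) c (sgn xx) (zeta k0 L (norm xx))"
 shows "sqi F" "ap (Wd c k0 L R ch) (abs_L2 f) = abs_L2 F"
proof -
 have k: "exp (\<Sum>j\<in>UNIV. cor c * tau k0 L j xx * coordR R j x) * (exp (\<i> * cor (c * (x \<bullet> xx))) * ch x)
   = exp ((\<i> * cor c) * zeta k0 L (norm xx) * cor (x \<bullet> sgn xx)) * ch x" for xx x :: "real^'n"
 proof (cases "norm x > R")
  case False
  then have "coordR R j x = cor (x $ j)" for j by (simp add: coordR_def)
  then have "(\<Sum>j\<in>UNIV. cor c * tau k0 L j xx * coordR R j x)
    = cor (c * tent k0 L (norm xx) * (x \<bullet> sgn xx))"
   by (simp add: tau_def inner_vec_def sum_distrib_left mult_ac)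
  moreover have "x \<bullet> xx = norm xx * (x \<bullet> sgn xx)"
   by (cases "xx = 0") (simp_all add: sgn_div_norm)
  ultimately have "(\<Sum>j\<in>UNIV. cor c * tau k0 L j xx * coordR R j x) + \<i> * cor (c * (x \<bullet> xx))
    = (\<i> * cor c) * zeta k0 L (norm xx) * cor (x \<bullet> sgn xx)"
   by (simp add: zeta_eq algebra_simps)
  then show ?thesis by (simp only: mult.assoc[symmetric] exp_add[symmetric])
 qed (simp add: ch)
 have "has_kernel (Wd c k0 L R ch) (%xx x. exp ((\<i> * cor c) * zeta k0 L (norm xx) * cor (x \<bullet> sgn xx)) * ch x)"
  unfolding Wd_def k[symmetric]
  by (rule has_kernel_exp_op[OF has_kernel_Ft[OF c ch] bdd_mult_tau[OF c L] bdd_mult_coordR[OF R]])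
 from has_kernelD(2,3)[OF this f] show "sqi F" "ap (Wd c k0 L R ch) (abs_L2 f) = abs_L2 F"
  by (simp_all only: F_def ray_int_def mult.assoc)
qed

lemma Ft_kernel:
 fixes ch :: "'n::finite cfun"
 assumes c: "\<bar>c\<bar> = 1" and ch: "bdd_mult ch" "!!x. norm x > R ==> ch x = 0" and f: "sqi f"
 defines "F \<equiv> %xx. ray_int (%x. ch x * f x) c xx 1"
 shows "sqi F" "ap (Ft c) (L2_mult ch (abs_L2 f)) = abs_L2 F"
proof -
 have "exp (\<i> * cor (c * (x \<bullet> xx))) = exp ((\<i> * cor c) * 1 * cor (x \<bullet> xx))" for x xx :: "real^'n"
  by (simp add: mult.assoc)
 with has_kernel_Ft[OF c ch]
 have "has_kernel (Ft c oL mult_op ch) (%xx x. exp ((\<i> * cor c) * 1 * cor (x \<bullet> xx)) * ch x)" by (simp only:)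
 from has_kernelD(2,3)[OF this f] show "sqi F" "ap (Ft c) (L2_mult ch (abs_L2 f)) = abs_L2 F"
  by (simp_all only: F_def ray_int_def mult.assoc blinfun_apply_blinfun_compose blinfun_apply_mult_op)
qed

lemma bdd_mult_pol_rz:
 assumes h: "h > 0" and z: "Im z > 0" and al: "length \<alpha> <= 2"
 shows "bdd_mult (%xx. pol \<alpha> (%i. xi i xx) * rz h z xx)"
proof -
 note d = decay_bdd[OF decay_rz[OF h z]]
 have "\<alpha> = [] \<or> (\<exists>i. \<alpha> = [i]) \<or> (\<exists>j i. \<alpha> = [j, i])"
  using al by (auto simp: le_Suc_eq numeral_2_eq_2 length_Suc_conv)
 then show ?thesis
  by (elim disjE exE) (use d in \<open>simp_all add: pol_def mult.assoc\<close>)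
qed

lemma pol_holomorphic:
 fixes \<eta> :: "real^'n::finite"
 shows "(%t. pol \<alpha> (%i. \<i> * t * cor (\<eta> $ i))) holomorphic_on S"
 by (induction \<alpha>) (auto simp: pol_def intro!: holomorphic_intros)

text \<open>Matrix elements are frequency integrals of two transforms that are entire in the radius
  thanks to the cut-offs. The two integrands agree where the detour is real, so their difference
  lives in an annulus; contour deformation kills its integral along each ray, and the averaging over
  rays kills the full integral.\<close>

lemma Td_eq_Tfree:
 fixes ch :: "'n::finite cfun"
 assumes L: "0 < L" "L <= k0 / 2" and h: "h > 0" and al: "length \<alpha> <= 2"
  and ch: "bdd_mult ch" "sqi ch" "!!x. norm x > R ==> ch x = 0" and R: "0 <= R"
  and zb: "z \<in> ball (cor (h\<^sup>2 * k0\<^sup>2)) (h\<^sup>2 * L * k0 / 4)" and z: "Im z > 0"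
 shows "Td k0 L R ch h \<alpha> z = Tfree ch h \<alpha> z"
proof (rule blinfun_eqI, rule pair_eqD)
 fix u v :: "'n L2"
 obtain f where f: "sqi f" "u = abs_L2 f" by (rule L2_cases)
 obtain g where g: "sqi g" "v = abs_L2 g" by (rule L2_cases)
 have k0: "k0 > 0" using L by linarith
 have L0: "0 <= L" using L by simp
 define cf where "cf x = ch x * f x" for x
 define cg where "cg x = ch x * g x" for x
 have cfi: "integrable lborel cf" "!!x. norm x > R ==> cf x = 0"
  unfolding cf_def by (auto intro: integrable_mult_sqi[OF ch(2) f(1)] simp: ch)
 have cgi: "integrable lborel cg" "!!x. norm x > R ==> cg x = 0"
  unfolding cg_def by (auto intro: integrable_mult_sqi[OF ch(2) g(1)] simp: ch)
 define A where "A xx = ray_int cf (- 1) (sgn xx) (zeta k0 L (norm xx))" for xx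
 define B where "B xx = ray_int cg 1 (sgn xx) (zeta k0 L (norm xx))" for xx
 define A0 where "A0 xx = ray_int cf (- 1) xx 1" for xx
 define B0 where "B0 xx = ray_int cg 1 xx 1" for xx
 define md where "md xx = symd k0 L \<alpha> xx / (qd k0 L h xx - z)" for xx :: "real^'n"
 define m where "m xx = pol \<alpha> (%i. xi i xx) * rz h z xx" for xx :: "real^'n"
 have bmd: "bdd_mult md" unfolding md_def[abs_def] by (rule Td_holo(2)[OF L h al ch(1) R zb])
 have bm: "bdd_mult m" unfolding m_def[abs_def] by (rule bdd_mult_pol_rz[OF h z al])
 have A: "sqi A" "ap (Wd (- 1) k0 L R ch) u = abs_L2 A"
  using Wd_kernel[of "- 1", OF _ ch(1,3) L0 R f(1)] by (simp_all add: A_def[abs_def] cf_def[abs_def] f(2))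
 have B: "sqi B" "ap (Wd 1 k0 L R ch) v = abs_L2 B"
  using Wd_kernel[of 1, OF _ ch(1,3) L0 R g(1)] by (simp_all add: B_def[abs_def] cg_def[abs_def] g(2))
 have A0: "sqi A0" "ap (Ft (- 1)) (L2_mult ch u) = abs_L2 A0"
  using Ft_kernel[of "- 1", OF _ ch(1,3) f(1)] by (simp_all add: A0_def[abs_def] cf_def[abs_def] f(2))
 have B0: "sqi B0" "ap (Ft 1) (L2_mult ch v) = abs_L2 B0"
  using Ft_kernel[of 1, OF _ ch(1,3) g(1)] by (simp_all add: B0_def[abs_def] cg_def[abs_def] g(2))
 have lhs: "pair (Td k0 L R ch h \<alpha> z u) v = (1 / (fconst TYPE('n))\<^sup>2) *\<^sub>R LI (%xx. md xx * A xx * B xx)"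
  unfolding Td_def blinfun.scaleR_left pair_scaleR_left blinfun_apply_blinfun_compose pair_Wt[OF ch(1) L0 R] A(2) B(2)
   blinfun_apply_mult_op md_def[symmetric]
  by (simp add: L2_mult_abs[OF A(1) bmd] pair_abs[OF sqi_bdd_mult[OF A(1) bmd] B(1)])
 have rhs: "pair (Tfree ch h \<alpha> z u) v = (1 / (fconst TYPE('n))\<^sup>2) *\<^sub>R LI (%xx. m xx * A0 xx * B0 xx)"
  unfolding Tfree_def Mop_def blinfun_apply_blinfun_compose blinfun_apply_mult_op pair_L2_mult[OF ch(1)] blinfun.scaleR_left pair_scaleR_left
   m_def[symmetric]
  by (simp add: pair_Ft A0(2) B0(2) L2_mult_abs[OF A0(1) bm] pair_abs[OF sqi_bdd_mult[OF A0(1) bm] B0(1)])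
 define D where "D xx = md xx * A xx * B xx - m xx * A0 xx * B0 xx" for xx
 have i1: "integrable lborel (%xx. md xx * A xx * B xx)"
  by (rule integrable_mult_sqi[OF sqi_bdd_mult[OF A(1) bmd] B(1)])
 have i2: "integrable lborel (%xx. m xx * A0 xx * B0 xx)"
  by (rule integrable_mult_sqi[OF sqi_bdd_mult[OF A0(1) bm] B0(1)])
 have "LI D = 0"
 proof -
  have Dm: "D \<in> bm borel"
   using borel_measurable_diff[OF borel_measurable_integrable[OF i1] borel_measurable_integrable[OF i2]]
   by (simp add: D_def[abs_def])
  let ?IA = "exp (L * R) * LI (%x. cmod (cf x))"
  let ?IB = "exp (L * R) * LI (%x. cmod (cg x))"
  obtain M1 where M1: "M1 > 0" "!!xx. cmod (md xx) <= M1" by (rule bdd_multE[OF bmd], rule that) auto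
  obtain M2 where M2: "M2 > 0" "!!xx. cmod (m xx) <= M2" by (rule bdd_multE[OF bm], rule that) auto
  have ns: "norm (sgn xx) <= 1" for xx :: "real^'n" by (simp add: norm_sgn)
  have Lz: "\<bar>Im (zeta k0 L (norm xx))\<bar> * norm (sgn xx) <= L" for xx :: "real^'n"
   using tent_bounds(1)[of k0 L "norm xx"] tent_bounds(2)[OF L0, of k0 "norm xx"] ns[of xx]
   by (intro order_trans[OF mult_left_le]) (auto simp: zeta_def)
  have bA: "cmod (A xx) <= ?IA" "cmod (A0 xx) <= ?IA" "cmod (B xx) <= ?IB" "cmod (B0 xx) <= ?IB" for xx
   unfolding A_def B_def A0_def B0_def
   using Lz[of xx] L0 by (auto intro!: norm_ray_int_le cfi cgi R)
  have Db: "cmod (D xx) <= M1 * ?IA * ?IB + M2 * ?IA * ?IB" for xx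
   unfolding D_def
  proof (intro order_trans[OF norm_triangle_ineq4] add_mono)
   have IA: "0 <= ?IA" "0 <= ?IB" by (auto intro!: mult_nonneg_nonneg integral_nonneg_AE)
   show "cmod (md xx * A xx * B xx) <= M1 * ?IA * ?IB" "cmod (m xx * A0 xx * B0 xx) <= M2 * ?IA * ?IB"
    unfolding norm_mult using M1(1) M2(1)
    by (intro mult_mono M1(2) M2(2) bA mult_nonneg_nonneg IA norm_ge_zero less_imp_le; simp)+
  qed
  have Ds: "k0 - L <= norm xx & norm xx <= k0 + L" if "D xx ~= 0" for xx
  proof (rule ccontr)
   assume "\<not> ?thesis"
   then have out: "L <= \<bar>norm xx - k0\<bar>" by linarith
   note zo = zeta_outside(1)[OF out]
   have xs: "xx = norm xx *\<^sub>R sgn xx" by (cases "xx = 0") (simp_all add: sgn_div_norm)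
   have xc: "xx $ i = norm xx * sgn xx $ i" for i using arg_cong[OF xs, of "%x. x $ i"] by simp
   have ray: "ray_int F c (sgn xx) (cor (norm xx)) = ray_int F c xx 1" for F c
    using ray_int_scale[of "cor (norm xx)" 1 1 "norm xx" F c "sgn xx"] xs by simp
   have "A xx = A0 xx" "B xx = B0 xx" unfolding A_def A0_def B_def B0_def zo by (rule ray)+
   moreover have "md xx = m xx"
   proof -
    have "symd k0 L \<alpha> xx = pol \<alpha> (%i. xi i xx)"
     using out xc by (simp add: symd_def jac_def zo xi_def mult.assoc)
    then show ?thesis by (simp add: md_def m_def qd_def rz_def zo)
   qed
   ultimately show False using that by (simp add: D_def)
  qed
  show ?thesis
  proof (rule integral_eq_0_if_ray_integrals_eq_0[OF Dm Db Ds])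
   show "0 < k0 - L" using L k0 by linarith
   fix \<eta> :: "real^'n" assume "1 <= norm \<eta>" "norm \<eta> <= 2"
   define e where "e = norm \<eta>"
   have e: "e > 0" unfolding e_def using \<open>1 <= norm \<eta>\<close> by linarith
   let ?n = "CARD('n) - 1"
   \<comment> \<open>The numerator on the ray through \<open>\<eta>\<close> as a function of the
     complex parameter; \<open>t ^ ?n\<close> is the polar weight. The parameter measures radii in
     units of \<open>e = |\<eta>|\<close>, so the path is \<open>zeta\<close> at
     \<open>s * e\<close>, divided by \<open>e\<close>.\<close>
   define \<A> where "\<A> t = pol \<alpha> (%i. \<i> * t * cor (\<eta> $ i)) * t ^ ?n * ray_int cf (- 1) \<eta> t * ray_int cg 1 \<eta> t" for t
   define Q where "Q t = \<A> t / (cor (h\<^sup>2 * e\<^sup>2) * t\<^sup>2 - z)" for t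
   have hol: "\<A> holomorphic_on UNIV"
    unfolding \<A>_def[abs_def] ray_int_def
    by (intro holomorphic_intros pol_holomorphic entire_exp_integral cfi cgi)
   have "LI (%s. indicator {0<..} s * (Q (zeta k0 L (s * e) / cor e) * dzeta k0 L (s * e) - Q (cor s))) = 0"
    unfolding Q_def by (rule deformation_along_ray[OF hol z]) (use h e L k0 in auto)
   moreover have "indicator {0<..} s * (Q (zeta k0 L (s * e) / cor e) * dzeta k0 L (s * e) - Q (cor s))
     = indicator {0<..} s * (cor (s ^ ?n) * D (s *\<^sub>R \<eta>))" for s
   proof (cases "s > 0")
    case True
    let ?\<zeta> = "zeta k0 L (s * e)"
    define xx where "xx = s *\<^sub>R \<eta>"
    have nx: "norm xx = s * e" using True by (simp add: xx_def e_def)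
    have sx: "sgn xx = (1 / e) *\<^sub>R \<eta>" using True e by (simp add: xx_def e_def sgn_div_norm inverse_eq_divide)
    have r1: "ray_int F c (sgn xx) ?\<zeta> = ray_int F c \<eta> (?\<zeta> / cor e)" for F c
     using ray_int_scale[of ?\<zeta> "1 / e" "?\<zeta> / cor e" 1 F c \<eta>] by (simp add: sx)
    have r2: "ray_int F c xx 1 = ray_int F c \<eta> (cor s)" for F c
     using ray_int_scale[of 1 s "cor s" 1 F c \<eta>] by (simp add: xx_def)
    have q2: "Q (cor s) = cor (s ^ ?n) * (m xx * A0 xx * B0 xx)"
    proof -
     have p: "pol \<alpha> (%i. \<i> * cor s * cor (\<eta> $ i)) = pol \<alpha> (%i. xi i xx)"
      by (simp add: xi_def xx_def mult.assoc)
     have q: "cor (h\<^sup>2 * e\<^sup>2) * (cor s)\<^sup>2 = cor (h\<^sup>2 * (norm xx)\<^sup>2)"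
      by (simp add: nx power_mult_distrib mult_ac)
     show ?thesis
      unfolding Q_def \<A>_def m_def A0_def B0_def r2 rz_def p q
      unfolding of_real_power[symmetric] times_divide_eq_left times_divide_eq_right mult_1_right
      by (simp only: mult_ac)
    qed
    have jac: "cor (s ^ ?n) * jac k0 L CARD('n) (s * e) = (?\<zeta> / cor e) ^ ?n * dzeta k0 L (s * e)"
    proof (cases "\<bar>s * e - k0\<bar> < L")
     case True
     then show ?thesis using \<open>s > 0\<close> e by (simp add: jac_def power_divide power_mult_distrib field_simps)
    next
     case False
     then show ?thesis using e zeta_outside(1)[of L "s * e" k0] by (simp add: jac_def dzeta_def)
    qed
    have q1: "Q (?\<zeta> / cor e) * dzeta k0 L (s * e) = cor (s ^ ?n) * (md xx * A xx * B xx)"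
    proof -
     have p: "pol \<alpha> (%i. \<i> * (?\<zeta> / cor e) * cor (\<eta> $ i)) = pol \<alpha> (%i. \<i> * ?\<zeta> * cor (sgn xx $ i))"
      by (simp add: sx)
     have q: "cor (h\<^sup>2 * e\<^sup>2) * (?\<zeta> / cor e)\<^sup>2 = qd k0 L h xx"
      using e by (simp add: qd_def nx power_divide)
     have "Q (?\<zeta> / cor e) * dzeta k0 L (s * e)
       = pol \<alpha> (%i. \<i> * ?\<zeta> * cor (sgn xx $ i)) * ((?\<zeta> / cor e) ^ ?n * dzeta k0 L (s * e)) * A xx * B xx / (qd k0 L h xx - z)"
      unfolding Q_def \<A>_def p q A_def B_def nx r1 by (simp add: mult_ac)
     also have "... = cor (s ^ ?n) * (md xx * A xx * B xx)"
      unfolding jac[symmetric] md_def symd_def nx by (simp add: mult_ac)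
     finally show ?thesis .
    qed
    show ?thesis unfolding q1 q2 D_def xx_def[symmetric] by (simp add: right_diff_distrib)
   qed auto
   ultimately show "LI (%s. indicator {0<..} s * (cor (s ^ ?n) * D (s *\<^sub>R \<eta>))) = 0"
    by (simp only:)
  qed
 qed
 then have "LI (%xx. md xx * A xx * B xx) = LI (%xx. m xx * A0 xx * B0 xx)"
  using Bochner_Integration.integral_diff[OF i1 i2] by (simp add: D_def[abs_def])
 then show "pair (Td k0 L R ch h \<alpha> z u) v = pair (Tfree ch h \<alpha> z u) v" by (simp only: lhs rhs)
qed

section \<open>Analytic Fredholm theory\<close>

text \<open>The Sherman-Morrison formula with denominators cleared: \<open>N\<close> inverts
  \<open>M\<close> up to the scalar \<open>d\<close>. The surplus factor \<open>d\<close> in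
  \<open>d * e\<close> is the price for avoiding division, which keeps the new inverse and the new
  scalar holomorphic.\<close>

lemma rank1_perturbation:
 fixes M N :: "'n::finite L2_op" and ph \<psi> :: "'n L2" and d :: complex
 assumes M: "complex_linear M" and N: "complex_linear N"
  and MN: "M oL N = op_scaleC d I1" "N oL M = op_scaleC d I1"
 defines "e \<equiv> d + pair (N ph) \<psi>"
 defines "N' \<equiv> op_scaleC e N - (N oL rank1 ph \<psi> oL N)"
 shows "(M + rank1 ph \<psi>) oL N' = op_scaleC (d * e) I1"
  "N' oL (M + rank1 ph \<psi>) = op_scaleC (d * e) I1"
proof -
 have 1: "M (N u) = L2_scaleC d u" "N (M u) = L2_scaleC d u" for u
  using arg_cong[OF MN(1), of "%T. ap T u"] arg_cong[OF MN(2), of "%T. ap T u"]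
  by (simp_all add: op_scaleC_apply)
 note s = op_scaleC_apply blinfun.add_left blinfun.diff_left blinfun.add_right blinfun.diff_right 1
  complex_linear_scaleC[OF M] complex_linear_scaleC[OF N] pair_add_left pair_diff_left pair_scaleC_left
  L2_scaleC_add_left L2_scaleC_diff_left L2_scaleC_add L2_scaleC_diff L2_scaleC_scaleC
 show "(M + rank1 ph \<psi>) oL N' = op_scaleC (d * e) I1"
 proof (rule blinfun_eqI)
  fix u
  have "ap ((M + rank1 ph \<psi>) oL N') u = L2_scaleC (e * d) u + L2_scaleC (e * pair (N u) \<psi> - pair (N u) \<psi> * d - pair (N u) \<psi> * pair (N ph) \<psi>) ph"
   by (simp add: N'_def s mult_ac)
  also have "e * pair (N u) \<psi> - pair (N u) \<psi> * d - pair (N u) \<psi> * pair (N ph) \<psi> = 0"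
   by (simp add: e_def algebra_simps)
  finally show "ap ((M + rank1 ph \<psi>) oL N') u = op_scaleC (d * e) I1 u"
   by (simp add: op_scaleC_apply mult.commute)
 qed
 show "N' oL (M + rank1 ph \<psi>) = op_scaleC (d * e) I1"
 proof (rule blinfun_eqI)
  fix u
  have "ap (N' oL (M + rank1 ph \<psi>)) u = L2_scaleC (e * d) u + L2_scaleC (e * pair u \<psi> - d * pair u \<psi> - pair u \<psi> * pair (N ph) \<psi>) (N ph)"
   by (simp add: N'_def s mult_ac)
  also have "e * pair u \<psi> - d * pair u \<psi> - pair u \<psi> * pair (N ph) \<psi> = 0"
   by (simp add: e_def algebra_simps)
  finally show "ap (N' oL (M + rank1 ph \<psi>)) u = op_scaleC (d * e) I1 u"
   by (simp add: op_scaleC_apply mult.commute)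
 qed
qed

definition op_inv :: "'n::finite L2_op => 'n L2_op => bool" where
 "op_inv T S \<longleftrightarrow> T oL S = I1 & S oL T = I1"

lemma op_inv_apply: "op_inv T S ==> ap S (T u) = u" "op_inv T S ==> ap T (S u) = u"
 unfolding op_inv_def by (metis blinfun_apply_blinfun_compose blinfun_apply_id_blinfun id_apply)+

lemma op_inv_unique: "op_inv T S ==> op_inv T S' ==> S = S'"
 by (rule blinfun_eqI) (metis op_inv_apply)

lemma op_inv_scale:
 assumes T: "complex_linear T" and d: "d ~= 0"
  and TN: "T oL N = op_scaleC d I1" "N oL T = op_scaleC d I1"
 shows "op_inv T (op_scaleC (1 / d) N)"
proof -
 have 1: "T (N u) = L2_scaleC d u" "N (T u) = L2_scaleC d u" for u
  using arg_cong[OF TN(1), of "%T. ap T u"] arg_cong[OF TN(2), of "%T. ap T u"]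
  by (simp_all add: op_scaleC_apply)
 show ?thesis unfolding op_inv_def
  by (intro conjI blinfun_eqI) (simp_all add: op_scaleC_apply complex_linear_scaleC[OF T] 1 L2_scaleC_scaleC L2_scaleC_one d)
qed

text \<open>If the scalar vanished, \<open>N ph\<close> would lie in the kernel of the invertible
  perturbed operator, hence be 0; but then the scalar would be \<open>d\<close>.\<close>

lemma rank1_denominator_nonzero:
 fixes M N :: "'n::finite L2_op"
 assumes MN: "M oL N = op_scaleC d I1" and d: "d ~= 0" and inv: "op_inv (M + rank1 ph \<psi>) S"
 shows "d + pair (N ph) \<psi> ~= 0"
proof
 assume e: "d + pair (N ph) \<psi> = 0"
 have "M (N ph) = L2_scaleC d ph" using arg_cong[OF MN, of "%T. ap T ph"] by (simp add: op_scaleC_apply)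
 then have "(M + rank1 ph \<psi>) (N ph) = L2_scaleC (d + pair (N ph) \<psi>) ph"
  by (simp add: blinfun.add_left L2_scaleC_add_left)
 then have "(M + rank1 ph \<psi>) (N ph) = 0" by (simp only: e L2_scaleC_zero)
 then have "N ph = 0" using op_inv_apply(1)[OF inv, of "N ph"] by (simp add: blinfun.zero_right)
 then show False using e d by simp
qed

lemma rank1_add_scaleC: "T + rank1 (L2_scaleC a ph) \<psi> + rank1 (L2_scaleC b ph) \<psi> = T + rank1 (L2_scaleC (a + b) ph) \<psi>"
 by (rule blinfun_eqI) (simp add: blinfun.add_left L2_scaleC_add L2_scaleC_add_left add.assoc)

lemma rank1_invertible:
 assumes T: "complex_linear T" and inv: "op_inv T S" and ne: "1 + c * pair (S ph) \<psi> ~= 0"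
 shows "\<exists>S'. op_inv (T + rank1 (L2_scaleC c ph) \<psi>) S'"
proof -
 have S: "complex_linear S" using complex_linear_inverse T inv by (auto simp: op_inv_def)
 have id: "op_scaleC 1 I1 = (I1 :: 'a L2_op)" by (rule blinfun_eqI) (simp add: op_scaleC_apply L2_scaleC_one)
 note R = rank1_perturbation[of T S 1 "L2_scaleC c ph" \<psi>, OF T S]
 have "1 * (1 + pair (S (L2_scaleC c ph)) \<psi>) ~= 0" using ne by (simp add: complex_linear_scaleC[OF S] pair_scaleC_left)
 then show ?thesis
  using op_inv_scale[OF _ _ R] inv T by (auto simp: op_inv_def id intro: complex_linear_add complex_linear_rank1)
qed

text \<open>Invertibility up to a holomorphic scalar, with no division. The condition at
  \<open>z1\<close> prevents the scalar from vanishing identically, so on a connected domain the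
  inverse is meromorphic.\<close>

definition fredholm_inv :: "(complex => 'n::finite L2_op) => complex set => complex => bool" where
 "fredholm_inv M D z1 \<longleftrightarrow> (\<exists>N d. holo N D & d holomorphic_on D & d z1 ~= 0 &
   (\<forall>z\<in>D. M z oL N z = op_scaleC (d z) I1 & N z oL M z = op_scaleC (d z) I1))"

lemma fredholm_inv_rank1:
 assumes F: "fredholm_inv M D z1" and M: "holo M D" and D: "open D" "z1 \<in> D" and inv: "op_inv (M z1 + rank1 ph \<psi>) S"
 shows "fredholm_inv (%z. M z + rank1 ph \<psi>) D z1"
proof -
 obtain N d where N: "holo N D" "d holomorphic_on D" "d z1 ~= 0"
  and MN: "!!z. z \<in> D ==> M z oL N z = op_scaleC (d z) I1" "!!z. z \<in> D ==> N z oL M z = op_scaleC (d z) I1"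
  using F unfolding fredholm_inv_def by blast
 define e where "e z = d z + pair (N z ph) \<psi>" for z
 define N' where "N' z = op_scaleC (e z) (N z) - (N z oL rank1 ph \<psi> oL N z)" for z
 have eh: "e holomorphic_on D" unfolding e_def[abs_def] by (intro holomorphic_intros N holo_pair D)
 show ?thesis unfolding fredholm_inv_def
 proof (intro exI conjI ballI)
  show "holo N' D" unfolding N'_def[abs_def]
   by (intro holo_diff holo_op_scaleC holo_comp holo_const complex_linear_rank1 N eh D)
  show "(%z. d z * e z) holomorphic_on D" by (intro holomorphic_intros N eh)
  show "d z1 * e z1 ~= 0" using rank1_denominator_nonzero[OF MN(1)[OF D(2)] N(3) inv] N(3) by (simp add: e_def)
  fix z assume z: "z \<in> D"
  note R = rank1_perturbation[OF holo_complex_linear[OF M z] holo_complex_linear[OF N(1) z] MN[OF z], of ph \<psi>]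
  show "(M z + rank1 ph \<psi>) oL N' z = op_scaleC (d z * e z) I1"
   "N' z oL (M z + rank1 ph \<psi>) = op_scaleC (d z * e z) I1"
   unfolding N'_def e_def by (rule R)+
 qed
qed

text \<open>The rank one terms are added one at a time, through families that stay invertible at
  \<open>z1\<close>; for this each term is split as \<open>c \<phi>\<psi> + (1 - c) \<phi>\<psi>\<close> with a suitable \<open>c\<close>.\<close>

lemma complex_linear_fin_rank: "fin_rank K ==> complex_linear K"
 by (induction rule: fin_rank.induct) (auto intro: complex_linear_add complex_linear_zero)

lemma fredholm_inv_fin_rank:
 assumes K: "fin_rank K" and D: "open D" "z1 \<in> D"
 shows "fredholm_inv M D z1 ==> holo M D ==> op_inv (M z1 + K) S ==> fredholm_inv (%z. M z + K) D z1"
 using K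
proof (induction K arbitrary: M S rule: fin_rank.induct)
 case (step K ph \<psi>)
 have Kl: "complex_linear K" by (rule complex_linear_fin_rank[OF step.hyps])
 have M1: "complex_linear (M z1)" by (rule holo_complex_linear[OF step.prems(2) D(2)])
 let ?T = "M z1 + (K + rank1 ph \<psi>)"
 have Tl: "complex_linear ?T" by (intro complex_linear_add M1 Kl complex_linear_rank1)
 obtain N d where "d z1 ~= 0" "M z1 oL N z1 = op_scaleC (d z1) I1" "N z1 oL M z1 = op_scaleC (d z1) I1"
  using step.prems(1) D unfolding fredholm_inv_def by blast
 from op_inv_scale[OF M1 this] obtain S1 where S1: "op_inv (M z1) S1" by blast
 define \<alpha> where "\<alpha> = pair (S1 ph) \<psi>"
 define \<beta> where "\<beta> = pair (S ph) \<psi>"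
 \<comment> \<open>The first condition keeps \<open>M z1\<close> with the fraction \<open>c\<close>
   of the new term invertible; the second keeps it invertible with \<open>K\<close> added as well,
   seen from the full operator \<open>?T\<close>. Each excludes at most one value of
   \<open>c\<close>.\<close>
 obtain c where c: "1 + c * \<alpha> ~= 0" "1 + (c - 1) * \<beta> ~= 0"
 proof (cases "\<beta> = 1")
  case True
  then show thesis using that[of 1] that[of "-1"] by (cases "\<alpha> = -1") (auto simp: add_eq_0_iff)
 qed (use that[of 0] in auto)
 let ?M = "%z. M z + rank1 (L2_scaleC c ph) \<psi>"
 have Mh: "holo ?M D" by (intro holo_add holo_const complex_linear_rank1 step.prems)
 obtain S2 where "op_inv (M z1 + rank1 (L2_scaleC c ph) \<psi>) S2"
  using rank1_invertible[OF M1 S1 c(1)[unfolded \<alpha>_def]] by blast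
 from fredholm_inv_rank1[OF step.prems(1,2) D this] have F: "fredholm_inv ?M D z1" .
 have eq: "?T + rank1 (L2_scaleC (c - 1) ph) \<psi> = ?M z1 + K"
  using rank1_add_scaleC[of "M z1 + K" 1 ph \<psi> "c - 1"] by (simp add: L2_scaleC_one add_ac)
 obtain S3 where "op_inv (?M z1 + K) S3"
  using rank1_invertible[OF Tl step.prems(3) c(2)[unfolded \<beta>_def]] unfolding eq by blast
 from step.IH[OF F Mh this] have G: "fredholm_inv (%z. ?M z + K) D z1" .
 have eq2: "?M z + K + rank1 (L2_scaleC (1 - c) ph) \<psi> = M z + (K + rank1 ph \<psi>)" for z
  using rank1_add_scaleC[of "M z + K" c ph \<psi> "1 - c"] by (simp add: L2_scaleC_one add_ac)
 have "holo (%z. ?M z + K) D" by (intro holo_add Mh holo_const Kl)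
 from fredholm_inv_rank1[OF G this D, of "L2_scaleC (1 - c) ph" \<psi> S] step.prems(3)
 show ?case unfolding eq2 by blast
qed simp

text \<open>Near \<open>w\<close> the family differs from a finite rank \<open>K0\<close> by less
  than 1/2, so \<open>I + (K z - K0)\<close> is invertible on the disc with scalar 1, and
  \<open>K0\<close> is put back one rank at a time. Invertibility at a single point of the disc
  keeps the scalar from vanishing identically.\<close>

lemma Fredholm_ball:
 fixes K :: "complex => 'n::finite L2_op"
 assumes K: "holo K (ball w r)" and r: "r > 0" and ap: "approximable (K w)"
 obtains \<rho> where "\<rho> > 0" "\<rho> <= r"
  "!!z1. z1 \<in> ball w \<rho> ==> \<exists>S. op_inv (I1 + K z1) S ==> fredholm_inv (%z. I1 + K z) (ball w \<rho>) z1"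
proof -
 obtain K0 where K0: "fin_rank K0" "norm (K w - K0) < 1/4" using ap unfolding approximable_def by (meson zero_less_divide_1_iff zero_less_numeral)
 have K0l: "complex_linear K0" by (rule complex_linear_fin_rank[OF K0(1)])
 have "isCont K w" by (rule holo_continuous[OF K]) (use r in simp)
 then obtain \<delta> where \<delta>: "\<delta> > 0" "!!z. dist z w < \<delta> ==> dist (K z) (K w) < 1/4"
  unfolding continuous_at_eps_delta by (meson zero_less_divide_1_iff zero_less_numeral)
 define \<rho> where "\<rho> = min r \<delta>"
 show thesis
 proof (rule that[of \<rho>])
  show "\<rho> > 0" "\<rho> <= r" using r \<delta> by (auto simp: \<rho>_def)
  fix z1 assume z1: "z1 \<in> ball w \<rho>" and ex: "\<exists>S. op_inv (I1 + K z1) S"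
  let ?D = "ball w \<rho>"
  let ?M = "%z. I1 + (K z - K0)"
  have Kh: "holo K ?D" by (rule holo_subset[OF K]) (auto simp: \<rho>_def)
  have Mh: "holo ?M ?D" by (intro holo_add holo_diff holo_const complex_linear_id K0l Kh)
  have small: "norm (K z - K0) < 1" if "z \<in> ?D" for z
  proof -
   have "norm (K z - K0) <= norm (K z - K w) + norm (K w - K0)" using norm_triangle_ineq[of "K z - K w" "K w - K0"] by simp
   moreover have "dist (K z) (K w) < 1/4" using that by (intro \<delta>(2)) (simp add: \<rho>_def dist_commute)
   then have "norm (K z - K w) < 1/4" by (simp add: dist_norm)
   ultimately show ?thesis using K0(2) by linarith
  qed
  have "\<exists>N. \<forall>z\<in>?D. ?M z oL N z = I1 & N z oL ?M z = I1"
   by (rule bchoice) (metis Neumann small)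
  then obtain N where N: "!!z. z \<in> ?D ==> ?M z oL N z = I1" "!!z. z \<in> ?D ==> N z oL ?M z = I1" by blast
  have id: "op_scaleC 1 I1 = (I1 :: 'n L2_op)" by (rule blinfun_eqI) (simp add: op_scaleC_apply L2_scaleC_one)
  have "fredholm_inv ?M ?D z1" unfolding fredholm_inv_def
   by (rule exI[of _ N], rule exI[of _ "%_. 1"]) (auto simp: id N intro: holo_inverse[OF Mh N])
  moreover obtain S where "op_inv (?M z1 + K0) S" using ex by (auto simp: add.assoc)
  ultimately have "fredholm_inv (%z. ?M z + K0) ?D z1"
   using fredholm_inv_fin_rank[OF K0(1) open_ball z1] Mh by blast
  then show "fredholm_inv (%z. I1 + K z) ?D z1" by (simp add: add.assoc)
 qed
qed

text \<open>Near \<open>w\<close> the scalar factors as \<open>(z - w)^k g z\<close> with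
  \<open>g\<close> free of zeros, and \<open>N / g\<close> is the holomorphic numerator. A constant
  scalar is treated apart because the factorisation of a zero presupposes a nonconstant
  function.\<close>

lemma fredholm_inv_meromorphic:
 fixes M :: "complex => 'n::finite L2_op"
 assumes F: "fredholm_inv M D z1" and M: "holo M D" and D: "open D" "connected D" "z1 \<in> D" and w: "w \<in> D"
 obtains k r G where "r > 0" "ball w r \<subseteq> D" "holo G (ball w r)"
  "!!z. z \<in> ball w r - {w} ==> op_inv (M z) (op_scaleC (1 / (z - w) ^ k) (G z))"
proof -
 obtain N d where N: "holo N D" "d holomorphic_on D" "d z1 ~= 0"
  and MN: "!!z. z \<in> D ==> M z oL N z = op_scaleC (d z) I1" "!!z. z \<in> D ==> N z oL M z = op_scaleC (d z) I1"
  using F unfolding fredholm_inv_def by blast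
 have "\<exists>k g r. r > 0 & ball w r \<subseteq> D & g holomorphic_on ball w r & (\<forall>z\<in>ball w r. g z ~= 0 & d z = (z - w) ^ k * g z)"
 proof (cases "d constant_on D")
  case True
  then have "d z = d z1" if "z \<in> D" for z using that D(3) unfolding constant_on_def by metis
  moreover obtain r where r: "r > 0" "ball w r \<subseteq> D" using D(1) w openE by blast
  ultimately show ?thesis
   using N(3) holomorphic_on_subset[OF N(2) r(2)]
   by (intro exI[of _ "0::nat"] exI[of _ d] exI[of _ r]) (use r subset_iff in auto)
 next
  case False
  show ?thesis
  proof (cases "d w = 0")
   case True
   obtain g r k where "0 < k" "0 < r" "ball w r \<subseteq> D" "g holomorphic_on ball w r"
    "!!z. z \<in> ball w r ==> d z = (z - w) ^ k * g z" "!!z. z \<in> ball w r ==> g z ~= 0"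
    by (rule holomorphic_factor_zero_nonconstant[OF N(2) D(1,2) w True False]) blast
   then show ?thesis by blast
  next
   case False
   have "continuous_on D d" using N(2) by (rule holomorphic_on_imp_continuous_on)
   then have "open (D \<inter> d -` (- {0}))" using D(1) by (intro continuous_open_preimage) auto
   then obtain r where r: "r > 0" "ball w r \<subseteq> D \<inter> d -` (- {0})" using False w by (metis (no_types, lifting) ComplI IntI openE singletonD vimageI)
   then have "d holomorphic_on ball w r" using holomorphic_on_subset[OF N(2)] by blast
   then show ?thesis using r
    by (intro exI[of _ "0::nat"] exI[of _ d] exI[of _ r]) auto
  qed
 qed
 then obtain k g r where r: "r > 0" "ball w r \<subseteq> D" "g holomorphic_on ball w r"
  and g: "!!z. z \<in> ball w r ==> g z ~= 0" "!!z. z \<in> ball w r ==> d z = (z - w) ^ k * g z" by blast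
 show thesis
 proof (rule that[of r "%z. op_scaleC (1 / g z) (N z)" k])
  show "holo (%z. op_scaleC (1 / g z) (N z)) (ball w r)"
   by (intro holo_op_scaleC holomorphic_intros r(3) g(1) open_ball holo_subset[OF N(1) r(2)])
  fix z assume z: "z \<in> ball w r - {w}"
  then have zD: "z \<in> D" "d z ~= 0" using r(2) g[of z] by auto
  have "op_scaleC (1 / (z - w) ^ k) (op_scaleC (1 / g z) (N z)) = op_scaleC (1 / d z) (N z)"
   using z g(2)[of z] by (intro blinfun_eqI) (simp add: op_scaleC_apply L2_scaleC_scaleC)
  then show "op_inv (M z) (op_scaleC (1 / (z - w) ^ k) (op_scaleC (1 / g z) (N z)))"
   using op_inv_scale[OF holo_complex_linear[OF M zD(1)] zD(2) MN[OF zD(1)]] by simp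
 qed (use r in auto)
qed

section \<open>The global continuation\<close>

lemma holo_local: "(!!z. z \<in> S ==> \<exists>T. z \<in> T & holo F T) ==> holo F S"
 unfolding holo_def op_holomorphic_on_def by blast

lemma holo_Tfree:
 fixes ch :: "'n::finite cfun"
 assumes ch: "bdd_mult ch" shows "holo (Tfree ch h []) {z. Im z > 0}"
proof (rule holo_local)
 fix z assume z: "z \<in> {z. Im z > 0}"
 let ?S = "{w. Im z / 2 < Im w}"
 let ?Q = "%xx::real^'n. cor (h\<^sup>2 * (norm xx)\<^sup>2)"
 have lb: "Im z / 2 <= cmod (?Q xx - w)" if "w \<in> ?S" for w xx
  using abs_Im_le_cmod[of "?Q xx - w"] that by simp
 have "holo (%w. mult_op (%xx::real^'n. 1 / (?Q xx - w))) ?S"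
 proof (rule holo_mult_op_quotient(1)[where C="1 / (Im z / 2)" and \<delta>="Im z / 2"])
  show "open ?S" by (rule open_halfspace_Im_gt)
  show "0 < Im z / 2" using z by simp
  show "cmod 1 <= 1 / (Im z / 2) * cmod (?Q xx - w)" if "w \<in> ?S" for w xx
   using lb[OF that, of xx] z by (simp add: field_simps)
 qed (use lb in auto)
 then have "holo (Tfree ch h []) ?S"
  unfolding Tfree_def[abs_def] Mop_def pol_def rz_def
  by (simp add: holo_comp holo_const holo_scaleR complex_linear_mult_op[OF ch] complex_linear_Ft)
 then show "\<exists>T. z \<in> T & holo (Tfree ch h []) T" using z by (intro exI[of _ ?S]) auto
qed

text \<open>The second resolvent identity in both orders. The cut-offs may be inserted around the
  potential because \<open>ch = 1\<close> wherever \<open>V\<close> does not vanish.\<close>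

lemma cutoff_resolvent_identities:
 fixes V :: "real^'n::finite => real" and f :: "'n L2"
 assumes V: "bdd_mult (%x. cor (V x))" and ch: "bdd_mult ch" "!!x. V x ~= 0 ==> ch x = 1"
  and h: "h > 0" and z: "Im z > 0"
 defines "A \<equiv> cutoff_resolvent V ch h z" and "B \<equiv> Tfree ch h [] z" and "v \<equiv> L2_mult (%x. cor (V x))"
 shows "A f = B f - B (v (A f))" "A f = B f - A (v (B f))"
proof -
 have B: "B u = L2_mult ch (free_resolvent h z (L2_mult ch u))" for u by (simp add: B_def Tfree_def pol_def free_resolvent_def)
 have A: "A u = L2_mult ch (resolvent V h z (L2_mult ch u))" for u by (simp add: A_def cutoff_resolvent_def)
 have v: "v u = L2_mult ch (v (L2_mult ch u))" for u
 proof -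
  have "(%x. ch x * (cor (V x) * ch x)) = (%x. cor (V x))"
  proof
   show "ch x * (cor (V x) * ch x) = cor (V x)" for x by (cases "V x = 0") (simp_all add: ch(2))
  qed
  then show ?thesis unfolding v_def
   by (simp add: L2_mult_L2_mult ch(1) V bdd_mult_mult)
 qed
 let ?g = "L2_mult ch f"
 note R = resolvent_props[OF V h z] and R0 = free_resolvent_props[OF h z]
 have sch: "schroedinger V h w = P0 h w + v w" for w by (simp add: schroedinger_def P0_def v_def)
 have "free_resolvent h z (P0 h (resolvent V h z ?g) - L2_scaleC z (resolvent V h z ?g)) = resolvent V h z ?g"
  by (rule R0(3)[OF R(1)])
 moreover have "P0 h (resolvent V h z ?g) - L2_scaleC z (resolvent V h z ?g) = ?g - v (resolvent V h z ?g)"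
  using R(2)[of ?g] unfolding sch by (simp add: algebra_simps)
 ultimately have 1: "resolvent V h z ?g = free_resolvent h z ?g - free_resolvent h z (v (resolvent V h z ?g))"
  by (simp add: blinfun.diff_right)
 show "A f = B f - B (v (A f))"
  unfolding A B v[of "resolvent V h z ?g", symmetric]
  using arg_cong[OF 1, of "L2_mult ch"] by (simp add: L2_mult_diff)
 have "resolvent V h z (schroedinger V h (free_resolvent h z ?g) - L2_scaleC z (free_resolvent h z ?g)) = free_resolvent h z ?g"
  by (rule R(3)[OF R0(1)])
 moreover have "schroedinger V h (free_resolvent h z ?g) - L2_scaleC z (free_resolvent h z ?g) = ?g + v (free_resolvent h z ?g)"
  using R0(2)[of ?g] unfolding sch by (simp add: algebra_simps)
 ultimately have 2: "resolvent V h z ?g = free_resolvent h z ?g - resolvent V h z (v (free_resolvent h z ?g))"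
  by (simp add: blinfun.add_right algebra_simps)
 show "A f = B f - A (v (B f))"
  unfolding A B v[of "free_resolvent h z ?g", symmetric]
  using arg_cong[OF 2, of "L2_mult ch"] by (simp add: L2_mult_diff)
qed

text \<open>\<open>A\<close> is recovered from the free operator as \<open>(I + B W)^-1 B\<close>,
  so continuing \<open>B\<close> and inverting continues \<open>A\<close>. Conversely
  \<open>A\<close> itself provides the inverse, as \<open>I - A W\<close>.\<close>

lemma cutoff_resolvent_op_inv:
 fixes V :: "real^'n::finite => real"
 assumes V: "bdd_mult (%x. cor (V x))" and ch: "bdd_mult ch" "!!x. V x ~= 0 ==> ch x = 1"
  and h: "h > 0" and z: "Im z > 0"
 defines "A \<equiv> cutoff_resolvent V ch h z" and "B \<equiv> Tfree ch h [] z" and "W \<equiv> mult_op (%x. cor (V x))"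
 shows "op_inv (I1 + (B oL W)) (I1 - (A oL W))" "(I1 - (A oL W)) oL B = A"
proof -
 note I = cutoff_resolvent_identities[OF assms(1-5), folded A_def B_def]
 show "op_inv (I1 + (B oL W)) (I1 - (A oL W))"
  unfolding op_inv_def
 proof (intro conjI blinfun_eqI)
  fix u
  show "((I1 + (B oL W)) oL (I1 - (A oL W))) u = I1 u"
   using I(1)[of "W u"] by (simp add: blinfun.add_left blinfun.diff_left blinfun.add_right blinfun.diff_right W_def L2_mult_diff algebra_simps)
  show "((I1 - (A oL W)) oL (I1 + (B oL W))) u = I1 u"
   using I(2)[of "W u"] by (simp add: blinfun.add_left blinfun.diff_left blinfun.add_right blinfun.diff_right W_def L2_mult_add algebra_simps)
 qed
 show "(I1 - (A oL W)) oL B = A"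
 proof (rule blinfun_eqI)
  show "((I1 - (A oL W)) oL B) u = A u" for u
   using I(2)[of u] unfolding blinfun_apply_blinfun_compose blinfun.diff_left W_def blinfun_apply_mult_op by simp
 qed
qed

lemma connected_upper_halfplane_discs:
 fixes \<rho> :: "real => real"
 assumes "!!ka. ka > 0 ==> \<rho> ka > 0"
 shows "connected ({z. Im z > 0} \<union> (\<Union>ka\<in>{0<..}. ball (cor ka) (\<rho> ka)))"
proof -
 have c: "connected ({z. Im z > 0} \<union> ball (cor ka) (\<rho> ka))" if "ka > 0" for ka
 proof (rule connected_Un)
  have "Complex ka (\<rho> ka / 2) \<in> {z. Im z > 0} \<inter> ball (cor ka) (\<rho> ka)"
   using assms[OF that] by (simp add: dist_norm norm_complex_def)
  then show "{z. Im z > 0} \<inter> ball (cor ka) (\<rho> ka) ~= {}" by blast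
 qed (auto intro!: convex_connected convex_halfspace_Im_gt)
 have "connected (\<Union>((%ka. {z. Im z > 0} \<union> ball (cor ka) (\<rho> ka)) ` {0<..}))"
 proof (rule connected_Union)
  have "\<i> \<in> \<Inter>((%ka. {z. Im z > 0} \<union> ball (cor ka) (\<rho> ka)) ` {0<..})" by simp
  then show "\<Inter>((%ka. {z. Im z > 0} \<union> ball (cor ka) (\<rho> ka)) ` {0<..}) ~= {}" by blast
 qed (use c in auto)
 moreover have "(\<Union>((%ka. {z. Im z > 0} \<union> ball (cor ka) (\<rho> ka)) ` {0<..}))
   = {z. Im z > 0} \<union> (\<Union>ka\<in>{0<..}. ball (cor ka) (\<rho> ka))"
  by (auto intro: exI[of _ "1::real"])
 ultimately show ?thesis by simp
qed

text \<open>Discs centred on the real axis have an intersection that is open and symmetric under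
  conjugation, so it reaches the upper half-plane, where all local continuations are one and the
  same operator.\<close>

lemma discs_meet_above:
 assumes z: "z \<in> ball (cor ka) r" "z \<in> ball (cor \<mu>) s"
 shows "\<exists>w. Im w > 0 & w \<in> ball (cor ka) r \<inter> ball (cor \<mu>) s"
proof -
 let ?I = "ball (cor ka) r \<inter> ball (cor \<mu>) s"
 consider "Im z > 0" | "Im z = 0" | "Im z < 0" by linarith
 then show ?thesis
 proof cases
  case 2
  have "open ?I" "z \<in> ?I" using z by auto
  then obtain e where e: "e > 0" "ball z e \<subseteq> ?I" using openE by blast
  have "z + \<i> * cor (e / 2) \<in> ball z e" using e by (simp add: dist_norm norm_mult)
  moreover have "Im (z + \<i> * cor (e / 2)) > 0" using 2 e by simp
  ultimately show ?thesis using e(2) by blast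
 next
  case 3
  have "cmod (cor a - cnj z) = cmod (cor a - z)" for a
   by (metis complex_cnj_complex_of_real complex_cnj_diff complex_mod_cnj)
  then have "cnj z \<in> ?I" using z by (simp add: dist_norm)
  then show ?thesis using 3 by (intro exI[of _ "cnj z"]) auto
 qed (use z in auto)
qed

text \<open>The free operators agree on overlapping discs by the identity theorem, and
  \<open>F\<close> is formed from the glued family by inversion. The last conclusion fixes
  \<open>F z\<close> at every single point where the inverse exists, not just outside a discrete
  set; this is what turns a bound for one particular inverse into a bound for
  \<open>F\<close>.\<close>

lemma cutoff_resolvent_continuation_glue:
 fixes V :: "real^'n::finite => real" and \<rho> :: "real => real"
 assumes V: "bdd_mult (%x. cor (V x))" and ch: "bdd_mult ch" "!!x. V x ~= 0 ==> ch x = 1"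
  and h: "h > 0"
  and rho: "!!ka. ka > 0 ==> \<rho> ka > 0"
  and Bh: "!!ka. ka > 0 ==> holo (Bf ka) (ball (cor ka) (\<rho> ka))"
  and Beq: "!!ka z. ka > 0 ==> z \<in> ball (cor ka) (\<rho> ka) ==> Im z > 0 ==> Bf ka z = Tfree ch h [] z"
  and Fr: "!!ka. ka > 0 ==> \<exists>z1\<in>ball (cor ka) (\<rho> ka).
   fredholm_inv (%z. I1 + (Bf ka z oL mult_op (%x. cor (V x)))) (ball (cor ka) (\<rho> ka)) z1"
 obtains U F where "cutoff_resolvent_continuation V ch h U F"
  "!!ka. ka > 0 ==> ball (cor ka) (\<rho> ka) \<subseteq> U"
  "!!ka z S. ka > 0 ==> z \<in> ball (cor ka) (\<rho> ka) ==>
    op_inv (I1 + (Bf ka z oL mult_op (%x. cor (V x)))) S ==> F z = S oL Bf ka z"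
proof -
 define W where "W = (mult_op (%x. cor (V x)) :: 'n L2_op)"
 have Wl: "complex_linear W" unfolding W_def by (rule complex_linear_mult_op[OF V])
 let ?b = "%ka. ball (cor ka) (\<rho> ka)"
 have consistent: "Bf ka z = Bf \<mu> z" if l: "ka > 0" "\<mu> > 0" "z \<in> ?b ka" "z \<in> ?b \<mu>" for ka \<mu> z
 proof (rule holo_identity[where S="?b ka \<inter> ?b \<mu>" and T="?b ka \<inter> ?b \<mu> \<inter> {z. Im z > 0}"])
  show "holo (Bf ka) (?b ka \<inter> ?b \<mu>)" "holo (Bf \<mu>) (?b ka \<inter> ?b \<mu>)"
   using Bh l by (auto intro: holo_subset)
  show "connected (?b ka \<inter> ?b \<mu>)" by (intro convex_connected convex_Int convex_ball)
  show "?b ka \<inter> ?b \<mu> \<inter> {z. Im z > 0} ~= {}" using discs_meet_above[OF l(3,4)] by blast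
  show "open (?b ka \<inter> ?b \<mu> \<inter> {z. Im z > 0})" by (intro open_Int open_ball open_halfspace_Im_gt)
 qed (use l Beq in auto)
 define Bg where "Bg z = (if Im z > 0 then Tfree ch h [] z else Bf (SOME ka. ka > 0 & z \<in> ?b ka) z)" for z
 have Bg: "Bg z = Bf ka z" if "ka > 0" "z \<in> ?b ka" for ka z
 proof (cases "Im z > 0")
  case False
  have "(SOME ka. ka > 0 & z \<in> ?b ka) > 0 & z \<in> ?b (SOME ka. ka > 0 & z \<in> ?b ka)"
   by (rule someI[of _ ka]) (use that in simp)
  then show ?thesis using consistent[OF _ that(1) _ that(2)] False by (simp add: Bg_def)
 qed (use that Beq in \<open>simp add: Bg_def\<close>)
 \<comment> \<open>Where there is no inverse, 0 is a placeholder: meromorphy tests \<open>F\<close>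
   on punctured discs only, and 0 is complex linear as the continuation demands.\<close>
 define F where "F z = (if \<exists>S. op_inv (I1 + (Bg z oL W)) S then (SOME S. op_inv (I1 + (Bg z oL W)) S) oL Bg z else 0)" for z
 have F: "F z = S oL Bg z" if "op_inv (I1 + (Bg z oL W)) S" for z S
 proof -
  have "(SOME S. op_inv (I1 + (Bg z oL W)) S) = S"
   by (rule some_equality[where P="op_inv (I1 + (Bg z oL W))", OF that]) (rule op_inv_unique[OF _ that])
  then show ?thesis using that by (auto simp: F_def)
 qed
 define U where "U = {z. Im z > 0} \<union> (\<Union>ka\<in>{0<..}. ?b ka)"
 have FA: "F z = cutoff_resolvent V ch h z" if z: "Im z > 0" for z
  using F[of z "I1 - (cutoff_resolvent V ch h z oL W)"] cutoff_resolvent_op_inv[OF V ch h z] z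
  by (simp add: Bg_def W_def)
 show thesis
 proof (rule that[of U F])
  show "cutoff_resolvent_continuation V ch h U F"
   unfolding cutoff_resolvent_continuation_def
  proof (intro conjI ballI allI impI)
   show "open U" unfolding U_def by (intro open_Un open_halfspace_Im_gt open_UN ballI open_ball)
   show "connected U" unfolding U_def by (rule connected_upper_halfplane_discs[OF rho])
   show "{z. 0 < Im z} \<subseteq> U" by (auto simp: U_def)
   show "cor ` {0<..} \<subseteq> U" using rho by (force simp: U_def)
   show "F z = cutoff_resolvent V ch h z" if "Im z > 0" for z by (rule FA[OF that])
   show "complex_linear (F z)" if z: "z \<in> U" for z
   proof (cases "\<exists>S. op_inv (I1 + (Bg z oL W)) S")
    case True
    then obtain S where S: "op_inv (I1 + (Bg z oL W)) S" by blast
    have Bl: "complex_linear (Bg z)"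
    proof (cases "Im z > 0")
     case True
     then show ?thesis using holo_complex_linear[OF holo_Tfree[OF ch(1)]] by (simp add: Bg_def)
    next
     case False
     then obtain ka where "ka > 0" "z \<in> ?b ka" using z by (auto simp: U_def)
     then show ?thesis using holo_complex_linear[OF Bh] Bg by simp
    qed
    have "complex_linear (I1 + (Bg z oL W))" by (intro complex_linear_add complex_linear_id complex_linear_comp Bl Wl)
    then have "complex_linear S" using complex_linear_inverse S unfolding op_inv_def by blast
    then show ?thesis unfolding F[OF S] by (rule complex_linear_comp[OF _ Bl])
   qed (simp add: F_def complex_linear_zero)
   show "op_meromorphic_on F U"
    unfolding op_meromorphic_on_def
   proof
    fix z assume z: "z \<in> U"
    show "\<exists>k. \<exists>r>0. \<exists>G. op_holomorphic_on G (ball z r) & (\<forall>w\<in>ball z r - {z}. F w = op_scaleC (1 / (w - z) ^ k) (G w))"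
    proof (cases "Im z > 0")
     case True
     let ?H = "{z. Im z > 0}"
     have Hop: "open ?H" by (rule open_halfspace_Im_gt)
     let ?A = "%z. cutoff_resolvent V ch h z"
     have M: "holo (%z. I1 + (Tfree ch h [] z oL W)) ?H"
      by (intro holo_add holo_const complex_linear_id holo_comp holo_Tfree ch(1) Wl)
     have "holo (%z. I1 - (?A z oL W)) ?H"
      by (rule holo_inverse[OF M _ _ Hop]) (use cutoff_resolvent_op_inv(1)[OF V ch h] in \<open>auto simp: op_inv_def W_def\<close>)
     then have "holo (%z. (I1 - (?A z oL W)) oL Tfree ch h [] z) ?H" by (intro holo_comp holo_Tfree ch(1))
     then have FH: "holo F ?H"
      by (rule holo_transform[OF _ Hop]) (use cutoff_resolvent_op_inv(2)[OF V ch h] FA in \<open>auto simp: W_def\<close>)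
     obtain r where "r > 0" "ball z r \<subseteq> ?H" using Hop True openE by blast
     then show ?thesis
      by (intro exI[of _ 0] exI[of _ r] conjI exI[of _ F])
        (auto intro!: holo_imp_op_holomorphic holo_subset[OF FH] blinfun_eqI simp: op_scaleC_apply L2_scaleC_one)
    next
     case False
     then obtain ka where l: "ka > 0" "z \<in> ?b ka" using z by (auto simp: U_def)
     obtain z1 where z1: "z1 \<in> ?b ka" "fredholm_inv (%z. I1 + (Bf ka z oL W)) (?b ka) z1"
      using Fr[OF l(1)] unfolding W_def by blast
     have M: "holo (%z. I1 + (Bf ka z oL W)) (?b ka)"
      by (intro holo_add holo_const complex_linear_id holo_comp Bh l Wl)
     obtain k r G where r: "r > 0" "ball z r \<subseteq> ?b ka" and G: "holo G (ball z r)"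
      and inv: "!!w. w \<in> ball z r - {z} ==> op_inv (I1 + (Bf ka w oL W)) (op_scaleC (1 / (w - z) ^ k) (G w))"
      by (rule fredholm_inv_meromorphic[OF z1(2) M open_ball connected_ball z1(1) l(2)]) (rule that)
     show ?thesis
     proof (intro exI[of _ k] exI[of _ r] conjI exI[of _ "%w. G w oL Bf ka w"] r ballI)
      show "op_holomorphic_on (%w. G w oL Bf ka w) (ball z r)"
       by (intro holo_imp_op_holomorphic holo_comp G holo_subset[OF Bh[OF l(1)] r(2)])
      fix w assume w: "w \<in> ball z r - {z}"
      then have "Bg w = Bf ka w" using r(2) l(1) by (intro Bg) auto
      with F[of w] inv[OF w] have "F w = op_scaleC (1 / (w - z) ^ k) (G w) oL Bf ka w" by simp
      then show "F w = op_scaleC (1 / (w - z) ^ k) (G w oL Bf ka w)"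
       by (simp add: op_scaleC_def blinfun_compose_assoc)
     qed
    qed
   qed
  qed
  show "?b ka \<subseteq> U" if "ka > 0" for ka using that by (auto simp: U_def)
  show "F z = S oL Bf ka z" if "ka > 0" "z \<in> ?b ka"
   "op_inv (I1 + (Bf ka z oL mult_op (%x. cor (V x)))) S" for ka z S
   using F[of z S] Bg[OF that(1,2)] that(3) by (simp add: W_def)
 qed
qed

text \<open>Away from \<open>E\<close> mere existence is the aim, so the depth is the largest
  admissible one, \<open>k0 / 2\<close>, with no regard to its growth in \<open>1/h\<close>. The
  point of invertibility is taken in the upper half of the disc, where it comes from the genuine
  resolvent.\<close>

lemma disc_exists:
 fixes V :: "real^'n::finite => real"
 assumes V: "bdd_mult (%x. cor (V x))"
  and ch: "bdd_mult ch" "sqi ch" "!!x. norm x > R ==> ch x = 0" "!!x. V x ~= 0 ==> ch x = 1"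
  and R: "0 <= R" and h: "h > 0" and l: "ka > 0"
 shows "\<exists>\<rho>>0. \<exists>B. holo B (ball (cor ka) \<rho>) &
  (\<forall>z\<in>ball (cor ka) \<rho>. Im z > 0 --> B z = Tfree ch h [] z) &
  (\<exists>z1\<in>ball (cor ka) \<rho>. fredholm_inv (%z. I1 + (B z oL mult_op (%x. cor (V x)))) (ball (cor ka) \<rho>) z1)"
proof -
 define k0 where "k0 = sqrt ka / h"
 define L where "L = k0 / 2"
 have k0: "k0 > 0" using l h by (simp add: k0_def)
 have L: "0 < L" "L <= k0 / 2" using k0 by (simp_all add: L_def)
 have c: "h\<^sup>2 * k0\<^sup>2 = ka" using l h by (simp add: k0_def power_divide)
 let ?W = "mult_op (%x. cor (V x)) :: 'n L2_op"
 let ?B = "Td k0 L R ch h []"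
 define r where "r = h\<^sup>2 * L * k0 / 4"
 have r: "r > 0" using h L k0 by (simp add: r_def)
 note Bh = Td_holo(1)[OF L h _ ch(1) R, of "[]", folded r_def, unfolded c]
 have Kh: "holo (%z. ?B z oL ?W) (ball (cor ka) r)"
  by (intro holo_comp Bh holo_const complex_linear_mult_op V) simp
 have m: "cor ka \<in> ball (cor (h\<^sup>2 * k0\<^sup>2)) (h\<^sup>2 * L * k0 / 4)"
  unfolding c r_def[symmetric] using r by simp
 have "approximable (?B (cor ka))"
  by (rule approximable_Td[OF L h ch(1-3) R m])
 moreover have "I1 oL T = T" for T :: "'n L2_op" by (rule blinfun_eqI) simp
 ultimately have ap: "approximable (?B (cor ka) oL ?W)"
  using approximable_comp[OF _ complex_linear_id V] by metis
 obtain \<rho> where rho: "\<rho> > 0" "\<rho> <= r"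
  and fr: "!!z1. z1 \<in> ball (cor ka) \<rho> ==> \<exists>S. op_inv (I1 + (?B z1 oL ?W)) S ==>
    fredholm_inv (%z. I1 + (?B z oL ?W)) (ball (cor ka) \<rho>) z1"
  by (rule Fredholm_ball[OF Kh r ap]) (rule that)
 have sub: "ball (cor ka) \<rho> \<subseteq> ball (cor ka) r" using rho by auto
 have Beq: "?B z = Tfree ch h [] z" if "z \<in> ball (cor ka) \<rho>" "Im z > 0" for z
  by (rule Td_eq_Tfree[OF L h _ ch(1-3) R _ that(2)]) (unfold c r_def[symmetric], use that(1) sub in auto)
 let ?z1 = "Complex ka (\<rho> / 2)"
 have z1: "?z1 \<in> ball (cor ka) \<rho>" "Im ?z1 > 0" using rho by (simp_all add: dist_norm norm_complex_def)
 have "op_inv (I1 + (?B ?z1 oL ?W)) (I1 - (cutoff_resolvent V ch h ?z1 oL ?W))"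
  unfolding Beq[OF z1] by (rule cutoff_resolvent_op_inv(1)[OF V ch(1,4) h z1(2)])
 then have "fredholm_inv (%z. I1 + (?B z oL ?W)) (ball (cor ka) \<rho>) ?z1" using fr[OF z1(1)] by blast
 then show ?thesis using rho(1) Beq z1(1) holo_subset[OF Bh sub]
  by (intro exI[of _ \<rho>] exI[of _ ?B] conjI bexI[of _ ?z1]) auto
qed

section \<open>Propagating the estimate to complex energies\<close>

text \<open>The commutator of the Laplacian with multiplication by \<open>\<theta>\<close>, applied
  to \<open>u\<close>.\<close>

definition comm :: "('n::finite cfun) => 'n L2 => 'n L2" where
 "comm \<theta> u = (\<Sum>i\<in>UNIV. 2 *\<^sub>R L2_mult (pd i \<theta>) (weak_deriv i u) + L2_mult (pd i (pd i \<theta>)) u)"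

lemma H2_L2_mult:
 fixes u :: "'n::finite L2"
 assumes u: "u \<in> H2" and th: "smooth \<theta>" "bdd_mult \<theta>" "!!i. bdd_mult (pd i \<theta>)"
  "!!i j. bdd_mult (pd j (pd i \<theta>))"
 shows "L2_mult \<theta> u \<in> H2" "laplacian (L2_mult \<theta> u) = L2_mult \<theta> (laplacian u) + comm \<theta> u"
  "weak_partial i (L2_mult (pd i \<theta>) u)
   (L2_mult (pd i \<theta>) (weak_deriv i u) + L2_mult (pd i (pd i \<theta>)) u)"
proof -
 note wp = H2_weak_partial[OF u]
 have 1: "weak_partial i (L2_mult \<theta> u) (L2_mult \<theta> (weak_deriv i u) + L2_mult (pd i \<theta>) u)" for i
  by (rule weak_partial_L2_mult[OF wp(1) th(1,2,3)])
 have sp: "smooth (pd i \<theta>)" for i by (rule smooth_partial_deriv[OF th(1)])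
 have 2: "weak_partial j (L2_mult \<theta> (weak_deriv i u))
   (L2_mult \<theta> (weak_deriv j (weak_deriv i u)) + L2_mult (pd j \<theta>) (weak_deriv i u))" for i j
  by (rule weak_partial_L2_mult[OF wp(2) th(1,2,3)])
 have 3: "weak_partial j (L2_mult (pd i \<theta>) u)
   (L2_mult (pd i \<theta>) (weak_deriv j u) + L2_mult (pd j (pd i \<theta>)) u)" for i j
  by (rule weak_partial_L2_mult[OF wp(1) sp th(3,4)])
 note H = H2I[of "L2_mult \<theta> u" "%i. L2_mult \<theta> (weak_deriv i u) + L2_mult (pd i \<theta>) u"
  "%i j. (L2_mult \<theta> (weak_deriv j (weak_deriv i u)) + L2_mult (pd j \<theta>) (weak_deriv i u))
   + (L2_mult (pd i \<theta>) (weak_deriv j u) + L2_mult (pd j (pd i \<theta>)) u)",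
  OF 1 weak_partial_add[OF 2 3]]
 show "L2_mult \<theta> u \<in> H2" by (rule H(1))
 show "laplacian (L2_mult \<theta> u) = L2_mult \<theta> (laplacian u) + comm \<theta> u"
  unfolding H(2) laplacian_def[of u] comm_def L2_mult_sum sum.distrib[symmetric]
  by (rule sum.cong) (simp_all add: scaleR_2 add_ac)
 show "weak_partial i (L2_mult (pd i \<theta>) u)
   (L2_mult (pd i \<theta>) (weak_deriv i u) + L2_mult (pd i (pd i \<theta>)) u)"
  by (rule 3)
qed

lemma L2_mult_minus: "L2_mult g (- u) = - L2_mult g u"
 using L2_mult_scaleR[of g "-1" u] by simp

lemma P0_diff_L2_mult:
 fixes u :: "'n::finite L2"
 assumes u: "u \<in> H2" and th: "C0_infinity \<theta>"
 shows "u - L2_mult \<theta> u \<in> H2" "P0 h (u - L2_mult \<theta> u) = P0 h u - L2_mult \<theta> (P0 h u) + h\<^sup>2 *\<^sub>R comm \<theta> u"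
proof -
 have s: "smooth \<theta>" using th by (simp add: C0_infinity_iff)
 have b: "bdd_mult \<theta>" "bdd_mult (pd i \<theta>)" "bdd_mult (pd j (pd i \<theta>))" for i j
  by (intro C0_integrable(3) C0_infinity_partial_deriv th)+
 note H = H2_L2_mult[OF u s b]
 show "u - L2_mult \<theta> u \<in> H2" by (rule H2_diff(1)[OF u H(1)])
 show "P0 h (u - L2_mult \<theta> u) = P0 h u - L2_mult \<theta> (P0 h u) + h\<^sup>2 *\<^sub>R comm \<theta> u"
  unfolding P0_def H2_diff(2)[OF u H(1)] H(2) L2_mult_minus L2_mult_scaleR scaleR_diff_right scaleR_add_right
  by simp
qed

text \<open>\<open>\<delta> \<beta>\<close> stands for a cut-off free operator carrying the
  derivatives \<open>\<beta>\<close>, and \<open>opG\<close> for its composition with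
  \<open>h^2 comm \<psi>\<close>. That commutator is written as
  \<open>2 d_i (\<psi>_i u) - \<psi>_ii u\<close>, and the outer derivative is moved onto the free
  operator by lengthening the list, so that \<open>u\<close> itself is never differentiated.\<close>

definition opG :: "real => ('n::finite cfun) => ('n list => 'n L2_op) => 'n list => 'n L2_op" where
 "opG h \<psi> \<delta> \<beta> = h\<^sup>2 *\<^sub>R (\<Sum>i\<in>UNIV. 2 *\<^sub>R (\<delta> (i # \<beta>) oL mult_op (pd i \<psi>))
   - (\<delta> \<beta> oL mult_op (pd i (pd i \<psi>))))"

text \<open>Here \<open>h^2 comm \<eta>\<close> acts from the left, and its first derivatives are
  those already carried by \<open>S [j]\<close>.\<close>

definition opC :: "real => ('n::finite cfun) => ('n list => 'n L2_op) => 'n L2_op" where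
 "opC h \<eta> S = h\<^sup>2 *\<^sub>R (\<Sum>j\<in>UNIV. 2 *\<^sub>R (mult_op (pd j \<eta>) oL S [j])
   + (mult_op (pd j (pd j \<eta>)) oL S []))"

text \<open>The sorted form of the transfer identity: \<open>opX\<close> collects what acts on the
  unknown \<open>A(z) f\<close>, and \<open>opY\<close> what acts on \<open>f\<close>
  directly.\<close>

definition opX where
 "opX h \<psi> \<eta> \<delta> T c = I1 + (mult_op (%x. 1 - \<eta> x) oL opG h \<psi> \<delta> [])
   - (T oL (op_scaleC c (mult_op \<eta>) + opC h \<eta> (opG h \<psi> \<delta>)))"

definition opY where
 "opY h \<psi> \<eta> \<delta> T = (T oL (I1 + opC h \<eta> (%\<beta>. \<delta> \<beta> oL mult_op (%x. 1 - \<psi> x))))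
   - (mult_op (%x. 1 - \<eta> x) oL (\<delta> [] oL mult_op (%x. 1 - \<psi> x)))"

lemma opG_apply: "ap (opG h \<psi> \<delta> \<beta>) u = h\<^sup>2 *\<^sub>R (\<Sum>i\<in>UNIV. 2 *\<^sub>R \<delta> (i # \<beta>) (L2_mult (pd i \<psi>) u)
   - \<delta> \<beta> (L2_mult (pd i (pd i \<psi>)) u))"
 by (simp add: opG_def blinfun.scaleR_left blinfun.sum_left blinfun.diff_left)

lemma opC_apply: "ap (opC h \<eta> S) u = h\<^sup>2 *\<^sub>R (\<Sum>j\<in>UNIV. 2 *\<^sub>R L2_mult (pd j \<eta>) (S [j] u)
   + L2_mult (pd j (pd j \<eta>)) (S [] u))"
 by (simp add: opC_def blinfun.scaleR_left blinfun.sum_left blinfun.add_left)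

lemma opG_diff: "opG h \<psi> (%\<beta>. \<delta> \<beta> - ep \<beta>) \<beta> = opG h \<psi> \<delta> \<beta> - opG h \<psi> ep \<beta>"
 by (rule blinfun_eqI)
   (simp add: opG_apply blinfun.diff_left scaleR_diff_right[symmetric] sum_subtractf[symmetric], simp add: scaleR_diff_right algebra_simps)

lemma supp_absorb:
 fixes f ch :: "'n::finite cfun"
 assumes "!!x. x \<in> supp f ==> ch x = 1"
 shows "ch x * f x = f x" "ch x * pd i f x = pd i f x"
  "ch x * pd j (pd i f) x = pd j (pd i f) x"
proof -
 have o: "open (- supp f)" by (simp add: supp_def open_Compl)
 have 1: "pd i f x = 0" if "x \<in> - supp f" for i x using partial_deriv_outside_supp[of x f i] that by simp
 have 2: "pd j (pd i f) x = 0" if "x \<in> - supp f" for i j x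
  by (rule partial_deriv_locally_const[OF o that 1])
 show "ch x * f x = f x" using assms[of x] supp_zero[of x f] by (cases "x \<in> supp f") auto
 show "ch x * pd i f x = pd i f x" using assms[of x] 1 by (cases "x \<in> supp f") auto
 show "ch x * pd j (pd i f) x = pd j (pd i f) x"
  using assms[of x] 2 by (cases "x \<in> supp f") auto
qed

lemma L2_mult_absorb:
 assumes "bdd_mult ch" "bdd_mult p" "!!x. ch x * p x = p x"
 shows "L2_mult ch (L2_mult p u) = L2_mult p u" "L2_mult p (L2_mult ch u) = L2_mult p u"
proof -
 have "(%x. ch x * p x) = p" "(%x. p x * ch x) = p" using assms(3) by (auto simp: fun_eq_iff mult.commute)
 then show "L2_mult ch (L2_mult p u) = L2_mult p u" "L2_mult p (L2_mult ch u) = L2_mult p u"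
  by (simp_all only: L2_mult_L2_mult assms(1,2))
qed

section \<open>The transfer identity between two energies\<close>

locale cutoffs =
 fixes V :: "real^'n::finite => real" and ch \<psi> \<eta> :: "real^'n => complex" and h :: real
 assumes V: "bdd_mult (%x. cor (V x))" and ch: "bdd_mult ch"
  and psi: "C0_infinity \<psi>" and eta: "C0_infinity \<eta>"
  and Vpsi: "!!x. V x ~= 0 ==> \<psi> x = 1" and psieta: "!!x. \<psi> x * \<eta> x = \<psi> x"
  and chpsi: "!!x. x \<in> supp \<psi> ==> ch x = 1" and cheta: "!!x. x \<in> supp \<eta> ==> ch x = 1"
  and h: "h > 0"
begin

lemma bdd_psi: "bdd_mult \<psi>" "bdd_mult (pd i \<psi>)" "bdd_mult (pd j (pd i \<psi>))"
 and bdd_eta: "bdd_mult \<eta>" "bdd_mult (pd i \<eta>)" "bdd_mult (pd j (pd i \<eta>))"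
 by (intro C0_integrable(3) C0_infinity_partial_deriv psi eta)+

lemma smooth_psi_eta: "smooth \<psi>" "smooth \<eta>" using psi eta by (simp_all add: C0_infinity_iff)

lemmas absorb = L2_mult_absorb[OF ch bdd_psi(2) supp_absorb(2)[where f=\<psi> and ch=ch, OF chpsi]] L2_mult_absorb[OF ch bdd_psi(3) supp_absorb(3)[where f=\<psi> and ch=ch, OF chpsi]]
 L2_mult_absorb[OF ch bdd_eta(1) supp_absorb(1)[where f=\<eta> and ch=ch, OF cheta]] L2_mult_absorb[OF ch bdd_eta(2) supp_absorb(2)[where f=\<eta> and ch=ch, OF cheta]]
 L2_mult_absorb[OF ch bdd_eta(3) supp_absorb(3)[where f=\<eta> and ch=ch, OF cheta]]

text \<open>The commutator is supported where \<open>ch = 1\<close>, so cut-offs can be inserted on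
  both sides of it. The unknown then enters only as \<open>ch u\<close>, the very quantity to be
  estimated.\<close>

lemma Mop_commutator:
 assumes z: "Im z > 0" and b: "length \<beta> <= 1" and u: "u \<in> H2"
 shows "L2_mult ch (Mop (%xx. pol \<beta> (%i. xi i xx) * rz h z xx) (L2_mult ch f + h\<^sup>2 *\<^sub>R comm \<psi> u))
  = Tfree ch h \<beta> z f + opG h \<psi> (%\<beta>. Tfree ch h \<beta> z) \<beta> (L2_mult ch u)"
proof -
 let ?N = "%\<beta>. Mop (%xx. pol \<beta> (%i. xi i xx) * rz h z xx) :: 'n L2_op"
 let ?a = "%i. pd i \<psi>" and ?b = "%i. pd i (pd i \<psi>)"
 have T: "Tfree ch h \<beta> z x = L2_mult ch (?N \<beta> (L2_mult ch x))" for \<beta> x by (simp add: Tfree_def)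
 define p where "p i = L2_mult (?a i) (weak_deriv i u) + L2_mult (?b i) u" for i
 have c: "comm \<psi> u = (\<Sum>i\<in>UNIV. 2 *\<^sub>R p i - L2_mult (?b i) u)"
  unfolding comm_def by (rule sum.cong) (simp_all add: p_def scaleR_2 scaleR_add_right)
 have Np: "?N \<beta> (p i) = ?N (i # \<beta>) (L2_mult (?a i) u)" for i
 proof -
  have 1: "(%xx. xi i xx * (pol \<beta> (%i. xi i xx) * rz h z xx)) = (%xx. pol (i # \<beta>) (%i. xi i xx) * rz h z xx)"
   by (simp add: pol_def mult.assoc)
  have b1: "bdd_mult (%xx. pol \<beta> (%i. xi i xx) * rz h z xx)" by (rule bdd_mult_pol_rz[OF h z]) (use b in simp)
  have b2: "bdd_mult (%xx. pol (i # \<beta>) (%i. xi i xx) * rz h z xx)" by (rule bdd_mult_pol_rz[OF h z]) (use b in simp)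
  show ?thesis
   using Mop_weak_partial[OF H2_L2_mult(3)[OF u smooth_psi_eta(1) bdd_psi] b1, of i] b2 unfolding 1 p_def by blast
 qed
 have a: "L2_mult (?a i) u = L2_mult ch (L2_mult (?a i) (L2_mult ch u))" "L2_mult (?b i) u = L2_mult ch (L2_mult (?b i) (L2_mult ch u))" for i
  by (simp_all only: absorb)
 show ?thesis
  unfolding opG_apply c blinfun.add_right blinfun.scaleR_right blinfun.sum_right blinfun.diff_right Np
   L2_mult_add L2_mult_scaleR L2_mult_sum L2_mult_diff T
  by (simp only: a[symmetric])
qed

text \<open>If \<open>u = R(z) ch f\<close> then \<open>(1 - \<psi>) u = R0(z) g\<close> with \<open>g\<close> supported where \<open>ch = 1\<close> or inside
  \<open>ch f\<close>; replacing \<open>R0(z) g\<close> by \<open>R0(w) g\<close> away from the potential turns \<open>u\<close> into an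
  approximate solution at the energy \<open>w\<close>.\<close>

lemma transfer_identity:
 assumes z: "Im z > 0" and w: "Im w > 0"
 defines "\<delta> \<equiv> %\<beta>. Tfree ch h \<beta> w - Tfree ch h \<beta> z"
 shows "opX h \<psi> \<eta> \<delta> (cutoff_resolvent V ch h w) (z - w) oL cutoff_resolvent V ch h z
  = opY h \<psi> \<eta> \<delta> (cutoff_resolvent V ch h w)"
proof (rule blinfun_eqI)
 fix f :: "'n L2"
 let ?v = "L2_mult (%x. cor (V x)) :: 'n L2 => 'n L2"
 let ?A = "cutoff_resolvent V ch h"
 define q where "q = L2_mult ch f"
 define u where "u = resolvent V h z q"
 note R = resolvent_props[OF V h z] and Rw = resolvent_props[OF V h w] and R0z = free_resolvent_props[OF h z] and R0w = free_resolvent_props[OF h w]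
 have sch: "schroedinger V h x = P0 h x + ?v x" for x by (simp add: schroedinger_def P0_def)
 have uH: "u \<in> H2" unfolding u_def by (rule R(1))
 have Au: "L2_mult ch u = ?A z f" by (simp add: u_def q_def cutoff_resolvent_def)
 have ueq: "P0 h u - L2_scaleC z u = q - ?v u"
  using R(2)[of q] unfolding sch u_def[symmetric] by (simp add: algebra_simps)
 define U where "U = u - L2_mult \<psi> u"
 have UH: "U \<in> H2" unfolding U_def by (rule P0_diff_L2_mult(1)[OF uH psi])
 define g where "g = L2_mult ch (f - L2_mult \<psi> f) + h\<^sup>2 *\<^sub>R comm \<psi> u"
 have PU: "P0 h U - L2_scaleC z U = g"
 proof -
  have "P0 h U - L2_scaleC z U = (P0 h u - L2_scaleC z u) - L2_mult \<psi> (P0 h u - L2_scaleC z u) + h\<^sup>2 *\<^sub>R comm \<psi> u"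
   unfolding U_def P0_diff_L2_mult(2)[OF uH psi]
   by (simp add: L2_mult_diff L2_scaleC_diff L2_mult_scaleC[OF bdd_psi(1)])
  also have "L2_mult \<psi> (?v u) = ?v u"
   using Vpsi by (intro L2_mult_absorb(1) bdd_psi V) (metis mult_1 mult_zero_right of_real_0)
  then have "(P0 h u - L2_scaleC z u) - L2_mult \<psi> (P0 h u - L2_scaleC z u) = q - L2_mult \<psi> q"
   unfolding ueq L2_mult_diff by simp
  also have "q - L2_mult \<psi> q = L2_mult ch (f - L2_mult \<psi> f)"
   by (simp add: q_def L2_mult_diff L2_mult_L2_mult ch bdd_psi mult.commute)
  finally show ?thesis by (simp add: g_def)
 qed
 have Uz: "free_resolvent h z g = U" using R0z(3)[OF UH] unfolding PU .
 \<comment> \<open>Two free solutions with the same source \<open>g\<close>; their difference solves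
   the free equation at energy \<open>w\<close> with source \<open>(w - z) U\<close>, which is not
   compactly supported.\<close>
 define d where "d = free_resolvent h w g - free_resolvent h z g"
 have dH: "d \<in> H2" unfolding d_def by (rule H2_diff(1)[OF R0w(1) R0z(1)])
 have Pd: "P0 h d - L2_scaleC w d = L2_scaleC (w - z) U"
 proof -
  have "P0 h d = P0 h (free_resolvent h w g) - P0 h (free_resolvent h z g)"
   unfolding d_def P0_def H2_diff(2)[OF R0w(1) R0z(1)] by (simp add: scaleR_diff_right)
  then have "P0 h d - L2_scaleC w d = (P0 h (free_resolvent h w g) - L2_scaleC w (free_resolvent h w g)) - (P0 h U - L2_scaleC z U) + (L2_scaleC w U - L2_scaleC z U)"
   by (simp add: d_def Uz L2_scaleC_diff)
  then show ?thesis unfolding R0w(2) PU by (simp add: L2_scaleC_diff_left)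
 qed
 \<comment> \<open>Removing the region where \<open>\<eta> = 1\<close> makes the correction
   invisible to \<open>V\<close>.\<close>
 define D where "D = d - L2_mult \<eta> d"
 have DH: "D \<in> H2" unfolding D_def by (rule P0_diff_L2_mult(1)[OF dH eta])
 have PD: "P0 h D - L2_scaleC w D = L2_scaleC (w - z) (u - L2_mult \<eta> u) + h\<^sup>2 *\<^sub>R comm \<eta> d"
 proof -
  have "P0 h D - L2_scaleC w D = (P0 h d - L2_scaleC w d) - L2_mult \<eta> (P0 h d - L2_scaleC w d) + h\<^sup>2 *\<^sub>R comm \<eta> d"
   unfolding D_def P0_diff_L2_mult(2)[OF dH eta]
   by (simp add: L2_mult_diff L2_scaleC_diff L2_mult_scaleC[OF bdd_eta(1)])
  also have "(P0 h d - L2_scaleC w d) - L2_mult \<eta> (P0 h d - L2_scaleC w d) = L2_scaleC (w - z) (U - L2_mult \<eta> U)"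
   unfolding Pd by (simp add: L2_mult_scaleC[OF bdd_eta(1)] L2_scaleC_diff)
  also have "L2_mult \<eta> (L2_mult \<psi> u) = L2_mult \<psi> u"
   by (rule L2_mult_absorb(1)[OF bdd_eta(1) bdd_psi(1)]) (subst mult.commute, rule psieta)
  then have "U - L2_mult \<eta> U = u - L2_mult \<eta> u" unfolding U_def L2_mult_diff by simp
  finally show ?thesis .
 qed
 have vD: "?v D = 0"
 proof -
  have "\<eta> x * cor (V x) = cor (V x)" for x
   using Vpsi[of x] psieta[of x] by (cases "V x = 0") auto
  from L2_mult_absorb(2)[OF bdd_eta(1) V this] have "?v (L2_mult \<eta> d) = ?v d" .
  then show ?thesis by (simp add: D_def L2_mult_diff)
 qed
 \<comment> \<open>The source of \<open>u + D\<close> at energy \<open>w\<close>. The contributions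
   at infinity cancel: \<open>(z - w) u\<close> from the change of energy and
   \<open>(w - z) (1 - \<eta>) u\<close> from \<open>D\<close> leave
   \<open>(z - w) \<eta> u\<close>. What remains has the form \<open>ch\<close> times a vector, so
   only the cut-off resolvent at \<open>w\<close> is involved.\<close>
 let ?rhs = "q + L2_scaleC (z - w) (L2_mult \<eta> u) + h\<^sup>2 *\<^sub>R comm \<eta> d"
 have uDH: "u + D \<in> H2" by (rule H2_add(1)[OF uH DH])
 have "schroedinger V h (u + D) - L2_scaleC w (u + D) = (P0 h u - L2_scaleC z u) + ?v u + (P0 h D - L2_scaleC w D) + ?v D + L2_scaleC z u - L2_scaleC w u"
  unfolding sch P0_def H2_add(2)[OF uH DH] by (simp add: L2_mult_add L2_scaleC_add scaleR_add_right)
 also have "... = ?rhs"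
  unfolding ueq PD vD by (simp add: L2_scaleC_diff L2_scaleC_diff_left)
 finally have uD: "u + D = resolvent V h w ?rhs" using Rw(3)[OF uDH] by simp
 have eu: "L2_mult \<eta> u = L2_mult ch (L2_mult \<eta> (L2_mult ch u))" by (simp only: absorb)
 have cd: "comm \<eta> d = L2_mult ch (\<Sum>i\<in>UNIV. 2 *\<^sub>R L2_mult (pd i \<eta>) (L2_mult ch (weak_deriv i d))
    + L2_mult (pd i (pd i \<eta>)) (L2_mult ch d))" (is "_ = L2_mult ch ?S")
  by (simp only: comm_def absorb L2_mult_sum L2_mult_add L2_mult_scaleR)
 have "?rhs = L2_mult ch (f + L2_scaleC (z - w) (L2_mult \<eta> (L2_mult ch u)) + h\<^sup>2 *\<^sub>R ?S)"
  by (subst eu, subst cd) (simp only: q_def L2_mult_add L2_mult_scaleC[OF ch] L2_mult_scaleR)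
 with arg_cong[OF uD, of "L2_mult ch"] have main: "L2_mult ch u + L2_mult ch D = ?A w (f + L2_scaleC (z - w) (L2_mult \<eta> (L2_mult ch u)) + h\<^sup>2 *\<^sub>R ?S)"
  unfolding L2_mult_add[of ch u D] by (simp only: cutoff_resolvent_def blinfun_apply_blinfun_compose blinfun_apply_mult_op)
 define H where "H \<beta> = \<delta> \<beta> (f - L2_mult \<psi> f)" for \<beta>
 define G where "G \<beta> = opG h \<psi> \<delta> \<beta> (L2_mult ch u)" for \<beta>
 have EE: "L2_mult ch (Mop (%xx. pol \<beta> (%i. xi i xx) * rz h w xx) g - Mop (%xx. pol \<beta> (%i. xi i xx) * rz h z xx) g) = H \<beta> + G \<beta>"
  if "length \<beta> <= 1" for \<beta>
  by (subst L2_mult_diff, unfold g_def Mop_commutator[OF z that uH] Mop_commutator[OF w that uH] H_def G_def \<delta>_def opG_diff blinfun.diff_left) simp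
 have d0: "L2_mult ch d = H [] + G []"
  using EE[of "[]"] by (simp add: d_def free_resolvent_def pol_def)
 have dj: "L2_mult ch (weak_deriv j d) = H [j] + G [j]" for j
 proof -
  have "weak_partial j (free_resolvent h w g - free_resolvent h z g) (Mop (%xx. xi j xx * rz h w xx) g - Mop (%xx. xi j xx * rz h z xx) g)"
   unfolding free_resolvent_def by (intro weak_partial_diff weak_partial_Mop decay_bdd decay_rz h z w)
  from weak_deriv_eq[OF this] show ?thesis using EE[of "[j]"] by (simp add: d_def pol_def)
 qed
 have chD: "L2_mult ch D = (H [] + G []) - L2_mult \<eta> (H [] + G [])"
  unfolding d0[symmetric] D_def L2_mult_diff by (simp only: absorb)
 have S: "h\<^sup>2 *\<^sub>R ?S = opC h \<eta> (%\<beta>. \<delta> \<beta> oL mult_op (%x. 1 - \<psi> x)) f + opC h \<eta> (opG h \<psi> \<delta>) (L2_mult ch u)"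
  unfolding opC_apply dj d0 scaleR_add_right[symmetric] sum.distrib[symmetric]
  by (rule arg_cong[where f="%x. h\<^sup>2 *\<^sub>R x"], rule sum.cong)
    (simp_all add: H_def G_def L2_mult_diff_left bdd_psi L2_mult_add scaleR_add_right add_ac)
 have eta1: "L2_mult (%x. 1 - \<eta> x) x = x - L2_mult \<eta> x" "L2_mult (%x. 1 - \<psi> x) x = x - L2_mult \<psi> x" for x
  by (simp_all add: L2_mult_diff_left bdd_eta bdd_psi)
 show "ap (opX h \<psi> \<eta> \<delta> (?A w) (z - w) oL ?A z) f = opY h \<psi> \<eta> \<delta> (?A w) f"
  using main[unfolded S chD] unfolding opX_def opY_def
  by (simp add: Au blinfun.add_left blinfun.diff_left blinfun.add_right op_scaleC_apply eta1 G_def H_def L2_mult_add algebra_simps)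
qed

end

lemmas blinfun_compose_tendsto = bounded_bilinear.tendsto[OF bounded_bilinear_blinfun_compose]

lemma opG_tendsto:
 assumes "!!\<beta>. length \<beta> <= 2 ==> ((%n. \<delta> n \<beta>) \<longlongrightarrow> \<delta>' \<beta>) F" "length \<beta> <= 1"
 shows "((%n. opG h \<psi> (\<delta> n) \<beta>) \<longlongrightarrow> opG h \<psi> \<delta>' \<beta>) F"
 unfolding opG_def using assms(2) by (intro tendsto_intros blinfun_compose_tendsto assms(1)) auto

lemma opC_tendsto:
 assumes "!!\<beta>. length \<beta> <= 1 ==> ((%n. S n \<beta>) \<longlongrightarrow> S' \<beta>) F"
 shows "((%n. opC h \<eta> (S n)) \<longlongrightarrow> opC h \<eta> S') F"
 unfolding opC_def by (intro tendsto_intros blinfun_compose_tendsto assms) auto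

lemma opX_tendsto:
 assumes d: "!!\<beta>. length \<beta> <= 2 ==> ((%n. \<delta> n \<beta>) \<longlongrightarrow> \<delta>' \<beta>) F" and T: "(T \<longlongrightarrow> T') F" "(c \<longlongrightarrow> c') F"
 shows "((%n. opX h \<psi> \<eta> (\<delta> n) (T n) (c n)) \<longlongrightarrow> opX h \<psi> \<eta> \<delta>' T' c') F"
  "((%n. opY h \<psi> \<eta> (\<delta> n) (T n)) \<longlongrightarrow> opY h \<psi> \<eta> \<delta>' T') F"
proof -
 have "((%n. op_scaleC (c n) (mult_op \<eta>)) \<longlongrightarrow> op_scaleC c' (mult_op \<eta>)) F"
  by (rule bounded_linear.tendsto[OF bounded_linear_op_scaleC T(2)])
 then show "((%n. opX h \<psi> \<eta> (\<delta> n) (T n) (c n)) \<longlongrightarrow> opX h \<psi> \<eta> \<delta>' T' c') F"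
  unfolding opX_def by (intro tendsto_intros blinfun_compose_tendsto opC_tendsto opG_tendsto d T) auto
 show "((%n. opY h \<psi> \<eta> (\<delta> n) (T n)) \<longlongrightarrow> opY h \<psi> \<eta> \<delta>' T') F"
  unfolding opY_def by (intro tendsto_intros blinfun_compose_tendsto opC_tendsto d T) auto
qed

text \<open>The identity is built from finitely many sums and products of operators that converge in
  norm, so \<open>w\<close> may go to the boundary while \<open>z\<close> stays fixed above
  it.\<close>

lemma (in cutoffs) limit_transfer_identity:
 assumes z: "Im z > 0" and w: "!!n. Im (w n) > 0" "w ----> w0"
  and T: "(%n. cutoff_resolvent V ch h (w n)) ----> T"
  and S: "!!\<beta>. length \<beta> <= 2 ==> (%n. Tfree ch h \<beta> (w n)) ----> S \<beta>"
 defines "\<delta> \<equiv> %\<beta>. S \<beta> - Tfree ch h \<beta> z"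
 shows "opX h \<psi> \<eta> \<delta> T (z - w0) oL cutoff_resolvent V ch h z = opY h \<psi> \<eta> \<delta> T"
proof -
 let ?\<delta> = "%n \<beta>. Tfree ch h \<beta> (w n) - Tfree ch h \<beta> z"
 have d: "(%n. ?\<delta> n \<beta>) ----> \<delta> \<beta>" if "length \<beta> <= 2" for \<beta>
  unfolding \<delta>_def by (intro tendsto_intros S that)
 have c: "(%n. z - w n) ----> z - w0" by (intro tendsto_intros w)
 note X = opX_tendsto[of ?\<delta> \<delta> sequentially _ T, OF d T c]
 have "(%n. opX h \<psi> \<eta> (?\<delta> n) (cutoff_resolvent V ch h (w n)) (z - w n) oL cutoff_resolvent V ch h z)
   ----> (opX h \<psi> \<eta> \<delta> T (z - w0) oL cutoff_resolvent V ch h z)"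
  by (intro blinfun_compose_tendsto X tendsto_const)
 then have "(%n. opY h \<psi> \<eta> (?\<delta> n) (cutoff_resolvent V ch h (w n)))
   ----> (opX h \<psi> \<eta> \<delta> T (z - w0) oL cutoff_resolvent V ch h z)"
  unfolding transfer_identity[OF z w(1)] .
 then show ?thesis by (rule LIMSEQ_unique) (rule X(2))
qed

section \<open>Counting powers of \<open>h\<close>\<close>

lemma norm_compose_le: "norm A <= a ==> norm B <= b ==> norm (A oL B) <= a * b"
 by (meson norm_blinfun_compose order_trans mult_mono norm_ge_zero)

lemma norm_opG_le:
 fixes \<psi> :: "'n::finite cfun"
 assumes M: "!!i. norm (mult_op (pd i \<psi>) :: 'n L2_op) <= M" "!!i. norm (mult_op (pd i (pd i \<psi>)) :: 'n L2_op) <= M"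
  and d: "!!i. norm (\<delta> (i # \<beta>)) <= \<sigma>" "norm (\<delta> \<beta>) <= \<sigma>"
 shows "norm (opG h \<psi> \<delta> \<beta>) <= h\<^sup>2 * (real CARD('n) * (3 * \<sigma> * M))"
proof -
 have "norm (2 *\<^sub>R (\<delta> (i # \<beta>) oL mult_op (pd i \<psi>)) - (\<delta> \<beta> oL mult_op (pd i (pd i \<psi>)))) <= 3 * \<sigma> * M" for i
  using norm_triangle_ineq4[of "2 *\<^sub>R (\<delta> (i # \<beta>) oL mult_op (pd i \<psi>))" "\<delta> \<beta> oL mult_op (pd i (pd i \<psi>))"]
   norm_compose_le[OF d(1) M(1), of i i] norm_compose_le[OF d(2) M(2), of i] by simp
 then have "norm (\<Sum>i\<in>UNIV. 2 *\<^sub>R (\<delta> (i # \<beta>) oL mult_op (pd i \<psi>)) - (\<delta> \<beta> oL mult_op (pd i (pd i \<psi>))))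
   <= real CARD('n) * (3 * \<sigma> * M)"
  by (intro order_trans[OF norm_sum] sum_bounded_above)
 then show ?thesis unfolding opG_def by (simp add: mult_left_mono)
qed

lemma norm_opC_le:
 fixes \<eta> :: "'n::finite cfun"
 assumes M: "!!i. norm (mult_op (pd i \<eta>) :: 'n L2_op) <= M" "!!i. norm (mult_op (pd i (pd i \<eta>)) :: 'n L2_op) <= M"
  and S: "!!j. norm (S [j]) <= \<sigma>" "norm (S []) <= \<sigma>"
 shows "norm (opC h \<eta> S) <= h\<^sup>2 * (real CARD('n) * (3 * M * \<sigma>))"
proof -
 have "norm (2 *\<^sub>R (mult_op (pd j \<eta>) oL S [j]) + (mult_op (pd j (pd j \<eta>)) oL S [])) <= 3 * M * \<sigma>" for j
  using norm_triangle_ineq[of "2 *\<^sub>R (mult_op (pd j \<eta>) oL S [j])" "mult_op (pd j (pd j \<eta>)) oL S []"]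
   norm_compose_le[OF M(1) S(1), of j j] norm_compose_le[OF M(2) S(2), of j] by simp
 then have "norm (\<Sum>j\<in>UNIV. 2 *\<^sub>R (mult_op (pd j \<eta>) oL S [j]) + (mult_op (pd j (pd j \<eta>)) oL S []))
   <= real CARD('n) * (3 * M * \<sigma>)"
  by (intro order_trans[OF norm_sum] sum_bounded_above)
 then show ?thesis unfolding opC_def by (simp add: mult_left_mono)
qed

text \<open>Each commutator contributes \<open>h^2\<close> and one further derivative, which costs
  \<open>1/h\<close>. So \<open>opG\<close> at \<open>[]\<close> is of size \<open>s / h\<close>,
  \<open>opC\<close> after \<open>opG\<close> of size \<open>s\<close>, and \<open>opC\<close> of a
  plain \<open>\<delta>\<close> of size \<open>s / h\<close>; the worst term is the bare
  \<open>\<delta> []\<close> in \<open>opY\<close>, of size \<open>s / h^2\<close>.\<close>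

lemma norm_opX_opY_le:
 fixes \<psi> \<eta> :: "'n::finite cfun"
 assumes psi: "!!i. norm (mult_op (pd i \<psi>) :: 'n L2_op) <= M" "!!i. norm (mult_op (pd i (pd i \<psi>)) :: 'n L2_op) <= M"
   "norm (mult_op (%x. 1 - \<psi> x) :: 'n L2_op) <= M"
  and eta: "!!i. norm (mult_op (pd i \<eta>) :: 'n L2_op) <= M" "!!i. norm (mult_op (pd i (pd i \<eta>)) :: 'n L2_op) <= M"
   "norm (mult_op (%x. 1 - \<eta> x) :: 'n L2_op) <= M" "norm (mult_op \<eta> :: 'n L2_op) <= M"
  and h: "0 < h" "h <= 1" and s: "0 <= s"
  and d: "!!\<beta>. length \<beta> <= 2 ==> norm (\<delta> \<beta>) <= s / h ^ (2 + length \<beta>)"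
 shows "norm (opX h \<psi> \<eta> \<delta> T c - I1) <= 3 * real CARD('n) * M\<^sup>2 * (s / h) + norm T * (cmod c * M + 9 * (real CARD('n))\<^sup>2 * M\<^sup>2 * s)"
  "norm (opY h \<psi> \<eta> \<delta> T) <= norm T * (1 + 3 * real CARD('n) * M\<^sup>2 * (s / h)) + M\<^sup>2 * (s / h\<^sup>2)"
proof -
 let ?n = "real CARD('n)"
 have M0: "0 <= M" using eta(4) norm_ge_zero order_trans by blast
 have le: "norm (\<delta> \<beta>) <= s / h ^ k" if "length \<beta> <= 2" "2 + length \<beta> <= k" for \<beta> k
 proof -
  have "h ^ k <= h ^ (2 + length \<beta>)" using h that(2) by (intro power_decreasing) auto
  then have "s / h ^ (2 + length \<beta>) <= s / h ^ k" using h s by (intro divide_left_mono) auto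
  then show ?thesis using d[OF that(1)] by simp
 qed
 have G0: "norm (opG h \<psi> \<delta> []) <= 3 * ?n * M * (s / h)"
 proof -
  have "norm (opG h \<psi> \<delta> []) <= h\<^sup>2 * (?n * (3 * (s / h ^ 3) * M))"
   by (rule norm_opG_le[OF psi(1,2)]) (auto intro!: le)
  also have "... = 3 * ?n * M * (s / h)" using h by (simp add: power2_eq_square power3_eq_cube)
  finally show ?thesis .
 qed
 have G1: "norm (opG h \<psi> \<delta> [j]) <= 3 * ?n * M * (s / h\<^sup>2)" for j
 proof -
  have "norm (opG h \<psi> \<delta> [j]) <= h\<^sup>2 * (?n * (3 * (s / h ^ 4) * M))"
   by (rule norm_opG_le[OF psi(1,2)]) (auto intro!: le)
  also have "... = 3 * ?n * M * (s / h\<^sup>2)" using h by (simp add: power2_eq_square power4_eq_xxxx)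
  finally show ?thesis .
 qed
 have G0': "norm (opG h \<psi> \<delta> []) <= 3 * ?n * M * (s / h\<^sup>2)"
 proof -
  have "h\<^sup>2 <= h" using h by (simp add: power2_eq_square mult_left_le)
  then have "s / h <= s / h\<^sup>2" using h s by (intro divide_left_mono) auto
  then show ?thesis using G0 M0 by (meson mult_left_mono order_trans mult_nonneg_nonneg of_nat_0_le_iff zero_le_numeral)
 qed
 have CG: "norm (opC h \<eta> (opG h \<psi> \<delta>)) <= 9 * ?n\<^sup>2 * M\<^sup>2 * s"
 proof -
  have "norm (opC h \<eta> (opG h \<psi> \<delta>)) <= h\<^sup>2 * (?n * (3 * M * (3 * ?n * M * (s / h\<^sup>2))))"
   by (rule norm_opC_le[OF eta(1,2) G1 G0'])
  also have "... = 9 * ?n\<^sup>2 * M\<^sup>2 * s" using h by (simp add: power2_eq_square)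
  finally show ?thesis .
 qed
 have Cd: "norm (opC h \<eta> (%\<beta>. \<delta> \<beta> oL mult_op (%x. 1 - \<psi> x))) <= 3 * ?n * M\<^sup>2 * (s / h)"
 proof -
  have "norm (opC h \<eta> (%\<beta>. \<delta> \<beta> oL mult_op (%x. 1 - \<psi> x))) <= h\<^sup>2 * (?n * (3 * M * (s / h ^ 3 * M)))"
   by (rule norm_opC_le[OF eta(1,2)]; rule norm_compose_le[OF le psi(3)]; simp)
  also have "... = 3 * ?n * M\<^sup>2 * (s / h)" using h by (simp add: power2_eq_square power3_eq_cube)
  finally show ?thesis .
 qed
 have "norm (opX h \<psi> \<eta> \<delta> T c - I1) <= norm (mult_op (%x. 1 - \<eta> x) oL opG h \<psi> \<delta> [])
   + norm (T oL (op_scaleC c (mult_op \<eta>) + opC h \<eta> (opG h \<psi> \<delta>)))"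
  unfolding opX_def by (simp add: add_diff_eq[symmetric] norm_triangle_ineq4 del: add_diff_eq)
 also have "... <= M * (3 * ?n * M * (s / h)) + norm T * (cmod c * M + 9 * ?n\<^sup>2 * M\<^sup>2 * s)"
  by (intro add_mono norm_compose_le eta(3) G0 order_refl order_trans[OF norm_triangle_ineq] CG
    order_trans[OF norm_op_scaleC_le] mult_left_mono eta(4)) auto
 finally show "norm (opX h \<psi> \<eta> \<delta> T c - I1) <= 3 * ?n * M\<^sup>2 * (s / h) + norm T * (cmod c * M + 9 * ?n\<^sup>2 * M\<^sup>2 * s)"
  by (simp add: power2_eq_square mult_ac)
 have "norm (opY h \<psi> \<eta> \<delta> T) <= norm T * (1 + 3 * ?n * M\<^sup>2 * (s / h)) + M * (s / h\<^sup>2 * M)"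
  unfolding opY_def
  by (intro order_trans[OF norm_triangle_ineq4] add_mono norm_compose_le order_refl eta(3) psi(3) le order_trans[OF norm_triangle_ineq]
    norm_blinfun_id_le Cd) auto
 then show "norm (opY h \<psi> \<eta> \<delta> T) <= norm T * (1 + 3 * ?n * M\<^sup>2 * (s / h)) + M\<^sup>2 * (s / h\<^sup>2)"
  by (simp add: power2_eq_square mult_ac)
qed

section \<open>The cutoff resolvent is at least of size \<open>1/h\<close>\<close>

lemma weak_partial_C0_infinity:
 fixes ph :: "'n::finite cfun"
 assumes phi: "C0_infinity ph" shows "weak_partial i (abs_L2 ph) (abs_L2 (pd i ph))"
 unfolding weak_partial_pair
proof (intro allI impI)
 fix f :: "real^'n => complex" assume f: "C0_infinity f"
 have s: "smooth ph" using phi by (simp add: C0_infinity_iff)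
 show "pair (abs_L2 ph) (abs_L2 (pd i f)) = - pair (abs_L2 (pd i ph)) (abs_L2 f)"
  using integration_by_parts[OF s f, of i] by (simp add: pair_abs C0_integrable(2) C0_infinity_partial_deriv phi f)
qed

lemma C0_infinity_L2_nonzero:
 fixes ph :: "'n::finite cfun"
 assumes phi: "C0_infinity ph" and x: "ph x ~= 0" shows "abs_L2 ph ~= 0"
proof
 assume "abs_L2 ph = 0"
 then have "abs_L2 ph = abs_L2 (%_. 0)" by (simp add: abs_L2_zero)
 then have "AE x in lborel. ph x = 0"
  using C0_integrable(2)[OF phi] by (simp add: abs_L2_eq_iff L2_rel_def)
 moreover have o: "open {x. ph x ~= 0}"
  using phi by (intro open_Collect_neq smooth_continuous continuous_on_const) (simp add: C0_infinity_iff)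
 ultimately have "{x. ph x ~= 0} \<in> null_sets lborel" by (subst AE_iff_null_sets) auto
 then have "negligible {x. ph x ~= 0}" by (simp add: negligible_iff_null_sets null_sets_completionI)
 then show False using o x open_not_negligible by blast
qed

lemma annulus_bump_exists:
 assumes "R > 0"
 obtains ph :: "'n::finite cfun" where "C0_infinity ph" "!!x. norm x < R ==> ph x = 0"
  "!!x. x \<in> supp ph ==> norm x <= R + 3" "abs_L2 ph ~= 0"
proof -
 obtain a :: "real^'n => real" where a: "smooth a" "!!x. norm x <= R ==> a x = 1" "!!x. norm x \<ge> R + 1 ==> a x = 0"
  by (rule smooth_cutoff_exists[of R "R + 1"]) (use assms in auto)
 obtain b :: "real^'n => real" where b: "smooth b" "!!x. norm x <= R + 2 ==> b x = 1" "!!x. norm x \<ge> R + 3 ==> b x = 0"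
  by (rule smooth_cutoff_exists[of "R + 2" "R + 3"]) (use assms in auto)
 define ph where "ph x = cor (b x) - cor (a x)" for x
 have s: "smooth ph" unfolding ph_def[abs_def] by (intro smooth_diff smooth_of_real a b)
 have z: "ph x = 0" if "norm x > R + 3" for x using a(3)[of x] b(3)[of x] that by (simp add: ph_def)
 have C: "C0_infinity ph" by (rule C0_infinityI[OF s z])
 have "supp ph \<subseteq> cball 0 (R + 3)" unfolding supp_def
  by (rule closure_minimal) (use z in \<open>force simp: not_less[symmetric]\<close>, simp)
 then have supp: "norm x <= R + 3" if "x \<in> supp ph" for x using that by auto
 let ?p = "(R + 3/2) *\<^sub>R axis undefined 1 :: real^'n"
 have "norm ?p = R + 3/2" using assms by simp
 then have "ph ?p ~= 0" unfolding ph_def using a(3)[of ?p] b(2)[of ?p] by simp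
 from C0_infinity_L2_nonzero[OF C this] have ne: "abs_L2 ph ~= 0" .
 have inner: "ph x = 0" if "norm x < R" for x using a(2)[of x] b(2)[of x] that by (simp add: ph_def)
 show thesis by (rule that[OF C inner supp ne])
qed

text \<open>The wave number \<open>sqrt E / h\<close> cancels \<open>E u\<close>, so every term left
  in \<open>(P - E) u\<close> has a derivative on the bump and is of size \<open>h\<close>;
  \<open>K\<close> collects those derivatives. The bump is fixed by \<open>R0\<close>, so
  \<open>c\<close> serves all potentials, cut-offs and \<open>h\<close> at once.\<close>

lemma resolvent_lower_bound:
 fixes R0 E :: real
 assumes R0: "R0 > 0" and E: "E > 0"
 shows "\<exists>c>0. \<forall>(V :: real^'n::finite => real) ch h T. bdd_mult (%x. cor (V x)) --> bdd_mult ch -->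
  (\<forall>x. V x ~= 0 --> norm x < R0) --> (\<forall>x. norm x <= R0 + 5 --> ch x = 1) --> 0 < h --> h <= 1 -->
  (%n. cutoff_resolvent V ch h (Complex E (inverse (real (Suc n))))) ----> T --> c / h <= norm T"
proof -
 obtain ph :: "real^'n => complex" where phi: "C0_infinity ph" "!!x. norm x < R0 ==> ph x = 0"
  "!!x. x \<in> supp ph ==> norm x <= R0 + 3" "abs_L2 ph ~= 0"
  using annulus_bump_exists[OF R0] by metis
 note dphi = C0_infinity_partial_deriv[OF phi(1)]
 note ddphi = C0_infinity_partial_deriv[OF dphi]
 \<comment> \<open>An arbitrary coordinate direction for the plane wave.\<close>
 let ?i = "undefined :: 'n"
 define v where "v = abs_L2 ph"
 define v1 where "v1 = abs_L2 (pd ?i ph)"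
 define v2 where "v2 = (\<Sum>i\<in>UNIV. abs_L2 (pd i (pd i ph)))"
 define K where "K = norm v2 + 2 * sqrt E * norm v1"
 have K0: "0 <= K" using E by (simp add: K_def)
 note H = H2I[of v "%i. abs_L2 (pd i ph)" "%i j. abs_L2 (pd j (pd i ph))",
  folded v_def, OF weak_partial_C0_infinity[OF phi(1), folded v_def] weak_partial_C0_infinity[OF dphi], folded v2_def]
 have v0: "norm v > 0" using phi(4) by (simp add: v_def)
 define c where "c = norm v / (K + 1)"
 have c: "c > 0" using v0 K0 by (simp add: c_def)
 have main: "c / h <= norm T"
  if V: "bdd_mult (%x. cor (V x))" and ch: "bdd_mult ch" "!!x. norm x <= R0 + 5 ==> ch x = 1"
   and V0: "!!x. V x ~= 0 ==> norm x < R0" and h: "0 < h" "h <= 1"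
   and T: "(%n. cutoff_resolvent V ch h (Complex E (inverse (real (Suc n))))) ----> T"
  for V :: "real^'n => real" and ch h T
 proof -
  define ka where "ka = sqrt E / h"
  have kh: "h\<^sup>2 * ka\<^sup>2 = E" "h\<^sup>2 * ka = h * sqrt E" "0 <= ka"
   using h E by (simp_all add: ka_def power2_eq_square)
  define ex where "ex r x = exp (\<i> * cor (r * (x \<bullet> axis ?i 1)))" for r and x :: "real^'n"
  have sm: "smooth (ex r)" for r unfolding ex_def[abs_def] by (rule smooth_exp_inner)
  have nex: "cmod (ex r x) <= 1" for r x unfolding ex_def by (simp only: norm_exp_i_times)
  have bex: "bdd_mult (ex r)" for r
   by (rule bdd_multI[OF _ nex]) (use smooth_measurable[OF sm] in simp)
  let ?e = "ex ka"
  define cc where "cc i = \<i> * cor (ka * (axis ?i 1 :: real^'n) $ i)" for i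
  have cc: "cc i = (if i = ?i then \<i> * cor ka else 0)" for i by (simp add: cc_def axis_def)
  have de: "pd i ?e = (%x. cc i * ?e x)" for i
   unfolding ex_def[abs_def] cc_def by (rule ext) (rule partial_deriv_exp_inner)
  have dde: "pd j (pd i ?e) = (%x. (cc i * cc j) * ?e x)" for i j
   unfolding de by (rule ext, subst smooth_partial_mult[OF smooth_const sm]) (simp add: partial_deriv_const de)
  define u where "u = L2_mult ?e v"
  have be: "bdd_mult (pd i ?e)" "bdd_mult (pd j (pd i ?e))" for i j
   unfolding dde unfolding de by (intro bdd_mult_mult bdd_mult_const bex)+
  note Hu = H2_L2_mult[OF H(1) sm bex be]
  have uH: "u \<in> H2" and lu: "laplacian u = L2_mult ?e v2 + comm ?e v"
   unfolding u_def H(2)[symmetric] by (rule Hu)+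
  have cm: "comm ?e v = 2 *\<^sub>R L2_scaleC (\<i> * cor ka) (L2_mult ?e v1) - ka\<^sup>2 *\<^sub>R u"
  proof -
   have "comm ?e v = (\<Sum>i\<in>UNIV. if i = ?i then 2 *\<^sub>R L2_scaleC (\<i> * cor ka) (L2_mult ?e v1) - ka\<^sup>2 *\<^sub>R u else 0)"
    unfolding comm_def
   proof (rule sum.cong)
    fix i
    have "cc ?i * cc ?i = cor (- ka\<^sup>2)" by (simp add: cc complex_eq_iff power2_eq_square)
    then show "2 *\<^sub>R L2_mult (pd i ?e) (weak_deriv i v) + L2_mult (pd i (pd i ?e)) v
     = (if i = ?i then 2 *\<^sub>R L2_scaleC (\<i> * cor ka) (L2_mult ?e v1) - ka\<^sup>2 *\<^sub>R u else 0)"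
     unfolding dde unfolding de L2_mult_scaleC_left[OF bex] H(3) u_def[symmetric]
     by (cases "i = ?i") (simp_all add: L2_scaleC_of_real cc L2_scaleC_zero v1_def del: of_real_minus of_real_power)
   qed simp
   then show ?thesis by simp
  qed
  have Vu: "L2_mult (%x. cor (V x)) u = 0"
  proof -
   have vp: "cor (V x) * ph x = 0" for x using V0[of x] phi(2)[of x] by auto
   have "L2_mult (%x. cor (V x)) v = 0"
    unfolding v_def L2_mult_abs[OF C0_integrable(2)[OF phi(1)] V] vp by (rule abs_L2_zero)
   moreover have "L2_mult (%x. cor (V x)) u = L2_mult ?e (L2_mult (%x. cor (V x)) v)"
    unfolding u_def by (simp add: L2_mult_L2_mult V bex mult.commute)
   ultimately show ?thesis by simp
  qed
  have supp1: "ch x = 1" if "x \<in> supp ph" for x using phi(3)[OF that] by (intro ch) simp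
  have chg: "L2_mult ch (L2_mult ?e (abs_L2 g)) = L2_mult ?e (abs_L2 g)" if "sqi g" "!!x. ch x * g x = g x" for g
  proof -
   have "L2_mult ch (L2_mult ?e (abs_L2 g)) = L2_mult ?e (L2_mult ch (abs_L2 g))"
    by (simp add: L2_mult_L2_mult ch bex mult.commute)
   then show ?thesis unfolding L2_mult_abs[OF that(1) ch(1)] that(2) .
  qed
  note sa = supp_absorb[where f=ph and ch=ch, OF supp1]
  have chu: "L2_mult ch u = u" "L2_mult ch (L2_mult ?e v1) = L2_mult ?e v1" "L2_mult ch (L2_mult ?e v2) = L2_mult ?e v2"
  proof -
   show "L2_mult ch u = u" unfolding u_def v_def
    by (rule chg[OF C0_integrable(2)[OF phi(1)] sa(1)])
   show "L2_mult ch (L2_mult ?e v1) = L2_mult ?e v1" unfolding v1_def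
    by (rule chg[OF C0_integrable(2)[OF dphi] sa(2)])
   show "L2_mult ch (L2_mult ?e v2) = L2_mult ?e v2" unfolding v2_def L2_mult_sum
    by (rule sum.cong[OF refl]) (rule chg[OF C0_integrable(2)[OF ddphi] sa(3)])
  qed
  have nv: "norm v <= norm u"
  proof -
   have "(%x. ex (- ka) x * ?e x) = (%_. 1)" unfolding ex_def by (simp add: exp_add[symmetric])
   then have "v = L2_mult (ex (- ka)) u" unfolding u_def by (simp only: L2_mult_L2_mult[OF bex bex] L2_mult_one)
   then show ?thesis using norm_L2_mult_le[OF bex nex, of "- ka" u] by simp
  qed
  have ne: "norm (L2_mult ?e x) <= norm x" for x using norm_L2_mult_le[OF bex nex, of ka x] by simp
  have bound: "norm v <= norm (cutoff_resolvent V ch h (Complex E ep)) * (h * K + ep * norm v)" if eps: "ep > 0" for ep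
  proof -
   let ?z = "Complex E ep"
   have z: "Im ?z > 0" using eps by simp
   define q where "q = - (h\<^sup>2 *\<^sub>R L2_mult ?e v2) - (2 * h\<^sup>2) *\<^sub>R L2_scaleC (\<i> * cor ka) (L2_mult ?e v1) - L2_scaleC (\<i> * cor ep) u"
   have zu: "L2_scaleC ?z u = E *\<^sub>R u + L2_scaleC (\<i> * cor ep) u"
   proof -
    have ze: "?z = cor E + \<i> * cor ep" by (simp add: complex_eq_iff)
    show ?thesis by (simp only: ze L2_scaleC_add_left L2_scaleC_of_real)
   qed
   have "h\<^sup>2 *\<^sub>R ka\<^sup>2 *\<^sub>R u = E *\<^sub>R u" by (simp add: kh(1))
   then have q: "schroedinger V h u - L2_scaleC ?z u = q"
    unfolding schroedinger_def Vu lu cm zu q_def by (simp add: scaleR_add_right scaleR_diff_right algebra_simps)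
   have "L2_mult ch q = q"
    unfolding q_def L2_mult_diff L2_mult_minus L2_mult_scaleR L2_mult_scaleC[OF ch(1)] chu ..
   then have "cutoff_resolvent V ch h ?z q = u"
    using resolvent_props(3)[OF V h(1) z uH] unfolding q by (simp add: cutoff_resolvent_def chu)
   then have "norm u <= norm (cutoff_resolvent V ch h ?z) * norm q" using norm_blinfun[of "cutoff_resolvent V ch h ?z" q] by simp
   also have "norm q <= h * K + ep * norm v"
   proof -
    have "norm q <= norm (h\<^sup>2 *\<^sub>R L2_mult ?e v2) + norm ((2 * h\<^sup>2) *\<^sub>R L2_scaleC (\<i> * cor ka) (L2_mult ?e v1)) + norm (L2_scaleC (\<i> * cor ep) u)"
    proof -
     have "norm (- x - y - w) <= norm x + norm y + norm w" for x y w :: "'n L2"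
      using norm_triangle_ineq4[of "- x - y" w] norm_triangle_ineq4[of "- x" y] by simp
     then show ?thesis unfolding q_def .
    qed
    also have "... = h\<^sup>2 * norm (L2_mult ?e v2) + 2 * (h\<^sup>2 * ka) * norm (L2_mult ?e v1) + ep * norm u"
     using kh(3) eps by (simp add: norm_L2_scaleC norm_mult)
    also have "... <= h * norm v2 + 2 * (h * sqrt E) * norm v1 + ep * norm v"
    proof -
     have h2: "h\<^sup>2 <= h" using h by (simp add: power2_eq_square mult_left_le)
     have nu: "norm u <= norm v" unfolding u_def by (rule ne)
     show ?thesis unfolding kh(2)
      by (intro add_mono mult_mono ne h2 nu order_refl) (use h eps E in auto)
    qed
    also have "... = h * K + ep * norm v" by (simp add: K_def algebra_simps)
    finally show ?thesis .
   qed
   finally show ?thesis using nv by (simp add: mult_left_mono)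
  qed
  have "(%n. norm (cutoff_resolvent V ch h (Complex E (inverse (real (Suc n))))) * (h * K + inverse (real (Suc n)) * norm v)) ----> norm T * (h * K + 0 * norm v)"
   by (intro tendsto_intros T LIMSEQ_inverse_real_of_nat)
  then have "norm v <= norm T * (h * K + 0 * norm v)"
   by (rule LIMSEQ_le_const) (intro exI allI impI bound, simp)
  also have "... <= norm T * (h * (K + 1))" using h by (intro mult_left_mono) auto
  finally have nT: "norm v <= norm T * (h * (K + 1))" .
  have "0 < h * (K + 1)" using h K0 by (intro mult_pos_pos) auto
  then have "norm v / (h * (K + 1)) <= norm T" using nT by (subst pos_divide_le_eq)
  moreover have "c / h = norm v / (h * (K + 1))" by (simp add: c_def mult.commute)
  ultimately show ?thesis by simp
 qed
 show ?thesis
 proof (intro exI[of _ c] conjI c allI impI)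
  fix V :: "real^'n => real" and ch h T
  assume a: "bdd_mult (%x. cor (V x))" "bdd_mult ch" "\<forall>x. V x ~= 0 --> norm x < R0"
   "\<forall>x. norm x <= R0 + 5 --> ch x = 1" "0 < h" "h <= 1"
   "(%n. cutoff_resolvent V ch h (Complex E (inverse (real (Suc n))))) ----> T"
  show "c / h <= norm T"
   by (rule main[OF a(1,2) _ _ a(5-7)]; use a(3,4) in blast)
 qed
qed

text \<open>\<open>F = X^-1 Y\<close> is defined on the whole disc and equals the cut-off resolvent
  on its upper half, where the transfer identity holds. The identity theorem spreads the relations
  between \<open>F\<close> and the continued free operator to the lower half; they show that
  \<open>I + B W\<close> is invertible throughout, which excludes poles.\<close>

lemma (in cutoffs) near_energy:
 assumes ch2: "sqi ch" "!!x. norm x > R ==> ch x = 0" and R: "0 <= R" and E: "E > 0" and hE: "h <= sqrt E / 2"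
  and T: "(%n. cutoff_resolvent V ch h (Complex E (inverse (real (Suc n))))) ----> T"
  and rho: "0 < \<rho>" "\<rho> <= h * sqrt E / 4"
 defines "B \<equiv> Td (sqrt E / h) 1 R ch h" and "D \<equiv> ball (cor E) \<rho>"
 defines "\<delta> \<equiv> %z \<beta>. B \<beta> (cor E) - B \<beta> z" and "W \<equiv> mult_op (%x. cor (V x))"
 assumes X: "!!z. z \<in> D ==> norm (opX h \<psi> \<eta> (\<delta> z) T (z - cor E) - I1) <= 1 / 2"
  and Y: "!!z. z \<in> D ==> norm (opY h \<psi> \<eta> (\<delta> z) T) <= K"
 shows "holo (B []) D" "!!z. z \<in> D ==> Im z > 0 ==> B [] z = Tfree ch h [] z"
  "\<exists>F. holo F D & (\<forall>z\<in>D. norm (F z) <= 2 * K) &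
    (\<forall>z\<in>D. op_inv (I1 + (B [] z oL W)) (I1 - (F z oL W)) & (I1 - (F z oL W)) oL B [] z = F z)"
proof -
 define k0 where "k0 = sqrt E / h"
 \<comment> \<open>The depth of the detour is 1; it must not exceed half the resonant radius
   \<open>sqrt E / h\<close>, whence the restriction on \<open>h\<close>.\<close>
 have k0: "1 <= k0 / 2" using h hE by (simp add: k0_def field_simps)
 have L: "(0::real) < 1" by simp
 have e1: "h\<^sup>2 * k0\<^sup>2 = E" "h\<^sup>2 * 1 * k0 / 4 = h * sqrt E / 4" using h E by (simp_all add: k0_def power_divide power2_eq_square)
 let ?b = "ball (cor E) (h * sqrt E / 4)"
 have sub: "D \<subseteq> ?b" using rho(2) by (auto simp: D_def)
 have ED: "cor E \<in> D" using rho by (simp add: D_def)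
 have oD: "open D" "connected D" by (simp_all add: D_def convex_connected)
 have Bh: "holo (B \<beta>) D" if "length \<beta> <= 2" for \<beta>
  using holo_subset[OF Td_holo(1)[OF L k0 h that ch R, unfolded e1] sub] by (simp only: B_def k0_def)
 show B0: "holo (B []) D" by (rule Bh) simp
 have Beq: "B \<beta> z = Tfree ch h \<beta> z" if "length \<beta> <= 2" "z \<in> D" "Im z > 0" for \<beta> z
  unfolding B_def k0_def[symmetric]
  by (rule Td_eq_Tfree[OF L k0 h that(1) ch ch2 R _ that(3)]) (use that(2) sub in \<open>auto simp only: e1\<close>)
 show "B [] z = Tfree ch h [] z" if "z \<in> D" "Im z > 0" for z by (rule Beq[OF _ that]) simp
 let ?w = "%n. Complex E (inverse (real (Suc n)))"
 have Imw: "Im (?w n) > 0" for n by simp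
 have w: "?w ----> cor E"
 proof -
  have "(%n. Complex E (inverse (real (Suc n)))) ----> Complex E 0"
   by (intro tendsto_Complex tendsto_const LIMSEQ_inverse_real_of_nat)
  then show ?thesis by (simp add: complex_of_real_def)
 qed
 have Tl: "complex_linear T"
 proof (rule complex_linear_lim[OF _ T])
  show "complex_linear (cutoff_resolvent V ch h (?w n))" for n
   unfolding cutoff_resolvent_def by (intro complex_linear_comp complex_linear_mult_op ch resolvent_props(4) V h Imw)
 qed
 \<comment> \<open>Boundary values of the free operators: the deformed ones are holomorphic across
   the axis, hence continuous at \<open>E\<close>.\<close>
 have S: "(%n. Tfree ch h \<beta> (?w n)) ----> B \<beta> (cor E)" if b: "length \<beta> <= 2" for \<beta>
 proof (rule Lim_transform_eventually)
  have "isCont (B \<beta>) (cor E)" by (rule holo_continuous[OF Bh[OF b] ED])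
  then show "(%n. B \<beta> (?w n)) ----> B \<beta> (cor E)" by (rule isCont_tendsto_compose[OF _ w])
  have "eventually (%n. ?w n \<in> D) sequentially" using w oD(1) ED by (rule topological_tendstoD)
  then show "eventually (%n. B \<beta> (?w n) = Tfree ch h \<beta> (?w n)) sequentially"
   by eventually_elim (rule Beq[OF b _ Imw])
 qed
 let ?X = "%z. opX h \<psi> \<eta> (\<delta> z) T (z - cor E)" and ?Y = "%z. opY h \<psi> \<eta> (\<delta> z) T"
 let ?A = "cutoff_resolvent V ch h"
 have dh: "holo (%z. \<delta> z \<beta>) D" if "length \<beta> <= 2" for \<beta>
  unfolding \<delta>_def by (intro holo_diff holo_const holo_complex_linear[OF Bh ED] Bh that)
 have b1: "bdd_mult (%x. 1 - \<psi> x)" "bdd_mult (%x. 1 - \<eta> x)" by (intro bdd_mult_diff bdd_mult_const bdd_psi bdd_eta)+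
 have Xh: "holo ?X D" unfolding opX_def opC_def opG_def
  by (intro holo_diff holo_add holo_comp holo_const holo_scaleR holo_sum holo_op_scaleC dh complex_linear_id complex_linear_mult_op
    b1 bdd_psi bdd_eta Tl oD holomorphic_intros) auto
 have Yh: "holo ?Y D" unfolding opY_def opC_def
  by (intro holo_diff holo_add holo_comp holo_const holo_scaleR holo_sum dh complex_linear_id complex_linear_mult_op
    b1 bdd_psi bdd_eta Tl) auto
 have "\<exists>N. (?X z oL N = I1 & N oL ?X z = I1) & norm N <= 2" if z: "z \<in> D" for z
 proof -
  have x: "norm (?X z - I1) <= 1 / 2" by (rule X[OF z])
  then have "norm (?X z - I1) < 1" by linarith
  then obtain N where N: "(I1 + (?X z - I1)) oL N = I1" "N oL (I1 + (?X z - I1)) = I1"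
   "norm N <= 1 / (1 - norm (?X z - I1))" by (rule Neumann)
  have "1 / (1 - norm (?X z - I1)) <= 1 / (1 / 2)" using x by (intro divide_left_mono) auto
  then have "norm N <= 2" using N(3) by simp
  moreover have "I1 + (?X z - I1) = ?X z" by simp
  ultimately show ?thesis using N(1,2) by metis
 qed
 then obtain N where N: "!!z. z \<in> D ==> ?X z oL N z = I1" "!!z. z \<in> D ==> N z oL ?X z = I1"
  "!!z. z \<in> D ==> norm (N z) <= 2" by metis
 define F where "F z = N z oL ?Y z" for z
 have Fh: "holo F D" unfolding F_def[abs_def] by (intro holo_comp holo_inverse[OF Xh N(1,2) oD(1)] Yh)
 have FA: "F z = ?A z" if z: "z \<in> D" "Im z > 0" for z
 proof -
  have "\<delta> z \<beta> = B \<beta> (cor E) - Tfree ch h \<beta> z" if "length \<beta> <= 2" for \<beta>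
   using Beq[OF that z] by (simp add: \<delta>_def)
  then have "?X z oL ?A z = ?Y z"
   using limit_transfer_identity[OF z(2) Imw w T S] by (simp add: opX_def opY_def opG_def opC_def)
  then have "F z = (N z oL ?X z) oL ?A z" by (simp add: F_def blinfun_compose_assoc)
  also have "... = ?A z" unfolding N(2)[OF z(1)] by (rule blinfun_eqI) simp
  finally show ?thesis .
 qed
 let ?D' = "D \<inter> {z. Im z > 0}"
 have D': "open ?D'" "?D' ~= {}" "?D' \<subseteq> D"
 proof -
  show "open ?D'" by (intro open_Int oD open_halfspace_Im_gt)
  have "Complex E (\<rho> / 2) \<in> ?D'" using rho by (simp add: D_def dist_norm norm_complex_def)
  then show "?D' ~= {}" by blast
 qed auto
 have Wl: "complex_linear W" unfolding W_def by (rule complex_linear_mult_op[OF V])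
 have up: "op_inv (I1 + (B [] z oL W)) (I1 - (F z oL W))" "(I1 - (F z oL W)) oL B [] z = F z"
  if z: "z \<in> ?D'" for z
 proof -
  have zz: "z \<in> D" "Im z > 0" using z by auto
  have chV: "ch x = 1" if "V x ~= 0" for x
  proof -
   have "x \<in> supp \<psi>" using Vpsi[OF that] supp_zero[of x \<psi>] by auto
   then show ?thesis by (rule chpsi)
  qed
  have bz: "B [] z = Tfree ch h [] z" by (rule Beq[OF _ zz]) simp
  show "op_inv (I1 + (B [] z oL W)) (I1 - (F z oL W))" "(I1 - (F z oL W)) oL B [] z = F z"
   unfolding FA[OF zz] bz W_def by (rule cutoff_resolvent_op_inv[OF V ch chV h zz(2)]; assumption)+
 qed
 have h1: "holo (%z. I1 + (B [] z oL W)) D" "holo (%z. I1 - (F z oL W)) D"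
  by (intro holo_add holo_diff holo_comp holo_const complex_linear_id Wl B0 Fh)+
 have all: "op_inv (I1 + (B [] z oL W)) (I1 - (F z oL W)) & (I1 - (F z oL W)) oL B [] z = F z"
  if z: "z \<in> D" for z
  unfolding op_inv_def
 proof (intro conjI)
  show "(I1 + (B [] z oL W)) oL (I1 - (F z oL W)) = I1"
   by (rule holo_identity[OF holo_comp[OF h1] holo_const[OF complex_linear_id] oD D' _ z]) (use up(1) in \<open>auto simp: op_inv_def\<close>)
  show "(I1 - (F z oL W)) oL (I1 + (B [] z oL W)) = I1"
   by (rule holo_identity[OF holo_comp[OF h1(2,1)] holo_const[OF complex_linear_id] oD D' _ z]) (use up(1) in \<open>auto simp: op_inv_def\<close>)
  show "(I1 - (F z oL W)) oL B [] z = F z"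
   by (rule holo_identity[OF holo_comp[OF h1(2) B0] Fh oD D' _ z]) (rule up(2))
 qed
 have nF: "norm (F z) <= 2 * K" if "z \<in> D" for z
  unfolding F_def by (rule norm_compose_le[OF N(3) Y]) (rule that)+
 show "\<exists>F. holo F D & (\<forall>z\<in>D. norm (F z) <= 2 * K) &
    (\<forall>z\<in>D. op_inv (I1 + (B [] z oL W)) (I1 - (F z oL W)) & (I1 - (F z oL W)) oL B [] z = F z)"
  using Fh nF all by blast
qed

lemma mult_op_bound_exists:
 fixes f :: "'n::finite cfun"
 obtains M where "!!i. norm (mult_op (pd i f) :: 'n L2_op) <= M"
  "!!i. norm (mult_op (pd i (pd i f)) :: 'n L2_op) <= M"
  "norm (mult_op f :: 'n L2_op) <= M" "norm (mult_op (%x. 1 - f x) :: 'n L2_op) <= M" "1 <= M"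
proof -
 let ?a = "%i. norm (mult_op (pd i f) :: 'n L2_op)"
 let ?b = "%i. norm (mult_op (pd i (pd i f)) :: 'n L2_op)"
 let ?c = "norm (mult_op f :: 'n L2_op)" and ?d = "norm (mult_op (%x. 1 - f x) :: 'n L2_op)"
 have s: "?a i <= sum ?a UNIV" "?b i <= sum ?b UNIV" for i by (intro member_le_sum; simp)+
 have s0: "0 <= sum ?a UNIV" "0 <= sum ?b UNIV" by (intro sum_nonneg; simp)+
 have n0: "0 <= ?c" "0 <= ?d" by simp_all
 show thesis
 proof (rule that[of "1 + sum ?a UNIV + sum ?b UNIV + ?c + ?d"])
  show "?a i <= 1 + sum ?a UNIV + sum ?b UNIV + ?c + ?d" "?b i <= 1 + sum ?a UNIV + sum ?b UNIV + ?c + ?d" for i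
   using s[of i] s0 n0 by linarith+
 qed (use s0 n0 in linarith)+
qed

section \<open>Choice of constants and assembly\<close>

theorem mainTheorem1:
  fixes V :: "real^'n::finite \<Rightarrow> real"
    and chi :: "real^'n \<Rightarrow> complex"
    and R0 E h0 :: real
    and a :: "real \<Rightarrow> real"
    and N :: nat
  assumes "C0_infinity V"
    and "R0 > 0"
    and "supp V \<subseteq> {x. norm x < R0}"
    and "E > 0"
    and "C0_infinity chi"
    and "\<exists>W. open W \<and> {x. norm x \<le> R0 + 5} \<subseteq> W \<and> (\<forall>x\<in>W. chi x = 1)"
    and "h0 > 0"
    and "\<And>h. 0 < h \<Longrightarrow> h \<le> h0 \<Longrightarrow> 1 \<le> a h \<and> a h \<le> h powr (- real N)"
    and "\<And>h. 0 < h \<Longrightarrow> h \<le> h0 \<Longrightarrow>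
           \<exists>T. ((\<lambda>\<epsilon>. cutoff_resolvent V chi h (Complex E \<epsilon>)) \<longlongrightarrow> T) (at_right 0) \<and>
               norm T \<le> a h"
  shows "\<exists>C>0. \<exists>h1>0. h1 \<le> h0 \<and> (\<forall>h. 0 < h \<and> h \<le> h1 \<longrightarrow>
           (\<exists>U F. cutoff_resolvent_continuation V chi h U F \<and>
                  cball (complex_of_real E) (1 / (C * a h)) \<subseteq> U \<and>
                  op_holomorphic_on F (cball (complex_of_real E) (1 / (C * a h))) \<and>
                  (\<forall>z\<in>cball (complex_of_real E) (1 / (C * a h)). norm (F z) \<le> C * a h)))"
proof -
 have V: "bdd_mult (%x. cor (V x))" by (rule bdd_mult_potential[OF assms(1)])
 have ch1: "chi x = 1" if "norm x <= R0 + 5" for x using assms(6) that by blast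
 note chs = C0_integrable(2)[OF assms(5)] and chb = C0_integrable(3)[OF assms(5)]
 obtain R where R: "R > 0" "!!x. norm x > R ==> chi x = 0" by (rule C0_infinity_boundedE[OF assms(5)], rule that) auto
 have R': "0 <= R" using R(1) by simp
 have V0: "norm x < R0" if "V x ~= 0" for x using assms(3) supp_zero[of x V] that by blast
 have chV: "chi x = 1" if "V x ~= 0" for x using V0[OF that] by (intro ch1) simp
 \<comment> \<open>Nested cut-offs in the collar between \<open>R0\<close> and
   \<open>R0 + 5\<close>: \<open>p\<close> is 1 around the support of \<open>V\<close>,
   \<open>q\<close> is 1 on the support of \<open>p\<close>, and \<open>chi\<close> is 1 on the
   support of \<open>q\<close>.\<close>
 obtain p :: "real^'n => real" where p: "smooth p" "!!x. norm x <= R0 + 1 ==> p x = 1" "!!x. norm x \<ge> R0 + 2 ==> p x = 0"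
  by (rule smooth_cutoff_exists[of "R0 + 1" "R0 + 2"]) (use assms(2) in auto)
 obtain q :: "real^'n => real" where q: "smooth q" "!!x. norm x <= R0 + 3 ==> q x = 1" "!!x. norm x \<ge> R0 + 4 ==> q x = 0"
  by (rule smooth_cutoff_exists[of "R0 + 3" "R0 + 4"]) (use assms(2) in auto)
 define \<psi> where "\<psi> x = cor (p x)" for x
 define \<eta> where "\<eta> x = cor (q x)" for x
 have psi: "C0_infinity \<psi>" unfolding \<psi>_def[abs_def]
  by (rule C0_infinityI[of _ "R0 + 2", OF smooth_of_real[OF p(1)]]) (use p(3) in simp)
 have eta: "C0_infinity \<eta>" unfolding \<eta>_def[abs_def]
  by (rule C0_infinityI[of _ "R0 + 4", OF smooth_of_real[OF q(1)]]) (use q(3) in simp)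
 have supp: "supp \<psi> \<subseteq> cball 0 (R0 + 2)" "supp \<eta> \<subseteq> cball 0 (R0 + 4)" unfolding supp_def \<psi>_def \<eta>_def
  by (rule closure_minimal; use p(3) q(3) in \<open>force simp: not_less[symmetric]\<close>)+
 have cut: "cutoffs V chi \<psi> \<eta> h" if "h > 0" for h
 proof
  show "\<psi> x = 1" if "V x ~= 0" for x using V0[OF that] by (simp add: \<psi>_def p(2))
  show "\<psi> x * \<eta> x = \<psi> x" for x using p(3)[of x] q(2)[of x] by (cases "norm x <= R0 + 3") (auto simp: \<psi>_def \<eta>_def)
  show "chi x = 1" if "x \<in> supp \<psi>" for x using supp(1) that by (intro ch1) auto
  show "chi x = 1" if "x \<in> supp \<eta>" for x using supp(2) that by (intro ch1) auto
 qed (fact V chb psi eta that)+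
 obtain M1 where M1: "!!i. norm (mult_op (pd i \<psi>) :: 'n L2_op) <= M1" "!!i. norm (mult_op (pd i (pd i \<psi>)) :: 'n L2_op) <= M1"
  "norm (mult_op \<psi> :: 'n L2_op) <= M1" "norm (mult_op (%x. 1 - \<psi> x) :: 'n L2_op) <= M1" "1 <= M1" by (rule mult_op_bound_exists[of \<psi>]) (rule that)
 obtain M2 where M2: "!!i. norm (mult_op (pd i \<eta>) :: 'n L2_op) <= M2" "!!i. norm (mult_op (pd i (pd i \<eta>)) :: 'n L2_op) <= M2"
  "norm (mult_op \<eta> :: 'n L2_op) <= M2" "norm (mult_op (%x. 1 - \<eta> x) :: 'n L2_op) <= M2" "1 <= M2" by (rule mult_op_bound_exists[of \<eta>]) (rule that)
 define M where "M = max M1 M2"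
 have M: "1 <= M" "M1 <= M" "M2 <= M" using M1(5) by (auto simp: M_def)
 note M1' = M1[THEN order_trans, OF M(2)] and M2' = M2[THEN order_trans, OF M(3)]
 obtain B where B: "B > 0" "!!x. cmod (chi x) <= B" by (rule bdd_multE[OF chb], rule that) auto
 obtain c where c: "c > 0" and lower: "!!h T. 0 < h ==> h <= 1 ==>
   (%n. cutoff_resolvent V chi h (Complex E (inverse (real (Suc n))))) ----> T ==> c / h <= norm T"
  using resolvent_lower_bound[OF assms(2,4), where 'n='n] V chb V0 ch1 by meson
 define n where "n = real CARD('n)"
 have n0: "0 <= n" by (simp add: n_def)
 have sE: "sqrt E > 0" using assms(4) by simp
 \<comment> \<open>The constant of \<open>Td_Lipschitz\<close> for depth 1 and
   \<open>k0 = sqrt E / h\<close>, stripped of its powers of \<open>h\<close>;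
   \<open>1 + sqrt E + E\<close> dominates \<open>sqrt E ^ k\<close> for 0, 1 and 2 derivatives at
   once.\<close>
 define K0 where "K0 = (B * exp (n * 1 * R))\<^sup>2 * 2 ^ CARD('n) * (16 * ((1 + sqrt E + E) / E))"
 have K0: "0 <= K0" unfolding K0_def using sE assms(4) by (intro mult_nonneg_nonneg) auto
 \<comment> \<open>\<open>K1\<close> is the coefficient of \<open>|z - E| a(h)\<close> in the bound
   for \<open>opX - I\<close>, and \<open>K2\<close> that of \<open>|z - E| a(h)^2\<close> coming
   from the term \<open>s / h^2\<close> of \<open>opY\<close>; each \<open>1/h\<close> has been
   replaced by \<open>a(h) / c\<close>.\<close>
 define K1 where "K1 = 3 * n * M\<^sup>2 * (K0 / c) + M + 9 * n\<^sup>2 * M\<^sup>2 * K0"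
 define K2 where "K2 = M\<^sup>2 * (K0 / c\<^sup>2)"
 have K1: "0 <= 3 * n * M\<^sup>2 * (K0 / c)" "0 <= M + 9 * n\<^sup>2 * M\<^sup>2 * K0" "0 <= K1"
  unfolding K1_def using n0 M K0 c by (auto intro!: add_nonneg_nonneg mult_nonneg_nonneg)
 have K2: "0 <= K2" unfolding K2_def using K0 c by (intro mult_nonneg_nonneg) auto
 \<comment> \<open>One summand per requirement on the disc of radius \<open>2 / (C a(h))\<close>:
   the 1 keeps \<open>|z - E| a(h)\<close> below 2, \<open>4 * K1\<close> makes
   \<open>opX - I\<close> at most 1/2, \<open>3 + 4 * K2\<close> is twice the bound for
   \<open>opY\<close>, and the last one fits the disc into that of radius
   \<open>h sqrt E / 4\<close>.\<close>
 define C where "C = 1 + 4 * K1 + (3 + 4 * K2) + 8 / (c * sqrt E)"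
 have C8: "0 < 8 / (c * sqrt E)" using c sE by simp
 have C: "C > 0" "1 <= C" "4 * K1 <= C" "3 + 4 * K2 <= C" "8 / (c * sqrt E) <= C"
  using K1(3) K2 C8 unfolding C_def by linarith+
 define h1 where "h1 = min h0 (min 1 (sqrt E / 2))"
 have h1: "h1 > 0" "h1 <= h0" using assms(7) sE by (auto simp: h1_def)
 have main: "\<exists>U F. cutoff_resolvent_continuation V chi h U F & cball (cor E) (1 / (C * a h)) \<subseteq> U &
   op_holomorphic_on F (cball (cor E) (1 / (C * a h))) &
   (\<forall>z\<in>cball (cor E) (1 / (C * a h)). norm (F z) <= C * a h)"
  if hp: "0 < h" "h <= h1" for h
 proof -
  interpret cutoffs V chi \<psi> \<eta> h by (rule cut[OF hp(1)])
  have hh: "h <= h0" "h <= 1" "h <= sqrt E / 2" using hp(2) by (auto simp: h1_def)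
  define A where "A = a h"
  obtain T where T: "((%ep. cutoff_resolvent V chi h (Complex E ep)) \<longlongrightarrow> T) (at_right 0)" "norm T <= A"
   using assms(9)[OF hp(1) hh(1)] unfolding A_def by blast
  have "filterlim (%n. inverse (real (Suc n))) (at_right 0) sequentially"
   unfolding filterlim_at by (intro conjI always_eventually allI LIMSEQ_inverse_real_of_nat) simp_all
  from filterlim_compose[OF T(1) this]
  have Tn: "(%n. cutoff_resolvent V chi h (Complex E (inverse (real (Suc n))))) ----> T" .
  have cA: "c / h <= A" using lower[OF hp(1) hh(2) Tn] T(2) by linarith
  have A: "A > 0" using cA c hp(1) by (meson divide_pos_pos less_le_trans)
  have ih: "1 / h <= A / c" using cA c hp(1) by (simp add: field_simps)
  \<comment> \<open>Twice the radius in the conclusion, so that the closed disc there lies in an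
    open one.\<close>
  define \<rho> where "\<rho> = 2 / (C * A)"
  have rho: "0 < \<rho>" "\<rho> <= h * sqrt E / 4"
  proof -
   show "0 < \<rho>" using C(1) A by (simp add: \<rho>_def)
   have "8 / (c * sqrt E) * (c / h) <= C * A" using C(5) cA c hp(1) C(1) by (intro mult_mono) auto
   then have "8 / (sqrt E * h) <= C * A" using c by simp
   then have "2 / (C * A) <= 2 / (8 / (sqrt E * h))" using sE hp(1) C(1) A by (intro divide_left_mono) auto
   then show "\<rho> <= h * sqrt E / 4" by (simp add: \<rho>_def mult.commute)
  qed
  define k0 where "k0 = sqrt E / h"
  have k0: "1 <= k0 / 2" using hp hh(3) by (simp add: k0_def field_simps)
  have e1: "h\<^sup>2 * k0\<^sup>2 = E" "h\<^sup>2 * 1 * k0 / 4 = h * sqrt E / 4"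
   using hp assms(4) by (simp_all add: k0_def power_divide power2_eq_square)
  let ?B = "Td (sqrt E / h) 1 R chi h" and ?E = "cor E" and ?D = "ball (cor E) \<rho>"
  let ?\<delta> = "%z \<beta>. ?B \<beta> ?E - ?B \<beta> z"
  have small: "cmod (z - ?E) * A * K1 <= 1 / 2" "cmod (z - ?E) * A <= 2" if "z \<in> ?D" for z
  proof -
   have "cmod (z - ?E) <= 2 / (C * A)" using that by (simp add: \<rho>_def dist_norm norm_minus_commute)
   then have "cmod (z - ?E) * A <= 2 / (C * A) * A" using A by (intro mult_right_mono) auto
   then have x: "cmod (z - ?E) * A <= 2 / C" using A by simp
   then have "cmod (z - ?E) * A * K1 <= 2 / C * K1" using K1(3) by (rule mult_right_mono)
   also have "... <= 1 / 2" using C(1,3) by (simp add: field_simps)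
   finally show "cmod (z - ?E) * A * K1 <= 1 / 2" .
   have "2 / C <= 2" using C(1,2) by (simp add: field_simps)
   then show "cmod (z - ?E) * A <= 2" using x by linarith
  qed
  have lip: "norm (?\<delta> z \<beta>) <= (K0 * cmod (z - ?E)) / h ^ (2 + length \<beta>)" if z: "z \<in> ?D" and b: "length \<beta> <= 2" for z \<beta>
  proof -
   have zb: "z \<in> ball (cor (h\<^sup>2 * k0\<^sup>2)) (h\<^sup>2 * 1 * k0 / 4)" unfolding e1 using z rho(2) by auto
   have "k0 ^ length \<beta> / k0\<^sup>2 = sqrt E ^ length \<beta> / E * (h\<^sup>2 / h ^ length \<beta>)"
    using assms(4) by (simp add: k0_def power_divide)
   also have "... <= (1 + sqrt E + E) / E * (h\<^sup>2 / h ^ length \<beta>)"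
   proof -
    have "length \<beta> = 0 \<or> length \<beta> = 1 \<or> length \<beta> = 2" using b by linarith
    then have "sqrt E ^ length \<beta> <= 1 + sqrt E + E" using sE assms(4) by (elim disjE) simp_all
    then show ?thesis using assms(4) hp(1) by (intro mult_right_mono divide_right_mono) auto
   qed
   finally have k: "k0 ^ length \<beta> / k0\<^sup>2 <= (1 + sqrt E + E) / E * (h\<^sup>2 / h ^ length \<beta>)" .
   have "norm (Td k0 1 R chi h \<beta> z - Td k0 1 R chi h \<beta> ?E)
     <= (B * exp (n * 1 * R))\<^sup>2 * 2 ^ CARD('n) * (cmod (z - ?E) * (16 / (h ^ 4 * 1\<^sup>2) * (k0 ^ length \<beta> / k0\<^sup>2)))"
    using Td_Lipschitz[OF _ k0 hp(1) b chb B(2) R' zb] unfolding e1(1) n_def by simp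
   also have "... <= (B * exp (n * 1 * R))\<^sup>2 * 2 ^ CARD('n) * (cmod (z - ?E) * (16 / (h ^ 4 * 1\<^sup>2) * ((1 + sqrt E + E) / E * (h\<^sup>2 / h ^ length \<beta>))))"
    using hp(1) by (intro mult_left_mono k) auto
   also have "... = (K0 * cmod (z - ?E)) / h ^ (2 + length \<beta>)"
   proof -
    have "P * (t * (16 / (h ^ 4 * 1\<^sup>2) * (e * (h\<^sup>2 / h ^ b)))) = (P * (16 * e) * t) / h ^ (2 + b)" for P t e :: real and b
     using hp(1) by (simp add: power_add power2_eq_square power4_eq_xxxx field_simps)
    then show ?thesis unfolding K0_def .
   qed
   finally show ?thesis by (simp add: k0_def norm_minus_commute)
  qed
  have XY: "norm (opX h \<psi> \<eta> (?\<delta> z) T (z - ?E) - I1) <= 1 / 2" "norm (opY h \<psi> \<eta> (?\<delta> z) T) <= A * (3 / 2 + 2 * K2)"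
   if z: "z \<in> ?D" for z
  proof -
   define t where "t = cmod (z - ?E)"
   define s where "s = K0 * t"
   have t0: "0 <= t" by (simp add: t_def)
   have s0: "0 <= s" using K0 t0 by (simp add: s_def)
   note bnd = norm_opX_opY_le[OF M1'(1,2,4) M2'(1,2,4,3) hp(1) hh(2) s0 lip[OF z, folded t_def s_def], of T, folded n_def]
   have sh: "s / h <= K0 / c * (t * A)"
    using mult_left_mono[OF ih s0] by (simp add: s_def mult_ac)
   have sh2: "s / h\<^sup>2 <= K0 / c\<^sup>2 * (t * A) * A"
   proof -
    have "s / h\<^sup>2 = (s / h) * (1 / h)" by (simp add: power2_eq_square)
    also have "... <= (K0 / c * (t * A)) * (A / c)"
     using K0 c t0 A hp(1) by (intro mult_mono sh ih) auto
    finally show ?thesis by (simp add: power2_eq_square mult_ac)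
   qed
   have p1: "3 * n * M\<^sup>2 * (s / h) <= 3 * n * M\<^sup>2 * (K0 / c) * (t * A)"
    using mult_left_mono[OF sh, of "3 * n * M\<^sup>2"] n0 by (simp add: mult_ac)
   have tA: "0 <= t * A" using t0 A by simp
   have "norm T * (t * M + 9 * n\<^sup>2 * M\<^sup>2 * s) <= A * (t * M + 9 * n\<^sup>2 * M\<^sup>2 * s)"
    using T(2) t0 M n0 s0 by (intro mult_right_mono add_nonneg_nonneg mult_nonneg_nonneg) auto
   also have "... = (M + 9 * n\<^sup>2 * M\<^sup>2 * K0) * (t * A)" by (simp add: s_def algebra_simps)
   finally have "norm (opX h \<psi> \<eta> (?\<delta> z) T (z - ?E) - I1) <= 3 * n * M\<^sup>2 * (K0 / c) * (t * A) + (M + 9 * n\<^sup>2 * M\<^sup>2 * K0) * (t * A)"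
    using bnd(1)[of "z - ?E"] p1 unfolding t_def[symmetric] by linarith
   also have "... = t * A * K1" by (simp add: K1_def algebra_simps)
   finally show "norm (opX h \<psi> \<eta> (?\<delta> z) T (z - ?E) - I1) <= 1 / 2" using small(1)[OF z] by (simp add: t_def)
   have "3 * n * M\<^sup>2 * (K0 / c) * (t * A) <= K1 * (t * A)"
    using K1(2) tA by (intro mult_right_mono) (auto simp: K1_def)
   then have p2: "3 * n * M\<^sup>2 * (s / h) <= 1 / 2" using p1 small(1)[OF z, folded t_def] unfolding mult.commute[of K1] by linarith
   have "norm T * (1 + 3 * n * M\<^sup>2 * (s / h)) <= A * (3 / 2)"
    using T(2) p2 A n0 s0 hp(1) by (intro mult_mono add_nonneg_nonneg mult_nonneg_nonneg) auto
   moreover have "M\<^sup>2 * (s / h\<^sup>2) <= A * (2 * K2)"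
   proof -
    have "M\<^sup>2 * (s / h\<^sup>2) <= M\<^sup>2 * (K0 / c\<^sup>2 * (t * A) * A)" by (rule mult_left_mono[OF sh2]) simp
    also have "... = (K2 * A) * (t * A)" by (simp add: K2_def mult_ac)
    also have "... <= (K2 * A) * 2" using small(2)[OF z] K2 A by (intro mult_left_mono) (auto simp: t_def)
    finally show ?thesis by (simp add: mult_ac)
   qed
   ultimately show "norm (opY h \<psi> \<eta> (?\<delta> z) T) <= A * (3 / 2 + 2 * K2)"
    using bnd(2) by (simp add: distrib_left)
  qed
  let ?W = "mult_op (%x. cor (V x)) :: 'n L2_op"
  have near: "holo (?B []) ?D" "!!z. z \<in> ?D ==> Im z > 0 ==> ?B [] z = Tfree chi h [] z"
   "\<exists>F. holo F ?D & (\<forall>z\<in>?D. norm (F z) <= 2 * (A * (3 / 2 + 2 * K2))) &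
    (\<forall>z\<in>?D. op_inv (I1 + (?B [] z oL ?W)) (I1 - (F z oL ?W)) & (I1 - (F z oL ?W)) oL ?B [] z = F z)"
   by (rule near_energy[OF chs R(2) R' assms(4) hh(3) Tn rho XY]; assumption)+
  obtain F where F: "holo F ?D" "!!z. z \<in> ?D ==> norm (F z) <= 2 * (A * (3 / 2 + 2 * K2))"
   and inv: "!!z. z \<in> ?D ==> op_inv (I1 + (?B [] z oL ?W)) (I1 - (F z oL ?W))"
   and FB: "!!z. z \<in> ?D ==> (I1 - (F z oL ?W)) oL ?B [] z = F z"
   using near(3) by blast
  \<comment> \<open>One disc and one local family for each \<open>ka > 0\<close>. The last conjunct
    forces the data at \<open>E\<close> to be the family of depth 1 on the disc of radius
    \<open>\<rho>\<close>, so that the global continuation can be compared with \<open>F\<close>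
    there.\<close>
  let ?P = "%ka r Q. r > 0 & holo Q (ball (cor ka) r) &
   (\<forall>z\<in>ball (cor ka) r. Im z > 0 --> Q z = Tfree chi h [] z) &
   (\<exists>z1\<in>ball (cor ka) r. fredholm_inv (%z. I1 + (Q z oL ?W)) (ball (cor ka) r) z1) &
   (ka = E --> r = \<rho> & Q = ?B [])"
  \<comment> \<open>At \<open>E\<close> the inverse is already known on the whole disc, so the
    scalar of \<open>fredholm_inv\<close> can be 1.\<close>
  have PE: "?P E \<rho> (?B [])"
  proof (intro conjI impI ballI refl rho(1) near(1))
   show "?B [] z = Tfree chi h [] z" if "z \<in> ?D" "0 < Im z" for z by (rule near(2)[OF that])
   have Wl: "complex_linear ?W" by (rule complex_linear_mult_op[OF V])
   have id: "op_scaleC 1 I1 = (I1 :: 'n L2_op)" by (rule blinfun_eqI) (simp add: op_scaleC_apply L2_scaleC_one)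
   have "holo (%z. I1 - (F z oL ?W)) ?D" by (intro holo_diff holo_comp holo_const complex_linear_id Wl F)
   then have "fredholm_inv (%z. I1 + (?B [] z oL ?W)) ?D ?E"
    unfolding fredholm_inv_def using inv
    by (intro exI[of _ "%z. I1 - (F z oL ?W)"] exI[of _ "%_. 1"]) (auto simp: id op_inv_def)
   then show "\<exists>z1\<in>?D. fredholm_inv (%z. I1 + (?B [] z oL ?W)) ?D z1"
    using rho(1) by (intro bexI[of _ ?E]) auto
  qed
  have ex: "\<exists>r Q. ka > 0 --> ?P ka r Q" for ka
  proof (cases "ka > 0 & ka ~= E")
   case True
   then show ?thesis using disc_exists[OF V chb chs R(2) chV R' hp(1), of ka] by blast
  next
   case False
   then show ?thesis using PE by blast
  qed
  have "\<exists>r. \<forall>ka. \<exists>Q. ka > 0 --> ?P ka (r ka) Q" by (rule choice, rule allI, rule ex)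
  then obtain r where r: "\<forall>ka. \<exists>Q. ka > 0 --> ?P ka (r ka) Q" ..
  have "\<exists>Q. \<forall>ka. ka > 0 --> ?P ka (r ka) (Q ka)" by (rule choice[OF r])
  then obtain Q where Q: "\<forall>ka. ka > 0 --> ?P ka (r ka) (Q ka)" ..
  have rQ: "?P ka (r ka) (Q ka)" if "ka > 0" for ka by (rule Q[THEN spec, THEN mp, OF that])
  note rQ1 = rQ[THEN conjunct1] and rQ2 = rQ[THEN conjunct2]
  note rQ3 = rQ2[THEN conjunct2] note rQ4 = rQ3[THEN conjunct2] note rQ5 = rQ4[THEN conjunct2]
  have rE: "r E = \<rho>" "Q E = ?B []" using rQ5[OF assms(4)] by (simp_all only: simp_thms)
  obtain U G where UG: "cutoff_resolvent_continuation V chi h U G"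
   and sub: "!!ka. ka > 0 ==> ball (cor ka) (r ka) \<subseteq> U"
   and G: "!!ka z S. ka > 0 ==> z \<in> ball (cor ka) (r ka) ==>
     op_inv (I1 + (Q ka z oL ?W)) S ==> G z = S oL Q ka z"
  proof (rule cutoff_resolvent_continuation_glue[OF V chb chV hp(1), of r Q])
   show "r ka > 0" "holo (Q ka) (ball (cor ka) (r ka))"
    "\<exists>z1\<in>ball (cor ka) (r ka). fredholm_inv (%z. I1 + (Q ka z oL ?W)) (ball (cor ka) (r ka)) z1"
    if "ka > 0" for ka using rQ1 rQ2[THEN conjunct1] rQ4[THEN conjunct1] that by (simp_all only:)
   show "Q ka z = Tfree chi h [] z" if "ka > 0" "z \<in> ball (cor ka) (r ka)" "Im z > 0" for ka z
    by (rule rQ3[THEN conjunct1, THEN bspec, THEN mp, OF that])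
  qed (assumption, rule that)
  \<comment> \<open>The inverse \<open>I - F W\<close> pins down the global continuation at each
    point of the disc, so the bound for \<open>F\<close> becomes the bound for
    \<open>G\<close>.\<close>
  have GF: "G z = F z" if "z \<in> ?D" for z
   using G[OF assms(4), of z, unfolded rE, OF that inv[OF that]] FB[OF that] by simp
  have cb: "cball ?E (1 / (C * a h)) \<subseteq> ?D"
  proof -
   have "1 / (C * A) < \<rho>" using C(1) A by (simp add: \<rho>_def divide_strict_right_mono)
   then show ?thesis unfolding A_def by auto
  qed
  show ?thesis
  proof (intro exI[of _ U] exI[of _ G] conjI UG ballI)
   show "cball ?E (1 / (C * a h)) \<subseteq> U" using cb sub[OF assms(4)] unfolding rE by (rule order_trans)
   have "holo G ?D" by (rule holo_transform[OF F(1) open_ball GF])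
   then show "op_holomorphic_on G (cball ?E (1 / (C * a h)))"
    by (intro holo_imp_op_holomorphic holo_subset[OF _ cb])
   fix z assume "z \<in> cball ?E (1 / (C * a h))"
   then have z: "z \<in> ?D" using cb by blast
   have "2 * (A * (3 / 2 + 2 * K2)) = (3 + 4 * K2) * A" by (simp add: algebra_simps)
   also have "... <= C * A" using C(4) A by (intro mult_right_mono) auto
   finally show "norm (G z) <= C * a h" using F(2)[OF z] GF[OF z] by (simp add: A_def)
  qed
 qed
 show ?thesis using main C(1) h1 by blast
qed

end
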